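(* Let $(\phi,\xi,\eta,g)$ be a contact pseudo-metric structure on a $(2n+1)$-dimensional manifold $M$, where $g$ has signature $(p,q)$, and put $\varepsilon:=(-1)^q$. Let $(\Lambda,E)$ be the Jacobi structure on $M$ corresponding to the contact form $\varepsilon\eta$. Let $G$ be the pseudo-Riemannian metric on the vector bundle $TM\oplus\mathbb{R}$ defined by $$G((X_1,f),(X_2,h)):=g(X_1,X_2)+\varepsilon fh,$$ and let $G^*$ be the dual metric of $G$ on $T^*M\oplus\mathbb{R}$ with respect to $(\Lambda,E)$. Then the pair $((\Lambda,E),G^* )$ is compatible on the Jacobi algebroid $(TM\oplus\mathbb{R},(0,1))$ if and only if $(\phi,\xi,\eta,g)$ is a Sasakian pseudo-metric structure on $M$.
   Context: **Contact and Sasakian pseudo-metric structures.** An almost contact structure on $M^{2n+1}$ is a triple $(\phi,\xi,\eta)$ of a $(1,1)$-tensor field $\phi$, a vector field $\xi$ and a 1-form $\eta$ with $\phi^2=-\mathrm{id}+\eta\otimes\xi$ and $\langle\eta,\xi\rangle=1$. It is normal if the almost complex structure $J$ on $M\times\mathbb{R}$ given by $J(X+f\frac{d}{dt})=\phi X+f\xi-\langle\eta,X\rangle\frac{d}{dt}$ ($X$ tangent to $M$, $f\in C^\infty(M\times\mathbb{R})$, $t$ the coordinate on $\mathbb{R}$) is integrable. If $g$ is a pseudo-Riemannian metric of signature $(p,q)$ ($q$ negative directions) and $\varepsilon=(-1)^q$, then $(\phi,\xi,\eta,g)$ is an almost contact pseudo-metric structure if $g(\phi X_1,\phi X_2)=g(X_1,X_2)-\varepsilon\eta(X_1)\eta(X_2)$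 for all vector fields $X_1,X_2$. It is a contact pseudo-metric structure if moreover $\eta$ is a contact form and $g(\phi X_1,X_2)=(d\eta)(X_1,X_2)$, with the convention $d\eta(X,Y)=X\eta(Y)-Y\eta(X)-\eta([X,Y])$ (no factor $\frac12$). A Sasakian pseudo-metric structure is a normal contact pseudo-metric structure. **The Jacobi algebroid $(TM\oplus\mathbb{R},(0,1))$.** A Lie algebroid over $M$ is a vector bundle $A$ with a Lie bracket $[\cdot,\cdot]_A$ on $\Gamma(A)$ and a bundle map $\rho_A:A\to TM$ with $[X,fY]_A=f[X,Y]_A+(\rho_A(X)f)Y$; a skew algebroid is the same without requiring the Jacobi identity. A Jacobi algebroid $(A,\phi_0)$ is a Lie algebroid $A$ with $\phi_0\in\Gamma(A^* )$, $d_A\phi_0=0$, where $d_A$ is the Lie algebroid differential. Here $A=TM\oplus\mathbb{R}:=TM\oplus(M\times\mathbb{R})$ with $[(X,f),(Y,h)]_A=([X,Y],X(h)-Y(f))$, $\rho_A(X,f)=X$, and $\phi_0=(0,1)\in\Omega^1(M)\times C^\infty(M)=\Gamma(A^* )$. Wedge products use the convention with factor $\frac{1}{k!l!}$ in front of the alternating sum over $S_{k+l}$. A pair $(\Lambda,E)$ of a bivector field and a vector field is regarded as the 2-section $\pi$ of $A$ given by $\pi((\alpha,f),(\beta,h))=\Lambda(\alpha,\beta)+f\langle\beta,E\rangle-h\langle\alpha,E\rangle$. **Jacobi structure of a contact form.** For a contact form $\theta$ on $M$, let $\theta^\flat(X):=\iota_Xd\theta+\langle\theta,X\rangle\theta$,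 a linear isomorphism $\mathfrak{X}(M)\to\Omega^1(M)$. The corresponding Jacobi structure is $(\Lambda,E)$ with $\Lambda(\alpha,\beta):=(d\theta)((\theta^\flat)^{-1}(\alpha),(\theta^\flat)^{-1}(\beta))$ and $E$ the Reeb vector field of $\theta$ (i.e. $\langle\theta,E\rangle=1$, $\iota_Ed\theta=0$). Here $\theta=\varepsilon\eta$. **Dual metric.** With $\pi$ the 2-section of $A$ given by $(\Lambda,E)$ and $\pi^\sharp:A^*\to A$, $\langle\pi^\sharp a,b\rangle:=\pi(a,b)$ (an isomorphism here), $G^*$ is the metric on $A^*=T^*M\oplus\mathbb{R}$ given by $G^*(a,b):=G(\pi^\sharp a,\pi^\sharp b)$. (In the present situation this coincides with the usual dual metric of $G$, obtained by transporting $G$ through $G^\flat:A\to A^*$.) **Compatibility on a Jacobi algebroid $(A,\phi_0)$.** Set $d_{A,\phi_0}\omega:=d_A\omega+\phi_0\wedge\omega$, $\mathcal{L}^{A,\phi_0}_X:=\iota_X\circ d_{A,\phi_0}+d_{A,\phi_0}\circ\iota_X$. For $\pi\in\Gamma(\Lambda^2A)$ put $\rho_\pi:=\rho_A\circ\pi^\sharp$, $X_0:=-\pi^\sharp\phi_0\in\Gamma(A)$, and $[\alpha,\beta]_{\pi,\phi_0}:=\mathcal{L}^{A,\phi_0}_{\pi^\sharp\alpha}\beta-\mathcal{L}^{A,\phi_0}_{\pi^\sharp\beta}\alpha-d_{A,\phi_0}\langle\pi^\sharp\alpha,\beta\rangle$ for $\alpha,\beta\in\Gamma(A^* )$. Then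 $A^*_{\pi,\phi_0}:=(A^*,[\cdot,\cdot]_{\pi,\phi_0},\rho_\pi)$ is a skew algebroid. For a pseudo-Riemannian metric $g^*$ on $A^*$, let $D^{\pi,\phi_0}$ be the Levi-Civita connection of $g^*$ on $A^*_{\pi,\phi_0}$, i.e. the unique $\mathbb{R}$-bilinear map $D:\Gamma(A^* )\times\Gamma(A^* )\to\Gamma(A^* )$ with $D_{f\alpha}\beta=fD_\alpha\beta$, $D_\alpha(f\beta)=fD_\alpha\beta+(\rho_\pi(\alpha)f)\beta$, $D_\alpha\beta-D_\beta\alpha=[\alpha,\beta]_{\pi,\phi_0}$, $\rho_\pi(\alpha)(g^*(\beta,\gamma))=g^*(D_\alpha\beta,\gamma)+g^*(\beta,D_\alpha\gamma)$. The pair $(\pi,g^* )$ is compatible on $(A,\phi_0)$ if for all $\alpha,\beta,\gamma\in\Gamma(A^* )$ $$(D^{\pi,\phi_0}_\alpha\pi)(\beta,\gamma)=-\tfrac12\big(\langle X_0,\beta\rangle\pi(\gamma,\alpha)+\langle X_0,\gamma\rangle\pi(\alpha,\beta)+g^*(\alpha,\beta)\,\pi((g^* )^{\flat-1}(X_0),\gamma)-g^*(\alpha,\gamma)\,\pi((g^* )^{\flat-1}(X_0),\beta)\big),$$ where $(D^{\pi,\phi_0}_\alpha\pi)(\beta,\gamma):=\rho_\pi(\alpha)(\pi(\beta,\gamma))-\pi(D^{\pi,\phi_0}_\alpha\beta,\gamma)-\pi(\beta,D^{\pi,\phi_0}_\alpha\gamma)$ and $(g^* )^\flat:A^*\to A$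 is given by $\langle(g^* )^\flat\alpha,\beta\rangle=g^*(\alpha,\beta)$. *)

theory Defs
  imports "HOL-Analysis.Analysis" "HOL-Library.Function_Algebras"
begin

section \<open>Function spaces as real vector spaces\<close>

instantiation "fun" :: (type, scaleR) scaleR
begin

definition scaleR_fun :: "real \<Rightarrow> ('a \<Rightarrow> 'b) \<Rightarrow> 'a \<Rightarrow> 'b" where
  "scaleR_fun c f = (\<lambda>x. c *\<^sub>R f x)"

instance ..

end

instance "fun" :: (type, real_vector) real_vector
  by standard (simp_all add: scaleR_fun_def fun_eq_iff scaleR_add_right scaleR_add_left)

definition linear_map_on :: "'v::real_vector set \<Rightarrow> ('v \<Rightarrow> 'w::real_vector) \<Rightarrow> bool" where
  "linear_map_on V f \<longleftrightarrow>
     (\<forall>u\<in>V. \<forall>v\<in>V. \<forall>a b. f (a *\<^sub>R u + b *\<^sub>R v) = a *\<^sub>R f u + b *\<^sub>R f v)"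


section \<open>Smooth manifolds\<close>

primrec k_smooth_on ::
  "'e::real_normed_vector set \<Rightarrow> nat \<Rightarrow> ('e \<Rightarrow> 'f::real_normed_vector) \<Rightarrow> bool" where
  "k_smooth_on S 0 f \<longleftrightarrow> continuous_on S f"
| "k_smooth_on S (Suc k) f \<longleftrightarrow>
     (\<forall>x\<in>S. f differentiable (at x)) \<and>
     (\<forall>v. k_smooth_on S k (\<lambda>x. frechet_derivative f (at x) v))"

definition smooth_on :: "'e::real_normed_vector set \<Rightarrow> ('e \<Rightarrow> 'f::real_normed_vector) \<Rightarrow> bool" where
  "smooth_on S f \<longleftrightarrow> (\<forall>k. k_smooth_on S k f)"

text \<open>The manifold is the whole type \<^typ>\<open>'a\<close>; its smooth structure is given by a set of
  charts \<open>(U, \<psi>)\<close>, where only the values of \<open>\<psi>\<close> on the open set \<open>U\<close> matter.\<close>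

type_synonym ('a, 'e) atlas = "('a set \<times> ('a \<Rightarrow> 'e)) set"

definition is_chart :: "'a::topological_space set \<times> ('a \<Rightarrow> 'e::euclidean_space) \<Rightarrow> bool" where
  "is_chart = (\<lambda>(U, \<psi>). open U \<and> open (\<psi> ` U) \<and> homeomorphism U (\<psi> ` U) \<psi> (inv_into U \<psi>))"

definition smooth_atlas :: "('a::topological_space, 'e::euclidean_space) atlas \<Rightarrow> bool" where
  "smooth_atlas \<A> \<longleftrightarrow>
     (\<forall>c\<in>\<A>. is_chart c) \<and>
     (\<Union>(U, \<psi>)\<in>\<A>. U) = UNIV \<and>
     (\<forall>(U, \<psi>)\<in>\<A>. \<forall>(V, \<psi>')\<in>\<A>. smooth_on (\<psi> ` (U \<inter> V)) (\<psi>' \<circ> inv_into U \<psi>))"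

definition smooth_funs :: "('a, 'e::euclidean_space) atlas \<Rightarrow> ('a \<Rightarrow> real) set" where
  "smooth_funs \<A> = {f. \<forall>(U, \<psi>)\<in>\<A>. smooth_on (\<psi> ` U) (f \<circ> inv_into U \<psi>)}"

definition product_with_line :: "('a, 'e) atlas \<Rightarrow> ('a \<times> real, 'e \<times> real) atlas" where
  "product_with_line \<A> = (\<lambda>(U, \<psi>). (U \<times> UNIV, \<lambda>(x, t). (\<psi> x, t))) ` \<A>"

text \<open>Tangent vectors at \<open>x\<close> are the derivations at \<open>x\<close> of the algebra of smooth functions,
  extended by \<open>0\<close> to the non-smooth functions so that equal derivations are equal in HOL.\<close>

type_synonym 'a tvec = "('a \<Rightarrow> real) \<Rightarrow> real"

definition tangent_space :: "('a, 'e::euclidean_space) atlas \<Rightarrow> 'a \<Rightarrow> 'a tvec set" where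
  "tangent_space \<A> x = {v.
     linear_map_on (smooth_funs \<A>) v \<and>
     (\<forall>f\<in>smooth_funs \<A>. \<forall>h\<in>smooth_funs \<A>. v (\<lambda>y. f y * h y) = f x * v h + h x * v f) \<and>
     (\<forall>f. f \<notin> smooth_funs \<A> \<longrightarrow> v f = 0)}"

definition vector_fields :: "('a, 'e::euclidean_space) atlas \<Rightarrow> ('a \<Rightarrow> 'a tvec) set" where
  "vector_fields \<A> = {X. (\<forall>x. X x \<in> tangent_space \<A> x) \<and>
     (\<forall>f\<in>smooth_funs \<A>. (\<lambda>x. X x f) \<in> smooth_funs \<A>)}"

definition lie_bracket :: "('a \<Rightarrow> 'a tvec) \<Rightarrow> ('a \<Rightarrow> 'a tvec) \<Rightarrow> 'a \<Rightarrow> 'a tvec" where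
  "lie_bracket X Y = (\<lambda>x f. X x (\<lambda>y. Y y f) - Y x (\<lambda>y. X y f))"

definition pushforward ::
  "('b, 'e::euclidean_space) atlas \<Rightarrow> ('a \<Rightarrow> 'b) \<Rightarrow> 'a tvec \<Rightarrow> 'b tvec" where
  "pushforward \<B> F v = (\<lambda>h. if h \<in> smooth_funs \<B> then v (h \<circ> F) else 0)"


section \<open>Vector bundles and skew algebroids\<close>

text \<open>A bundle over the manifold is given by its fibres (subspaces of one ambient real vector
  space) together with its smooth sections.\<close>

record ('a, 'b) vbundle =
  fiber :: "'a \<Rightarrow> 'b set"
  sections :: "('a \<Rightarrow> 'b) set"

record ('a, 'b) algebroid = "('a, 'b) vbundle" +
  anchor :: "'a \<Rightarrow> 'b \<Rightarrow> 'a tvec"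
  bracket :: "('a \<Rightarrow> 'b) \<Rightarrow> ('a \<Rightarrow> 'b) \<Rightarrow> 'a \<Rightarrow> 'b"

text \<open>Covectors are likewise extended by \<open>0\<close> outside the fibre.\<close>

definition dual_fiber :: "('a, 'b::real_vector, 'm) vbundle_scheme \<Rightarrow> 'a \<Rightarrow> ('b \<Rightarrow> real) set" where
  "dual_fiber A x = {a. linear_map_on (fiber A x) a \<and> (\<forall>v. v \<notin> fiber A x \<longrightarrow> a v = 0)}"

definition dual_sections ::
  "('a, 'e::euclidean_space) atlas \<Rightarrow> ('a, 'b::real_vector, 'm) vbundle_scheme
   \<Rightarrow> ('a \<Rightarrow> 'b \<Rightarrow> real) set" where
  "dual_sections \<A> A = {\<alpha>. (\<forall>x. \<alpha> x \<in> dual_fiber A x) \<and>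
     (\<forall>X\<in>sections A. (\<lambda>x. \<alpha> x (X x)) \<in> smooth_funs \<A>)}"

definition pseudo_metric ::
  "('a, 'e::euclidean_space) atlas \<Rightarrow> ('a, 'b::real_vector, 'm) vbundle_scheme
   \<Rightarrow> ('a \<Rightarrow> 'b \<Rightarrow> 'b \<Rightarrow> real) \<Rightarrow> bool" where
  "pseudo_metric \<A> A g \<longleftrightarrow>
     (\<forall>x. \<forall>v\<in>fiber A x. linear_map_on (fiber A x) (g x v)) \<and>
     (\<forall>x. \<forall>v\<in>fiber A x. \<forall>w\<in>fiber A x. g x v w = g x w v) \<and>
     (\<forall>x. \<forall>v\<in>fiber A x. (\<forall>w\<in>fiber A x. g x v w = 0) \<longrightarrow> v = 0) \<and>
     (\<forall>X\<in>sections A. \<forall>Y\<in>sections A. (\<lambda>x. g x (X x) (Y x)) \<in> smooth_funs \<A>)"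

text \<open>Signature \<open>(p, q)\<close>: every fibre has a pseudo-orthonormal basis with \<open>p\<close> vectors of square
  \<open>1\<close> and \<open>q\<close> vectors of square \<open>-1\<close> (independence is implied by orthonormality).\<close>

definition has_signature ::
  "('a, 'b::real_vector, 'm) vbundle_scheme \<Rightarrow> ('a \<Rightarrow> 'b \<Rightarrow> 'b \<Rightarrow> real) \<Rightarrow> nat \<Rightarrow> nat \<Rightarrow> bool" where
  "has_signature A g p q \<longleftrightarrow> (\<forall>x. \<exists>e :: nat \<Rightarrow> 'b.
     (\<forall>i<p + q. e i \<in> fiber A x) \<and> span (e ` {..<p + q}) = fiber A x \<and>
     (\<forall>i<p + q. \<forall>j<p + q. g x (e i) (e j) = (if i \<noteq> j then 0 else if i < p then 1 else - 1)))"

text \<open>For a bilinear form \<open>T\<close> on the dual fibre, \<open>contract A T x a\<close> is the element \<open>v\<close> of the fibre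
  with \<open>\<langle>v, b\<rangle> = T(a, b)\<close> for all covectors \<open>b\<close>. For a 2-section \<open>\<pi>\<close> this is \<open>\<pi>\<^sup>\<sharp>\<close>, for a metric \<open>g\<^sup>*\<close>
  on the dual bundle it is \<open>(g\<^sup>*)\<^sup>\<flat>\<close>.\<close>

definition contract ::
  "('a, 'b::real_vector, 'm) vbundle_scheme \<Rightarrow> ('a \<Rightarrow> ('b \<Rightarrow> real) \<Rightarrow> ('b \<Rightarrow> real) \<Rightarrow> real)
   \<Rightarrow> 'a \<Rightarrow> ('b \<Rightarrow> real) \<Rightarrow> 'b" where
  "contract A T x a = (THE v. v \<in> fiber A x \<and> (\<forall>b\<in>dual_fiber A x. b v = T x a b))"

text \<open>The algebroid differential on functions and on 1-forms. The 2-form \<open>d1 A \<beta>\<close> is tensorial, so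
  its value at \<open>(v, w)\<close> is computed with arbitrary sections through \<open>v\<close> and \<open>w\<close>; there is no
  factor 1/2.\<close>

definition extend :: "('a, 'b, 'm) vbundle_scheme \<Rightarrow> 'a \<Rightarrow> 'b \<Rightarrow> 'a \<Rightarrow> 'b" where
  "extend A x v = (SOME X. X \<in> sections A \<and> X x = v)"

definition d0 :: "('a, 'b, 'm) algebroid_scheme \<Rightarrow> ('a \<Rightarrow> real) \<Rightarrow> 'a \<Rightarrow> 'b \<Rightarrow> real" where
  "d0 A f x v = (if v \<in> fiber A x then anchor A x v f else 0)"

definition d1 ::
  "('a, 'b, 'm) algebroid_scheme \<Rightarrow> ('a \<Rightarrow> 'b \<Rightarrow> real) \<Rightarrow> 'a \<Rightarrow> 'b \<Rightarrow> 'b \<Rightarrow> real" where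
  "d1 A \<beta> x v w =
     (let X = extend A x v; Y = extend A x w in
        anchor A x v (\<lambda>y. \<beta> y (Y y)) - anchor A x w (\<lambda>y. \<beta> y (X y)) - \<beta> x (bracket A X Y x))"

definition tangent_algebroid :: "('a, 'e::euclidean_space) atlas \<Rightarrow> ('a, 'a tvec) algebroid" where
  "tangent_algebroid \<A> = \<lparr>fiber = tangent_space \<A>, sections = vector_fields \<A>,
     anchor = (\<lambda>x v. v), bracket = lie_bracket\<rparr>"


section \<open>Contact forms and their Jacobi structures\<close>

text \<open>A \<open>k\<close>-form on a vector space is a function of a sequence of vectors that only depends on the
  first \<open>k\<close> of them.\<close>

definition wedge ::
  "nat \<Rightarrow> nat \<Rightarrow> ((nat \<Rightarrow> 'v) \<Rightarrow> real) \<Rightarrow> ((nat \<Rightarrow> 'v) \<Rightarrow> real) \<Rightarrow> (nat \<Rightarrow> 'v) \<Rightarrow> real" where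
  "wedge k l \<omega> \<tau> v = 1 / (fact k * fact l) *
     (\<Sum>\<sigma> | \<sigma> permutes {..<k + l}.
        of_int (sign \<sigma>) * \<omega> (\<lambda>i. v (\<sigma> i)) * \<tau> (\<lambda>i. v (\<sigma> (k + i))))"

primrec wedge_power_2form ::
  "((nat \<Rightarrow> 'v) \<Rightarrow> real) \<Rightarrow> nat \<Rightarrow> (nat \<Rightarrow> 'v) \<Rightarrow> real" where
  "wedge_power_2form \<omega> 0 = (\<lambda>v. 1)"
| "wedge_power_2form \<omega> (Suc m) = wedge 2 (2 * m) \<omega> (wedge_power_2form \<omega> m)"

text \<open>On a manifold of dimension \<open>2n+1\<close>: \<open>\<theta> \<and> (d\<theta>)\<^sup>n\<close> vanishes nowhere.\<close>

definition contact_form ::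
  "('a, 'e::euclidean_space) atlas \<Rightarrow> nat \<Rightarrow> ('a \<Rightarrow> 'a tvec \<Rightarrow> real) \<Rightarrow> bool" where
  "contact_form \<A> n \<theta> \<longleftrightarrow>
     \<theta> \<in> dual_sections \<A> (tangent_algebroid \<A>) \<and>
     (\<forall>x. \<exists>v. (\<forall>i. v i \<in> tangent_space \<A> x) \<and>
        wedge 1 (2 * n) (\<lambda>u. \<theta> x (u 0))
          (wedge_power_2form (\<lambda>u. d1 (tangent_algebroid \<A>) \<theta> x (u 0) (u 1)) n) v \<noteq> 0)"

definition contact_flat ::
  "('a, 'e::euclidean_space) atlas \<Rightarrow> ('a \<Rightarrow> 'a tvec \<Rightarrow> real) \<Rightarrow> 'a \<Rightarrow> 'a tvec \<Rightarrow> 'a tvec \<Rightarrow> real" where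
  "contact_flat \<A> \<theta> x v = (\<lambda>w. if w \<in> tangent_space \<A> x
     then d1 (tangent_algebroid \<A>) \<theta> x v w + \<theta> x v * \<theta> x w else 0)"

definition contact_bivector ::
  "('a, 'e::euclidean_space) atlas \<Rightarrow> ('a \<Rightarrow> 'a tvec \<Rightarrow> real)
   \<Rightarrow> 'a \<Rightarrow> ('a tvec \<Rightarrow> real) \<Rightarrow> ('a tvec \<Rightarrow> real) \<Rightarrow> real" where
  "contact_bivector \<A> \<theta> x \<alpha> \<beta> = d1 (tangent_algebroid \<A>) \<theta> x
     (inv_into (tangent_space \<A> x) (contact_flat \<A> \<theta> x) \<alpha>)
     (inv_into (tangent_space \<A> x) (contact_flat \<A> \<theta> x) \<beta>)"

definition reeb_field ::
  "('a, 'e::euclidean_space) atlas \<Rightarrow> ('a \<Rightarrow> 'a tvec \<Rightarrow> real) \<Rightarrow> 'a \<Rightarrow> 'a tvec" where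
  "reeb_field \<A> \<theta> = (THE E. E \<in> vector_fields \<A> \<and>
     (\<forall>x. \<theta> x (E x) = 1) \<and>
     (\<forall>x. \<forall>w\<in>tangent_space \<A> x. d1 (tangent_algebroid \<A>) \<theta> x (E x) w = 0))"


section \<open>Contact and Sasakian pseudo-metric structures\<close>

definition endomorphism_field ::
  "('a, 'e::euclidean_space) atlas \<Rightarrow> ('a \<Rightarrow> 'a tvec \<Rightarrow> 'a tvec) \<Rightarrow> bool" where
  "endomorphism_field \<A> \<phi> \<longleftrightarrow>
     (\<forall>x. linear_map_on (tangent_space \<A> x) (\<phi> x)) \<and>
     (\<forall>x. \<phi> x ` tangent_space \<A> x \<subseteq> tangent_space \<A> x) \<and>
     (\<forall>X\<in>vector_fields \<A>. (\<lambda>x. \<phi> x (X x)) \<in> vector_fields \<A>)"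

definition almost_contact ::
  "('a, 'e::euclidean_space) atlas \<Rightarrow> ('a \<Rightarrow> 'a tvec \<Rightarrow> 'a tvec) \<Rightarrow> ('a \<Rightarrow> 'a tvec)
   \<Rightarrow> ('a \<Rightarrow> 'a tvec \<Rightarrow> real) \<Rightarrow> bool" where
  "almost_contact \<A> \<phi> \<xi> \<eta> \<longleftrightarrow>
     endomorphism_field \<A> \<phi> \<and> \<xi> \<in> vector_fields \<A> \<and>
     \<eta> \<in> dual_sections \<A> (tangent_algebroid \<A>) \<and>
     (\<forall>x. \<forall>v\<in>tangent_space \<A> x. \<phi> x (\<phi> x v) = - v + \<eta> x v *\<^sub>R \<xi> x) \<and>
     (\<forall>x. \<eta> x (\<xi> x) = 1)"

definition line_vector :: "('a, 'e::euclidean_space) atlas \<Rightarrow> 'a \<times> real \<Rightarrow> ('a \<times> real) tvec" where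
  "line_vector \<A> = (\<lambda>(x, t) h. if h \<in> smooth_funs (product_with_line \<A>)
     then deriv (\<lambda>s. h (x, s)) t else 0)"

text \<open>\<open>J(X + f d/dt) = \<phi> X + f \<xi> - \<langle>\<eta>, X\<rangle> d/dt\<close> at \<open>(x, t)\<close>: the component of \<open>V\<close> tangent to \<open>M\<close> is its
  pushforward along the projection, the component \<open>f\<close> is \<open>V(t)\<close>, and vectors tangent to \<open>M\<close> at \<open>x\<close>
  are pushed into the product along \<open>y \<mapsto> (y, t)\<close>.\<close>

definition almost_complex_J ::
  "('a, 'e::euclidean_space) atlas \<Rightarrow> ('a \<Rightarrow> 'a tvec \<Rightarrow> 'a tvec) \<Rightarrow> ('a \<Rightarrow> 'a tvec)
   \<Rightarrow> ('a \<Rightarrow> 'a tvec \<Rightarrow> real) \<Rightarrow> 'a \<times> real \<Rightarrow> ('a \<times> real) tvec \<Rightarrow> ('a \<times> real) tvec" where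
  "almost_complex_J \<A> \<phi> \<xi> \<eta> = (\<lambda>(x, t) V.
     (let v = pushforward \<A> fst V; f = V snd in
        pushforward (product_with_line \<A>) (\<lambda>y. (y, t)) (\<phi> x v + f *\<^sub>R \<xi> x)
        - \<eta> x v *\<^sub>R line_vector \<A> (x, t)))"

text \<open>Integrability of an almost complex structure is vanishing of its Nijenhuis torsion.\<close>

definition integrable_acs ::
  "('a, 'e::euclidean_space) atlas \<Rightarrow> ('a \<Rightarrow> 'a tvec \<Rightarrow> 'a tvec) \<Rightarrow> bool" where
  "integrable_acs \<A> J \<longleftrightarrow>
     (\<forall>V\<in>vector_fields \<A>. \<forall>W\<in>vector_fields \<A>. \<forall>x.
        lie_bracket (\<lambda>y. J y (V y)) (\<lambda>y. J y (W y)) x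
        - J x (lie_bracket (\<lambda>y. J y (V y)) W x)
        - J x (lie_bracket V (\<lambda>y. J y (W y)) x)
        - lie_bracket V W x = 0)"

definition normal_structure ::
  "('a, 'e::euclidean_space) atlas \<Rightarrow> ('a \<Rightarrow> 'a tvec \<Rightarrow> 'a tvec) \<Rightarrow> ('a \<Rightarrow> 'a tvec)
   \<Rightarrow> ('a \<Rightarrow> 'a tvec \<Rightarrow> real) \<Rightarrow> bool" where
  "normal_structure \<A> \<phi> \<xi> \<eta> \<longleftrightarrow>
     integrable_acs (product_with_line \<A>) (almost_complex_J \<A> \<phi> \<xi> \<eta>)"

definition almost_contact_pseudo_metric ::
  "('a, 'e::euclidean_space) atlas \<Rightarrow> nat \<Rightarrow> nat \<Rightarrow> ('a \<Rightarrow> 'a tvec \<Rightarrow> 'a tvec)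
   \<Rightarrow> ('a \<Rightarrow> 'a tvec) \<Rightarrow> ('a \<Rightarrow> 'a tvec \<Rightarrow> real) \<Rightarrow> ('a \<Rightarrow> 'a tvec \<Rightarrow> 'a tvec \<Rightarrow> real) \<Rightarrow> bool" where
  "almost_contact_pseudo_metric \<A> p q \<phi> \<xi> \<eta> g \<longleftrightarrow>
     almost_contact \<A> \<phi> \<xi> \<eta> \<and>
     pseudo_metric \<A> (tangent_algebroid \<A>) g \<and> has_signature (tangent_algebroid \<A>) g p q \<and>
     (\<forall>x. \<forall>v\<in>tangent_space \<A> x. \<forall>w\<in>tangent_space \<A> x.
        g x (\<phi> x v) (\<phi> x w) = g x v w - (- 1) ^ q * \<eta> x v * \<eta> x w)"

definition contact_pseudo_metric ::
  "('a, 'e::euclidean_space) atlas \<Rightarrow> nat \<Rightarrow> nat \<Rightarrow> nat \<Rightarrow> ('a \<Rightarrow> 'a tvec \<Rightarrow> 'a tvec)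
   \<Rightarrow> ('a \<Rightarrow> 'a tvec) \<Rightarrow> ('a \<Rightarrow> 'a tvec \<Rightarrow> real) \<Rightarrow> ('a \<Rightarrow> 'a tvec \<Rightarrow> 'a tvec \<Rightarrow> real) \<Rightarrow> bool" where
  "contact_pseudo_metric \<A> n p q \<phi> \<xi> \<eta> g \<longleftrightarrow>
     almost_contact_pseudo_metric \<A> p q \<phi> \<xi> \<eta> g \<and> contact_form \<A> n \<eta> \<and>
     (\<forall>x. \<forall>v\<in>tangent_space \<A> x. \<forall>w\<in>tangent_space \<A> x.
        g x (\<phi> x v) w = d1 (tangent_algebroid \<A>) \<eta> x v w)"

definition sasakian_pseudo_metric ::
  "('a, 'e::euclidean_space) atlas \<Rightarrow> nat \<Rightarrow> nat \<Rightarrow> nat \<Rightarrow> ('a \<Rightarrow> 'a tvec \<Rightarrow> 'a tvec)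
   \<Rightarrow> ('a \<Rightarrow> 'a tvec) \<Rightarrow> ('a \<Rightarrow> 'a tvec \<Rightarrow> real) \<Rightarrow> ('a \<Rightarrow> 'a tvec \<Rightarrow> 'a tvec \<Rightarrow> real) \<Rightarrow> bool" where
  "sasakian_pseudo_metric \<A> n p q \<phi> \<xi> \<eta> g \<longleftrightarrow>
     contact_pseudo_metric \<A> n p q \<phi> \<xi> \<eta> g \<and> normal_structure \<A> \<phi> \<xi> \<eta>"


section \<open>The Jacobi algebroid \<open>(TM \<oplus> \<real>, (0, 1))\<close>\<close>

definition TM_plus_R :: "('a, 'e::euclidean_space) atlas \<Rightarrow> ('a, 'a tvec \<times> real) algebroid" where
  "TM_plus_R \<A> = \<lparr>fiber = (\<lambda>x. tangent_space \<A> x \<times> UNIV),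
     sections = {s. (\<lambda>x. fst (s x)) \<in> vector_fields \<A> \<and> (\<lambda>x. snd (s x)) \<in> smooth_funs \<A>},
     anchor = (\<lambda>x s. fst s),
     bracket = (\<lambda>s t x.
       (lie_bracket (\<lambda>y. fst (s y)) (\<lambda>y. fst (t y)) x,
        fst (s x) (\<lambda>y. snd (t y)) - fst (t x) (\<lambda>y. snd (s y))))\<rparr>"

text \<open>A pair \<open>(\<alpha>, f)\<close> of a 1-form and a function is the section \<open>(X, h) \<mapsto> \<alpha>(X) + f h\<close> of the dual
  bundle; conversely \<open>\<alpha> = a(\<cdot>, 0)\<close> and \<open>f = a(0, 1)\<close>.\<close>

definition dual_pair ::
  "('a, 'e::euclidean_space) atlas \<Rightarrow> ('a \<Rightarrow> 'a tvec \<Rightarrow> real) \<Rightarrow> ('a \<Rightarrow> real)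
   \<Rightarrow> 'a \<Rightarrow> 'a tvec \<times> real \<Rightarrow> real" where
  "dual_pair \<A> \<alpha> f x = (\<lambda>(v, r). if v \<in> tangent_space \<A> x then \<alpha> x v + f x * r else 0)"

definition bisection_of_pair ::
  "('a \<Rightarrow> ('a tvec \<Rightarrow> real) \<Rightarrow> ('a tvec \<Rightarrow> real) \<Rightarrow> real) \<Rightarrow> ('a \<Rightarrow> 'a tvec)
   \<Rightarrow> 'a \<Rightarrow> ('a tvec \<times> real \<Rightarrow> real) \<Rightarrow> ('a tvec \<times> real \<Rightarrow> real) \<Rightarrow> real" where
  "bisection_of_pair \<Lambda> E x a b =
     (let \<alpha> = (\<lambda>v. a (v, 0)); f = a (0, 1); \<beta> = (\<lambda>v. b (v, 0)); h = b (0, 1) in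
        \<Lambda> x \<alpha> \<beta> + f * \<beta> (E x) - h * \<alpha> (E x))"

definition dual_metric ::
  "('a, 'b::real_vector, 'm) vbundle_scheme \<Rightarrow> ('a \<Rightarrow> ('b \<Rightarrow> real) \<Rightarrow> ('b \<Rightarrow> real) \<Rightarrow> real)
   \<Rightarrow> ('a \<Rightarrow> 'b \<Rightarrow> 'b \<Rightarrow> real) \<Rightarrow> 'a \<Rightarrow> ('b \<Rightarrow> real) \<Rightarrow> ('b \<Rightarrow> real) \<Rightarrow> real" where
  "dual_metric A \<pi> G x a b = G x (contract A \<pi> x a) (contract A \<pi> x b)"


section \<open>Compatibility on a Jacobi algebroid\<close>

text \<open>\<open>d\<^sub>A\<^sub>,\<^sub>\<phi>\<^sub>0 \<omega> = d\<^sub>A \<omega> + \<phi>\<^sub>0 \<and> \<omega>\<close> in degrees 0 and 1, the only ones entering the bracket below; with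
  the convention of \<^const>\<open>wedge\<close>, \<open>(\<phi>\<^sub>0 \<and> \<beta>)(v, w) = \<phi>\<^sub>0(v) \<beta>(w) - \<phi>\<^sub>0(w) \<beta>(v)\<close>.\<close>

definition dphi0 ::
  "('a, 'b, 'm) algebroid_scheme \<Rightarrow> ('a \<Rightarrow> 'b \<Rightarrow> real) \<Rightarrow> ('a \<Rightarrow> real) \<Rightarrow> 'a \<Rightarrow> 'b \<Rightarrow> real" where
  "dphi0 A \<phi>\<^sub>0 f x v = d0 A f x v + f x * \<phi>\<^sub>0 x v"

definition dphi1 ::
  "('a, 'b, 'm) algebroid_scheme \<Rightarrow> ('a \<Rightarrow> 'b \<Rightarrow> real) \<Rightarrow> ('a \<Rightarrow> 'b \<Rightarrow> real)
   \<Rightarrow> 'a \<Rightarrow> 'b \<Rightarrow> 'b \<Rightarrow> real" where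
  "dphi1 A \<phi>\<^sub>0 \<beta> x v w = d1 A \<beta> x v w + (\<phi>\<^sub>0 x v * \<beta> x w - \<phi>\<^sub>0 x w * \<beta> x v)"

definition lie_deriv_phi ::
  "('a, 'b, 'm) algebroid_scheme \<Rightarrow> ('a \<Rightarrow> 'b \<Rightarrow> real) \<Rightarrow> ('a \<Rightarrow> 'b) \<Rightarrow> ('a \<Rightarrow> 'b \<Rightarrow> real)
   \<Rightarrow> 'a \<Rightarrow> 'b \<Rightarrow> real" where
  "lie_deriv_phi A \<phi>\<^sub>0 X \<beta> x v =
     (if v \<in> fiber A x
      then dphi1 A \<phi>\<^sub>0 \<beta> x (X x) v + dphi0 A \<phi>\<^sub>0 (\<lambda>y. \<beta> y (X y)) x v else 0)"

definition dual_bracket ::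
  "('a, 'b::real_vector, 'm) algebroid_scheme \<Rightarrow> ('a \<Rightarrow> 'b \<Rightarrow> real)
   \<Rightarrow> ('a \<Rightarrow> ('b \<Rightarrow> real) \<Rightarrow> ('b \<Rightarrow> real) \<Rightarrow> real)
   \<Rightarrow> ('a \<Rightarrow> 'b \<Rightarrow> real) \<Rightarrow> ('a \<Rightarrow> 'b \<Rightarrow> real) \<Rightarrow> 'a \<Rightarrow> 'b \<Rightarrow> real" where
  "dual_bracket A \<phi>\<^sub>0 \<pi> \<alpha> \<beta> =
     (let \<pi>\<alpha> = (\<lambda>x. contract A \<pi> x (\<alpha> x)); \<pi>\<beta> = (\<lambda>x. contract A \<pi> x (\<beta> x)) in
        (\<lambda>x v. lie_deriv_phi A \<phi>\<^sub>0 \<pi>\<alpha> \<beta> x v - lie_deriv_phi A \<phi>\<^sub>0 \<pi>\<beta> \<alpha> x v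
               - dphi0 A \<phi>\<^sub>0 (\<lambda>y. \<beta> y (\<pi>\<alpha> y)) x v))"

text \<open>The skew algebroid \<open>A\<^sup>*\<^sub>\<pi>\<^sub>,\<^sub>\<phi>\<^sub>0\<close>.\<close>

definition dual_algebroid ::
  "('a, 'e::euclidean_space) atlas \<Rightarrow> ('a, 'b::real_vector, 'm) algebroid_scheme
   \<Rightarrow> ('a \<Rightarrow> 'b \<Rightarrow> real) \<Rightarrow> ('a \<Rightarrow> ('b \<Rightarrow> real) \<Rightarrow> ('b \<Rightarrow> real) \<Rightarrow> real)
   \<Rightarrow> ('a, 'b \<Rightarrow> real) algebroid" where
  "dual_algebroid \<A> A \<phi>\<^sub>0 \<pi> = \<lparr>fiber = dual_fiber A, sections = dual_sections \<A> A,
     anchor = (\<lambda>x a. anchor A x (contract A \<pi> x a)), bracket = dual_bracket A \<phi>\<^sub>0 \<pi>\<rparr>"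

definition levi_civita ::
  "('a, 'e::euclidean_space) atlas \<Rightarrow> ('a, 'c::real_vector, 'm) algebroid_scheme
   \<Rightarrow> ('a \<Rightarrow> 'c \<Rightarrow> 'c \<Rightarrow> real) \<Rightarrow> (('a \<Rightarrow> 'c) \<Rightarrow> ('a \<Rightarrow> 'c) \<Rightarrow> 'a \<Rightarrow> 'c) \<Rightarrow> bool" where
  "levi_civita \<A> B m D \<longleftrightarrow>
     (\<forall>\<alpha>\<in>sections B. \<forall>\<beta>\<in>sections B. D \<alpha> \<beta> \<in> sections B) \<and>
     (\<forall>\<alpha>\<in>sections B. linear_map_on (sections B) (D \<alpha>)) \<and>
     (\<forall>\<beta>\<in>sections B. linear_map_on (sections B) (\<lambda>\<alpha>. D \<alpha> \<beta>)) \<and>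
     (\<forall>f\<in>smooth_funs \<A>. \<forall>\<alpha>\<in>sections B. \<forall>\<beta>\<in>sections B.
        D (\<lambda>x. f x *\<^sub>R \<alpha> x) \<beta> = (\<lambda>x. f x *\<^sub>R D \<alpha> \<beta> x)) \<and>
     (\<forall>f\<in>smooth_funs \<A>. \<forall>\<alpha>\<in>sections B. \<forall>\<beta>\<in>sections B.
        D \<alpha> (\<lambda>x. f x *\<^sub>R \<beta> x)
          = (\<lambda>x. f x *\<^sub>R D \<alpha> \<beta> x + anchor B x (\<alpha> x) f *\<^sub>R \<beta> x)) \<and>
     (\<forall>\<alpha>\<in>sections B. \<forall>\<beta>\<in>sections B. (\<lambda>x. D \<alpha> \<beta> x - D \<beta> \<alpha> x) = bracket B \<alpha> \<beta>) \<and>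
     (\<forall>\<alpha>\<in>sections B. \<forall>\<beta>\<in>sections B. \<forall>\<gamma>\<in>sections B. \<forall>x.
        anchor B x (\<alpha> x) (\<lambda>y. m y (\<beta> y) (\<gamma> y))
          = m x (D \<alpha> \<beta> x) (\<gamma> x) + m x (\<beta> x) (D \<alpha> \<gamma> x))"

text \<open>The Levi-Civita connection is unique (Koszul formula), so it is referred to by an existential
  quantifier.\<close>

definition compatible ::
  "('a, 'e::euclidean_space) atlas \<Rightarrow> ('a, 'b::real_vector, 'm) algebroid_scheme
   \<Rightarrow> ('a \<Rightarrow> 'b \<Rightarrow> real) \<Rightarrow> ('a \<Rightarrow> ('b \<Rightarrow> real) \<Rightarrow> ('b \<Rightarrow> real) \<Rightarrow> real)
   \<Rightarrow> ('a \<Rightarrow> ('b \<Rightarrow> real) \<Rightarrow> ('b \<Rightarrow> real) \<Rightarrow> real) \<Rightarrow> bool" where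
  "compatible \<A> A \<phi>\<^sub>0 \<pi> gs \<longleftrightarrow>
     (let B = dual_algebroid \<A> A \<phi>\<^sub>0 \<pi>;
          X\<^sub>0 = (\<lambda>x. - contract A \<pi> x (\<phi>\<^sub>0 x));
          X\<^sub>0' = (\<lambda>x. inv_into (dual_fiber A x) (contract A gs x) (X\<^sub>0 x)) in
      \<exists>D. levi_civita \<A> B gs D \<and>
        (\<forall>\<alpha>\<in>sections B. \<forall>\<beta>\<in>sections B. \<forall>\<gamma>\<in>sections B. \<forall>x.
          anchor B x (\<alpha> x) (\<lambda>y. \<pi> y (\<beta> y) (\<gamma> y))
            - \<pi> x (D \<alpha> \<beta> x) (\<gamma> x) - \<pi> x (\<beta> x) (D \<alpha> \<gamma> x)
          = - (1 / 2) *
            (\<beta> x (X\<^sub>0 x) * \<pi> x (\<gamma> x) (\<alpha> x) + \<gamma> x (X\<^sub>0 x) * \<pi> x (\<alpha> x) (\<beta> x)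
             + gs x (\<alpha> x) (\<beta> x) * \<pi> x (X\<^sub>0' x) (\<gamma> x)
             - gs x (\<alpha> x) (\<gamma> x) * \<pi> x (X\<^sub>0' x) (\<beta> x))))"

end

theory Submission
  imports Defs
begin

text \<open>
  Let \<open>\<nabla>\<close> be the Levi-Civita connection of \<open>g\<close>. The isomorphism \<open>\<pi>\<^sup>\<sharp>\<close> carries the skew algebroid \<open>A\<^sup>*\<close> with
  the metric \<open>G\<^sup>*\<close> to \<open>TM \<oplus> \<real>\<close> with the metric \<open>G\<close>, because the 2-form inverse to \<open>\<pi>\<close> is exact for the
  twisted differential. The Levi-Civita connection of \<open>G\<close> maps \<open>((X, f), (Y, h))\<close> to \<open>(\<nabla>\<^sub>X Y, X h)\<close>, and
  the transported compatibility equation is \<open>(\<nabla>\<^sub>X \<phi>) Y = (\<epsilon> \<eta>(Y) X - g(X, Y) \<xi>) / 2\<close>. That this is equivalent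
  to normality, i.e. to the vanishing of \<open>[\<phi>, \<phi>] + d\<eta> \<otimes> \<xi>\<close>, is trilinear algebra: the difference of the two
  sides is skew in its last two arguments and has vanishing cyclic sum since \<open>d\<eta>\<close> is closed.

  Tangent vectors are derivations of the algebra of global smooth functions. Pointwise linear
  algebra is made smooth by means of bump functions and local frames.
\<close>

section \<open>Calculus of smooth maps between Euclidean spaces\<close>

text \<open>Three points shape the proof. First, \<open>compatible\<close> asserts only that some
  Levi-Civita connection of the dual metric satisfies the equation. One direction therefore starts
  from an arbitrary connection on TM + R and extracts from it a Levi-Civita connection of
  \<open>g\<close>; the other has to construct one by the Koszul formula. Second, all objects are
  global: a frame exists only up to a cut-off factor, and smoothness of the solution of a linear
  system is tested after multiplication by a function that does not vanish at the point. Third, the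
  factor 1/2 in the equation for \<phi> arises because d eta carries no factor 1/2: normality kills
  the symmetric part of the covariant derivative of eta, whose skew part is d eta / 2. The trilinear
  algebra becomes available only after this, since moving \<phi> between the last two arguments
  produces covariant derivatives of eta. The sign \<epsilon> is the square of \<xi> under
  \<open>g\<close>.\<close>

lemma k_smooth_on_Suc_frechet:
  "k_smooth_on S (Suc k) f \<Longrightarrow> k_smooth_on S k (\<lambda>x. frechet_derivative f (at x) v)"
  by simp

lemma k_smooth_on_cong:
  assumes "open S" "\<And>x. x \<in> S \<Longrightarrow> f x = g x" "k_smooth_on S k f"
  shows "k_smooth_on S k g"
  using assms(2,3)
proof (induction k arbitrary: f g)
  case 0
  then show ?case by (auto cong: continuous_on_cong)
next
  case (Suc k)
  have d: "f differentiable (at x)" if "x \<in> S" for x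
    using Suc.prems(2) that by simp
  have "frechet_derivative f (at x) = frechet_derivative g (at x)" if "x \<in> S" for x
    by (rule frechet_derivative_transform_within_open[OF d[OF that] \<open>open S\<close> that Suc.prems(1)])
  then have "k_smooth_on S k (\<lambda>x. frechet_derivative g (at x) v)" for v
    by (intro Suc.IH[OF _ k_smooth_on_Suc_frechet[OF Suc.prems(2)]]) simp
  moreover have "g differentiable (at x)" if "x \<in> S" for x
  proof -
    have "(f has_derivative frechet_derivative f (at x)) (at x)"
      using d[OF that] frechet_derivative_works by blast
    then have "(g has_derivative frechet_derivative f (at x)) (at x)"
      by (rule has_derivative_transform_within_open[OF _ \<open>open S\<close> that Suc.prems(1)])
    then show ?thesis by (rule differentiableI)
  qed
  ultimately show ?case by simp
qed

text \<open>\<open>frechet_derivative\<close> is a choice operator that is awkward to compute with.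
  This form accepts any explicit derivative, so that closure properties follow from the calculus
  rules by induction on the order.\<close>

lemma k_smooth_on_Suc_intro:
  assumes "open S" "\<And>x. x \<in> S \<Longrightarrow> (f has_derivative f' x) (at x)"
    and "\<And>v. k_smooth_on S k (\<lambda>x. f' x v)"
  shows "k_smooth_on S (Suc k) f"
proof -
  have e: "f' x = frechet_derivative f (at x)" if "x \<in> S" for x
    by (rule frechet_derivative_at[OF assms(2)[OF that]])
  have "k_smooth_on S k (\<lambda>x. frechet_derivative f (at x) v)" for v
    by (rule k_smooth_on_cong[OF assms(1) _ assms(3)[of v]]) (simp add: e)
  then show ?thesis
    using assms(2) by (auto simp: differentiable_def)
qed

lemma k_smooth_on_Suc_derivative:
  assumes "k_smooth_on S (Suc k) f" "x \<in> S"
  shows "(f has_derivative frechet_derivative f (at x)) (at x)"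
  using assms by (simp add: frechet_derivative_works[symmetric])

lemma k_smooth_on_SucD: "k_smooth_on S (Suc k) f \<Longrightarrow> k_smooth_on S k f"
proof (induction k arbitrary: f)
  case 0
  then have "f differentiable_on S"
    by (simp add: differentiable_on_def differentiable_at_withinI)
  then show ?case
    by (simp add: differentiable_imp_continuous_on)
next
  case (Suc k)
  have "k_smooth_on S k (\<lambda>x. frechet_derivative f (at x) v)" for v
    by (rule Suc.IH[OF k_smooth_on_Suc_frechet[OF Suc.prems]])
  moreover have "\<forall>x\<in>S. f differentiable (at x)"
    using Suc.prems by (subst (asm) k_smooth_on.simps(2)) blast
  ultimately show ?case by simp
qed

lemma k_smooth_on_subset: "k_smooth_on S k f \<Longrightarrow> T \<subseteq> S \<Longrightarrow> k_smooth_on T k f"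
proof (induction k arbitrary: f)
  case 0
  then show ?case by (simp add: continuous_on_subset)
next
  case (Suc k)
  then show ?case by (simp add: subset_iff)
qed

lemma k_smooth_on_const: "open S \<Longrightarrow> k_smooth_on S k (\<lambda>x. c)"
proof (induction k arbitrary: c)
  case (Suc k)
  show ?case
    by (rule k_smooth_on_Suc_intro[OF Suc.prems has_derivative_const Suc.IH[OF Suc.prems]])
qed simp

lemma k_smooth_on_bounded_linear:
  assumes "open S" "bounded_linear L"
  shows "k_smooth_on S k L"
proof (cases k)
  case 0
  then show ?thesis using assms by (simp add: linear_continuous_on)
next
  case (Suc m)
  show ?thesis unfolding Suc
    by (rule k_smooth_on_Suc_intro[OF assms(1) bounded_linear_imp_has_derivative[OF assms(2)]
          k_smooth_on_const[OF assms(1)]])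
qed

lemma k_smooth_on_linear_compose:
  assumes "open S" "bounded_linear L"
  shows "k_smooth_on S k f \<Longrightarrow> k_smooth_on S k (\<lambda>x. L (f x))"
proof (induction k arbitrary: f)
  case 0
  then show ?case
    using assms by (simp add: bounded_linear.continuous_on)
next
  case (Suc k)
  show ?case
    by (rule k_smooth_on_Suc_intro[OF assms(1)
          bounded_linear.has_derivative[OF assms(2) k_smooth_on_Suc_derivative[OF Suc.prems]]
          Suc.IH[OF k_smooth_on_Suc_frechet[OF Suc.prems]]])
qed

lemma k_smooth_on_add:
  assumes "open S"
  shows "k_smooth_on S k f \<Longrightarrow> k_smooth_on S k g \<Longrightarrow> k_smooth_on S k (\<lambda>x. f x + g x)"
proof (induction k arbitrary: f g)
  case 0
  then show ?case by (simp add: continuous_on_add)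
next
  case (Suc k)
  show ?case
    by (rule k_smooth_on_Suc_intro[OF assms has_derivative_add[OF
            k_smooth_on_Suc_derivative[OF Suc.prems(1)] k_smooth_on_Suc_derivative[OF Suc.prems(2)]]
          Suc.IH[OF k_smooth_on_Suc_frechet[OF Suc.prems(1)] k_smooth_on_Suc_frechet[OF Suc.prems(2)]]])
qed

lemma k_smooth_on_scaleR:
  assumes "open S"
  shows "k_smooth_on S k f \<Longrightarrow> k_smooth_on S k g \<Longrightarrow> k_smooth_on S k (\<lambda>x. f x *\<^sub>R g x)"
proof (induction k arbitrary: f g)
  case 0
  then show ?case by (simp add: continuous_on_scaleR)
next
  case (Suc k)
  show ?case
    by (rule k_smooth_on_Suc_intro[OF assms has_derivative_scaleR[OF
            k_smooth_on_Suc_derivative[OF Suc.prems(1)] k_smooth_on_Suc_derivative[OF Suc.prems(2)]]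
          k_smooth_on_add[OF assms
            Suc.IH[OF k_smooth_on_SucD[OF Suc.prems(1)] k_smooth_on_Suc_frechet[OF Suc.prems(2)]]
            Suc.IH[OF k_smooth_on_Suc_frechet[OF Suc.prems(1)] k_smooth_on_SucD[OF Suc.prems(2)]]]])
qed

lemma k_smooth_on_sum:
  assumes "open S" "\<And>i. i \<in> I \<Longrightarrow> k_smooth_on S k (f i)"
  shows "k_smooth_on S k (\<lambda>x. \<Sum>i\<in>I. f i x)"
  using assms(2)
  by (induction I rule: infinite_finite_induct)
    (auto intro!: k_smooth_on_const k_smooth_on_add simp: assms(1))

text \<open>The derivative of \<open>g\<close> at \<open>f x\<close> is applied to a direction that
  moves with \<open>x\<close>, which the induction hypothesis does not cover. Expanding that
  direction in \<open>Basis\<close> leaves scalar factors from \<open>f\<close> and derivatives of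
  \<open>g\<close> at \<open>f x\<close> in fixed directions; these are again compositions, hence
  \<open>g\<close> is arbitrary in the induction.\<close>

lemma k_smooth_on_compose:
  fixes f :: "'x::real_normed_vector \<Rightarrow> 'y::euclidean_space"
    and g :: "'y \<Rightarrow> 'z::real_normed_vector"
  assumes "open S" "open T" "f ` S \<subseteq> T"
  shows "k_smooth_on S k f \<Longrightarrow> k_smooth_on T k g \<Longrightarrow> k_smooth_on S k (\<lambda>x. g (f x))"
proof (induction k arbitrary: g)
  case 0
  then show ?case using assms(3) by (auto intro: continuous_on_compose2)
next
  case (Suc k)
  let ?f = "\<lambda>x. frechet_derivative f (at x)" and ?g = "\<lambda>x. frechet_derivative g (at x)"
  have f: "k_smooth_on S k f"
    using Suc.prems k_smooth_on_SucD by blast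
  have d: "((\<lambda>x. g (f x)) has_derivative (\<lambda>v. \<Sum>b\<in>Basis. (?f x v \<bullet> b) *\<^sub>R ?g (f x) b)) (at x)"
    if "x \<in> S" for x
  proof -
    have dg: "(g has_derivative ?g (f x)) (at (f x))"
      using k_smooth_on_Suc_derivative[OF Suc.prems(2)] assms(3) that by blast
    have "((\<lambda>x. g (f x)) has_derivative (\<lambda>v. ?g (f x) (?f x v))) (at x)"
      using has_derivative_compose[OF k_smooth_on_Suc_derivative[OF Suc.prems(1) that] dg] .
    moreover have "?g (f x) (?f x v) = (\<Sum>b\<in>Basis. (?f x v \<bullet> b) *\<^sub>R ?g (f x) b)" for v
    proof -
      have lin: "linear (?g (f x))"
        using dg has_derivative_linear by blast
      have "?g (f x) (?f x v) = ?g (f x) (\<Sum>b\<in>Basis. (?f x v \<bullet> b) *\<^sub>R b)"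
        by (simp add: euclidean_representation)
      then show ?thesis
        by (simp add: linear_sum[OF lin] linear_cmul[OF lin])
    qed
    ultimately show ?thesis by simp
  qed
  show ?case
  proof (rule k_smooth_on_Suc_intro[OF assms(1) d])
    fix v
    have "k_smooth_on S k (\<lambda>x. ?f x v \<bullet> b)" for b
      using Suc.prems(1)
      by (intro k_smooth_on_linear_compose[OF assms(1) bounded_linear_inner_left]) simp
    moreover have "k_smooth_on S k (\<lambda>x. ?g (f x) b)" for b
      using Suc.prems(2) by (intro Suc.IH f) simp
    ultimately show "k_smooth_on S k (\<lambda>x. \<Sum>b\<in>Basis. (?f x v \<bullet> b) *\<^sub>R ?g (f x) b)"
      using assms(1) by (intro k_smooth_on_sum k_smooth_on_scaleR) auto
  qed
qed

text \<open>The derivative of the reciprocal contains the reciprocal itself, needed only to one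
  order less, so the induction closes.\<close>

lemma k_smooth_on_inverse:
  fixes f :: "'x::real_normed_vector \<Rightarrow> real"
  assumes "open S" "\<And>x. x \<in> S \<Longrightarrow> f x \<noteq> 0"
  shows "k_smooth_on S k f \<Longrightarrow> k_smooth_on S k (\<lambda>x. inverse (f x))"
proof (induction k)
  case 0
  then show ?case using assms by (auto intro: continuous_on_inverse)
next
  case (Suc k)
  let ?f = "\<lambda>x. frechet_derivative f (at x)"
  have i: "k_smooth_on S k (\<lambda>x. inverse (f x))"
    using Suc k_smooth_on_SucD by blast
  have d: "((\<lambda>x. inverse (f x)) has_derivative
      (\<lambda>v. - (inverse (f x) *\<^sub>R ?f x v *\<^sub>R inverse (f x)))) (at x)"
    if "x \<in> S" for x
    using Deriv.has_derivative_inverse[OF assms(2)[OF that] k_smooth_on_Suc_derivative[OF Suc.prems that]]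
    by (simp add: mult.assoc)
  show ?case
  proof (rule k_smooth_on_Suc_intro[OF assms(1) d])
    fix v
    have "k_smooth_on S k (\<lambda>x. ?f x v)"
      using Suc.prems by simp
    then show "k_smooth_on S k (\<lambda>x. - (inverse (f x) *\<^sub>R ?f x v *\<^sub>R inverse (f x)))"
      using assms(1) i
      by (intro k_smooth_on_linear_compose[OF assms(1) bounded_linear_minus[OF bounded_linear_ident]]
          k_smooth_on_scaleR)
  qed
qed

lemma k_smooth_on_local:
  assumes "\<And>x. x \<in> S \<Longrightarrow> \<exists>T. open T \<and> x \<in> T \<and> k_smooth_on (S \<inter> T) k f"
  shows "k_smooth_on S k f"
  using assms
proof (induction k arbitrary: f)
  case 0
  have "continuous (at x within S) f" if "x \<in> S" for x
  proof -
    from 0[OF that] obtain T where T: "open T" "x \<in> T" "continuous_on (S \<inter> T) f" by auto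
    then have "continuous (at x within S \<inter> T) f"
      using that by (auto simp: continuous_on_eq_continuous_within)
    then show ?thesis
      using T(1,2) at_within_nhd[of x T S "S \<inter> T"] unfolding continuous_within by auto
  qed
  then show ?case by (auto simp: continuous_on_eq_continuous_within)
next
  case (Suc k)
  have "f differentiable (at x)" if "x \<in> S" for x
    using Suc.prems[OF that] that by auto
  moreover have "k_smooth_on S k (\<lambda>x. frechet_derivative f (at x) v)" for v
  proof (rule Suc.IH)
    fix x assume "x \<in> S"
    from Suc.prems[OF this] obtain T where "open T" "x \<in> T" "k_smooth_on (S \<inter> T) (Suc k) f"
      by blast
    then show "\<exists>T. open T \<and> x \<in> T \<and> k_smooth_on (S \<inter> T) k (\<lambda>x. frechet_derivative f (at x) v)"
      using k_smooth_on_Suc_frechet by blast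
  qed
  ultimately show ?case by simp
qed

lemma smooth_onI: "(\<And>k. k_smooth_on S k f) \<Longrightarrow> smooth_on S f"
  by (simp add: smooth_on_def)

lemma smooth_onD: "smooth_on S f \<Longrightarrow> k_smooth_on S k f"
  by (simp add: smooth_on_def)

lemma smooth_on_cong:
  assumes "open S" "\<And>x. x \<in> S \<Longrightarrow> f x = g x" "smooth_on S f"
  shows "smooth_on S g"
  by (rule smooth_onI, rule k_smooth_on_cong[OF assms(1,2) smooth_onD[OF assms(3)]])

lemma smooth_on_subset: "smooth_on S f \<Longrightarrow> T \<subseteq> S \<Longrightarrow> smooth_on T f"
  by (rule smooth_onI, rule k_smooth_on_subset[OF smooth_onD])

lemma smooth_on_const: "open S \<Longrightarrow> smooth_on S (\<lambda>x. c)"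
  by (rule smooth_onI, rule k_smooth_on_const)

lemma smooth_on_bounded_linear: "open S \<Longrightarrow> bounded_linear L \<Longrightarrow> smooth_on S L"
  by (rule smooth_onI, rule k_smooth_on_bounded_linear)

lemma smooth_on_linear_compose:
  assumes "open S" "bounded_linear L" "smooth_on S f"
  shows "smooth_on S (\<lambda>x. L (f x))"
  by (rule smooth_onI, rule k_smooth_on_linear_compose[OF assms(1,2) smooth_onD[OF assms(3)]])

lemma smooth_on_add:
  assumes "open S" "smooth_on S f" "smooth_on S g"
  shows "smooth_on S (\<lambda>x. f x + g x)"
  by (rule smooth_onI, rule k_smooth_on_add[OF assms(1) smooth_onD[OF assms(2)] smooth_onD[OF assms(3)]])

lemma smooth_on_scaleR:
  assumes "open S" "smooth_on S f" "smooth_on S g"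
  shows "smooth_on S (\<lambda>x. f x *\<^sub>R g x)"
  by (rule smooth_onI, rule k_smooth_on_scaleR[OF assms(1) smooth_onD[OF assms(2)] smooth_onD[OF assms(3)]])

lemma smooth_on_mult:
  fixes f g :: "'x::real_normed_vector \<Rightarrow> real"
  shows "open S \<Longrightarrow> smooth_on S f \<Longrightarrow> smooth_on S g \<Longrightarrow> smooth_on S (\<lambda>x. f x * g x)"
  using smooth_on_scaleR[of S f g] by simp

lemma smooth_on_diff:
  assumes "open S" "smooth_on S f" "smooth_on S g"
  shows "smooth_on S (\<lambda>x. f x - g x)"
  using smooth_on_add[OF assms(1,2) smooth_on_linear_compose[OF assms(1)
        bounded_linear_minus[OF bounded_linear_ident] assms(3)]] by simp

lemma smooth_on_sum:
  assumes "open S" "\<And>i. i \<in> I \<Longrightarrow> smooth_on S (f i)"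
  shows "smooth_on S (\<lambda>x. \<Sum>i\<in>I. f i x)"
  by (rule smooth_onI, rule k_smooth_on_sum[OF assms(1) smooth_onD[OF assms(2)]])

lemma smooth_on_compose:
  fixes f :: "'x::real_normed_vector \<Rightarrow> 'y::euclidean_space"
    and g :: "'y \<Rightarrow> 'z::real_normed_vector"
  assumes "open S" "open T" "smooth_on S f" "smooth_on T g" "f ` S \<subseteq> T"
  shows "smooth_on S (\<lambda>x. g (f x))"
  unfolding smooth_on_def
proof
  fix k
  show "k_smooth_on S k (\<lambda>x. g (f x))"
    by (rule k_smooth_on_compose[OF assms(1,2,5)]) (use assms(3,4) in \<open>simp_all add: smooth_on_def\<close>)
qed

lemma smooth_on_divide:
  fixes f g :: "'x::real_normed_vector \<Rightarrow> real"
  assumes "open S" "smooth_on S f" "smooth_on S g" "\<And>x. x \<in> S \<Longrightarrow> g x \<noteq> 0"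
  shows "smooth_on S (\<lambda>x. f x / g x)"
proof -
  have "smooth_on S (\<lambda>x. inverse (g x))"
    unfolding smooth_on_def
  proof
    fix k
    show "k_smooth_on S k (\<lambda>x. inverse (g x))"
      by (rule k_smooth_on_inverse[OF assms(1,4)]) (use assms(3) in \<open>simp_all add: smooth_on_def\<close>)
  qed
  from smooth_on_mult[OF assms(1,2) this] show ?thesis
    by (simp add: divide_inverse)
qed

lemma smooth_on_local:
  assumes "\<And>x. x \<in> S \<Longrightarrow> \<exists>T. open T \<and> x \<in> T \<and> smooth_on (S \<inter> T) f"
  shows "smooth_on S f"
  unfolding smooth_on_def
proof (intro allI, rule k_smooth_on_local)
  fix k x assume "x \<in> S"
  from assms[OF this] show "\<exists>T. open T \<and> x \<in> T \<and> k_smooth_on (S \<inter> T) k f"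
    by (meson smooth_on_def)
qed

lemma smooth_on_differentiable: "smooth_on S f \<Longrightarrow> x \<in> S \<Longrightarrow> f differentiable (at x)"
  using smooth_onD[of S f "Suc 0"] by simp

lemma smooth_on_derivative:
  "smooth_on S f \<Longrightarrow> x \<in> S \<Longrightarrow> (f has_derivative frechet_derivative f (at x)) (at x)"
  by (simp add: frechet_derivative_works[symmetric] smooth_on_differentiable)

lemma smooth_on_frechet_derivative:
  "smooth_on S f \<Longrightarrow> smooth_on S (\<lambda>x. frechet_derivative f (at x) v)"
  by (rule smooth_onI, rule k_smooth_on_Suc_frechet[OF smooth_onD])

lemma smooth_on_imp_continuous_on: "smooth_on S f \<Longrightarrow> continuous_on S f"
  using smooth_onD[of S f 0] by simp

lemma smooth_on_Pair:
  fixes f :: "'x::real_normed_vector \<Rightarrow> 'y::euclidean_space" and g :: "'x \<Rightarrow> 'z::euclidean_space"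
  assumes "open S" "smooth_on S f" "smooth_on S g"
  shows "smooth_on S (\<lambda>x. (f x, g x))"
proof -
  have l: "bounded_linear (\<lambda>a::'y. (a, 0::'z))" "bounded_linear (\<lambda>b::'z. (0::'y, b))"
    by (intro bounded_linear_Pair bounded_linear_ident bounded_linear_zero)+
  have "smooth_on S (\<lambda>x. (f x, 0) + (0, g x))"
    using smooth_on_linear_compose[OF assms(1) l(1) assms(2)]
      smooth_on_linear_compose[OF assms(1) l(2) assms(3)]
    by (intro smooth_on_add assms(1))
  then show ?thesis by simp
qed

section \<open>Bump functions on Euclidean space\<close>

definition exp_germ :: "real poly \<Rightarrow> real \<Rightarrow> real" where
  "exp_germ p t = (if t \<le> 0 then 0 else poly p (inverse t) * exp (- inverse t))"

lemma exp_germ_tendsto_0: "(exp_germ p \<longlongrightarrow> 0) (at 0)"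
proof -
  have "((\<lambda>s::real. \<Sum>i\<le>degree p. coeff p i * (s ^ i / exp s)) \<longlongrightarrow> (\<Sum>i\<le>degree p. coeff p i * 0)) at_top"
    by (intro tendsto_sum tendsto_mult tendsto_const tendsto_power_div_exp_0)
  moreover have "(\<Sum>i\<le>degree p. coeff p i * (s ^ i / exp s)) = poly p s * exp (- s)" for s :: real
    by (simp add: poly_altdef sum_distrib_right exp_minus divide_inverse mult.assoc)
  ultimately have "((\<lambda>s. poly p s * exp (- s)) \<longlongrightarrow> 0) at_top"
    by simp
  then have "((\<lambda>t. poly p (inverse t) * exp (- inverse t)) \<longlongrightarrow> 0) (at_right 0)"
    by (rule filterlim_compose[OF _ filterlim_inverse_at_top_right])
  then have r: "(exp_germ p \<longlongrightarrow> 0) (at_right 0)"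
    by (rule Lim_transform_eventually)
      (simp add: exp_germ_def eventually_at_filter)
  have "((\<lambda>t::real. 0::real) \<longlongrightarrow> 0) (at_left 0)"
    by (rule tendsto_const)
  then have "(exp_germ p \<longlongrightarrow> 0) (at_left 0)"
    by (rule Lim_transform_eventually)
      (simp add: exp_germ_def eventually_at_filter)
  with r show ?thesis
    by (simp add: filterlim_split_at)
qed

text \<open>The functions p(1/t) exp(-1/t), extended by 0 to t at most 0, are closed under
  differentiation: the chain rule contributes 1/t^2 to both terms, which is the factor
  \<open>[:0, 0, 1:]\<close>. Smoothness then follows by induction over all \<open>p\<close> at
  once.\<close>

lemma exp_germ_has_derivative:
  "(exp_germ p has_real_derivative exp_germ ([:0, 0, 1:] * (p - pderiv p)) t) (at t)"
proof -
  consider "t > 0" | "t < 0" | "t = 0" by linarith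
  then show ?thesis
  proof cases
    case 1
    have i: "(inverse has_real_derivative - (inverse t * inverse t)) (at t)"
      using DERIV_inverse[of t UNIV] 1 by (simp add: power2_eq_square)
    have e: "((\<lambda>t. exp (- inverse t)) has_real_derivative exp (- inverse t) * (inverse t * inverse t)) (at t)"
      using DERIV_chain2[OF DERIV_exp DERIV_minus[OF i]] by simp
    have "((\<lambda>t. poly p (inverse t) * exp (- inverse t)) has_real_derivative
        exp_germ ([:0, 0, 1:] * (p - pderiv p)) t) (at t)"
      using DERIV_mult[OF DERIV_chain2[OF poly_DERIV i] e] 1
      by (simp add: exp_germ_def algebra_simps)
    then show ?thesis
      by (rule has_field_derivative_transform_within_open[where S = "{0<..}"])
        (use 1 in \<open>auto simp: exp_germ_def\<close>)
  next
    case 2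
    have "((\<lambda>t. 0) has_real_derivative exp_germ ([:0, 0, 1:] * (p - pderiv p)) t) (at t)"
      using 2 by (simp add: exp_germ_def)
    then show ?thesis
      by (rule has_field_derivative_transform_within_open[where S = "{..<0}"])
        (use 2 in \<open>auto simp: exp_germ_def\<close>)
  next
    case 3
    \<comment> \<open>The difference quotient at 0 is again in the family: dividing by h multiplies
      the polynomial by its variable.\<close>
    have "(exp_germ (pCons 0 p) \<longlongrightarrow> 0) (at 0)"
      by (rule exp_germ_tendsto_0)
    moreover have "exp_germ (pCons 0 p) = (\<lambda>h. (exp_germ p (0 + h) - exp_germ p 0) / h)"
      by (auto simp: exp_germ_def fun_eq_iff divide_inverse)
    ultimately have "(exp_germ p has_real_derivative 0) (at 0)"
      by (simp add: DERIV_def)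
    then show ?thesis using 3 by (simp add: exp_germ_def)
  qed
qed

lemma smooth_exp_germ: "smooth_on UNIV (exp_germ p)"
proof (rule smooth_onI)
  fix k
  show "k_smooth_on UNIV k (exp_germ p)"
  proof (induction k arbitrary: p)
    case 0
    show ?case
      using DERIV_isCont[OF exp_germ_has_derivative[of p]]
      by (simp add: continuous_at_imp_continuous_on)
  next
    case (Suc k)
    show ?case
    proof (rule k_smooth_on_Suc_intro)
      show "(exp_germ p has_derivative (*) (exp_germ ([:0, 0, 1:] * (p - pderiv p)) x)) (at x)" for x
        using exp_germ_has_derivative by (simp add: has_field_derivative_def)
      show "k_smooth_on UNIV k (\<lambda>x. exp_germ ([:0, 0, 1:] * (p - pderiv p)) x * v)" for v
        by (rule k_smooth_on_linear_compose[OF open_UNIV bounded_linear_mult_left Suc.IH])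
    qed simp
  qed
qed

lemma smooth_cutoff:
  obtains h :: "real \<Rightarrow> real" where "smooth_on UNIV h"
    "\<And>s. s \<le> 1 \<Longrightarrow> h s = 1" "\<And>s. s \<ge> 2 \<Longrightarrow> h s = 0" "\<And>s. 0 \<le> h s" "\<And>s. h s \<le> 1"
proof -
  let ?F = "exp_germ 1"
  define h where "h s = ?F (2 - s) / (?F (2 - s) + ?F (s - 1))" for s
  have nn: "?F s \<ge> 0" and pos: "s > 0 \<Longrightarrow> ?F s > 0" and zero: "s \<le> 0 \<Longrightarrow> ?F s = 0" for s
    by (auto simp: exp_germ_def)
  \<comment> \<open>The two arguments add up to 1, so at least one of them is positive.\<close>
  have p: "?F (2 - s) + ?F (s - 1) > 0" for s
    using nn[of "2 - s"] nn[of "s - 1"] pos[of "2 - s"] pos[of "s - 1"] by linarith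
  have s1: "smooth_on UNIV (\<lambda>s::real. 2 - s)" "smooth_on UNIV (\<lambda>s::real. s - 1)"
    by (intro smooth_on_diff smooth_on_const smooth_on_bounded_linear bounded_linear_ident open_UNIV)+
  have s2: "smooth_on UNIV (\<lambda>s. ?F (2 - s))" "smooth_on UNIV (\<lambda>s. ?F (s - 1))"
    by (rule smooth_on_compose[OF open_UNIV open_UNIV s1(1) smooth_exp_germ],
        simp, rule smooth_on_compose[OF open_UNIV open_UNIV s1(2) smooth_exp_germ], simp)
  have "smooth_on UNIV h"
    unfolding h_def
    by (rule smooth_on_divide[OF open_UNIV s2(1) smooth_on_add[OF open_UNIV s2]])
      (use p less_irrefl in metis)
  moreover have "h s = 1" if "s \<le> 1" for s
    using that zero[of "s - 1"] p[of s] by (simp add: h_def)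
  moreover have "h s = 0" if "s \<ge> 2" for s
    using that zero[of "2 - s"] by (simp add: h_def)
  moreover have "0 \<le> h s" "h s \<le> 1" for s
    using nn[of "2 - s"] nn[of "s - 1"] p[of s] by (auto simp: h_def)
  ultimately show ?thesis using that by blast
qed

lemma smooth_bump:
  fixes z0 :: "'e::euclidean_space"
  assumes "r > 0"
  obtains b :: "'e \<Rightarrow> real" where "smooth_on UNIV b"
    "\<And>z. dist z0 z \<le> r / 2 \<Longrightarrow> b z = 1" "\<And>z. dist z0 z \<ge> r \<Longrightarrow> b z = 0"
    "\<And>z. 0 \<le> b z" "\<And>z. b z \<le> 1"
proof -
  obtain h :: "real \<Rightarrow> real" where h: "smooth_on UNIV h"
    "\<And>s. s \<le> 1 \<Longrightarrow> h s = 1" "\<And>s. s \<ge> 2 \<Longrightarrow> h s = 0" "\<And>s. 0 \<le> h s" "\<And>s. h s \<le> 1"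
    by (rule smooth_cutoff) blast
  \<comment> \<open>The squared distance is a polynomial in the coordinates. The factor 4 / r^2
    sends the radius r / 2 to 1 and the radius r to 4, beyond the point 2 from which the cut-off
    vanishes.\<close>
  define q where "q z = (\<Sum>i\<in>Basis. ((z - z0) \<bullet> i) * ((z - z0) \<bullet> i)) * (4 / r\<^sup>2)" for z
  have q: "q z = 4 * (dist z0 z)\<^sup>2 / r\<^sup>2" for z
  proof -
    have "(\<Sum>i\<in>Basis. ((z - z0) \<bullet> i) * ((z - z0) \<bullet> i)) = (dist z0 z)\<^sup>2"
      by (simp add: dist_norm norm_minus_commute[of z0 z] power2_norm_eq_inner euclidean_inner[symmetric])
    then show ?thesis by (simp add: q_def)
  qed
  have l: "smooth_on UNIV (\<lambda>z. (z - z0) \<bullet> i)" for i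
    by (intro smooth_on_linear_compose[OF _ bounded_linear_inner_left] smooth_on_diff smooth_on_const
        smooth_on_bounded_linear bounded_linear_ident open_UNIV)
  have "smooth_on UNIV q"
    unfolding q_def by (intro smooth_on_mult smooth_on_sum l smooth_on_const open_UNIV)
  then have "smooth_on UNIV (\<lambda>z. h (q z))"
    by (rule smooth_on_compose[OF open_UNIV open_UNIV _ h(1)]) simp
  moreover have "h (q z) = 1" if "dist z0 z \<le> r / 2" for z
  proof -
    have "(dist z0 z)\<^sup>2 \<le> (r / 2)\<^sup>2" using that by (intro power_mono) auto
    then show ?thesis using assms by (intro h(2)) (simp add: q field_simps)
  qed
  moreover have "h (q z) = 0" if "dist z0 z \<ge> r" for z
  proof -
    have "r\<^sup>2 \<le> (dist z0 z)\<^sup>2" using that assms by (intro power_mono) auto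
    then have "2 * r\<^sup>2 \<le> 4 * (dist z0 z)\<^sup>2" using zero_le_power2[of r] by linarith
    then show ?thesis using assms by (intro h(3)) (simp add: q field_simps)
  qed
  ultimately show ?thesis using that[of "\<lambda>z. h (q z)"] h(4,5) by blast
qed

section \<open>Hadamard's lemma with smooth factors\<close>

lemma star_point_in_ball:
  fixes z0 :: "'e::euclidean_space"
  assumes "x \<in> ball z0 r" "0 \<le> s" "s \<le> 1"
  shows "z0 + s *\<^sub>R (x - z0) \<in> ball z0 r"
proof -
  have "s * norm (x - z0) \<le> 1 * norm (x - z0)"
    using assms by (intro mult_right_mono) auto
  then show ?thesis
    using assms by (simp add: dist_norm norm_minus_commute[of z0 x])
qed

text \<open>Differentiation under the integral sign yields, by the chain rule, another factor s and
  a derivative of \<open>f\<close>, so both the weight \<open>s ^ m\<close> and the function must be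
  free in the induction. \<open>Blinfun\<close> packages the derivative as an element of a normed
  space, the form in which \<open>leibniz_rule\<close> expects it.\<close>

lemma k_smooth_on_ray_integral:
  fixes f :: "'e::euclidean_space \<Rightarrow> real"
  shows "smooth_on (ball z0 r) f \<Longrightarrow>
    k_smooth_on (ball z0 r) k (\<lambda>z. integral (cbox 0 1) (\<lambda>s. s ^ m * f (z0 + s *\<^sub>R (z - z0))))"
proof (induction k arbitrary: m f)
  let ?B = "ball z0 r"
  have cont: "continuous_on (?B \<times> cbox 0 1) (\<lambda>p. snd p ^ m * f (z0 + snd p *\<^sub>R (fst p - z0)))"
    if "smooth_on ?B f" for f :: "'e \<Rightarrow> real" and m
    using star_point_in_ball
    by (intro continuous_intros continuous_on_compose2[OF smooth_on_imp_continuous_on[OF that]])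
      (force simp: cbox_interval)
  {
    case 0
    show ?case
      using integral_continuous_on_param[of ?B 0 1 "\<lambda>z s. s ^ m * f (z0 + s *\<^sub>R (z - z0))"]
        cont[OF 0, of m] by (simp add: case_prod_unfold)
  next
    case (Suc k)
    let ?f = "\<lambda>x. frechet_derivative f (at x)"
    define D where "D z s = Blinfun (\<lambda>v. s ^ Suc m * ?f (z0 + s *\<^sub>R (z - z0)) v)" for z and s :: real
    have df: "(f has_derivative ?f x) (at x)" if "x \<in> ?B" for x
      using smooth_on_derivative[OF Suc.prems that] .
    have D: "blinfun_apply (D z s) = (\<lambda>v. s ^ Suc m * ?f (z0 + s *\<^sub>R (z - z0)) v)"
      if "z \<in> ?B" "s \<in> cbox 0 1" for z s
      unfolding D_def
      using has_derivative_bounded_linear[OF df] star_point_in_ball[of z z0 r s] that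
      by (intro bounded_linear_Blinfun_apply bounded_linear_mult_const bounded_linear_const_mult) auto
    have der: "((\<lambda>z. s ^ m * f (z0 + s *\<^sub>R (z - z0))) has_derivative blinfun_apply (D z s)) (at z within ?B)"
      if z: "z \<in> ?B" "s \<in> cbox 0 1" for z s
    proof -
      have "z0 + s *\<^sub>R (z - z0) \<in> ?B"
        using star_point_in_ball[of z z0 r s] z by auto
      note d = df[OF this]
      interpret bounded_linear "?f (z0 + s *\<^sub>R (z - z0))"
        using d by (rule has_derivative_bounded_linear)
      have "((\<lambda>z. f (z0 + s *\<^sub>R (z - z0))) has_derivative (\<lambda>v. ?f (z0 + s *\<^sub>R (z - z0)) (s *\<^sub>R v)))
          (at z within ?B)"
        by (rule has_derivative_compose[where g = f and f = "\<lambda>z. z0 + s *\<^sub>R (z - z0)", OF _ d]) (auto intro!: derivative_eq_intros)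
      then have "((\<lambda>z. s ^ m * f (z0 + s *\<^sub>R (z - z0))) has_derivative
          (\<lambda>v. s ^ m * ?f (z0 + s *\<^sub>R (z - z0)) (s *\<^sub>R v))) (at z within ?B)"
        by (rule has_derivative_mult_right)
      then show ?thesis
        by (simp add: D[OF z] scaleR mult.assoc mult.left_commute)
    qed
    have cD: "continuous_on (?B \<times> cbox 0 1) (\<lambda>(z, s). D z s)"
    proof (rule continuous_on_blinfun_componentwise)
      fix i :: 'e
      have "continuous_on (?B \<times> cbox 0 1) (\<lambda>p. snd p ^ Suc m * ?f (z0 + snd p *\<^sub>R (fst p - z0)) i)"
        by (rule cont[OF smooth_on_frechet_derivative[OF Suc.prems]])
      then show "continuous_on (?B \<times> cbox 0 1) (\<lambda>p. blinfun_apply (case p of (z, s) \<Rightarrow> D z s) i)"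
        by (rule continuous_on_eq) (auto simp: D)
    qed
    have int: "(\<lambda>s. s ^ m * f (z0 + s *\<^sub>R (z - z0))) integrable_on cbox 0 1" if "z \<in> ?B" for z
    proof (rule integrable_continuous)
      show "continuous_on (cbox 0 1) (\<lambda>s. s ^ m * f (z0 + s *\<^sub>R (z - z0)))"
        using continuous_on_compose2[OF cont[OF Suc.prems, of m], of "cbox 0 1" "\<lambda>s. (z, s)"] that
        by (auto simp: continuous_on_Pair continuous_on_const continuous_on_id image_subset_iff)
    qed
    have intD: "D z integrable_on cbox 0 1" if "z \<in> ?B" for z
    proof (rule integrable_continuous)
      show "continuous_on (cbox 0 1) (D z)"
        using continuous_on_compose2[OF cD, of "cbox 0 1" "\<lambda>s. (z, s)"] that
        by (auto simp: continuous_on_Pair continuous_on_const continuous_on_id image_subset_iff)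
    qed
    have "((\<lambda>z. integral (cbox 0 1) (\<lambda>s. s ^ m * f (z0 + s *\<^sub>R (z - z0)))) has_derivative
        integral (cbox 0 1) (D z)) (at z within ?B)" if "z \<in> ?B" for z
      by (rule leibniz_rule[OF der int cD that convex_ball])
    then have d: "((\<lambda>z. integral (cbox 0 1) (\<lambda>s. s ^ m * f (z0 + s *\<^sub>R (z - z0)))) has_derivative
        integral (cbox 0 1) (D z)) (at z)" if "z \<in> ?B" for z
      using that by (simp add: at_within_open[OF _ open_ball])
    show ?case
    proof (rule k_smooth_on_Suc_intro[OF open_ball d])
      fix v
      have e: "blinfun_apply (integral (cbox 0 1) (D z)) v
          = integral (cbox 0 1) (\<lambda>s. s ^ Suc m * ?f (z0 + s *\<^sub>R (z - z0)) v)" if "z \<in> ?B" for z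
      proof -
        have "blinfun_apply (integral (cbox 0 1) (D z)) v
            = integral (cbox 0 1) ((\<lambda>L. blinfun_apply L v) \<circ> D z)"
          by (rule integral_linear[OF intD[OF that], symmetric])
            (rule blinfun.bounded_linear_left)
        also have "\<dots> = integral (cbox 0 1) (\<lambda>s. s ^ Suc m * ?f (z0 + s *\<^sub>R (z - z0)) v)"
          by (rule integral_cong) (use that in \<open>simp add: D\<close>)
        finally show ?thesis .
      qed
      show "k_smooth_on ?B k (\<lambda>z. blinfun_apply (integral (cbox 0 1) (D z)) v)"
        by (rule k_smooth_on_cong[OF open_ball e[symmetric]
              Suc.IH[OF smooth_on_frechet_derivative[OF Suc.prems]]])
    qed
  }
qed

text \<open>Integrating the derivative of \<open>f\<close> along the segment from \<open>z0\<close>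
  to \<open>z\<close> gives the difference of the values; the partial derivatives averaged along the
  segment are the factors \<open>g i\<close>. This is what makes a derivation at a point determined
  by its values on coordinates.\<close>

lemma hadamard_lemma:
  fixes f :: "'e::euclidean_space \<Rightarrow> real"
  assumes f: "smooth_on (ball z0 r) f" and "r > 0"
  obtains g where "\<And>i. smooth_on (ball z0 r) (g i)"
    "\<And>z. z \<in> ball z0 r \<Longrightarrow> f z = f z0 + (\<Sum>i\<in>Basis. ((z - z0) \<bullet> i) * g i z)"
    "\<And>i. g i z0 = frechet_derivative f (at z0) i"
proof -
  let ?f = "\<lambda>x. frechet_derivative f (at x)" and ?B = "ball z0 r"
  define g where "g i z = integral (cbox 0 1) (\<lambda>s::real. s ^ 0 * ?f (z0 + s *\<^sub>R (z - z0)) i)" for i z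
  have sm: "smooth_on ?B (g i)" for i
    unfolding g_def
    by (intro smooth_onI k_smooth_on_ray_integral smooth_on_frechet_derivative f)
  moreover have "f z = f z0 + (\<Sum>i\<in>Basis. ((z - z0) \<bullet> i) * g i z)" if z: "z \<in> ?B" for z
  proof -
    have p: "z0 + s *\<^sub>R (z - z0) \<in> ?B" if "s \<in> {0..1}" for s
      using star_point_in_ball[OF z] that by auto
    have "((\<lambda>s. f (z0 + s *\<^sub>R (z - z0))) has_vector_derivative
        (\<Sum>i\<in>Basis. ((z - z0) \<bullet> i) * ?f (z0 + s *\<^sub>R (z - z0)) i)) (at s within {0..1})"
      if s: "s \<in> {0..1}" for s :: real
    proof -
      have d: "(f has_derivative ?f (z0 + s *\<^sub>R (z - z0))) (at (z0 + s *\<^sub>R (z - z0)))"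
        by (rule smooth_on_derivative[OF f p[OF s]])
      interpret bounded_linear "?f (z0 + s *\<^sub>R (z - z0))"
        using d by (rule has_derivative_bounded_linear)
      have "?f (z0 + s *\<^sub>R (z - z0)) (z - z0)
          = ?f (z0 + s *\<^sub>R (z - z0)) (\<Sum>i\<in>Basis. ((z - z0) \<bullet> i) *\<^sub>R i)"
        by (simp add: euclidean_representation)
      also have "\<dots> = (\<Sum>i\<in>Basis. ((z - z0) \<bullet> i) * ?f (z0 + s *\<^sub>R (z - z0)) i)"
        by (simp add: sum scaleR)
      finally have e: "?f (z0 + s *\<^sub>R (z - z0)) (z - z0) = \<dots>" .
      have "((\<lambda>s. f (z0 + s *\<^sub>R (z - z0))) has_derivative
          (\<lambda>t. ?f (z0 + s *\<^sub>R (z - z0)) (t *\<^sub>R (z - z0)))) (at s within {0..1})"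
        by (rule has_derivative_compose[where g = f and f = "\<lambda>s. z0 + s *\<^sub>R (z - z0)", OF _ d]) (auto intro!: derivative_eq_intros)
      then show ?thesis
        by (simp add: has_vector_derivative_def scaleR e)
    qed
    then have "((\<lambda>s. \<Sum>i\<in>Basis. ((z - z0) \<bullet> i) * ?f (z0 + s *\<^sub>R (z - z0)) i) has_integral
        (f (z0 + 1 *\<^sub>R (z - z0)) - f (z0 + 0 *\<^sub>R (z - z0)))) {0..1}"
      by (rule fundamental_theorem_of_calculus[OF zero_le_one])
    then have "f z - f z0 = integral {0..1} (\<lambda>s. \<Sum>i\<in>Basis. ((z - z0) \<bullet> i) * ?f (z0 + s *\<^sub>R (z - z0)) i)"
      by (simp add: integral_unique)
    also have "\<dots> = (\<Sum>i\<in>Basis. integral {0..1} (\<lambda>s. ((z - z0) \<bullet> i) * ?f (z0 + s *\<^sub>R (z - z0)) i))"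
    proof (rule integral_sum)
      fix i :: 'e
      have "continuous_on {0..1} (\<lambda>s. ?f (z0 + s *\<^sub>R (z - z0)) i)"
        by (rule continuous_on_compose2[OF smooth_on_imp_continuous_on[OF
                smooth_on_frechet_derivative[OF f]]])
          (use p in \<open>auto intro!: continuous_intros\<close>)
      then show "(\<lambda>s. ((z - z0) \<bullet> i) * ?f (z0 + s *\<^sub>R (z - z0)) i) integrable_on {0..1}"
        by (intro integrable_continuous_real continuous_intros)
    qed simp
    also have "\<dots> = (\<Sum>i\<in>Basis. ((z - z0) \<bullet> i) * g i z)"
      by (simp add: g_def cbox_interval)
    finally show ?thesis by simp
  qed
  moreover have "g i z0 = ?f z0 i" for i
    by (simp add: g_def)
  ultimately show ?thesis using that by blast
qed

section \<open>Smooth functions on a manifold\<close>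

lemma linear_map_onD:
  assumes "linear_map_on V f"
  shows linear_map_on_add: "u \<in> V \<Longrightarrow> v \<in> V \<Longrightarrow> f (u + v) = f u + f v"
    and linear_map_on_scaleR: "u \<in> V \<Longrightarrow> f (c *\<^sub>R u) = c *\<^sub>R f u"
    and linear_map_on_diff: "u \<in> V \<Longrightarrow> v \<in> V \<Longrightarrow> f (u - v) = f u - f v"
    and linear_map_on_minus: "u \<in> V \<Longrightarrow> f (- u) = - f u"
    and linear_map_on_zero: "u \<in> V \<Longrightarrow> f 0 = 0"
proof -
  have *: "f (a *\<^sub>R u + b *\<^sub>R v) = a *\<^sub>R f u + b *\<^sub>R f v" if "u \<in> V" "v \<in> V" for u v a b
    using assms that by (simp add: linear_map_on_def)
  show "u \<in> V \<Longrightarrow> v \<in> V \<Longrightarrow> f (u + v) = f u + f v"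
    using *[of u v 1 1] by simp
  show "u \<in> V \<Longrightarrow> f (c *\<^sub>R u) = c *\<^sub>R f u"
    using *[of u u c 0] by simp
  show "u \<in> V \<Longrightarrow> v \<in> V \<Longrightarrow> f (u - v) = f u - f v"
    using *[of u v 1 "-1"] by simp
  show "u \<in> V \<Longrightarrow> f (- u) = - f u"
    using *[of u u "-1" 0] by simp
  show "u \<in> V \<Longrightarrow> f 0 = 0"
    using *[of u u 0 0] by simp
qed

lemma linear_map_onI:
  assumes "\<And>u v. u \<in> V \<Longrightarrow> v \<in> V \<Longrightarrow> f (u + v) = f u + f v"
    and "\<And>u c. u \<in> V \<Longrightarrow> f (c *\<^sub>R u) = c *\<^sub>R f u"
    and "\<And>u c. u \<in> V \<Longrightarrow> c *\<^sub>R u \<in> V"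
  shows "linear_map_on V f"
  using assms by (simp add: linear_map_on_def)

lemma sum_fun_apply: "(\<Sum>i\<in>I. F i) x = (\<Sum>i\<in>I. F i x)"
  by (induction I rule: infinite_finite_induct) simp_all

locale smooth_manifold =
  fixes \<A> :: "('a::t2_space, 'e::euclidean_space) atlas"
  assumes atlas: "smooth_atlas \<A>"
begin

abbreviation "C \<equiv> smooth_funs \<A>"
abbreviation "TS \<equiv> tangent_space \<A>"
abbreviation "VF \<equiv> vector_fields \<A>"

lemma chart_exists: obtains U \<psi> where "(U, \<psi>) \<in> \<A>" "x \<in> U"
proof -
  have "x \<in> (\<Union>(U, \<psi>)\<in>\<A>. U)" using atlas by (simp add: smooth_atlas_def)
  then show ?thesis using that by auto
qed

lemma chart:
  assumes "(U, \<psi>) \<in> \<A>"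
  shows chart_open: "open U" and chart_open_image: "open (\<psi> ` U)"
    and chart_inv: "y \<in> U \<Longrightarrow> inv_into U \<psi> (\<psi> y) = y"
    and chart_inv': "z \<in> \<psi> ` U \<Longrightarrow> \<psi> (inv_into U \<psi> z) = z"
    and chart_inv_in: "z \<in> \<psi> ` U \<Longrightarrow> inv_into U \<psi> z \<in> U"
    and chart_cont: "continuous_on U \<psi>" and chart_cont_inv: "continuous_on (\<psi> ` U) (inv_into U \<psi>)"
proof -
  have "is_chart (U, \<psi>)" using assms atlas by (auto simp: smooth_atlas_def)
  then have *: "open U" "open (\<psi> ` U)" "homeomorphism U (\<psi> ` U) \<psi> (inv_into U \<psi>)"
    by (simp_all add: is_chart_def)
  then show "open U" "open (\<psi> ` U)" "y \<in> U \<Longrightarrow> inv_into U \<psi> (\<psi> y) = y"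
    "z \<in> \<psi> ` U \<Longrightarrow> \<psi> (inv_into U \<psi> z) = z" "z \<in> \<psi> ` U \<Longrightarrow> inv_into U \<psi> z \<in> U"
    "continuous_on U \<psi>" "continuous_on (\<psi> ` U) (inv_into U \<psi>)"
    by (auto simp: homeomorphism_def)
qed

lemma chart_image_open:
  assumes "(U, \<psi>) \<in> \<A>" "open W"
  shows "open (\<psi> ` (U \<inter> W))"
proof -
  have "\<psi> ` (U \<inter> W) = \<psi> ` U \<inter> inv_into U \<psi> -` W"
    using chart_inv[OF assms(1)] chart_inv'[OF assms(1)] chart_inv_in[OF assms(1)]
    by (auto simp: image_iff)
  also have "open \<dots>"
    using continuous_open_preimage[OF chart_cont_inv[OF assms(1)] chart_open_image[OF assms(1)] assms(2)] .
  finally show ?thesis .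
qed

lemma chart_preimage_open:
  assumes "(U, \<psi>) \<in> \<A>" "open T"
  shows "open {y \<in> U. \<psi> y \<in> T}"
proof -
  have "{y \<in> U. \<psi> y \<in> T} = U \<inter> \<psi> -` T" by auto
  then show ?thesis
    using continuous_open_preimage[OF chart_cont[OF assms(1)] chart_open[OF assms(1)] assms(2)] by simp
qed

lemma transition_smooth:
  assumes "(U, \<psi>) \<in> \<A>" "(V, \<psi>') \<in> \<A>"
  shows "smooth_on (\<psi> ` (U \<inter> V)) (\<lambda>z. \<psi>' (inv_into U \<psi> z))"
  using atlas assms unfolding smooth_atlas_def comp_def by blast

lemma CI: "(\<And>U \<psi>. (U, \<psi>) \<in> \<A> \<Longrightarrow> smooth_on (\<psi> ` U) (\<lambda>z. f (inv_into U \<psi> z))) \<Longrightarrow> f \<in> C"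
  by (auto simp: smooth_funs_def comp_def)

lemma CD: "f \<in> C \<Longrightarrow> (U, \<psi>) \<in> \<A> \<Longrightarrow> smooth_on (\<psi> ` U) (\<lambda>z. f (inv_into U \<psi> z))"
  by (auto simp: smooth_funs_def comp_def)

lemma C_const [simp]: "(\<lambda>x. c) \<in> C"
  by (rule CI) (rule smooth_on_const[OF chart_open_image])

lemma C_add: "f \<in> C \<Longrightarrow> g \<in> C \<Longrightarrow> (\<lambda>x. f x + g x) \<in> C"
  by (rule CI) (rule smooth_on_add[OF chart_open_image CD CD])

lemma C_diff: "f \<in> C \<Longrightarrow> g \<in> C \<Longrightarrow> (\<lambda>x. f x - g x) \<in> C"
  by (rule CI) (rule smooth_on_diff[OF chart_open_image CD CD])

lemma C_mult: "f \<in> C \<Longrightarrow> g \<in> C \<Longrightarrow> (\<lambda>x. f x * g x) \<in> C"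
  by (rule CI) (rule smooth_on_mult[OF chart_open_image CD CD])

lemma C_cmult: "f \<in> C \<Longrightarrow> (\<lambda>x. c * f x) \<in> C"
  by (rule C_mult[OF C_const])

lemma C_minus: "f \<in> C \<Longrightarrow> (\<lambda>x. - f x) \<in> C"
  using C_cmult[of f "-1"] by simp

lemma C_sum: "(\<And>i. i \<in> I \<Longrightarrow> f i \<in> C) \<Longrightarrow> (\<lambda>x. \<Sum>i\<in>I. f i x) \<in> C"
  by (rule CI) (rule smooth_on_sum[OF chart_open_image CD])

text \<open>Near a point where \<kappa> does not vanish, \<open>F\<close> is a quotient of smooth
  functions. Smoothness is thereby checked locally although only globally defined functions are
  handled.\<close>

lemma C_local_mult:
  assumes "\<And>x. \<exists>\<kappa>\<in>C. \<kappa> x \<noteq> 0 \<and> (\<lambda>y. \<kappa> y * F y) \<in> C"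
  shows "F \<in> C"
proof (rule CI, rule smooth_on_local)
  fix U \<psi> z assume U: "(U, \<psi>) \<in> \<A>" and z: "z \<in> \<psi> ` U"
  let ?i = "inv_into U \<psi>"
  obtain \<kappa> where \<kappa>: "\<kappa> \<in> C" "\<kappa> (?i z) \<noteq> 0" "(\<lambda>y. \<kappa> y * F y) \<in> C"
    using assms by blast
  define T where "T = \<psi> ` U \<inter> (\<lambda>z. \<kappa> (?i z)) -` (- {0})"
  have T: "open T" unfolding T_def
    by (rule continuous_open_preimage[OF smooth_on_imp_continuous_on[OF CD[OF \<kappa>(1) U]] chart_open_image[OF U]])
      auto
  have "smooth_on T (\<lambda>z. (\<kappa> (?i z) * F (?i z)) / \<kappa> (?i z))"
    by (rule smooth_on_divide[OF T smooth_on_subset[OF CD[OF \<kappa>(3) U]] smooth_on_subset[OF CD[OF \<kappa>(1) U]]])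
      (auto simp: T_def)
  then have "smooth_on T (\<lambda>z. F (?i z))"
    by (rule smooth_on_cong[OF T, rotated]) (simp add: T_def)
  moreover have "\<psi> ` U \<inter> T = T" by (auto simp: T_def)
  ultimately show "\<exists>T. open T \<and> z \<in> T \<and> smooth_on (\<psi> ` U \<inter> T) (\<lambda>z. F (?i z))"
    using T z \<kappa>(2) by (intro exI[of _ T]) (auto simp: T_def)
qed

text \<open>\<open>U\<close> and the complement of the closed set \<open>K\<close> cover the
  manifold. On the former the claim is a change of coordinates, on the latter the function is
  0.\<close>

lemma C_extend_by_zero:
  assumes U: "(U, \<psi>) \<in> \<A>" and "closed K" "K \<subseteq> U" and zero: "\<And>y. y \<notin> K \<Longrightarrow> F y = 0"
    and F: "smooth_on (\<psi> ` U) (\<lambda>z. F (inv_into U \<psi> z))"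
  shows "F \<in> C"
proof (rule CI, rule smooth_on_local)
  fix V \<psi>' w assume V: "(V, \<psi>') \<in> \<A>" and w: "w \<in> \<psi>' ` V"
  let ?y = "inv_into V \<psi>' w"
  show "\<exists>T. open T \<and> w \<in> T \<and> smooth_on (\<psi>' ` V \<inter> T) (\<lambda>w. F (inv_into V \<psi>' w))"
  proof (cases "?y \<in> U")
    case True
    let ?T = "\<psi>' ` (V \<inter> U)"
    have oT: "open ?T" by (rule chart_image_open[OF V chart_open[OF U]])
    have "smooth_on ?T (\<lambda>w. F (inv_into U \<psi> (\<psi> (inv_into V \<psi>' w))))"
      by (rule smooth_on_compose[OF oT chart_open_image[OF U] transition_smooth[OF V U] F])
        (use chart_inv[OF V] in auto)
    then have "smooth_on ?T (\<lambda>w. F (inv_into V \<psi>' w))"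
      by (rule smooth_on_cong[OF oT, rotated]) (use chart_inv[OF V] chart_inv[OF U] in auto)
    moreover have "w \<in> ?T"
      using True w chart_inv'[OF V w] chart_inv_in[OF V w] by (metis IntI imageI)
    moreover have "\<psi>' ` V \<inter> ?T = ?T" by auto
    ultimately show ?thesis using oT by (intro exI[of _ ?T]) simp
  next
    case False
    let ?T = "\<psi>' ` (V \<inter> - K)"
    have oT: "open ?T" by (rule chart_image_open[OF V]) (use \<open>closed K\<close> in auto)
    have "smooth_on ?T (\<lambda>w. 0)" by (rule smooth_on_const[OF oT])
    then have "smooth_on ?T (\<lambda>w. F (inv_into V \<psi>' w))"
      by (rule smooth_on_cong[OF oT, rotated]) (use chart_inv[OF V] zero in auto)
    moreover have "w \<in> ?T"
      using False w chart_inv'[OF V w] chart_inv_in[OF V w] \<open>K \<subseteq> U\<close>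
      by (metis ComplI IntI imageI subsetD)
    moreover have "\<psi>' ` V \<inter> ?T = ?T" by auto
    ultimately show ?thesis using oT by (intro exI[of _ ?T]) simp
  qed
qed

definition chart_fun :: "'a set \<Rightarrow> ('a \<Rightarrow> 'e) \<Rightarrow> ('e \<Rightarrow> real) \<Rightarrow> 'a \<Rightarrow> real" where
  "chart_fun U \<psi> k = (\<lambda>y. if y \<in> U then k (\<psi> y) else 0)"

text \<open>The preimage of a closed ball is compact; the Hausdorff property makes it closed in the
  whole manifold, as extension by zero requires.\<close>

lemma chart_ball_closed:
  assumes U: "(U, \<psi>) \<in> \<A>" and "cball z0 r \<subseteq> \<psi> ` U"
  shows "closed (inv_into U \<psi> ` cball z0 r)" "inv_into U \<psi> ` cball z0 r \<subseteq> U"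
proof -
  have "compact (inv_into U \<psi> ` cball z0 r)"
    by (rule compact_continuous_image[OF continuous_on_subset[OF chart_cont_inv[OF U] assms(2)]]) simp
  then show "closed (inv_into U \<psi> ` cball z0 r)" by (rule compact_imp_closed)
  show "inv_into U \<psi> ` cball z0 r \<subseteq> U"
    using chart_inv_in[OF U] assms(2) by blast
qed

lemma chart_fun_C:
  assumes U: "(U, \<psi>) \<in> \<A>" and sub: "cball z0 r \<subseteq> \<psi> ` U"
    and k: "smooth_on UNIV k" "\<And>z. z \<notin> cball z0 r \<Longrightarrow> k z = 0"
  shows "chart_fun U \<psi> k \<in> C"
proof (rule C_extend_by_zero[OF U chart_ball_closed[OF U sub]])
  fix y assume "y \<notin> inv_into U \<psi> ` cball z0 r"
  then have "\<psi> y \<notin> cball z0 r" if "y \<in> U"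
    using chart_inv[OF U that] by (metis imageI)
  then show "chart_fun U \<psi> k y = 0" using k(2) by (simp add: chart_fun_def)
next
  show "smooth_on (\<psi> ` U) (\<lambda>z. chart_fun U \<psi> k (inv_into U \<psi> z))"
    by (rule smooth_on_cong[OF chart_open_image[OF U] _ smooth_on_subset[OF k(1)]])
      (use chart_inv[OF U] in \<open>auto simp: chart_fun_def\<close>)
qed

lemma smooth_on_bump_mult:
  fixes b h :: "'e \<Rightarrow> real"
  assumes b: "smooth_on UNIV b" "\<And>z. z \<notin> cball z0 r \<Longrightarrow> b z = 0"
    and "open S" "cball z0 r \<subseteq> S" "smooth_on S h"
  shows "smooth_on UNIV (\<lambda>z. b z * h z)"
proof (rule smooth_on_local)
  fix z
  show "\<exists>T. open T \<and> z \<in> T \<and> smooth_on (UNIV \<inter> T) (\<lambda>z. b z * h z)"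
  proof (cases "z \<in> S")
    case True
    then show ?thesis
      using smooth_on_mult[OF assms(3) smooth_on_subset[OF b(1)] assms(5)] assms(3) by auto
  next
    case False
    have o: "open (- cball z0 r)" by auto
    have "smooth_on (- cball z0 r) (\<lambda>z. b z * h z)"
      by (rule smooth_on_cong[OF o _ smooth_on_const[OF o, of 0]]) (use b(2) in auto)
    then show ?thesis using False assms(4) o by (intro exI[of _ "- cball z0 r"]) auto
  qed
qed

lemma chart_ball:
  assumes U: "(U, \<psi>) \<in> \<A>" and "x \<in> U" "open W" "x \<in> W"
  obtains r where "r > 0" "cball (\<psi> x) r \<subseteq> \<psi> ` (U \<inter> W)"
proof -
  have "\<psi> x \<in> \<psi> ` (U \<inter> W)" using assms by auto
  then show ?thesis
    using chart_image_open[OF U \<open>open W\<close>] open_contains_cball that by metis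
qed

lemma in_chart_image:
  assumes "(U, \<psi>) \<in> \<A>" "y \<in> U" "\<psi> y \<in> \<psi> ` (U \<inter> W)"
  shows "y \<in> W"
  using assms chart_inv[OF assms(1)] by (metis IntE imageE)

lemma manifold_bump:
  assumes "open W" "x \<in> W"
  obtains \<kappa> N where "\<kappa> \<in> C" "open N" "x \<in> N" "N \<subseteq> W" "\<And>y. y \<in> N \<Longrightarrow> \<kappa> y = 1"
    "\<And>y. y \<notin> W \<Longrightarrow> \<kappa> y = 0"
proof -
  obtain U \<psi> where U: "(U, \<psi>) \<in> \<A>" "x \<in> U" by (rule chart_exists)
  obtain r where r: "r > 0" "cball (\<psi> x) r \<subseteq> \<psi> ` (U \<inter> W)"
    by (rule chart_ball[OF U assms])
  obtain b where b: "smooth_on UNIV b" "\<And>z. dist (\<psi> x) z \<le> r / 2 \<Longrightarrow> b z = 1"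
    "\<And>z. dist (\<psi> x) z \<ge> r \<Longrightarrow> b z = (0::real)"
    using smooth_bump[OF r(1), of "\<psi> x"] by metis
  show ?thesis
  proof (rule that[of "chart_fun U \<psi> b" "{y \<in> U. \<psi> y \<in> ball (\<psi> x) (r / 2)}"])
    show "chart_fun U \<psi> b \<in> C"
      by (rule chart_fun_C[OF U(1) _ b(1)]) (use r b(3) in auto)
    show "open {y \<in> U. \<psi> y \<in> ball (\<psi> x) (r / 2)}"
      by (rule chart_preimage_open[OF U(1) open_ball])
    show "x \<in> {y \<in> U. \<psi> y \<in> ball (\<psi> x) (r / 2)}" using U r by simp
    have in_W: "y \<in> W" if "y \<in> U" "\<psi> y \<in> cball (\<psi> x) r" for y
      using in_chart_image[OF U(1) that(1)] that(2) r(2) by blast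
    then show "{y \<in> U. \<psi> y \<in> ball (\<psi> x) (r / 2)} \<subseteq> W" using r(1) by auto
    show "chart_fun U \<psi> b y = 1" if "y \<in> {y \<in> U. \<psi> y \<in> ball (\<psi> x) (r / 2)}" for y
      using that b(2) by (simp add: chart_fun_def)
    show "chart_fun U \<psi> b y = 0" if "y \<notin> W" for y
      using in_W[of y] b(3)[of "\<psi> y"] that linear[of "dist (\<psi> x) (\<psi> y)" r]
      by (auto simp: chart_fun_def)
  qed
qed

section \<open>Tangent vectors as derivations\<close>

lemma TSI:
  assumes "\<And>f h. f \<in> C \<Longrightarrow> h \<in> C \<Longrightarrow> v (\<lambda>y. f y + h y) = v f + v h"
    and "\<And>f c. f \<in> C \<Longrightarrow> v (\<lambda>y. c * f y) = c * v f"
    and "\<And>f h. f \<in> C \<Longrightarrow> h \<in> C \<Longrightarrow> v (\<lambda>y. f y * h y) = f x * v h + h x * v f"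
    and "\<And>f. f \<notin> C \<Longrightarrow> v f = 0"
  shows "v \<in> TS x"
proof -
  have "linear_map_on C v"
    by (rule linear_map_onI) (use assms C_cmult in \<open>auto simp: plus_fun_def scaleR_fun_def\<close>)
  then show ?thesis using assms(3,4) by (simp add: tangent_space_def)
qed

lemma TS_nonsmooth: "v \<in> TS x \<Longrightarrow> f \<notin> C \<Longrightarrow> v f = 0"
  by (simp add: tangent_space_def)

lemma TS_mult: "v \<in> TS x \<Longrightarrow> f \<in> C \<Longrightarrow> h \<in> C \<Longrightarrow> v (\<lambda>y. f y * h y) = f x * v h + h x * v f"
  by (simp add: tangent_space_def)

lemma TS_linear: "v \<in> TS x \<Longrightarrow> linear_map_on C v"
  by (simp add: tangent_space_def)

lemma TS_add: "v \<in> TS x \<Longrightarrow> f \<in> C \<Longrightarrow> h \<in> C \<Longrightarrow> v (\<lambda>y. f y + h y) = v f + v h"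
  using linear_map_on_add[OF TS_linear, of v x f h] by (simp add: plus_fun_def)

lemma TS_diff: "v \<in> TS x \<Longrightarrow> f \<in> C \<Longrightarrow> h \<in> C \<Longrightarrow> v (\<lambda>y. f y - h y) = v f - v h"
  using linear_map_on_diff[OF TS_linear, of v x f h] by (simp add: fun_diff_def)

lemma TS_cmult: "v \<in> TS x \<Longrightarrow> f \<in> C \<Longrightarrow> v (\<lambda>y. c * f y) = c * v f"
  using linear_map_on_scaleR[OF TS_linear, of v x f c] by (simp add: scaleR_fun_def)

lemma TS_minus: "v \<in> TS x \<Longrightarrow> f \<in> C \<Longrightarrow> v (\<lambda>y. - f y) = - v f"
  using TS_cmult[of v x f "-1"] by simp

lemma TS_const: "v \<in> TS x \<Longrightarrow> v (\<lambda>y. c) = 0"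
  using TS_mult[of v x "\<lambda>y. 1" "\<lambda>y. 1"] TS_cmult[of v x "\<lambda>y. 1" c] by simp

lemma TS_sum: "v \<in> TS x \<Longrightarrow> (\<And>i. i \<in> I \<Longrightarrow> f i \<in> C) \<Longrightarrow> v (\<lambda>y. \<Sum>i\<in>I. f i y) = (\<Sum>i\<in>I. v (f i))"
proof (induction I rule: infinite_finite_induct)
  case (insert i F)
  have "(\<lambda>y. \<Sum>i\<in>F. f i y) \<in> C" by (rule C_sum) (use insert in auto)
  then show ?case using insert TS_add[of v x "f i" "\<lambda>y. \<Sum>i\<in>F. f i y"] by simp
qed (simp_all add: TS_const)

text \<open>A bump function \<kappa> supported in \<open>N\<close> makes
  \<open>\<kappa> y * (f y - h y)\<close> vanish identically. The product rule at \<open>x\<close>,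
  where \<kappa> is 1 and the difference is 0, gives the claim.\<close>

lemma TS_local:
  assumes v: "v \<in> TS x" and f: "f \<in> C" "h \<in> C" and N: "open N" "x \<in> N" "\<And>y. y \<in> N \<Longrightarrow> f y = h y"
  shows "v f = v h"
proof -
  obtain \<kappa> where \<kappa>: "\<kappa> \<in> C" "\<kappa> x = 1" "\<And>y. y \<notin> N \<Longrightarrow> \<kappa> y = 0"
    using manifold_bump[OF N(1,2)] by metis
  have "\<kappa> y * (f y - h y) = 0" for y
    using \<kappa>(3)[of y] N(3)[of y] by (cases "y \<in> N") auto
  then have "(\<lambda>y. \<kappa> y * (f y - h y)) = (\<lambda>y. 0)"
    by (rule ext)
  then have "v (\<lambda>y. \<kappa> y * (f y - h y)) = 0"
    using TS_const[OF v, of 0] by simp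
  then show ?thesis
    using TS_mult[OF v \<kappa>(1) C_diff[OF f]] TS_diff[OF v f] N(2,3) \<kappa>(2) by simp
qed

text \<open>Coordinates and Hadamard factors live only on a chart, whereas \<open>v\<close> acts on
  global functions. They are replaced by global functions \<open>u i\<close> and \<open>G i\<close>
  that agree with them near \<open>x\<close>. By locality and the product rule only the values of
  \<open>G i\<close> at \<open>x\<close> survive, because \<open>u i y - u i x\<close> vanishes at
  \<open>x\<close>.\<close>

lemma TS_in_coordinates:
  assumes U: "(U, \<psi>) \<in> \<A>" "x \<in> U" and u: "\<And>i. i \<in> Basis \<Longrightarrow> u i \<in> C"
    and N: "open N" "x \<in> N" "\<And>y i. y \<in> N \<Longrightarrow> i \<in> Basis \<Longrightarrow> u i y = \<psi> y \<bullet> i"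
    and v: "v \<in> TS x" and f: "f \<in> C"
  shows "v f = (\<Sum>i\<in>Basis. v (u i) * frechet_derivative (\<lambda>z. f (inv_into U \<psi> z)) (at (\<psi> x)) i)"
proof -
  let ?f = "\<lambda>z. f (inv_into U \<psi> z)"
  obtain r where r: "r > 0" "cball (\<psi> x) r \<subseteq> \<psi> ` (U \<inter> N)"
    by (rule chart_ball[OF U N(1,2)])
  have "smooth_on (ball (\<psi> x) r) ?f"
    by (rule smooth_on_subset[OF CD[OF f U(1)]]) (use r(2) ball_subset_cball in blast)
  from hadamard_lemma[OF this r(1)] obtain g where g: "\<And>i. smooth_on (ball (\<psi> x) r) (g i)"
    "\<And>z. z \<in> ball (\<psi> x) r \<Longrightarrow> ?f z = ?f (\<psi> x) + (\<Sum>i\<in>Basis. ((z - \<psi> x) \<bullet> i) * g i z)"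
    "\<And>i. g i (\<psi> x) = frechet_derivative ?f (at (\<psi> x)) i"
    by blast
  \<comment> \<open>A bump supported in the closed ball of radius r / 2 can be multiplied with the
    factors \<open>g i\<close>, which are smooth only on the open ball of radius r.\<close>
  have r2: "r / 2 > 0" using r(1) by simp
  obtain b where b: "smooth_on UNIV b" "\<And>z. dist (\<psi> x) z \<le> r / 2 / 2 \<Longrightarrow> b z = 1"
    "\<And>z. dist (\<psi> x) z \<ge> r / 2 \<Longrightarrow> b z = (0::real)"
    using smooth_bump[OF r2, of "\<psi> x"] by metis
  define G where "G i = chart_fun U \<psi> (\<lambda>z. b z * g i z)" for i
  have b0: "b z = 0" if "z \<notin> cball (\<psi> x) (r / 2)" for z
    using b(3) that by simp
  have sub: "cball (\<psi> x) (r / 2) \<subseteq> ball (\<psi> x) r" using r(1) by auto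
  have sub': "cball (\<psi> x) (r / 2) \<subseteq> \<psi> ` U"
    using r(2) sub ball_subset_cball[of "\<psi> x" r] by blast
  have G: "G i \<in> C" for i
    unfolding G_def
    by (rule chart_fun_C[OF U(1) sub' smooth_on_bump_mult[OF b(1) b0 open_ball sub g(1)]])
      (use b0 in auto)
  have Gx: "G i x = frechet_derivative ?f (at (\<psi> x)) i" for i
    using b(2)[of "\<psi> x"] r(1) U(2) g(3)[of i] by (simp add: G_def chart_fun_def)
  let ?h = "\<lambda>y. f x + (\<Sum>i\<in>Basis. (u i y - u i x) * G i y)"
  have hs: "(\<lambda>y. (u i y - u i x) * G i y) \<in> C" if "i \<in> Basis" for i
    by (rule C_mult[OF C_diff[OF u[OF that] C_const] G])
  have "v f = v ?h"
  proof (rule TS_local[OF v f C_add[OF C_const C_sum[OF hs]]])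
    show "open {y \<in> U. \<psi> y \<in> ball (\<psi> x) (r / 4)}"
      by (rule chart_preimage_open[OF U(1) open_ball])
    show "x \<in> {y \<in> U. \<psi> y \<in> ball (\<psi> x) (r / 4)}" using U(2) r(1) by simp
    fix y assume y: "y \<in> {y \<in> U. \<psi> y \<in> ball (\<psi> x) (r / 4)}"
    then have "dist (\<psi> x) (\<psi> y) < r / 4" by simp
    then have "\<psi> y \<in> ball (\<psi> x) r"
      using zero_le_dist[of "\<psi> x" "\<psi> y"] r(1) unfolding mem_ball by linarith
    note e = g(2)[OF this]
    have "\<psi> y \<in> \<psi> ` (U \<inter> N)" using y r by (intro subsetD[OF r(2)]) auto
    then have "y \<in> N" using in_chart_image[OF U(1)] y by blast
    then have "u i y - u i x = (\<psi> y - \<psi> x) \<bullet> i" if "i \<in> Basis" for i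
      using N(2,3) that by (simp add: inner_diff_left)
    moreover have "G i y = g i (\<psi> y)" for i
      using y b(2)[of "\<psi> y"] by (simp add: G_def chart_fun_def)
    ultimately show "f y = ?h y"
      using e y chart_inv[OF U(1)] U(2) by simp
  qed
  also have "\<dots> = (\<Sum>i\<in>Basis. v (\<lambda>y. (u i y - u i x) * G i y))"
    by (simp add: TS_add[OF v C_const C_sum[OF hs]] TS_sum[OF v hs] TS_const[OF v])
  also have "\<dots> = (\<Sum>i\<in>Basis. v (u i) * frechet_derivative ?f (at (\<psi> x)) i)"
  proof (rule sum.cong[OF refl])
    fix i :: 'e assume i: "i \<in> Basis"
    have "v (\<lambda>y. (u i y - u i x) * G i y) = G i x * v (\<lambda>y. u i y - u i x)"
      using TS_mult[OF v C_diff[OF u[OF i] C_const[of "u i x"]] G[of i]] by simp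
    then show "v (\<lambda>y. (u i y - u i x) * G i y) = v (u i) * frechet_derivative ?f (at (\<psi> x)) i"
      by (simp add: TS_diff[OF v u[OF i] C_const] TS_const[OF v] Gx)
  qed
  finally show ?thesis .
qed

lemma TS_zero: "0 \<in> TS x"
  by (rule TSI) auto

lemma TS_plus: "v \<in> TS x \<Longrightarrow> w \<in> TS x \<Longrightarrow> v + w \<in> TS x"
  by (rule TSI) (auto simp: TS_add TS_cmult TS_mult TS_nonsmooth algebra_simps)

lemma TS_scaleR: "v \<in> TS x \<Longrightarrow> c *\<^sub>R v \<in> TS x"
  by (rule TSI) (auto simp: TS_add TS_cmult TS_mult TS_nonsmooth algebra_simps scaleR_fun_def)

lemma TS_uminus: "v \<in> TS x \<Longrightarrow> - v \<in> TS x"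
  using TS_scaleR[of v x "-1"] by simp

lemma TS_diff_closed: "v \<in> TS x \<Longrightarrow> w \<in> TS x \<Longrightarrow> v - w \<in> TS x"
  using TS_plus[OF _ TS_uminus, of v x w] by simp

lemma TS_sum_closed:
  assumes "\<And>i. i \<in> I \<Longrightarrow> v i \<in> TS x"
  shows "(\<Sum>i\<in>I. v i) \<in> TS x"
  using assms
proof (induction I rule: infinite_finite_induct)
  case (insert i F)
  then have "v i + (\<Sum>i\<in>F. v i) \<in> TS x" by (intro TS_plus) simp_all
  then show ?case by (simp only: sum.insert[OF insert(1,2)])
qed (simp_all add: TS_zero)

section \<open>Vector fields and local frames\<close>

lemma VFI: "(\<And>x. X x \<in> TS x) \<Longrightarrow> (\<And>f. f \<in> C \<Longrightarrow> (\<lambda>x. X x f) \<in> C) \<Longrightarrow> X \<in> VF"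
  by (simp add: vector_fields_def)

lemma VF_TS: "X \<in> VF \<Longrightarrow> X x \<in> TS x"
  by (simp add: vector_fields_def)

lemma VF_C: "X \<in> VF \<Longrightarrow> f \<in> C \<Longrightarrow> (\<lambda>x. X x f) \<in> C"
  by (simp add: vector_fields_def)

lemma VF_add:
  assumes "X \<in> VF" "Y \<in> VF"
  shows "(\<lambda>x. X x + Y x) \<in> VF"
proof (rule VFI)
  show "X x + Y x \<in> TS x" for x
    by (rule TS_plus[OF VF_TS[OF assms(1)] VF_TS[OF assms(2)]])
  show "(\<lambda>x. (X x + Y x) f) \<in> C" if "f \<in> C" for f
    using C_add[OF VF_C[OF assms(1) that] VF_C[OF assms(2) that]] by simp
qed

lemma VF_fmult:
  assumes "f \<in> C" "X \<in> VF"
  shows "(\<lambda>x. f x *\<^sub>R X x) \<in> VF"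
proof (rule VFI)
  show "f x *\<^sub>R X x \<in> TS x" for x
    by (rule TS_scaleR[OF VF_TS[OF assms(2)]])
  show "(\<lambda>x. (f x *\<^sub>R X x) h) \<in> C" if "h \<in> C" for h
    using C_mult[OF assms(1) VF_C[OF assms(2) that]] by (simp add: scaleR_fun_def)
qed

lemma VF_scaleR: "X \<in> VF \<Longrightarrow> (\<lambda>x. c *\<^sub>R X x) \<in> VF"
  by (rule VF_fmult[OF C_const])

lemma VF_uminus: "X \<in> VF \<Longrightarrow> (\<lambda>x. - X x) \<in> VF"
  using VF_scaleR[of X "-1"] by simp

lemma VF_diff: "X \<in> VF \<Longrightarrow> Y \<in> VF \<Longrightarrow> (\<lambda>x. X x - Y x) \<in> VF"
  using VF_add[OF _ VF_uminus, of X Y] by simp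

lemma VF_0: "(\<lambda>x. 0) \<in> VF"
  by (rule VFI) (simp_all add: TS_zero)

lemma VF_sum:
  assumes "\<And>i. i \<in> I \<Longrightarrow> X i \<in> VF"
  shows "(\<lambda>x. \<Sum>i\<in>I. X i x) \<in> VF"
  using assms
proof (induction I rule: infinite_finite_induct)
  case (insert i F)
  then have "(\<lambda>x. \<Sum>i\<in>F. X i x) \<in> VF" by simp
  then have "(\<lambda>x. X i x + (\<Sum>i\<in>F. X i x)) \<in> VF" using insert by (intro VF_add) simp_all
  then show ?case by (simp only: sum.insert[OF insert(1,2)])
qed (simp_all add: VF_0)

text \<open>The fields \<open>E i\<close> are coordinate fields cut off by the bump function
  \<kappa> and extended by 0, so that the expansion reproduces \<open>\<kappa> y *\<^sub>R v\<close>
  instead of \<open>v\<close>. In this form it holds at every point of the manifold, and at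
  \<open>x\<close> it is an honest expansion because \<kappa> is 1 there.\<close>

definition local_frame :: "'a \<Rightarrow> ('a \<Rightarrow> real) \<Rightarrow> ('e \<Rightarrow> 'a \<Rightarrow> real) \<Rightarrow> ('e \<Rightarrow> 'a \<Rightarrow> 'a tvec) \<Rightarrow> bool" where
  "local_frame x \<kappa> u E \<longleftrightarrow> \<kappa> \<in> C \<and> \<kappa> x = 1 \<and> (\<forall>i\<in>Basis. u i \<in> C) \<and> (\<forall>i\<in>Basis. E i \<in> VF) \<and>
     (\<forall>i\<in>Basis. \<forall>j\<in>Basis. E i x (u j) = (if i = j then 1 else 0)) \<and>
     (\<forall>y. \<forall>v\<in>TS y. \<kappa> y *\<^sub>R v = (\<Sum>i\<in>Basis. v (u i) *\<^sub>R E i y))"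

lemma local_frame_exists: "\<exists>\<kappa> u E. local_frame x \<kappa> u E"
proof -
  obtain U \<psi> where U: "(U, \<psi>) \<in> \<A>" "x \<in> U" by (rule chart_exists)
  obtain r where r: "r > 0" "cball (\<psi> x) r \<subseteq> \<psi> ` (U \<inter> UNIV)"
    by (rule chart_ball[OF U open_UNIV UNIV_I])
  have r2: "r / 2 > 0" using r(1) by simp
  obtain b where b: "smooth_on UNIV b" "\<And>z. dist (\<psi> x) z \<le> r / 2 / 2 \<Longrightarrow> b z = 1"
    "\<And>z. dist (\<psi> x) z \<ge> r / 2 \<Longrightarrow> b z = (0::real)"
    using smooth_bump[OF r2, of "\<psi> x"] by metis
  \<comment> \<open>\<open>b'\<close> equals 1 wherever \<open>b\<close> is nonzero, so that the
    functions \<open>u i\<close> are the true coordinates wherever the fields \<open>E i\<close> do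
    not vanish.\<close>
  obtain b' where b': "smooth_on UNIV b'" "\<And>z. dist (\<psi> x) z \<le> r / 2 \<Longrightarrow> b' z = 1"
    "\<And>z. dist (\<psi> x) z \<ge> r \<Longrightarrow> b' z = (0::real)"
    using smooth_bump[OF r(1), of "\<psi> x"] by metis
  have b0: "b z = 0" if "z \<notin> cball (\<psi> x) (r / 2)" for z
    using b(3) that by simp
  have sub: "cball (\<psi> x) (r / 2) \<subseteq> \<psi> ` U" "cball (\<psi> x) r \<subseteq> \<psi> ` U"
    using r(1) order.trans[OF subset_cball[of "r / 2" r "\<psi> x"] r(2)] r(2) by simp_all
  let ?i = "inv_into U \<psi>"
  define \<kappa> where "\<kappa> = chart_fun U \<psi> b"
  define u where "u i = chart_fun U \<psi> (\<lambda>z. b' z * (z \<bullet> i))" for i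
  define E where "E i y f = (if f \<in> C \<and> y \<in> U
    then b (\<psi> y) * frechet_derivative (\<lambda>z. f (?i z)) (at (\<psi> y)) i else 0)" for i :: 'e and y f
  define N where "N = {y \<in> U. \<psi> y \<in> ball (\<psi> x) (r / 2)}"
  have N: "open N" unfolding N_def by (rule chart_preimage_open[OF U(1) open_ball])
  have uN: "u i y = \<psi> y \<bullet> i" if "y \<in> N" for i y
    using that b'(2) by (simp add: N_def u_def chart_fun_def)
  have \<kappa>: "\<kappa> \<in> C"
    unfolding \<kappa>_def by (rule chart_fun_C[OF U(1) sub(1) b(1) b0])
  have u: "u i \<in> C" for i
    unfolding u_def
    by (rule chart_fun_C[OF U(1) sub(2) smooth_on_mult[OF open_UNIV b'(1)
            smooth_on_bounded_linear[OF open_UNIV bounded_linear_inner_left]]])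
      (use b'(3) in auto)
  have der: "((\<lambda>z. f (?i z)) has_derivative frechet_derivative (\<lambda>z. f (?i z)) (at (\<psi> y))) (at (\<psi> y))"
    if "f \<in> C" "y \<in> U" for f y
    by (rule smooth_on_derivative[OF CD[OF that(1) U(1)]]) (use that in auto)
  have E_TS: "E i y \<in> TS y" for i y
  proof (rule TSI)
    fix f h assume f: "f \<in> C" and h: "h \<in> C"
    show "E i y (\<lambda>y. f y + h y) = E i y f + E i y h"
      using fun_cong[OF frechet_derivative_at[OF has_derivative_add[OF der[OF f, of y] der[OF h, of y]]],
          of i, symmetric] f h C_add[OF f h]
      by (simp add: E_def algebra_simps)
    show "E i y (\<lambda>y. f y * h y) = f y * E i y h + h y * E i y f"
      using fun_cong[OF frechet_derivative_at[OF has_derivative_mult[OF der[OF f, of y] der[OF h, of y]]], of i, symmetric]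
        f h C_mult[OF f h] chart_inv[OF U(1), of y]
      by (simp add: E_def algebra_simps)
  next
    fix f and c :: real assume f: "f \<in> C"
    show "E i y (\<lambda>y. c * f y) = c * E i y f"
      using fun_cong[OF frechet_derivative_at[OF has_derivative_mult_right[OF der[OF f, of y], of c]], of i, symmetric]
        f C_cmult[OF f, of c]
      by (simp add: E_def)
  qed (simp add: E_def)
  have E: "E i \<in> VF" for i
  proof (rule VFI[OF E_TS])
    fix f assume f: "f \<in> C"
    have "smooth_on UNIV (\<lambda>z. b z * frechet_derivative (\<lambda>z. f (?i z)) (at z) i)"
      by (rule smooth_on_bump_mult[OF b(1) b0 chart_open_image[OF U(1)] sub(1)
            smooth_on_frechet_derivative[OF CD[OF f U(1)]]])
    from chart_fun_C[OF U(1) sub(1) this]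
    have "chart_fun U \<psi> (\<lambda>z. b z * frechet_derivative (\<lambda>z. f (?i z)) (at z) i) \<in> C"
      using b0 by simp
    moreover have "chart_fun U \<psi> (\<lambda>z. b z * frechet_derivative (\<lambda>z. f (?i z)) (at z) i) = (\<lambda>y. E i y f)"
      using f by (auto simp: E_def chart_fun_def fun_eq_iff)
    ultimately show "(\<lambda>y. E i y f) \<in> C" by simp
  qed
  have Eu: "E i x (u j) = (if i = j then 1 else 0)" if "i \<in> Basis" "j \<in> Basis" for i j
  proof -
    have "frechet_derivative (\<lambda>z. u j (?i z)) (at (\<psi> x)) = (\<lambda>v. v \<bullet> j)"
    proof (rule sym, rule frechet_derivative_at)
      have l: "((\<lambda>v. v \<bullet> j) has_derivative (\<lambda>v. v \<bullet> j)) (at (\<psi> x))"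
        by (rule bounded_linear_imp_has_derivative[OF bounded_linear_inner_left])
      show "((\<lambda>z. u j (?i z)) has_derivative (\<lambda>v. v \<bullet> j)) (at (\<psi> x))"
      proof (rule has_derivative_transform_within_open[OF l open_ball])
        show "\<psi> x \<in> ball (\<psi> x) (r / 2)" using r2 by simp
        fix z assume z: "z \<in> ball (\<psi> x) (r / 2)"
        then have zU: "z \<in> \<psi> ` U" using sub(1) by auto
        then have "?i z \<in> N"
          using z chart_inv'[OF U(1) zU] chart_inv_in[OF U(1) zU] by (simp add: N_def)
        then show "z \<bullet> j = u j (?i z)"
          using uN chart_inv'[OF U(1) zU] by simp
      qed
    qed
    then show ?thesis
      using that u U(2) b(2)[of "\<psi> x"] r by (simp add: E_def inner_Basis)
  qed
  have "\<kappa> y *\<^sub>R v = (\<Sum>i\<in>Basis. v (u i) *\<^sub>R E i y)" if v: "v \<in> TS y" for y v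
  proof (rule ext)
    fix f
    show "(\<kappa> y *\<^sub>R v) f = (\<Sum>i\<in>Basis. v (u i) *\<^sub>R E i y) f"
    proof (cases "f \<in> C \<and> y \<in> N")
      case True
      then have y: "y \<in> U" by (simp add: N_def)
      have "v f = (\<Sum>i\<in>Basis. v (u i) * frechet_derivative (\<lambda>z. f (?i z)) (at (\<psi> y)) i)"
        by (rule TS_in_coordinates[OF U(1) y u N _ _ v]) (use True uN in auto)
      then show ?thesis
        using True y by (simp add: scaleR_fun_def sum_fun_apply E_def \<kappa>_def chart_fun_def
            sum_distrib_left mult.left_commute)
    next
      case False
      have "\<kappa> y = 0 \<and> (\<forall>i. E i y = 0)" if "y \<notin> N"
        using that b(3)[of "\<psi> y"] by (auto simp: \<kappa>_def chart_fun_def N_def E_def fun_eq_iff)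
      moreover have "E i y f = 0" if "f \<notin> C" for i
        using that by (simp add: E_def)
      ultimately show ?thesis
        using False TS_nonsmooth[OF v, of f]
        by (auto simp: scaleR_fun_def sum_fun_apply)
    qed
  qed
  moreover have "\<kappa> x = 1" using U(2) b(2)[of "\<psi> x"] r by (simp add: \<kappa>_def chart_fun_def)
  ultimately have "local_frame x \<kappa> u E"
    unfolding local_frame_def using \<kappa> u E Eu by blast
  then show ?thesis by blast
qed

section \<open>Tensoriality and the exterior derivative of 1-forms\<close>

definition tensor_at :: "'a \<Rightarrow> (('a \<Rightarrow> 'a tvec) \<Rightarrow> 'w::real_vector) \<Rightarrow> bool" where
  "tensor_at x N \<longleftrightarrow>
     (\<forall>V\<in>VF. \<forall>W\<in>VF. N (\<lambda>y. V y + W y) = N V + N W) \<and>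
     (\<forall>f\<in>C. \<forall>V\<in>VF. N (\<lambda>y. f y *\<^sub>R V y) = f x *\<^sub>R N V)"

lemma tensor_atI:
  assumes "\<And>V W. V \<in> VF \<Longrightarrow> W \<in> VF \<Longrightarrow> N (\<lambda>y. V y + W y) = N V + N W"
    and "\<And>f V. f \<in> C \<Longrightarrow> V \<in> VF \<Longrightarrow> N (\<lambda>y. f y *\<^sub>R V y) = f x *\<^sub>R N V"
  shows "tensor_at x N"
  using assms by (simp add: tensor_at_def)

lemma tensor_at_add:
  "tensor_at x N \<Longrightarrow> V \<in> VF \<Longrightarrow> W \<in> VF \<Longrightarrow> N (\<lambda>y. V y + W y) = N V + N W"
  by (simp add: tensor_at_def)

lemma tensor_at_fmult:
  "tensor_at x N \<Longrightarrow> f \<in> C \<Longrightarrow> V \<in> VF \<Longrightarrow> N (\<lambda>y. f y *\<^sub>R V y) = f x *\<^sub>R N V"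
  by (simp add: tensor_at_def)

lemma tensor_at_sum:
  assumes "tensor_at x N" "\<And>i. i \<in> I \<Longrightarrow> f i \<in> C" "\<And>i. i \<in> I \<Longrightarrow> V i \<in> VF"
  shows "N (\<lambda>y. \<Sum>i\<in>I. f i y *\<^sub>R V i y) = (\<Sum>i\<in>I. f i x *\<^sub>R N (V i))"
proof -
  have z: "N (\<lambda>y. 0) = 0"
    using tensor_at_fmult[OF assms(1) C_const[of 0] VF_0] by simp
  show ?thesis
    using assms(2,3)
  proof (induction I rule: infinite_finite_induct)
    case (insert i F)
    have "N (\<lambda>y. f i y *\<^sub>R V i y + (\<Sum>i\<in>F. f i y *\<^sub>R V i y))
      = N (\<lambda>y. f i y *\<^sub>R V i y) + N (\<lambda>y. \<Sum>i\<in>F. f i y *\<^sub>R V i y)"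
      by (rule tensor_at_add[OF assms(1)]; (rule VF_sum)?; rule VF_fmult; use insert in simp)
    also have "\<dots> = f i x *\<^sub>R N (V i) + (\<Sum>i\<in>F. f i x *\<^sub>R N (V i))"
      using insert tensor_at_fmult[OF assms(1)] by simp
    finally show ?case by (simp only: sum.insert[OF insert(1,2)])
  qed (simp_all add: z)
qed

text \<open>Linearity over functions makes the value depend on \<open>V x\<close> alone:
  \<open>\<kappa> y *\<^sub>R V y\<close> expands in the frame with coefficients
  \<open>V y (u i)\<close>, and these vanish at \<open>x\<close> together with
  \<open>V\<close>.\<close>

lemma tensor_at_zero:
  assumes N: "tensor_at x N" and V: "V \<in> VF" "V x = 0"
  shows "N V = 0"
proof -
  obtain \<kappa> u E where f: "local_frame x \<kappa> u E"
    using local_frame_exists by blast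
  then have \<kappa>: "\<kappa> \<in> C" "\<kappa> x = 1" and u: "\<And>i. i \<in> (Basis::'e set) \<Longrightarrow> u i \<in> C"
    and E: "\<And>i. i \<in> Basis \<Longrightarrow> E i \<in> VF"
    and frame: "\<And>y v. v \<in> TS y \<Longrightarrow> \<kappa> y *\<^sub>R v = (\<Sum>i\<in>Basis. v (u i) *\<^sub>R E i y)"
    by (simp_all add: local_frame_def)
  have "N V = N (\<lambda>y. \<kappa> y *\<^sub>R V y)"
    using tensor_at_fmult[OF N \<kappa>(1) V(1)] \<kappa>(2) by simp
  also have "\<dots> = N (\<lambda>y. \<Sum>i\<in>Basis. V y (u i) *\<^sub>R E i y)"
    using frame[OF VF_TS[OF V(1)]] by simp
  also have "\<dots> = (\<Sum>i\<in>Basis. V x (u i) *\<^sub>R N (E i))"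
    by (rule tensor_at_sum[OF N VF_C[OF V(1) u] E])
  also have "\<dots> = 0" using V(2) by simp
  finally show ?thesis .
qed

lemma tensor_at_cong:
  assumes N: "tensor_at x N" and V: "V \<in> VF" "W \<in> VF" "V x = W x"
  shows "N V = N W"
proof -
  have "N (\<lambda>y. V y + (-1) *\<^sub>R W y) = 0"
    by (rule tensor_at_zero[OF N VF_add[OF V(1) VF_scaleR[OF V(2)]]]) (simp add: V(3))
  then show ?thesis
    using tensor_at_add[OF N V(1) VF_scaleR[OF V(2), of "-1"]]
      tensor_at_fmult[OF N C_const[of "-1"] V(2)] by simp
qed

lemma vector_field_through:
  assumes v: "v \<in> TS x"
  obtains X where "X \<in> VF" "X x = v"
proof -
  obtain \<kappa> u E where f: "local_frame x \<kappa> u E"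
    using local_frame_exists by blast
  then have \<kappa>: "\<kappa> \<in> C" "\<kappa> x = 1" and u: "\<And>i. i \<in> (Basis::'e set) \<Longrightarrow> u i \<in> C"
    and E: "\<And>i. i \<in> Basis \<Longrightarrow> E i \<in> VF"
    and frame: "\<And>y v. v \<in> TS y \<Longrightarrow> \<kappa> y *\<^sub>R v = (\<Sum>i\<in>Basis. v (u i) *\<^sub>R E i y)"
    by (simp_all add: local_frame_def)
  show ?thesis
  proof (rule that)
    show "(\<lambda>y. \<Sum>i\<in>Basis. v (u i) *\<^sub>R E i y) \<in> VF"
      by (rule VF_sum, rule VF_scaleR, rule E)
    show "(\<Sum>i\<in>Basis. v (u i) *\<^sub>R E i x) = v"
      using frame[OF v] \<kappa>(2) by simp
  qed
qed

lemma extend_tangent: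
  assumes "v \<in> TS x"
  shows "extend (tangent_algebroid \<A>) x v \<in> VF" "extend (tangent_algebroid \<A>) x v x = v"
proof -
  have "\<exists>X. X \<in> sections (tangent_algebroid \<A>) \<and> X x = v"
    using vector_field_through[OF assms] by (metis algebroid.simps tangent_algebroid_def vbundle.simps)
  from someI_ex[OF this] show "extend (tangent_algebroid \<A>) x v \<in> VF"
    "extend (tangent_algebroid \<A>) x v x = v"
    by (simp_all add: extend_def tangent_algebroid_def)
qed

section \<open>Derivative rules and the Lie bracket of vector fields\<close>

lemma VFD_add: "X \<in> VF \<Longrightarrow> f \<in> C \<Longrightarrow> h \<in> C \<Longrightarrow> X x (\<lambda>y. f y + h y) = X x f + X x h"
  by (rule TS_add[OF VF_TS])

lemma VFD_diff: "X \<in> VF \<Longrightarrow> f \<in> C \<Longrightarrow> h \<in> C \<Longrightarrow> X x (\<lambda>y. f y - h y) = X x f - X x h"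
  by (rule TS_diff[OF VF_TS])

lemma VFD_mult:
  "X \<in> VF \<Longrightarrow> f \<in> C \<Longrightarrow> h \<in> C \<Longrightarrow> X x (\<lambda>y. f y * h y) = f x * X x h + h x * X x f"
  by (rule TS_mult[OF VF_TS])

lemma VFD_cmult: "X \<in> VF \<Longrightarrow> f \<in> C \<Longrightarrow> X x (\<lambda>y. c * f y) = c * X x f"
  by (rule TS_cmult[OF VF_TS])

lemma VFD_minus: "X \<in> VF \<Longrightarrow> f \<in> C \<Longrightarrow> X x (\<lambda>y. - f y) = - X x f"
  by (rule TS_minus[OF VF_TS])

lemma VFD_const: "X \<in> VF \<Longrightarrow> X x (\<lambda>y. c) = 0"
  by (rule TS_const[OF VF_TS])

lemma VFD_nonsmooth: "X \<in> VF \<Longrightarrow> f \<notin> C \<Longrightarrow> X x f = 0"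
  by (rule TS_nonsmooth[OF VF_TS])

lemmas VFD = VFD_add VFD_diff VFD_mult VFD_cmult VFD_minus VFD_const

lemma lie_bracket_nonsmooth:
  assumes "X \<in> VF" "Y \<in> VF" "f \<notin> C"
  shows "lie_bracket X Y x f = 0"
  using assms by (simp add: lie_bracket_def VFD_nonsmooth[OF assms(1)] VFD_nonsmooth[OF assms(2)] VFD_const)

lemma lie_bracket_VF:
  assumes X: "X \<in> VF" and Y: "Y \<in> VF"
  shows "lie_bracket X Y \<in> VF"
proof (rule VFI)
  show "lie_bracket X Y x \<in> TS x" for x
  proof (rule TSI)
    fix f h assume f: "f \<in> C" and h: "h \<in> C"
    note fh = VF_C[OF X f] VF_C[OF X h] VF_C[OF Y f] VF_C[OF Y h] f h
    show "lie_bracket X Y x (\<lambda>y. f y + h y) = lie_bracket X Y x f + lie_bracket X Y x h"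
      by (simp add: lie_bracket_def VFD[OF X] VFD[OF Y] fh)
    show "lie_bracket X Y x (\<lambda>y. f y * h y) = f x * lie_bracket X Y x h + h x * lie_bracket X Y x f"
      by (simp add: lie_bracket_def VFD[OF X] VFD[OF Y] fh C_mult algebra_simps)
    show "lie_bracket X Y x (\<lambda>y. c * f y) = c * lie_bracket X Y x f" for c
      by (simp add: lie_bracket_def VFD[OF X] VFD[OF Y] fh algebra_simps)
  qed (rule lie_bracket_nonsmooth[OF X Y])
  show "(\<lambda>x. lie_bracket X Y x f) \<in> C" if "f \<in> C" for f
    unfolding lie_bracket_def
    by (rule C_diff[OF VF_C[OF X VF_C[OF Y that]] VF_C[OF Y VF_C[OF X that]]])
qed

lemma lie_bracket_skew: "lie_bracket X Y x = - lie_bracket Y X x"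
  by (simp add: lie_bracket_def fun_eq_iff)

lemma lie_bracket_self: "lie_bracket X X x = 0"
  by (simp add: lie_bracket_def fun_eq_iff)

text \<open>Tangent vectors are HOL functions of arbitrary real functions, so equality must also
  hold on nonsmooth arguments, where both sides are 0.\<close>

lemma lie_bracket_eqI:
  assumes "X \<in> VF" "Y \<in> VF" "v \<in> TS x"
    and "\<And>f. f \<in> C \<Longrightarrow> lie_bracket X Y x f = v f"
  shows "lie_bracket X Y x = v"
proof (rule ext)
  fix f show "lie_bracket X Y x f = v f"
    using assms lie_bracket_nonsmooth[of X Y f] TS_nonsmooth[of v x f] by (cases "f \<in> C") auto
qed

lemma lie_bracket_add_right:
  assumes X: "X \<in> VF" and Y: "Y \<in> VF" "Z \<in> VF"
  shows "lie_bracket X (\<lambda>y. Y y + Z y) x = lie_bracket X Y x + lie_bracket X Z x"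
proof (rule lie_bracket_eqI[OF X VF_add[OF Y]])
  show "lie_bracket X Y x + lie_bracket X Z x \<in> TS x"
    by (intro TS_plus VF_TS lie_bracket_VF X Y)
  fix f assume f: "f \<in> C"
  show "lie_bracket X (\<lambda>y. Y y + Z y) x f = (lie_bracket X Y x + lie_bracket X Z x) f"
    by (simp add: lie_bracket_def VFD[OF X] VF_C[OF Y(1) f] VF_C[OF Y(2) f])
qed

lemma lie_bracket_fmult_right:
  assumes X: "X \<in> VF" and Y: "Y \<in> VF" and h: "h \<in> C"
  shows "lie_bracket X (\<lambda>y. h y *\<^sub>R Y y) x = h x *\<^sub>R lie_bracket X Y x + X x h *\<^sub>R Y x"
proof (rule lie_bracket_eqI[OF X VF_fmult[OF h Y]])
  show "h x *\<^sub>R lie_bracket X Y x + X x h *\<^sub>R Y x \<in> TS x"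
    by (intro TS_plus TS_scaleR VF_TS lie_bracket_VF X Y)
  fix f assume f: "f \<in> C"
  show "lie_bracket X (\<lambda>y. h y *\<^sub>R Y y) x f = (h x *\<^sub>R lie_bracket X Y x + X x h *\<^sub>R Y x) f"
    by (simp add: lie_bracket_def scaleR_fun_def VFD[OF X] VF_C[OF Y f] h algebra_simps)
qed

lemma lie_bracket_add_left:
  assumes "X \<in> VF" "Y \<in> VF" "Z \<in> VF"
  shows "lie_bracket (\<lambda>y. X y + Y y) Z x = lie_bracket X Z x + lie_bracket Y Z x"
  using lie_bracket_add_right[OF assms(3,1,2), of x]
    lie_bracket_skew[of "\<lambda>y. X y + Y y" Z x] lie_bracket_skew[of X Z x] lie_bracket_skew[of Y Z x]
  by simp

lemma lie_bracket_fmult_left: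
  assumes "X \<in> VF" "Y \<in> VF" "h \<in> C"
  shows "lie_bracket (\<lambda>y. h y *\<^sub>R X y) Y x = h x *\<^sub>R lie_bracket X Y x - Y x h *\<^sub>R X x"
  using lie_bracket_fmult_right[OF assms(2,1,3), of x]
    lie_bracket_skew[of "\<lambda>y. h y *\<^sub>R X y" Y x] lie_bracket_skew[of X Y x]
  by simp

lemma lie_bracket_jacobi:
  assumes X: "X \<in> VF" and Y: "Y \<in> VF" and Z: "Z \<in> VF"
  shows "lie_bracket (lie_bracket X Y) Z x + lie_bracket (lie_bracket Y Z) X x
    + lie_bracket (lie_bracket Z X) Y x = 0"
proof (rule ext)
  fix f
  show "(lie_bracket (lie_bracket X Y) Z x + lie_bracket (lie_bracket Y Z) X x
    + lie_bracket (lie_bracket Z X) Y x) f = 0 f"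
  proof (cases "f \<in> C")
    case f: True
    note XYZ = X Y Z VF_C[OF X] VF_C[OF Y] VF_C[OF Z] f
    show ?thesis
      by (simp add: lie_bracket_def VFD[OF X] VFD[OF Y] VFD[OF Z] XYZ)
  next
    case False
    then show ?thesis
      by (simp add: lie_bracket_nonsmooth lie_bracket_VF X Y Z)
  qed
qed

section \<open>Differential 1-forms and their exterior derivative\<close>

abbreviation "\<Omega> \<equiv> dual_sections \<A> (tangent_algebroid \<A>)"

abbreviation "dd \<equiv> d1 (tangent_algebroid \<A>)"

lemma \<Omega>_linear: "\<alpha> \<in> \<Omega> \<Longrightarrow> linear_map_on (TS x) (\<alpha> x)"
  by (simp add: dual_sections_def dual_fiber_def tangent_algebroid_def)

lemma \<Omega>_C: "\<alpha> \<in> \<Omega> \<Longrightarrow> X \<in> VF \<Longrightarrow> (\<lambda>x. \<alpha> x (X x)) \<in> C"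
  by (simp add: dual_sections_def tangent_algebroid_def)

lemma \<Omega>_outside: "\<alpha> \<in> \<Omega> \<Longrightarrow> v \<notin> TS x \<Longrightarrow> \<alpha> x v = 0"
  by (simp add: dual_sections_def dual_fiber_def tangent_algebroid_def)

lemma \<Omega>I:
  assumes "\<And>x. linear_map_on (TS x) (\<alpha> x)" "\<And>x v. v \<notin> TS x \<Longrightarrow> \<alpha> x v = 0"
    and "\<And>X. X \<in> VF \<Longrightarrow> (\<lambda>x. \<alpha> x (X x)) \<in> C"
  shows "\<alpha> \<in> \<Omega>"
  using assms by (simp add: dual_sections_def dual_fiber_def tangent_algebroid_def)

lemma \<Omega>_add: "\<alpha> \<in> \<Omega> \<Longrightarrow> v \<in> TS x \<Longrightarrow> w \<in> TS x \<Longrightarrow> \<alpha> x (v + w) = \<alpha> x v + \<alpha> x w"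
  by (rule linear_map_on_add[OF \<Omega>_linear])

lemma \<Omega>_diff: "\<alpha> \<in> \<Omega> \<Longrightarrow> v \<in> TS x \<Longrightarrow> w \<in> TS x \<Longrightarrow> \<alpha> x (v - w) = \<alpha> x v - \<alpha> x w"
  by (rule linear_map_on_diff[OF \<Omega>_linear])

lemma \<Omega>_scaleR: "\<alpha> \<in> \<Omega> \<Longrightarrow> v \<in> TS x \<Longrightarrow> \<alpha> x (c *\<^sub>R v) = c * \<alpha> x v"
  using linear_map_on_scaleR[OF \<Omega>_linear, of \<alpha> v x c] by simp

lemma \<Omega>_minus: "\<alpha> \<in> \<Omega> \<Longrightarrow> v \<in> TS x \<Longrightarrow> \<alpha> x (- v) = - \<alpha> x v"
  by (rule linear_map_on_minus[OF \<Omega>_linear])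

lemma \<Omega>_zero: "\<alpha> \<in> \<Omega> \<Longrightarrow> \<alpha> x 0 = 0"
  by (rule linear_map_on_zero[OF \<Omega>_linear TS_zero])

lemma dd_tensor:
  assumes \<beta>: "\<beta> \<in> \<Omega>" and X: "X \<in> VF"
  shows "tensor_at x (\<lambda>Y. X x (\<lambda>y. \<beta> y (Y y)) - Y x (\<lambda>y. \<beta> y (X y)) - \<beta> x (lie_bracket X Y x))"
proof (rule tensor_atI)
  fix V W assume V: "V \<in> VF" and W: "W \<in> VF"
  note facts = \<Omega>_C[OF \<beta> X] \<Omega>_C[OF \<beta> V] \<Omega>_C[OF \<beta> W] VF_TS[OF V] VF_TS[OF W]
    VF_TS[OF lie_bracket_VF[OF X V]] VF_TS[OF lie_bracket_VF[OF X W]]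
  show "X x (\<lambda>y. \<beta> y (V y + W y)) - (V x + W x) (\<lambda>y. \<beta> y (X y)) - \<beta> x (lie_bracket X (\<lambda>y. V y + W y) x)
    = X x (\<lambda>y. \<beta> y (V y)) - V x (\<lambda>y. \<beta> y (X y)) - \<beta> x (lie_bracket X V x)
      + (X x (\<lambda>y. \<beta> y (W y)) - W x (\<lambda>y. \<beta> y (X y)) - \<beta> x (lie_bracket X W x))"
    by (simp only: lie_bracket_add_right[OF X V W] \<Omega>_add[OF \<beta>] facts VFD_add[OF X])
      (simp add: algebra_simps)
next
  fix f V assume f: "f \<in> C" and V: "V \<in> VF"
  note facts = \<Omega>_C[OF \<beta> X] \<Omega>_C[OF \<beta> V] VF_TS[OF V] VF_TS[OF lie_bracket_VF[OF X V]]
    TS_scaleR[OF VF_TS[OF V]] TS_scaleR[OF VF_TS[OF lie_bracket_VF[OF X V]]]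
  show "X x (\<lambda>y. \<beta> y (f y *\<^sub>R V y)) - (f x *\<^sub>R V x) (\<lambda>y. \<beta> y (X y)) - \<beta> x (lie_bracket X (\<lambda>y. f y *\<^sub>R V y) x)
    = f x *\<^sub>R (X x (\<lambda>y. \<beta> y (V y)) - V x (\<lambda>y. \<beta> y (X y)) - \<beta> x (lie_bracket X V x))"
    by (simp only: lie_bracket_fmult_right[OF X V f] \<Omega>_add[OF \<beta>] \<Omega>_scaleR[OF \<beta>] facts VFD_mult[OF X f] f)
      (simp add: scaleR_fun_def algebra_simps)
qed

text \<open>\<open>d1\<close> evaluates on extensions picked by a choice operator. Tensoriality in
  the second slot replaces one of them by \<open>Y\<close>, and skew-symmetry moves the other into
  that slot.\<close>

lemma dd_fields:
  assumes \<beta>: "\<beta> \<in> \<Omega>" and X: "X \<in> VF" and Y: "Y \<in> VF"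
  shows "dd \<beta> x (X x) (Y x) = X x (\<lambda>y. \<beta> y (Y y)) - Y x (\<lambda>y. \<beta> y (X y)) - \<beta> x (lie_bracket X Y x)"
proof -
  let ?X = "extend (tangent_algebroid \<A>) x (X x)" and ?Y = "extend (tangent_algebroid \<A>) x (Y x)"
  let ?N = "\<lambda>X Y. X x (\<lambda>y. \<beta> y (Y y)) - Y x (\<lambda>y. \<beta> y (X y)) - \<beta> x (lie_bracket X Y x)"
  note eX = extend_tangent[OF VF_TS[OF X, of x]] and eY = extend_tangent[OF VF_TS[OF Y, of x]]
  have skew: "?N X Y = - ?N Y X" if "X \<in> VF" "Y \<in> VF" for X Y
    using \<Omega>_minus[OF \<beta> VF_TS[OF lie_bracket_VF[OF that(2,1)]], of x] lie_bracket_skew[of X Y x] by simp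
  have "dd \<beta> x (X x) (Y x) = ?N ?X ?Y"
    using eX(2) eY(2) by (simp add: d1_def Let_def tangent_algebroid_def)
  also have "\<dots> = ?N ?X Y"
    by (rule tensor_at_cong[OF dd_tensor[OF \<beta> eX(1)] eY(1) Y eY(2)])
  also have "\<dots> = - ?N Y ?X" by (rule skew[OF eX(1) Y])
  also have "\<dots> = - ?N Y X"
    by (rule arg_cong[OF tensor_at_cong[OF dd_tensor[OF \<beta> Y] eX(1) X eX(2)]])
  also have "\<dots> = ?N X Y" by (rule skew[OF X Y, symmetric])
  finally show ?thesis .
qed

lemma dd_skew:
  assumes \<beta>: "\<beta> \<in> \<Omega>" and v: "v \<in> TS x" and w: "w \<in> TS x"
  shows "dd \<beta> x v w = - dd \<beta> x w v"
proof -
  obtain X where X: "X \<in> VF" "X x = v" by (rule vector_field_through[OF v])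
  obtain Y where Y: "Y \<in> VF" "Y x = w" by (rule vector_field_through[OF w])
  show ?thesis
    using dd_fields[OF \<beta> X(1) Y(1), of x] dd_fields[OF \<beta> Y(1) X(1), of x] X(2) Y(2)
      \<Omega>_minus[OF \<beta> VF_TS[OF lie_bracket_VF[OF Y(1) X(1)]], of x] lie_bracket_skew[of X Y x] by simp
qed

lemma dd_linear:
  assumes \<beta>: "\<beta> \<in> \<Omega>" and v: "v \<in> TS x"
  shows "linear_map_on (TS x) (dd \<beta> x v)"
proof (rule linear_map_onI)
  obtain X where X: "X \<in> VF" "X x = v" by (rule vector_field_through[OF v])
  fix w assume w: "w \<in> TS x"
  obtain Y where Y: "Y \<in> VF" "Y x = w" by (rule vector_field_through[OF w])
  note t = dd_tensor[OF \<beta> X(1), of x]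
  show "dd \<beta> x v (c *\<^sub>R w) = c *\<^sub>R dd \<beta> x v w" for c
    using tensor_at_fmult[OF t C_const[of c] Y(1)]
      dd_fields[OF \<beta> X(1) Y(1), of x] dd_fields[OF \<beta> X(1) VF_scaleR[OF Y(1), of c], of x] X(2) Y(2)
    by simp
  fix w' assume w': "w' \<in> TS x"
  obtain Z where Z: "Z \<in> VF" "Z x = w'" by (rule vector_field_through[OF w'])
  show "dd \<beta> x v (w + w') = dd \<beta> x v w + dd \<beta> x v w'"
    using tensor_at_add[OF t Y(1) Z(1)] dd_fields[OF \<beta> X(1) Y(1), of x] dd_fields[OF \<beta> X(1) Z(1), of x]
      dd_fields[OF \<beta> X(1) VF_add[OF Y(1) Z(1)], of x] X(2) Y(2) Z(2)
    by simp
qed (rule TS_scaleR)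

lemma dd_C:
  assumes "\<beta> \<in> \<Omega>" "X \<in> VF" "Y \<in> VF"
  shows "(\<lambda>x. dd \<beta> x (X x) (Y x)) \<in> C"
  by (simp only: dd_fields[OF assms])
    (intro C_diff VF_C[OF assms(2)] VF_C[OF assms(3)] \<Omega>_C[OF assms(1)] assms lie_bracket_VF)

text \<open>The invariant formula for d(d beta) = 0. The iterated derivatives of functions cancel,
  and what remains is \<open>\<beta>\<close> applied to the Jacobi identity.\<close>

lemma dd_closed:
  assumes \<beta>: "\<beta> \<in> \<Omega>" and X: "X \<in> VF" and Y: "Y \<in> VF" and Z: "Z \<in> VF"
  shows "X x (\<lambda>y. dd \<beta> y (Y y) (Z y)) + Y x (\<lambda>y. dd \<beta> y (Z y) (X y)) + Z x (\<lambda>y. dd \<beta> y (X y) (Y y))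
    - dd \<beta> x (lie_bracket X Y x) (Z x) - dd \<beta> x (lie_bracket Y Z x) (X x)
    - dd \<beta> x (lie_bracket Z X x) (Y x) = 0"
proof -
  note br = lie_bracket_VF[OF X Y] lie_bracket_VF[OF Y Z] lie_bracket_VF[OF Z X]
  note c = \<Omega>_C[OF \<beta>]
  note cs = c[OF X] c[OF Y] c[OF Z] VF_C[OF X] VF_C[OF Y] VF_C[OF Z] c[OF br(1)] c[OF br(2)] c[OF br(3)]
    C_diff X Y Z
  have j: "\<beta> x (lie_bracket (lie_bracket X Y) Z x) + \<beta> x (lie_bracket (lie_bracket Y Z) X x)
      + \<beta> x (lie_bracket (lie_bracket Z X) Y x) = 0"
    using lie_bracket_jacobi[OF X Y Z, of x] \<Omega>_zero[OF \<beta>, of x]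
      \<Omega>_add[OF \<beta> TS_plus[OF VF_TS[OF lie_bracket_VF[OF br(1) Z]] VF_TS[OF lie_bracket_VF[OF br(2) X]]]
        VF_TS[OF lie_bracket_VF[OF br(3) Y]], of x]
      \<Omega>_add[OF \<beta> VF_TS[OF lie_bracket_VF[OF br(1) Z]] VF_TS[OF lie_bracket_VF[OF br(2) X]], of x]
    by simp
  have b: "lie_bracket X Y x f = X x (\<lambda>y. Y y f) - Y x (\<lambda>y. X y f)" for X Y f
    by (simp add: lie_bracket_def)
  show ?thesis
    using j
    by (simp add: dd_fields[OF \<beta>] X Y Z br VFD[OF X] VFD[OF Y] VFD[OF Z] cs b)
qed

section \<open>Smooth solutions of linear systems\<close>

text \<open>The localization of the ring of smooth functions at the maximal ideal of \<open>x\<close>.\<close>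

definition loc :: "'a \<Rightarrow> ('a \<Rightarrow> real) \<Rightarrow> bool" where
  "loc x F \<longleftrightarrow> (\<exists>\<kappa>\<in>C. \<kappa> x \<noteq> 0 \<and> (\<lambda>y. \<kappa> y * F y) \<in> C)"

lemma loc_C: "F \<in> C \<Longrightarrow> loc x F"
  unfolding loc_def by (rule bexI[of _ "\<lambda>x. 1"]) simp_all

lemma loc_add:
  assumes "loc x F" "loc x G"
  shows "loc x (\<lambda>y. F y + G y)"
proof -
  obtain k l where k: "k \<in> C" "k x \<noteq> 0" "(\<lambda>y. k y * F y) \<in> C"
    and l: "l \<in> C" "l x \<noteq> 0" "(\<lambda>y. l y * G y) \<in> C"
    using assms by (auto simp: loc_def)
  have "(\<lambda>y. l y * (k y * F y) + k y * (l y * G y)) \<in> C"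
    by (intro C_add C_mult k l)
  then have "(\<lambda>y. (k y * l y) * (F y + G y)) \<in> C" by (simp add: algebra_simps)
  then show ?thesis
    unfolding loc_def using C_mult[OF k(1) l(1)] k(2) l(2) by (intro bexI[of _ "\<lambda>y. k y * l y"]) simp_all
qed

lemma loc_Cmult:
  assumes "loc x F" "G \<in> C"
  shows "loc x (\<lambda>y. G y * F y)"
proof -
  obtain k where k: "k \<in> C" "k x \<noteq> 0" "(\<lambda>y. k y * F y) \<in> C"
    using assms by (auto simp: loc_def)
  have "(\<lambda>y. G y * (k y * F y)) \<in> C" by (intro C_mult k assms)
  then have "(\<lambda>y. k y * (G y * F y)) \<in> C" by (simp add: algebra_simps)
  then show ?thesis unfolding loc_def using k by (intro bexI[of _ k]) simp_all
qed

lemma loc_divide: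
  assumes "loc x (\<lambda>y. G y * F y)" "G \<in> C" "G x \<noteq> 0"
  shows "loc x F"
proof -
  obtain k where k: "k \<in> C" "k x \<noteq> 0" "(\<lambda>y. k y * (G y * F y)) \<in> C"
    using assms by (auto simp: loc_def)
  then show ?thesis
    unfolding loc_def using C_mult[OF k(1) assms(2)] assms(3)
    by (intro bexI[of _ "\<lambda>y. k y * G y"]) (simp_all add: mult.assoc)
qed

lemma loc_sum: "(\<And>i. i \<in> I \<Longrightarrow> loc x (F i)) \<Longrightarrow> loc x (\<lambda>y. \<Sum>i\<in>I. F i y)"
proof (induction I rule: infinite_finite_induct)
  case (insert i J)
  have "loc x (\<lambda>y. F i y + (\<Sum>i\<in>J. F i y))"
    by (rule loc_add) (use insert in auto)
  then show ?case by (simp only: sum.insert[OF insert(1,2)])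
qed (simp_all add: loc_C)

lemma C_if_loc: "(\<And>x. loc x F) \<Longrightarrow> F \<in> C"
  unfolding loc_def by (rule C_local_mult)

text \<open>Gaussian elimination, division-free so that all coefficients stay smooth.\<close>

lemma linear_system_loc:
  assumes "finite J" "\<And>i j. i \<in> I \<Longrightarrow> j \<in> J \<Longrightarrow> G i j \<in> C" "\<And>i. i \<in> I \<Longrightarrow> c i \<in> C"
    and "\<And>i y. i \<in> I \<Longrightarrow> (\<Sum>j\<in>J. G i j y * a j y) = c i y"
    and "\<And>v. (\<And>i. i \<in> I \<Longrightarrow> (\<Sum>j\<in>J. G i j x * v j) = 0) \<Longrightarrow> (\<forall>j\<in>J. v j = 0)"
    and "j \<in> J"
  shows "loc x (a j)"
  using assms
proof (induction J arbitrary: G c j rule: finite_induct)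
  case (insert j0 J)
  note G = insert.prems(1) and c = insert.prems(2) and eq = insert.prems(3) and inj = insert.prems(4)
  \<comment> \<open>A pivot exists: otherwise the unit vector at \<open>j0\<close> would lie in the
    kernel of the matrix at \<open>x\<close>.\<close>
  obtain i0 where i0: "i0 \<in> I" "G i0 j0 x \<noteq> 0"
  proof (rule ccontr)
    assume "\<not> thesis"
    with that have z: "\<And>i. i \<in> I \<Longrightarrow> G i j0 x = 0" by blast
    have "(\<Sum>j\<in>insert j0 J. G i j x * (if j = j0 then 1 else 0)) = 0" if "i \<in> I" for i
      by (rule sum.neutral) (use z[OF that] in auto)
    from inj[OF this] show False by auto
  qed
  define p where "p = G i0 j0"
  define G' where "G' i j y = p y * G i j y - G i j0 y * G i0 j y" for i j y
  define c' where "c' i y = p y * c i y - G i j0 y * c i0 y" for i y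
  have p: "p \<in> C" "p x \<noteq> 0" using G[OF i0(1)] i0(2) by (auto simp: p_def)
  have eq': "G i j0 y * a j0 y + (\<Sum>j\<in>J. G i j y * a j y) = c i y" if "i \<in> I" for i y
    using eq[OF that, of y] insert.hyps by simp
  have J: "loc x (a j)" if "j \<in> J" for j
  proof (rule insert.IH[of G' c' j])
    show "G' i j \<in> C" if "i \<in> I" "j \<in> J" for i j
    proof -
      have "G i j \<in> C" "G i j0 \<in> C" "G i0 j \<in> C" using G that i0(1) by auto
      then have "(\<lambda>y. p y * G i j y - G i j0 y * G i0 j y) \<in> C"
        by (intro C_diff C_mult p)
      then show ?thesis by (simp add: G'_def[abs_def])
    qed
    show "c' i \<in> C" if "i \<in> I" for i
    proof -
      have "G i j0 \<in> C" "c i \<in> C" "c i0 \<in> C" using G c that i0(1) by auto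
      then have "(\<lambda>y. p y * c i y - G i j0 y * c i0 y) \<in> C"
        by (intro C_diff C_mult p)
      then show ?thesis by (simp add: c'_def[abs_def])
    qed
    show "(\<Sum>j\<in>J. G' i j y * a j y) = c' i y" if "i \<in> I" for i y
    proof -
      have "(\<Sum>j\<in>J. G' i j y * a j y)
          = p y * (\<Sum>j\<in>J. G i j y * a j y) - G i j0 y * (\<Sum>j\<in>J. G i0 j y * a j y)"
        by (simp add: G'_def left_diff_distrib sum_subtractf sum_distrib_left mult.assoc)
      also have "(\<Sum>j\<in>J. G i j y * a j y) = c i y - G i j0 y * a j0 y"
        using eq'[OF that, of y] by simp
      also have "(\<Sum>j\<in>J. G i0 j y * a j y) = c i0 y - p y * a j0 y"
        using eq'[OF i0(1), of y] by (simp add: p_def)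
      finally show ?thesis by (simp add: c'_def algebra_simps)
    qed
    show "\<forall>j\<in>J. v j = 0" if v: "\<And>i. i \<in> I \<Longrightarrow> (\<Sum>j\<in>J. G' i j x * v j) = 0" for v
    proof -
      \<comment> \<open>Back substitution: a kernel vector of the reduced system extends to one of
        the full system, its entry at \<open>j0\<close> being solved from the pivot row.\<close>
      define v' where "v' = v(j0 := - (\<Sum>j\<in>J. G i0 j x * v j) / p x)"
      have "(\<Sum>j\<in>insert j0 J. G i j x * v' j) = 0" if "i \<in> I" for i
      proof -
        have "(\<Sum>j\<in>J. G i j x * v' j) = (\<Sum>j\<in>J. G i j x * v j)"
          by (rule sum.cong) (use insert.hyps in \<open>auto simp: v'_def\<close>)
        then have e: "(\<Sum>j\<in>insert j0 J. G i j x * v' j)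
            = (\<Sum>j\<in>J. G i j x * v j) - G i j0 x * (\<Sum>j\<in>J. G i0 j x * v j) / p x"
          using insert.hyps by (simp add: v'_def)
        have "p x * (\<Sum>j\<in>J. G i j x * v j) - G i j0 x * (\<Sum>j\<in>J. G i0 j x * v j) = 0"
          using v[OF that] by (simp add: G'_def left_diff_distrib sum_subtractf sum_distrib_left mult.assoc)
        then show ?thesis using p(2) unfolding e by (simp add: field_simps)
      qed
      then have z: "\<forall>j\<in>insert j0 J. v' j = 0" by (rule inj)
      show ?thesis
      proof
        fix j assume "j \<in> J"
        then have "v' j = v j" using insert.hyps by (auto simp: v'_def)
        then show "v j = 0" using z \<open>j \<in> J\<close> by simp
      qed
    qed
  qed (rule that)
  show ?case
  proof (cases "j = j0")
    case True
    have "loc x (\<lambda>y. c i0 y + (-1) * (\<Sum>j\<in>J. G i0 j y * a j y))"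
      by (intro loc_add loc_C c[OF i0(1)] loc_Cmult[OF _ C_const] loc_sum loc_Cmult[OF J])
        (use G[OF i0(1)] in auto)
    moreover have "c i0 y + (-1) * (\<Sum>j\<in>J. G i0 j y * a j y) = p y * a j0 y" for y
      using eq'[OF i0(1), of y] by (simp add: p_def)
    ultimately have "loc x (\<lambda>y. p y * a j0 y)" by simp
    from loc_divide[OF this p] show ?thesis using True by simp
  next
    case False
    then show ?thesis using J insert.prems(5) by simp
  qed
qed simp

end

lemma scaleR_tvec_apply: "(c *\<^sub>R (v :: 'a tvec)) f = c * v f"
  by (simp add: scaleR_fun_def)

lemma linear_map_on_sum:
  assumes "subspace V" "linear_map_on V f" "\<And>i. i \<in> I \<Longrightarrow> w i \<in> V"
  shows "f (\<Sum>i\<in>I. c i *\<^sub>R w i) = (\<Sum>i\<in>I. c i *\<^sub>R f (w i))"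
  using assms(3)
proof (induction I rule: infinite_finite_induct)
  case (insert i I)
  have "(\<Sum>i\<in>I. c i *\<^sub>R w i) \<in> V"
    using insert by (intro subspace_sum subspace_scale assms(1)) auto
  then show ?case
    using insert linear_map_on_add[OF assms(2), of "c i *\<^sub>R w i" "\<Sum>i\<in>I. c i *\<^sub>R w i"]
      subspace_scale[OF assms(1)] linear_map_on_scaleR[OF assms(2)] by simp
qed (simp_all add: linear_map_on_zero[OF assms(2) subspace_0[OF assms(1)]])

lemma (in smooth_manifold) subspace_TS: "subspace (TS x)"
  by (rule subspaceI) (rule TS_zero TS_plus TS_scaleR; assumption)+

section \<open>Pseudo-Riemannian metrics and the Levi-Civita connection\<close>

locale pseudo_riemannian = smooth_manifold \<A>
  for \<A> :: "('a::t2_space, 'e::euclidean_space) atlas" +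
  fixes g :: "'a \<Rightarrow> 'a tvec \<Rightarrow> 'a tvec \<Rightarrow> real" and p q :: nat
  assumes metric: "pseudo_metric \<A> (tangent_algebroid \<A>) g"
    and signature: "has_signature (tangent_algebroid \<A>) g p q"
begin

lemma g_linear: "v \<in> TS x \<Longrightarrow> linear_map_on (TS x) (g x v)"
  using metric by (simp add: pseudo_metric_def tangent_algebroid_def)

lemma g_sym: "v \<in> TS x \<Longrightarrow> w \<in> TS x \<Longrightarrow> g x v w = g x w v"
  using metric by (simp add: pseudo_metric_def tangent_algebroid_def)

lemma g_nondegenerate: "v \<in> TS x \<Longrightarrow> (\<And>w. w \<in> TS x \<Longrightarrow> g x v w = 0) \<Longrightarrow> v = 0"
  using metric by (simp add: pseudo_metric_def tangent_algebroid_def)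

lemma g_C: "X \<in> VF \<Longrightarrow> Y \<in> VF \<Longrightarrow> (\<lambda>x. g x (X x) (Y x)) \<in> C"
  using metric by (simp add: pseudo_metric_def tangent_algebroid_def)

lemma g_right:
  assumes "v \<in> TS x" "w \<in> TS x"
  shows g_add_right: "w' \<in> TS x \<Longrightarrow> g x v (w + w') = g x v w + g x v w'"
    and g_diff_right: "w' \<in> TS x \<Longrightarrow> g x v (w - w') = g x v w - g x v w'"
    and g_scaleR_right: "g x v (c *\<^sub>R w) = c * g x v w"
    and g_minus_right: "g x v (- w) = - g x v w"
    and g_zero_right: "g x v 0 = 0"
  using linear_map_on_add[OF g_linear[OF assms(1)] assms(2)] linear_map_on_diff[OF g_linear[OF assms(1)] assms(2)]
    linear_map_on_minus[OF g_linear[OF assms(1)] assms(2)] linear_map_on_zero[OF g_linear[OF assms(1)] assms(2)]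
    linear_map_on_scaleR[OF g_linear[OF assms(1)] assms(2), of c] by simp_all

lemma g_left:
  assumes v: "v \<in> TS x" and w: "w \<in> TS x"
  shows g_add_left: "v' \<in> TS x \<Longrightarrow> g x (v + v') w = g x v w + g x v' w"
    and g_diff_left: "v' \<in> TS x \<Longrightarrow> g x (v - v') w = g x v w - g x v' w"
    and g_scaleR_left: "g x (c *\<^sub>R v) w = c * g x v w"
    and g_minus_left: "g x (- v) w = - g x v w"
    and g_zero_left: "g x 0 w = 0"
  using g_right[OF w v] g_sym[OF w v] g_sym[OF w] g_sym[OF w TS_scaleR[OF v, of c]] TS_plus[OF v] TS_diff_closed[OF v] TS_scaleR[OF v, of c]
    TS_uminus[OF v] TS_zero by simp_all

lemma g_eqI:
  assumes v: "v \<in> TS x" "w \<in> TS x" and eq: "\<And>Z. Z \<in> VF \<Longrightarrow> g x v (Z x) = g x w (Z x)"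
  shows "v = w"
proof -
  have "v - w = 0"
  proof (rule g_nondegenerate[OF TS_diff_closed[OF v]])
    fix u assume u: "u \<in> TS x"
    obtain Z where "Z \<in> VF" "Z x = u" by (rule vector_field_through[OF u])
    then show "g x (v - w) u = 0" using eq[of Z] g_diff_left[OF v(1) u v(2)] by simp
  qed
  then show ?thesis by simp
qed

definition sharp :: "'a \<Rightarrow> ('a tvec \<Rightarrow> real) \<Rightarrow> 'a tvec" where
  "sharp x \<alpha> = (THE a. a \<in> TS x \<and> (\<forall>w\<in>TS x. g x a w = \<alpha> w))"

lemma sharp_unique:
  assumes "a \<in> TS x" "\<And>w. w \<in> TS x \<Longrightarrow> g x a w = \<alpha> w"
  shows "sharp x \<alpha> = a"
  unfolding sharp_def
proof (rule the_equality)
  fix b assume b: "b \<in> TS x \<and> (\<forall>w\<in>TS x. g x b w = \<alpha> w)"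
  show "b = a" by (rule g_eqI) (use b assms VF_TS in auto)
qed (use assms in auto)

text \<open>Nondegeneracy makes the map from vectors to covectors injective; that it is onto comes
  from the finite pseudo-orthonormal basis. The numbers \<open>g x (e i) (e i)\<close> are signs,
  hence their own inverses, which explains the coefficients of \<open>a\<close>.\<close>

lemma sharp:
  assumes \<alpha>: "linear_map_on (TS x) \<alpha>"
  shows sharp_TS: "sharp x \<alpha> \<in> TS x" and g_sharp: "w \<in> TS x \<Longrightarrow> g x (sharp x \<alpha>) w = \<alpha> w"
proof -
  have "\<exists>e :: nat \<Rightarrow> 'a tvec. (\<forall>i<p + q. e i \<in> TS x) \<and> span (e ` {..<p + q}) = TS x \<and>
     (\<forall>i<p + q. \<forall>j<p + q. g x (e i) (e j) = (if i \<noteq> j then 0 else if i < p then 1 else - 1))"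
    using signature unfolding has_signature_def tangent_algebroid_def by simp
  then obtain e :: "nat \<Rightarrow> 'a tvec" where e: "\<And>i. i < p + q \<Longrightarrow> e i \<in> TS x"
    and span: "span (e ` {..<p + q}) = TS x"
    and on: "\<And>i j. i < p + q \<Longrightarrow> j < p + q \<Longrightarrow>
      g x (e i) (e j) = (if i \<noteq> j then 0 else if i < p then 1 else - 1)"
    by blast
  define a where "a = (\<Sum>i<p + q. (g x (e i) (e i) * \<alpha> (e i)) *\<^sub>R e i)"
  have a: "a \<in> TS x" unfolding a_def by (rule TS_sum_closed, rule TS_scaleR, rule e) simp
  have ae: "g x a (e j) = \<alpha> (e j)" if j: "j < p + q" for j
  proof -
    have "g x (e j) a = (\<Sum>i<p + q. (g x (e i) (e i) * \<alpha> (e i)) *\<^sub>R g x (e j) (e i))"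
      unfolding a_def by (rule linear_map_on_sum[OF subspace_TS g_linear[OF e[OF j]] e]) simp
    then have "g x a (e j) = (\<Sum>i<p + q. g x (e i) (e i) * \<alpha> (e i) * g x (e j) (e i))"
      using g_sym[OF a e[OF j]] by simp
    also have "\<dots> = (\<Sum>i<p + q. if i = j then \<alpha> (e j) else 0)"
      by (rule sum.cong) (use on j in auto)
    also have "\<dots> = \<alpha> (e j)" using j by simp
    finally show ?thesis .
  qed
  have aw: "g x a w = \<alpha> w" if w: "w \<in> TS x" for w
  proof -
    have "w \<in> span (e ` {..<p + q})" using w span by simp
    then have "w \<in> TS x \<and> g x a w = \<alpha> w"
    proof (induction rule: span_induct_alt)
      case base
      show ?case using TS_zero linear_map_on_zero[OF \<alpha> TS_zero] linear_map_on_zero[OF g_linear[OF a] TS_zero] by metis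
    next
      case (step c v w)
      then have v: "v \<in> TS x" "g x a v = \<alpha> v" using e ae by auto
      from step have w: "w \<in> TS x" "g x a w = \<alpha> w" by auto
      have "c *\<^sub>R v + w \<in> TS x \<and> g x a (c *\<^sub>R v + w) = \<alpha> (c *\<^sub>R v + w)"
        using TS_plus[OF TS_scaleR[OF v(1), of c] w(1)] v w
          linear_map_on_add[OF \<alpha> TS_scaleR[OF v(1), of c] w(1)] linear_map_on_scaleR[OF \<alpha> v(1), of c]
          g_add_right[OF a TS_scaleR[OF v(1), of c] w(1)] g_scaleR_right[OF a v(1), of c]
        by simp
      then show ?case by blast
    qed
    then show ?thesis by simp
  qed
  have "sharp x \<alpha> = a" by (rule sharp_unique[OF a aw])
  then show "sharp x \<alpha> \<in> TS x" "w \<in> TS x \<Longrightarrow> g x (sharp x \<alpha>) w = \<alpha> w"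
    using a aw by simp_all
qed

text \<open>The components \<open>?a y (u j)\<close> solve a linear system whose matrix is the Gram
  matrix of the frame and whose right-hand side is \<open>\<kappa> y * \<alpha> y (E i y)\<close>.
  The frame degenerates away from \<open>x\<close>, so invertibility is established at
  \<open>x\<close> alone, as \<open>linear_system_loc\<close> asks; the factor \<kappa> is divided
  out in the end.\<close>

lemma sharp_VF:
  assumes \<alpha>: "\<And>x. linear_map_on (TS x) (\<alpha> x)" and sm: "\<And>X. X \<in> VF \<Longrightarrow> (\<lambda>x. \<alpha> x (X x)) \<in> C"
  shows "(\<lambda>x. sharp x (\<alpha> x)) \<in> VF"
proof (rule VFI[OF sharp_TS[OF \<alpha>]], rule C_if_loc)
  fix f x assume f: "f \<in> C"
  let ?a = "\<lambda>x. sharp x (\<alpha> x)"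
  obtain \<kappa> u E where fr: "local_frame x \<kappa> u E"
    using local_frame_exists by blast
  then have \<kappa>: "\<kappa> \<in> C" "\<kappa> x = 1" and u: "\<And>i. i \<in> (Basis::'e set) \<Longrightarrow> u i \<in> C"
    and E: "\<And>i. i \<in> Basis \<Longrightarrow> E i \<in> VF"
    and dual: "\<And>i j. i \<in> Basis \<Longrightarrow> j \<in> Basis \<Longrightarrow> E i x (u j) = (if i = j then 1 else 0)"
    and frame: "\<And>y v. v \<in> TS y \<Longrightarrow> \<kappa> y *\<^sub>R v = (\<Sum>i\<in>Basis. v (u i) *\<^sub>R E i y)"
    by (simp_all add: local_frame_def)
  have gsum: "g y w (\<Sum>i\<in>Basis. c i *\<^sub>R E i y) = (\<Sum>i\<in>Basis. g y (E i y) w * c i)"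
    if w: "w \<in> TS y" for y w and c :: "'e \<Rightarrow> real"
  proof -
    have "g y w (\<Sum>i\<in>Basis. c i *\<^sub>R E i y) = (\<Sum>i\<in>Basis. c i *\<^sub>R g y w (E i y))"
      by (rule linear_map_on_sum[OF subspace_TS g_linear[OF w] VF_TS[OF E]])
    also have "\<dots> = (\<Sum>i\<in>Basis. g y (E i y) w * c i)"
      by (rule sum.cong) (use g_sym[OF w VF_TS[OF E]] in simp_all)
    finally show ?thesis .
  qed
  have "loc x (\<lambda>y. ?a y (u j))" if j: "j \<in> Basis" for j
  proof (rule linear_system_loc[where I = Basis and J = Basis
        and G = "\<lambda>i j y. g y (E j y) (E i y)" and a = "\<lambda>j y. ?a y (u j)"
        and c = "\<lambda>i y. \<kappa> y * \<alpha> y (E i y)"])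
    fix i :: 'e assume i: "i \<in> Basis"
    show "(\<lambda>y. \<kappa> y * \<alpha> y (E i y)) \<in> C" by (rule C_mult[OF \<kappa>(1) sm[OF E[OF i]]])
    show "(\<lambda>y. g y (E j y) (E i y)) \<in> C" if "j \<in> Basis" for j
      by (rule g_C[OF E[OF that] E[OF i]])
    fix y
    have a: "?a y \<in> TS y" by (rule sharp_TS[OF \<alpha>])
    have Ei: "E i y \<in> TS y" by (rule VF_TS[OF E[OF i]])
    have "(\<Sum>j\<in>Basis. g y (E j y) (E i y) * ?a y (u j)) = g y (E i y) (\<kappa> y *\<^sub>R ?a y)"
      unfolding frame[OF a] gsum[OF Ei] by simp
    also have "\<dots> = \<kappa> y * \<alpha> y (E i y)"
      using g_scaleR_right[OF Ei a] g_sym[OF Ei a] g_sharp[OF \<alpha> Ei] by simp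
    finally show "(\<Sum>j\<in>Basis. g y (E j y) (E i y) * ?a y (u j)) = \<kappa> y * \<alpha> y (E i y)" .
  next
    fix v :: "'e \<Rightarrow> real"
    assume v: "\<And>i. i \<in> Basis \<Longrightarrow> (\<Sum>j\<in>Basis. g x (E j x) (E i x) * v j) = 0"
    define w where "w = (\<Sum>j\<in>Basis. v j *\<^sub>R E j x)"
    have w: "w \<in> TS x" unfolding w_def by (rule TS_sum_closed, rule TS_scaleR, rule VF_TS, rule E)
    have "w = 0"
    proof (rule g_nondegenerate[OF w])
      fix z assume z: "z \<in> TS x"
      have Ei: "g x (E i x) w = 0" if "i \<in> Basis" for i
        unfolding w_def gsum[OF VF_TS[OF E[OF that]]] by (rule v[OF that])
      have "g x w z = g x w (\<Sum>i\<in>Basis. z (u i) *\<^sub>R E i x)"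
        using frame[OF z] \<kappa>(2) by simp
      also have "\<dots> = 0" unfolding gsum[OF w] using Ei by simp
      finally show "g x w z = 0" .
    qed
    show "\<forall>j\<in>Basis. v j = 0"
    proof
      fix j :: 'e assume j: "j \<in> Basis"
      have "w (u j) = (\<Sum>i\<in>Basis. v i * (if i = j then 1 else 0))"
        unfolding w_def by (simp add: sum_fun_apply scaleR_fun_def dual j)
      also have "\<dots> = (\<Sum>i\<in>Basis. if i = j then v i else 0)"
        by (rule sum.cong) auto
      also have "\<dots> = v j" using j by simp
      finally have "w (u j) = v j" .
      then show "v j = 0" using \<open>w = 0\<close> j by simp
    qed
  qed (use j in simp_all)
  then have "loc x (\<lambda>y. \<Sum>i\<in>Basis. E i y f * ?a y (u i))"
    by (intro loc_sum loc_Cmult) (use VF_C[OF E f] in auto)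
  moreover have "(\<Sum>i\<in>Basis. E i y f * ?a y (u i)) = \<kappa> y * ?a y f" for y
    using fun_cong[OF frame[OF sharp_TS[OF \<alpha>, of y]], of f]
    by (simp add: sum_fun_apply scaleR_fun_def mult.commute)
  ultimately have "loc x (\<lambda>y. \<kappa> y * ?a y f)" by simp
  then show "loc x (\<lambda>y. ?a y f)"
    by (rule loc_divide[OF _ \<kappa>(1)]) (simp add: \<kappa>(2))
qed

definition koszul :: "('a \<Rightarrow> 'a tvec) \<Rightarrow> ('a \<Rightarrow> 'a tvec) \<Rightarrow> ('a \<Rightarrow> 'a tvec) \<Rightarrow> 'a \<Rightarrow> real" where
  "koszul X Y Z x = (X x (\<lambda>y. g y (Y y) (Z y)) + Y x (\<lambda>y. g y (Z y) (X y)) - Z x (\<lambda>y. g y (X y) (Y y))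
     + g x (lie_bracket X Y x) (Z x) - g x (lie_bracket Y Z x) (X x) + g x (lie_bracket Z X x) (Y x)) / 2"

lemma koszul_C:
  assumes "X \<in> VF" "Y \<in> VF" "Z \<in> VF"
  shows "koszul X Y Z \<in> C"
proof -
  have "(\<lambda>x. (1 / 2) * (X x (\<lambda>y. g y (Y y) (Z y)) + Y x (\<lambda>y. g y (Z y) (X y)) - Z x (\<lambda>y. g y (X y) (Y y))
     + g x (lie_bracket X Y x) (Z x) - g x (lie_bracket Y Z x) (X x) + g x (lie_bracket Z X x) (Y x))) \<in> C"
    by (intro C_cmult C_add C_diff VF_C[OF assms(1)] VF_C[OF assms(2)] VF_C[OF assms(3)]
        g_C assms lie_bracket_VF)
  then show ?thesis by (simp add: koszul_def[abs_def])
qed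

lemma g_add_fields:
  assumes "X \<in> VF" "Y \<in> VF" "Z \<in> VF"
  shows "g x (X x + Y x) (Z x) = g x (X x) (Z x) + g x (Y x) (Z x)"
    and "g x (Z x) (X x + Y x) = g x (Z x) (X x) + g x (Z x) (Y x)"
  using g_add_left g_add_right VF_TS assms by auto

lemma g_diff_fields:
  assumes "X \<in> VF" "Y \<in> VF" "Z \<in> VF"
  shows "g x (X x - Y x) (Z x) = g x (X x) (Z x) - g x (Y x) (Z x)"
    and "g x (Z x) (X x - Y x) = g x (Z x) (X x) - g x (Z x) (Y x)"
  using g_diff_left g_diff_right VF_TS assms by auto

lemma g_scaleR_fields:
  assumes "X \<in> VF" "Z \<in> VF"
  shows "g x (c *\<^sub>R X x) (Z x) = c * g x (X x) (Z x)"
    and "g x (Z x) (c *\<^sub>R X x) = c * g x (Z x) (X x)"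
  using g_scaleR_left g_scaleR_right VF_TS assms by auto

text \<open>The terms in which \<open>f\<close> is differentiated cancel by symmetry of
  \<open>g\<close>. Hence the expression is a 1-form in \<open>Z\<close>, and \<open>sharp\<close>
  turns it into the covariant derivative of \<open>Y\<close> along \<open>X\<close>.\<close>

lemma koszul_tensor:
  assumes X: "X \<in> VF" and Y: "Y \<in> VF"
  shows "tensor_at x (\<lambda>Z. koszul X Y Z x)"
proof (rule tensor_atI)
  fix V W assume V: "V \<in> VF" and W: "W \<in> VF"
  note br = lie_bracket_VF[OF X V] lie_bracket_VF[OF X W] lie_bracket_VF[OF Y V] lie_bracket_VF[OF Y W]
    lie_bracket_VF[OF V X] lie_bracket_VF[OF W X] lie_bracket_VF[OF X Y]
  show "koszul X Y (\<lambda>y. V y + W y) x = koszul X Y V x + koszul X Y W x"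
    unfolding koszul_def
    by (simp add: lie_bracket_add_right[OF Y V W] lie_bracket_add_left[OF V W X]
        g_add_fields V W X Y br VFD[OF X] VFD[OF Y] g_C add_divide_distrib[symmetric])
next
  fix f V assume f: "f \<in> C" and V: "V \<in> VF"
  note br = lie_bracket_VF[OF X V] lie_bracket_VF[OF Y V] lie_bracket_VF[OF V X] lie_bracket_VF[OF X Y]
  have r1: "g x (f x *\<^sub>R lie_bracket Y V x + Y x f *\<^sub>R V x) (X x)
      = f x * g x (lie_bracket Y V x) (X x) + Y x f * g x (V x) (X x)"
    using g_add_left[OF TS_scaleR[OF VF_TS[OF br(2)]] VF_TS[OF X] TS_scaleR[OF VF_TS[OF V]]]
      g_scaleR_fields br V X by simp
  have r2: "g x (f x *\<^sub>R lie_bracket V X x - X x f *\<^sub>R V x) (Y x)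
      = f x * g x (lie_bracket V X x) (Y x) - X x f * g x (V x) (Y x)"
    using g_diff_left[OF TS_scaleR[OF VF_TS[OF br(3)]] VF_TS[OF Y] TS_scaleR[OF VF_TS[OF V]]]
      g_scaleR_fields br V Y by simp
  show "koszul X Y (\<lambda>y. f y *\<^sub>R V y) x = f x *\<^sub>R koszul X Y V x"
    unfolding koszul_def lie_bracket_fmult_right[OF Y V f] lie_bracket_fmult_left[OF V X f] r1 r2
    using g_sym[OF VF_TS[OF V, of x] VF_TS[OF Y, of x]] g_sym[OF VF_TS[OF V, of x] VF_TS[OF X, of x]]
    by (simp add: g_scaleR_fields V X Y br VFD[OF X] VFD[OF Y] g_C f scaleR_tvec_apply algebra_simps)
qed

text \<open>Identities between fields are verified after pairing with an arbitrary \<open>Z\<close>,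
  where they become identities between Koszul expressions.\<close>

lemma levi_civita_exists: "\<exists>D. levi_civita \<A> (tangent_algebroid \<A>) g D"
proof -
  \<comment> \<open>Reading the 1-form as a function of a single vector requires an extension of
    that vector to a field; by tensoriality the choice does not matter.\<close>
  define K where "K X Y x v = koszul X Y (extend (tangent_algebroid \<A>) x v) x" for X Y x v
  define D where "D X Y x = sharp x (K X Y x)" for X Y x
  have K: "K X Y x (Z x) = koszul X Y Z x" if "X \<in> VF" "Y \<in> VF" "Z \<in> VF" for X Y Z x
    unfolding K_def
    using tensor_at_cong[OF koszul_tensor[OF that(1,2)] _ that(3)] extend_tangent[OF VF_TS[OF that(3), of x]]
    by blast
  have K_lin: "linear_map_on (TS x) (K X Y x)" if XY: "X \<in> VF" "Y \<in> VF" for X Y x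
  proof (rule linear_map_onI)
    fix v assume v: "v \<in> TS x"
    obtain V where V: "V \<in> VF" "V x = v" by (rule vector_field_through[OF v])
    show "K X Y x (c *\<^sub>R v) = c *\<^sub>R K X Y x v" for c
      using K[OF XY VF_scaleR[OF V(1), of c], of x] K[OF XY V(1), of x] V(2)
        tensor_at_fmult[OF koszul_tensor[OF XY] C_const[of c] V(1), of x] by simp
    fix w assume w: "w \<in> TS x"
    obtain W where W: "W \<in> VF" "W x = w" by (rule vector_field_through[OF w])
    show "K X Y x (v + w) = K X Y x v + K X Y x w"
      using K[OF XY VF_add[OF V(1) W(1)], of x] K[OF XY V(1), of x] K[OF XY W(1), of x] V(2) W(2)
        tensor_at_add[OF koszul_tensor[OF XY] V(1) W(1), of x] by simp
  qed (rule TS_scaleR)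
  have D_VF: "D X Y \<in> VF" if XY: "X \<in> VF" "Y \<in> VF" for X Y
  proof -
    have "(\<lambda>x. K X Y x (Z x)) \<in> C" if "Z \<in> VF" for Z
      using koszul_C[OF XY that] K[OF XY that] by simp
    then show ?thesis
      using sharp_VF[OF K_lin[OF XY]] by (simp add: D_def[abs_def])
  qed
  have gD: "g x (D X Y x) (Z x) = koszul X Y Z x" if XYZ: "X \<in> VF" "Y \<in> VF" "Z \<in> VF" for X Y Z x
    using g_sharp[OF K_lin[OF XYZ(1,2)] VF_TS[OF XYZ(3)]] K[OF XYZ] by (simp add: D_def)
  have add_left: "D (\<lambda>y. X y + X' y) Y x = D X Y x + D X' Y x"
    if X: "X \<in> VF" "X' \<in> VF" and Y: "Y \<in> VF" for X X' Y x
  proof (rule g_eqI[OF VF_TS[OF D_VF[OF VF_add[OF X] Y]] TS_plus[OF VF_TS[OF D_VF[OF X(1) Y]] VF_TS[OF D_VF[OF X(2) Y]]]])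
    fix Z assume Z: "Z \<in> VF"
    note br = lie_bracket_VF[OF X(1) Y] lie_bracket_VF[OF X(2) Y] lie_bracket_VF[OF Y Z]
      lie_bracket_VF[OF Z X(1)] lie_bracket_VF[OF Z X(2)]
    show "g x (D (\<lambda>y. X y + X' y) Y x) (Z x) = g x (D X Y x + D X' Y x) (Z x)"
      unfolding g_add_fields(1)[OF D_VF[OF X(1) Y] D_VF[OF X(2) Y] Z]
        gD[OF VF_add[OF X] Y Z] gD[OF X(1) Y Z] gD[OF X(2) Y Z] koszul_def
      by (simp add: lie_bracket_add_right[OF Z X] lie_bracket_add_left[OF X Y]
          g_add_fields X Y Z br VFD[OF Y] VFD[OF Z] g_C add_divide_distrib[symmetric])
  qed
  have fmult_left: "D (\<lambda>y. f y *\<^sub>R X y) Y x = f x *\<^sub>R D X Y x"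
    if f: "f \<in> C" and X: "X \<in> VF" and Y: "Y \<in> VF" for f X Y x
  proof (rule g_eqI[OF VF_TS[OF D_VF[OF VF_fmult[OF f X] Y]] TS_scaleR[OF VF_TS[OF D_VF[OF X Y]]]])
    fix Z assume Z: "Z \<in> VF"
    note br = lie_bracket_VF[OF X Y] lie_bracket_VF[OF Z X] lie_bracket_VF[OF Y Z]
    have r1: "g x (f x *\<^sub>R lie_bracket X Y x - Y x f *\<^sub>R X x) (Z x)
        = f x * g x (lie_bracket X Y x) (Z x) - Y x f * g x (X x) (Z x)"
      using g_diff_left[OF TS_scaleR[OF VF_TS[OF br(1)]] VF_TS[OF Z] TS_scaleR[OF VF_TS[OF X]]]
        g_scaleR_fields br Z X by simp
    have r2: "g x (f x *\<^sub>R lie_bracket Z X x + Z x f *\<^sub>R X x) (Y x)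
        = f x * g x (lie_bracket Z X x) (Y x) + Z x f * g x (X x) (Y x)"
      using g_add_left[OF TS_scaleR[OF VF_TS[OF br(2)]] VF_TS[OF Y] TS_scaleR[OF VF_TS[OF X]]]
        g_scaleR_fields br X Y by simp
    show "g x (D (\<lambda>y. f y *\<^sub>R X y) Y x) (Z x) = g x (f x *\<^sub>R D X Y x) (Z x)"
      unfolding g_scaleR_fields(1)[OF D_VF[OF X Y] Z]
        gD[OF VF_fmult[OF f X] Y Z] gD[OF X Y Z] koszul_def
        lie_bracket_fmult_right[OF Z X f] lie_bracket_fmult_left[OF X Y f] r1 r2
      using g_sym[OF VF_TS[OF X, of x] VF_TS[OF Z, of x]]
      by (simp add: g_scaleR_fields X Y Z br VFD[OF Y] VFD[OF Z] g_C f scaleR_tvec_apply algebra_simps)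
  qed
  have add_right: "D X (\<lambda>y. Y y + Y' y) x = D X Y x + D X Y' x"
    if X: "X \<in> VF" and Y: "Y \<in> VF" "Y' \<in> VF" for X Y Y' x
  proof (rule g_eqI[OF VF_TS[OF D_VF[OF X VF_add[OF Y]]] TS_plus[OF VF_TS[OF D_VF[OF X Y(1)]] VF_TS[OF D_VF[OF X Y(2)]]]])
    fix Z assume Z: "Z \<in> VF"
    note br = lie_bracket_VF[OF X Y(1)] lie_bracket_VF[OF X Y(2)] lie_bracket_VF[OF Z X]
      lie_bracket_VF[OF Y(1) Z] lie_bracket_VF[OF Y(2) Z]
    show "g x (D X (\<lambda>y. Y y + Y' y) x) (Z x) = g x (D X Y x + D X Y' x) (Z x)"
      unfolding g_add_fields(1)[OF D_VF[OF X Y(1)] D_VF[OF X Y(2)] Z]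
        gD[OF X VF_add[OF Y] Z] gD[OF X Y(1) Z] gD[OF X Y(2) Z] koszul_def
      by (simp add: lie_bracket_add_right[OF X Y] lie_bracket_add_left[OF Y Z]
          g_add_fields X Y Z br VFD[OF X] VFD[OF Z] g_C add_divide_distrib[symmetric])
  qed
  have fmult_right: "D X (\<lambda>y. f y *\<^sub>R Y y) x = f x *\<^sub>R D X Y x + X x f *\<^sub>R Y x"
    if f: "f \<in> C" and X: "X \<in> VF" and Y: "Y \<in> VF" for f X Y x
  proof (rule g_eqI[OF VF_TS[OF D_VF[OF X VF_fmult[OF f Y]]] TS_plus[OF TS_scaleR[OF VF_TS[OF D_VF[OF X Y]]]
          TS_scaleR[OF VF_TS[OF Y]]]])
    fix Z assume Z: "Z \<in> VF"
    note br = lie_bracket_VF[OF X Y] lie_bracket_VF[OF Z X] lie_bracket_VF[OF Y Z]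
    have r1: "g x (f x *\<^sub>R lie_bracket X Y x + X x f *\<^sub>R Y x) (Z x)
        = f x * g x (lie_bracket X Y x) (Z x) + X x f * g x (Y x) (Z x)"
      using g_add_left[OF TS_scaleR[OF VF_TS[OF br(1)]] VF_TS[OF Z] TS_scaleR[OF VF_TS[OF Y]]]
        g_scaleR_fields br Z Y by simp
    have r2: "g x (f x *\<^sub>R lie_bracket Y Z x - Z x f *\<^sub>R Y x) (X x)
        = f x * g x (lie_bracket Y Z x) (X x) - Z x f * g x (Y x) (X x)"
      using g_diff_left[OF TS_scaleR[OF VF_TS[OF br(3)]] VF_TS[OF X] TS_scaleR[OF VF_TS[OF Y]]]
        g_scaleR_fields br X Y by simp
    have r3: "g x (f x *\<^sub>R D X Y x + X x f *\<^sub>R Y x) (Z x)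
        = f x * g x (D X Y x) (Z x) + X x f * g x (Y x) (Z x)"
      using g_add_left[OF TS_scaleR[OF VF_TS[OF D_VF[OF X Y]]] VF_TS[OF Z] TS_scaleR[OF VF_TS[OF Y]]]
        g_scaleR_fields D_VF[OF X Y] Z Y by simp
    show "g x (D X (\<lambda>y. f y *\<^sub>R Y y) x) (Z x) = g x (f x *\<^sub>R D X Y x + X x f *\<^sub>R Y x) (Z x)"
      unfolding r3 gD[OF X VF_fmult[OF f Y] Z] gD[OF X Y Z] koszul_def
        lie_bracket_fmult_right[OF X Y f] lie_bracket_fmult_left[OF Y Z f] r1 r2
      using g_sym[OF VF_TS[OF X, of x] VF_TS[OF Y, of x]]
      by (simp add: g_scaleR_fields X Y Z br VFD[OF X] VFD[OF Z] g_C f scaleR_tvec_apply field_simps)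
  qed
  have torsion: "D X Y x - D Y X x = lie_bracket X Y x" if X: "X \<in> VF" and Y: "Y \<in> VF" for X Y x
  proof (rule g_eqI[OF TS_diff_closed[OF VF_TS[OF D_VF[OF X Y]] VF_TS[OF D_VF[OF Y X]]] VF_TS[OF lie_bracket_VF[OF X Y]]])
    fix Z assume Z: "Z \<in> VF"
    have sk: "g x (lie_bracket V W x) u = - g x (lie_bracket W V x) u" if "V \<in> VF" "W \<in> VF" "u \<in> TS x" for V W u
      using g_minus_left[OF VF_TS[OF lie_bracket_VF[OF that(2,1)]] that(3)] lie_bracket_skew[of V W x] by simp
    have sy: "(\<lambda>y. g y (V y) (W y)) = (\<lambda>y. g y (W y) (V y))" if "V \<in> VF" "W \<in> VF" for V W
      using g_sym VF_TS that by blast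
    show "g x (D X Y x - D Y X x) (Z x) = g x (lie_bracket X Y x) (Z x)"
      unfolding g_diff_fields(1)[OF D_VF[OF X Y] D_VF[OF Y X] Z] gD[OF X Y Z] gD[OF Y X Z] koszul_def
      using sk[OF X Y VF_TS[OF Z]] sk[OF Y Z VF_TS[OF X]] sk[OF Z X VF_TS[OF Y]]
        sy[OF X Y] sy[OF Y Z] sy[OF Z X] by (simp add: field_simps)
  qed
  have metric: "X x (\<lambda>y. g y (Y y) (Z y)) = g x (D X Y x) (Z x) + g x (Y x) (D X Z x)"
    if X: "X \<in> VF" and Y: "Y \<in> VF" and Z: "Z \<in> VF" for X Y Z x
  proof -
    have sk: "g x (lie_bracket V W x) u = - g x (lie_bracket W V x) u" if "V \<in> VF" "W \<in> VF" "u \<in> TS x" for V W u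
      using g_minus_left[OF VF_TS[OF lie_bracket_VF[OF that(2,1)]] that(3)] lie_bracket_skew[of V W x] by simp
    have sy: "(\<lambda>y. g y (V y) (W y)) = (\<lambda>y. g y (W y) (V y))" if "V \<in> VF" "W \<in> VF" for V W
      using g_sym VF_TS that by blast
    show ?thesis
      unfolding g_sym[OF VF_TS[OF Y] VF_TS[OF D_VF[OF X Z]]] gD[OF X Y Z] gD[OF X Z Y] koszul_def
      using sk[OF X Y VF_TS[OF Z]] sk[OF Y Z VF_TS[OF X]] sk[OF Z X VF_TS[OF Y]]
        sy[OF X Y] sy[OF Y Z] sy[OF Z X] by (simp add: field_simps)
  qed
  have scale: "a *\<^sub>R X = (\<lambda>y. a *\<^sub>R X y)" "X + Y = (\<lambda>y. X y + Y y)" for a and X Y :: "'a \<Rightarrow> 'a tvec"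
    by (simp_all add: scaleR_fun_def plus_fun_def)
  have "linear_map_on VF (D X)" if X: "X \<in> VF" for X
  proof (rule linear_map_onI, unfold scale)
    show "D X (\<lambda>y. u y + v y) = (\<lambda>y. D X u y + D X v y)" if "u \<in> VF" "v \<in> VF" for u v
      by (rule ext, rule add_right[OF X that])
    show "D X (\<lambda>y. c *\<^sub>R u y) = (\<lambda>y. c *\<^sub>R D X u y)" if "u \<in> VF" for u c
      using fmult_right[OF C_const X that] VFD_const[OF X] by (intro ext) simp
  qed (rule VF_scaleR)
  moreover have "linear_map_on VF (\<lambda>X. D X Y)" if Y: "Y \<in> VF" for Y
  proof (rule linear_map_onI, unfold scale)
    show "D (\<lambda>y. u y + v y) Y = (\<lambda>y. D u Y y + D v Y y)" if "u \<in> VF" "v \<in> VF" for u v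
      by (rule ext, rule add_left[OF that Y])
    show "D (\<lambda>y. c *\<^sub>R u y) Y = (\<lambda>y. c *\<^sub>R D u Y y)" if "u \<in> VF" for u c
      by (rule ext, rule fmult_left[OF C_const that Y])
  qed (rule VF_scaleR)
  moreover have fl: "D (\<lambda>y. f y *\<^sub>R X y) Y = (\<lambda>x. f x *\<^sub>R D X Y x)"
    if "f \<in> C" "X \<in> VF" "Y \<in> VF" for f X Y
    by (rule ext, rule fmult_left[OF that])
  moreover have fr: "D X (\<lambda>y. f y *\<^sub>R Y y) = (\<lambda>x. f x *\<^sub>R D X Y x + X x f *\<^sub>R Y x)"
    if "f \<in> C" "X \<in> VF" "Y \<in> VF" for f X Y
    by (rule ext, rule fmult_right[OF that])
  ultimately have "levi_civita \<A> (tangent_algebroid \<A>) g D"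
    unfolding levi_civita_def tangent_algebroid_def
    using D_VF fl fr torsion metric by simp
  then show ?thesis by blast
qed

end

section \<open>The product with the real line\<close>

context smooth_manifold
begin

lemma local_coordinates:
  assumes U: "(U, \<psi>) \<in> \<A>" "x \<in> U"
  shows "\<exists>u N. (\<forall>i\<in>(Basis::'e set). u i \<in> C) \<and> open N \<and> x \<in> N \<and> N \<subseteq> U \<and>
    (\<forall>y\<in>N. \<forall>i\<in>Basis. u i y = \<psi> y \<bullet> i)"
proof -
  obtain r where r: "r > 0" "cball (\<psi> x) r \<subseteq> \<psi> ` (U \<inter> UNIV)"
    by (rule chart_ball[OF U open_UNIV UNIV_I])
  obtain b where b: "smooth_on UNIV b" "\<And>z. dist (\<psi> x) z \<le> r / 2 \<Longrightarrow> b z = 1"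
    "\<And>z. dist (\<psi> x) z \<ge> r \<Longrightarrow> b z = (0::real)"
    using smooth_bump[OF r(1), of "\<psi> x"] by metis
  let ?N = "{y \<in> U. \<psi> y \<in> ball (\<psi> x) (r / 2)}"
  show ?thesis
  proof (intro exI[of _ "\<lambda>i. chart_fun U \<psi> (\<lambda>z. b z * (z \<bullet> i))"] exI[of _ ?N] conjI ballI)
    show "chart_fun U \<psi> (\<lambda>z. b z * (z \<bullet> i)) \<in> C" for i
      by (rule chart_fun_C[OF U(1) _ smooth_on_mult[OF open_UNIV b(1)
              smooth_on_bounded_linear[OF open_UNIV bounded_linear_inner_left]]])
        (use r b(3) in auto)
    show "open ?N" by (rule chart_preimage_open[OF U(1) open_ball])
    show "x \<in> ?N" using U r by simp
    show "?N \<subseteq> U" by auto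
    show "chart_fun U \<psi> (\<lambda>z. b z * (z \<bullet> i)) y = \<psi> y \<bullet> i" if "y \<in> ?N" for y i
      using that b(2) by (simp add: chart_fun_def)
  qed
qed

abbreviation "prod_chart \<psi> \<equiv> (\<lambda>(x, t). (\<psi> x, t :: real))"

lemma prod_chart_in: "(U, \<psi>) \<in> \<A> \<Longrightarrow> (U \<times> UNIV, prod_chart \<psi>) \<in> product_with_line \<A>"
  unfolding product_with_line_def by (rule image_eqI[where x = "(U, \<psi>)"]) simp_all

lemma prod_chart_image: "prod_chart \<psi> ` (U \<times> UNIV) = \<psi> ` U \<times> UNIV"
  by (auto simp: image_iff)

lemma prod_chart_inv:
  assumes U: "(U, \<psi>) \<in> \<A>" and z: "z \<in> \<psi> ` U"
  shows "inv_into (U \<times> UNIV) (prod_chart \<psi>) (z, t) = (inv_into U \<psi> z, t)"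
proof (rule inv_into_f_eq)
  have "inj_on \<psi> U" using chart_inv[OF U] by (metis inj_onI)
  then show "inj_on (prod_chart \<psi>) (U \<times> UNIV)" by (auto simp: inj_on_def)
  show "(inv_into U \<psi> z, t) \<in> U \<times> UNIV" using chart_inv_in[OF U z] by simp
  show "prod_chart \<psi> (inv_into U \<psi> z, t) = (z, t)" using chart_inv'[OF U z] by simp
qed

lemma prod_chart_is_chart:
  assumes U: "(U, \<psi>) \<in> \<A>"
  shows "is_chart (U \<times> UNIV, prod_chart \<psi>)"
proof -
  have c1: "continuous_on (U \<times> UNIV) (prod_chart \<psi>)"
    unfolding case_prod_unfold
    by (intro continuous_on_Pair continuous_on_compose2[OF chart_cont[OF U]] continuous_on_fst
        continuous_on_snd continuous_on_id) auto
  have "continuous_on (\<psi> ` U \<times> UNIV) (\<lambda>p. (inv_into U \<psi> (fst p), snd p :: real))"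
    by (intro continuous_on_Pair continuous_on_compose2[OF chart_cont_inv[OF U]] continuous_on_fst
        continuous_on_snd continuous_on_id) auto
  then have c2: "continuous_on (\<psi> ` U \<times> UNIV) (inv_into (U \<times> UNIV) (prod_chart \<psi>))"
    by (rule continuous_on_eq) (use prod_chart_inv[OF U] in auto)
  have i1: "\<forall>p\<in>U \<times> UNIV. inv_into (U \<times> UNIV) (prod_chart \<psi>) (prod_chart \<psi> p) = p"
  proof
    fix p :: "'a \<times> real" assume p: "p \<in> U \<times> UNIV"
    show "inv_into (U \<times> UNIV) (prod_chart \<psi>) (prod_chart \<psi> p) = p"
      using p prod_chart_inv[OF U, of "\<psi> (fst p)" "snd p"] chart_inv[OF U, of "fst p"]
      by (auto simp: case_prod_unfold)
  qed
  have i2: "\<forall>p\<in>\<psi> ` U \<times> UNIV. prod_chart \<psi> (inv_into (U \<times> UNIV) (prod_chart \<psi>) p) = p"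
  proof
    fix p :: "'e \<times> real" assume p: "p \<in> \<psi> ` U \<times> UNIV"
    show "prod_chart \<psi> (inv_into (U \<times> UNIV) (prod_chart \<psi>) p) = p"
      using p prod_chart_inv[OF U, of "fst p" "snd p"] chart_inv'[OF U, of "fst p"]
      by (auto simp: case_prod_unfold)
  qed
  have "inv_into (U \<times> UNIV) (prod_chart \<psi>) ` (prod_chart \<psi> ` (U \<times> UNIV)) = U \<times> UNIV"
  proof -
    have "(\<lambda>p. inv_into (U \<times> UNIV) (prod_chart \<psi>) (prod_chart \<psi> p)) ` (U \<times> UNIV) = (\<lambda>p. p) ` (U \<times> UNIV)"
      by (rule image_cong[OF refl]) (rule i1[rule_format])
    then show ?thesis by (simp only: image_image image_ident)
  qed
  then have i3: "inv_into (U \<times> UNIV) (prod_chart \<psi>) ` (\<psi> ` U \<times> UNIV) = U \<times> UNIV"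
    by (simp only: prod_chart_image)
  show ?thesis
    unfolding is_chart_def homeomorphism_def prod.case prod_chart_image
    by (intro conjI i1 i2 i3 c1 c2 refl open_Times chart_open[OF U] chart_open_image[OF U] open_UNIV)
qed

text \<open>Trades the inverse of the product chart for the inverse of the chart on M paired with
  the identity, the form in which smoothness on the product is handled.\<close>

lemma prod_smooth_on:
  assumes U: "(U, \<psi>) \<in> \<A>"
  shows "smooth_on (prod_chart \<psi> ` (U \<times> UNIV)) (\<lambda>z. h (inv_into (U \<times> UNIV) (prod_chart \<psi>) z))
    \<longleftrightarrow> smooth_on (\<psi> ` U \<times> UNIV) (\<lambda>p. h (inv_into U \<psi> (fst p), snd p))"
proof -
  have o: "open (\<psi> ` U \<times> (UNIV :: real set))" using chart_open_image[OF U] by (simp add: open_Times)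
  show ?thesis
    unfolding prod_chart_image
    using smooth_on_cong[OF o, of "\<lambda>z. h (inv_into (U \<times> UNIV) (prod_chart \<psi>) z)"
        "\<lambda>p. h (inv_into U \<psi> (fst p), snd p)"]
      smooth_on_cong[OF o, of "\<lambda>p. h (inv_into U \<psi> (fst p), snd p)"
        "\<lambda>z. h (inv_into (U \<times> UNIV) (prod_chart \<psi>) z)"]
      prod_chart_inv[OF U] by (auto simp del: split_paired_All)
qed

lemma smooth_on_fst_compose:
  fixes f :: "'e \<Rightarrow> 'z::real_normed_vector"
  assumes "open S" "smooth_on S f"
  shows "smooth_on (S \<times> (UNIV :: real set)) (\<lambda>p. f (fst p))"
  by (rule smooth_on_compose[OF open_Times[OF assms(1) open_UNIV] assms(1)
        smooth_on_bounded_linear[OF open_Times[OF assms(1) open_UNIV] bounded_linear_fst] assms(2)]) auto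

lemma smooth_atlas_product: "smooth_atlas (product_with_line \<A>)"
proof -
  have 1: "is_chart c" if "c \<in> product_with_line \<A>" for c
    using that prod_chart_is_chart by (auto simp: product_with_line_def)
  have 2: "(\<Union>(U, \<psi>)\<in>product_with_line \<A>. U) = UNIV"
  proof (rule set_eqI)
    fix p :: "'a \<times> real"
    obtain U \<psi> where "(U, \<psi>) \<in> \<A>" "fst p \<in> U" by (rule chart_exists)
    then have "(U \<times> UNIV, prod_chart \<psi>) \<in> product_with_line \<A>" "p \<in> U \<times> UNIV"
      using prod_chart_in by (simp_all add: mem_Times_iff)
    then show "p \<in> (\<Union>(U, \<psi>)\<in>product_with_line \<A>. U) \<longleftrightarrow> p \<in> UNIV" by blast
  qed
  have 3: "smooth_on (prod_chart \<psi> ` (U \<times> UNIV \<inter> V \<times> UNIV)) (prod_chart \<psi>' \<circ> inv_into (U \<times> UNIV) (prod_chart \<psi>))"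
    if U: "(U, \<psi>) \<in> \<A>" and V: "(V, \<psi>') \<in> \<A>" for U \<psi> V \<psi>'
  proof -
    have e: "U \<times> UNIV \<inter> V \<times> (UNIV :: real set) = (U \<inter> V) \<times> UNIV" by auto
    have o: "open (\<psi> ` (U \<inter> V))" by (rule chart_image_open[OF U chart_open[OF V]])
    have o': "open (\<psi> ` (U \<inter> V) \<times> (UNIV :: real set))" by (rule open_Times[OF o open_UNIV])
    have "smooth_on (\<psi> ` (U \<inter> V) \<times> UNIV) (\<lambda>p. (\<psi>' (inv_into U \<psi> (fst p)), snd p :: real))"
      by (rule smooth_on_Pair[OF o' smooth_on_fst_compose[OF o transition_smooth[OF U V]]
            smooth_on_bounded_linear[OF o' bounded_linear_snd]])
    then show ?thesis
      unfolding e prod_chart_image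
      by (rule smooth_on_cong[OF o', rotated]) (use prod_chart_inv[OF U] in auto)
  qed
  show ?thesis
    unfolding smooth_atlas_def
    using 1 2 3 by (auto simp: product_with_line_def)
qed

end

lemma lie_bracket_apply: "lie_bracket X Y x f = X x (\<lambda>y. Y y f) - Y x (\<lambda>y. X y f)"
  by (simp add: lie_bracket_def)

context smooth_manifold
begin

interpretation prod: smooth_manifold "product_with_line \<A>"
  by (rule smooth_manifold.intro[OF smooth_atlas_product])

lemma prod_CI:
  assumes "\<And>U \<psi>. (U, \<psi>) \<in> \<A> \<Longrightarrow> smooth_on (\<psi> ` U \<times> UNIV) (\<lambda>p. h (inv_into U \<psi> (fst p), snd p))"
  shows "h \<in> prod.C"
proof (rule prod.CI)
  fix U \<psi> assume "(U, \<psi>) \<in> product_with_line \<A>"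
  then obtain V \<psi>' where V: "(V, \<psi>') \<in> \<A>" "U = V \<times> UNIV" "\<psi> = prod_chart \<psi>'"
    by (auto simp: product_with_line_def)
  show "smooth_on (\<psi> ` U) (\<lambda>z. h (inv_into U \<psi> z))"
    unfolding V(2,3) by (rule iffD2[OF prod_smooth_on[OF V(1), of h] assms[OF V(1)]])
qed

lemma prod_CD:
  assumes "h \<in> prod.C" and U: "(U, \<psi>) \<in> \<A>"
  shows "smooth_on (\<psi> ` U \<times> UNIV) (\<lambda>p. h (inv_into U \<psi> (fst p), snd p))"
proof -
  have "(U \<times> UNIV, prod_chart \<psi>) \<in> product_with_line \<A>"
    by (rule prod_chart_in[OF U])
  from prod.CD[OF assms(1) this] show ?thesis by (rule iffD1[OF prod_smooth_on[OF U, of h]])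
qed

lemma fst_C:
  assumes "f \<in> C" shows "(\<lambda>p. f (fst p)) \<in> prod.C"
proof (rule prod_CI)
  fix U \<psi> assume U: "(U, \<psi>) \<in> \<A>"
  show "smooth_on (\<psi> ` U \<times> UNIV) (\<lambda>p. f (fst (inv_into U \<psi> (fst p), snd p :: real)))"
    unfolding fst_conv by (rule smooth_on_fst_compose[OF chart_open_image[OF U] CD[OF assms U]])
qed

lemma snd_C: "snd \<in> prod.C"
proof (rule prod_CI)
  fix U \<psi> assume U: "(U, \<psi>) \<in> \<A>"
  show "smooth_on (\<psi> ` U \<times> UNIV) (\<lambda>p. snd (inv_into U \<psi> (fst p), snd p :: real))"
    unfolding snd_conv
    by (rule smooth_on_bounded_linear[OF open_Times[OF chart_open_image[OF U] open_UNIV] bounded_linear_snd])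
qed

lemma slice_C:
  assumes "h \<in> prod.C" shows "(\<lambda>y. h (y, t)) \<in> C"
proof (rule CI)
  fix U \<psi> assume U: "(U, \<psi>) \<in> \<A>"
  note o = chart_open_image[OF U]
  have "smooth_on (\<psi> ` U) (\<lambda>z. (z, t))"
    by (rule smooth_on_Pair[OF o smooth_on_bounded_linear[OF o bounded_linear_ident] smooth_on_const[OF o]])
  from smooth_on_compose[OF o open_Times[OF o open_UNIV] this prod_CD[OF assms U]]
  show "smooth_on (\<psi> ` U) (\<lambda>z. h (inv_into U \<psi> z, t))" by auto
qed

text \<open>The \<open>deriv\<close> in \<open>line_vector\<close> is a partial derivative in a
  product chart. This form shows both that it exists and that it depends smoothly on the
  point.\<close>

lemma line_derivative:
  assumes h: "h \<in> prod.C" and U: "(U, \<psi>) \<in> \<A>" "x \<in> U"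
  shows "((\<lambda>s. h (x, s)) has_real_derivative
    frechet_derivative (\<lambda>p. h (inv_into U \<psi> (fst p), snd p)) (at (\<psi> x, t)) (0, 1)) (at t)"
proof -
  let ?h = "\<lambda>p. h (inv_into U \<psi> (fst p), snd p)"
  have d: "(?h has_derivative frechet_derivative ?h (at (\<psi> x, t))) (at (\<psi> x, t))"
    by (rule smooth_on_derivative[OF prod_CD[OF h U(1)]]) (use U in auto)
  have l: "((\<lambda>s. ?h (\<psi> x, s)) has_derivative (\<lambda>s. frechet_derivative ?h (at (\<psi> x, t)) (0, s))) (at t)"
    by (rule has_derivative_compose[where g = ?h and f = "\<lambda>s. (\<psi> x, s)",
          OF has_derivative_Pair[OF has_derivative_const has_derivative_ident] d])
  have e: "(\<lambda>s. frechet_derivative ?h (at (\<psi> x, t)) (0, s))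
      = (*) (frechet_derivative ?h (at (\<psi> x, t)) (0, 1))"
  proof (rule ext)
    fix s show "frechet_derivative ?h (at (\<psi> x, t)) (0, s) = frechet_derivative ?h (at (\<psi> x, t)) (0, 1) * s"
      using linear_cmul[OF has_derivative_linear[OF d], of s "(0, 1)"] by (simp add: mult.commute)
  qed
  have "(\<lambda>s. ?h (\<psi> x, s)) = (\<lambda>s. h (x, s))"
    using chart_inv[OF U] by simp
  with l e show ?thesis by (simp only: has_field_derivative_def)
qed

lemma line_deriv:
  assumes h: "h \<in> prod.C" shows "((\<lambda>s. h (x, s)) has_real_derivative deriv (\<lambda>s. h (x, s)) t) (at t)"
proof -
  obtain U \<psi> where U: "(U, \<psi>) \<in> \<A>" "x \<in> U" by (rule chart_exists)
  show ?thesis using line_derivative[OF h U, of t] unfolding DERIV_imp_deriv[OF line_derivative[OF h U]] .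
qed

section \<open>Splitting the tangent vectors of the product\<close>

abbreviation "push_fst \<equiv> pushforward \<A> (fst :: 'a \<times> real \<Rightarrow> 'a)"
abbreviation "lift t \<equiv> pushforward (product_with_line \<A>) (\<lambda>y. (y, t))"

lemma push_fst_apply: "f \<in> C \<Longrightarrow> push_fst V f = V (\<lambda>p. f (fst p))"
  by (simp add: pushforward_def comp_def)

lemma lift_apply: "h \<in> prod.C \<Longrightarrow> lift t v h = v (\<lambda>y. h (y, t))"
  by (simp add: pushforward_def comp_def)

lemma line_vector_apply: "h \<in> prod.C \<Longrightarrow> line_vector \<A> (x, t) h = deriv (\<lambda>s. h (x, s)) t"
  by (simp add: line_vector_def)

lemma push_fst_TS:
  assumes V: "V \<in> prod.TS (x, t)" shows "push_fst V \<in> TS x"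
proof (rule TSI)
  show "push_fst V f = 0" if "f \<notin> C" for f using that by (simp add: pushforward_def)
next
  fix f h assume f: "f \<in> C" and h: "h \<in> C"
  show "push_fst V (\<lambda>y. f y + h y) = push_fst V f + push_fst V h"
    unfolding push_fst_apply[OF C_add[OF f h]] push_fst_apply[OF f] push_fst_apply[OF h]
    by (rule prod.TS_add[OF V fst_C[OF f] fst_C[OF h]])
  show "push_fst V (\<lambda>y. f y * h y) = f x * push_fst V h + h x * push_fst V f"
    unfolding push_fst_apply[OF C_mult[OF f h]] push_fst_apply[OF f] push_fst_apply[OF h]
      prod.TS_mult[OF V fst_C[OF f] fst_C[OF h]] by simp
  show "push_fst V (\<lambda>y. c * f y) = c * push_fst V f" for c
    unfolding push_fst_apply[OF C_cmult[OF f]] push_fst_apply[OF f]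
    by (rule prod.TS_cmult[OF V fst_C[OF f]])
qed

lemma lift_TS:
  assumes v: "v \<in> TS x" shows "lift t v \<in> prod.TS (x, t)"
proof (rule prod.TSI)
  show "lift t v f = 0" if "f \<notin> prod.C" for f using that by (simp add: pushforward_def)
next
  fix f h assume f: "f \<in> prod.C" and h: "h \<in> prod.C"
  show "lift t v (\<lambda>y. f y + h y) = lift t v f + lift t v h"
    unfolding lift_apply[OF prod.C_add[OF f h]] lift_apply[OF f] lift_apply[OF h]
    by (rule TS_add[OF v slice_C[OF f] slice_C[OF h]])
  show "lift t v (\<lambda>y. f y * h y) = f (x, t) * lift t v h + h (x, t) * lift t v f"
    unfolding lift_apply[OF prod.C_mult[OF f h]] lift_apply[OF f] lift_apply[OF h]
    by (rule TS_mult[OF v slice_C[OF f] slice_C[OF h]])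
  show "lift t v (\<lambda>y. c * f y) = c * lift t v f" for c
    unfolding lift_apply[OF prod.C_cmult[OF f]] lift_apply[OF f]
    by (rule TS_cmult[OF v slice_C[OF f]])
qed

lemma line_vector_TS: "line_vector \<A> (x, t) \<in> prod.TS (x, t)"
proof (rule prod.TSI)
  show "line_vector \<A> (x, t) f = 0" if "f \<notin> prod.C" for f using that by (simp add: line_vector_def)
next
  fix f h assume f: "f \<in> prod.C" and h: "h \<in> prod.C"
  note d = line_deriv[OF f, of x t] line_deriv[OF h, of x t]
  show "line_vector \<A> (x, t) (\<lambda>y. f y + h y) = line_vector \<A> (x, t) f + line_vector \<A> (x, t) h"
    using DERIV_imp_deriv[OF DERIV_add[OF d]] by (simp add: line_vector_apply f h prod.C_add)
  show "line_vector \<A> (x, t) (\<lambda>y. f y * h y)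
      = f (x, t) * line_vector \<A> (x, t) h + h (x, t) * line_vector \<A> (x, t) f"
    using DERIV_imp_deriv[OF DERIV_mult[OF d]] by (simp add: line_vector_apply f h prod.C_mult)
next
  fix f and c :: real assume f: "f \<in> prod.C"
  show "line_vector \<A> (x, t) (\<lambda>y. c * f y) = c * line_vector \<A> (x, t) f"
    using DERIV_imp_deriv[OF DERIV_cmult[OF line_deriv[OF f, of x t], of c]]
    by (simp add: line_vector_apply f prod.C_cmult)
qed

lemma lift_snd:
  assumes v: "v \<in> TS x" shows "lift t v snd = 0"
  using TS_const[OF v, of t] by (simp add: lift_apply[OF snd_C])

lemma line_snd: "line_vector \<A> (x, t) snd = 1"
  by (simp add: line_vector_apply[OF snd_C])

text \<open>Local coordinates of the product are pullbacks of coordinates on M together with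
  \<open>snd\<close>, so a derivation is determined by its values on these two kinds of
  functions.\<close>

lemma prod_TS_eqI:
  assumes V: "V \<in> prod.TS (x, t)" and W: "W \<in> prod.TS (x, t)"
    and eq: "\<And>f. f \<in> C \<Longrightarrow> V (\<lambda>p. f (fst p)) = W (\<lambda>p. f (fst p))" "V snd = W snd"
  shows "V = W"
proof (rule ext)
  fix h
  obtain U \<psi> where U: "(U, \<psi>) \<in> \<A>" "x \<in> U" by (rule chart_exists)
  obtain u N where uN: "(\<forall>i\<in>(Basis::'e set). u i \<in> C) \<and> open N \<and> x \<in> N \<and> N \<subseteq> U \<and>
    (\<forall>y\<in>N. \<forall>i\<in>Basis. u i y = \<psi> y \<bullet> i)"
    using local_coordinates[OF U] by (elim exE)
  then have u: "\<And>i. i \<in> (Basis::'e set) \<Longrightarrow> u i \<in> C" and N: "open N" "x \<in> N" "N \<subseteq> U"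
    "\<And>y i. y \<in> N \<Longrightarrow> i \<in> Basis \<Longrightarrow> u i y = \<psi> y \<bullet> i"
    by simp_all
  \<comment> \<open>\<open>Basis\<close> of the product consists of the pairs \<open>(i, 0)\<close>
    and the single pair \<open>(0, 1)\<close>; the second component tells them apart.\<close>
  define u' where "u' k p = (if snd k = 0 then u (fst k) (fst p) else snd p)" for k :: "'e \<times> real" and p :: "'a \<times> real"
  have u'0: "u' (i, 0) = (\<lambda>p. u i (fst p))" and u'1: "u' (0, 1) = snd" for i
    by (auto simp: u'_def)
  have u'C: "u' k \<in> prod.C" and VW: "V (u' k) = W (u' k)" if k: "k \<in> Basis" for k
  proof -
    consider i where "i \<in> Basis" "k = (i, 0)" | "k = (0, 1)"
      using k unfolding Basis_prod_def Basis_real_def by blast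
    then have "u' k \<in> prod.C \<and> V (u' k) = W (u' k)"
      by cases (simp_all add: u'0 u'1 fst_C u snd_C eq)
    then show "u' k \<in> prod.C" "V (u' k) = W (u' k)" by auto
  qed
  have c: "(U \<times> UNIV, prod_chart \<psi>) \<in> product_with_line \<A>"
    by (rule prod_chart_in[OF U(1)])
  have uN: "u' k p = prod_chart \<psi> p \<bullet> k" if "p \<in> N \<times> UNIV" "k \<in> Basis" for p k
    using that N(4) by (auto simp: u'_def Basis_prod_def case_prod_unfold inner_prod_def)
  have coord: "V h = (\<Sum>k\<in>Basis. V (u' k) * frechet_derivative (\<lambda>z. h (inv_into (U \<times> UNIV) (prod_chart \<psi>) z))
      (at (prod_chart \<psi> (x, t))) k)" if "V \<in> prod.TS (x, t)" "h \<in> prod.C" for V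
    by (rule prod.TS_in_coordinates[OF c _ u'C _ _ uN that]) (use U N in \<open>auto simp: open_Times\<close>)
  show "V h = W h"
  proof (cases "h \<in> prod.C")
    case True
    then show ?thesis using coord[OF V] coord[OF W] VW by simp
  next
    case False
    then show ?thesis using prod.TS_nonsmooth[OF V False] prod.TS_nonsmooth[OF W False] by simp
  qed
qed

text \<open>A vector field \<open>X\<close> and a function \<open>f\<close> on \<open>M\<close> give the \<open>t\<close>-invariant field \<open>X + f d/dt\<close>.\<close>

definition inv_field :: "('a \<Rightarrow> 'a tvec) \<Rightarrow> ('a \<Rightarrow> real) \<Rightarrow> 'a \<times> real \<Rightarrow> ('a \<times> real) tvec" where
  "inv_field X f p = lift (snd p) (X (fst p)) + f (fst p) *\<^sub>R line_vector \<A> p"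

lemma inv_field_TS:
  assumes "X \<in> VF" shows "inv_field X f p \<in> prod.TS p"
proof (cases p)
  case (Pair x t)
  show ?thesis unfolding inv_field_def Pair fst_conv snd_conv
    by (rule prod.TS_plus[OF lift_TS[OF VF_TS[OF assms]] prod.TS_scaleR[OF line_vector_TS]])
qed

lemma inv_field_fst:
  assumes "X \<in> VF" and F: "F \<in> C"
  shows "inv_field X f p (\<lambda>p. F (fst p)) = X (fst p) F"
proof (cases p)
  case (Pair x t)
  then show ?thesis
    using line_vector_apply[OF fst_C[OF F], of x t]
    by (simp add: inv_field_def lift_apply[OF fst_C[OF F]] scaleR_tvec_apply)
qed

lemma inv_field_snd:
  assumes X: "X \<in> VF" shows "inv_field X f p snd = f (fst p)"
proof (cases p)
  case (Pair x t)
  then show ?thesis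
    using line_snd[of x t] lift_snd[OF VF_TS[OF X], of t x]
    by (simp add: inv_field_def scaleR_tvec_apply)
qed

text \<open>For fixed t the field acts on a slice of \<open>h\<close>. Joint smoothness in t is seen
  in coordinates, where the result is the sum over i of \<open>X\<close> applied to
  \<open>u i\<close> times a partial derivative of \<open>h\<close> in the product chart.\<close>

lemma lift_field_C:
  assumes X: "X \<in> VF" and h: "h \<in> prod.C"
  shows "(\<lambda>p. X (fst p) (\<lambda>y. h (y, snd p))) \<in> prod.C"
proof (rule prod_CI, rule smooth_on_local)
  fix U \<psi> and p :: "'e \<times> real" assume U: "(U, \<psi>) \<in> \<A>" and p: "p \<in> \<psi> ` U \<times> UNIV"
  let ?i = "inv_into U \<psi>" and ?h = "\<lambda>p. h (inv_into U \<psi> (fst p), snd p)"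
  have pU: "fst p \<in> \<psi> ` U" using p by auto
  obtain u N where "(\<forall>i\<in>(Basis::'e set). u i \<in> C) \<and> open N \<and> ?i (fst p) \<in> N \<and> N \<subseteq> U \<and>
    (\<forall>y\<in>N. \<forall>i\<in>Basis. u i y = \<psi> y \<bullet> i)"
    using local_coordinates[OF U chart_inv_in[OF U pU]] by (elim exE)
  then have u: "\<And>i. i \<in> (Basis::'e set) \<Longrightarrow> u i \<in> C" and N: "open N" "?i (fst p) \<in> N" "N \<subseteq> U"
    "\<And>y i. y \<in> N \<Longrightarrow> i \<in> Basis \<Longrightarrow> u i y = \<psi> y \<bullet> i"
    by simp_all
  define T where "T = \<psi> ` (U \<inter> N) \<times> (UNIV :: real set)"
  have o: "open (\<psi> ` (U \<inter> N))" by (rule chart_image_open[OF U N(1)])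
  have T: "open T" unfolding T_def by (rule open_Times[OF o open_UNIV])
  have TU: "T \<subseteq> \<psi> ` U \<times> UNIV" by (auto simp: T_def)
  have pT: "p \<in> T"
  proof -
    have "?i (fst p) \<in> U \<inter> N" using N(2) chart_inv_in[OF U pU] by simp
    then have "fst p \<in> \<psi> ` (U \<inter> N)" using chart_inv'[OF U pU] by (metis imageI)
    then show ?thesis by (simp add: T_def mem_Times_iff)
  qed
  have "smooth_on T (\<lambda>p. \<Sum>i\<in>Basis. X (?i (fst p)) (u i) * frechet_derivative ?h (at p) (i, 0))"
  proof (rule smooth_on_sum[OF T], rule smooth_on_mult[OF T])
    fix i :: 'e assume i: "i \<in> Basis"
    have "smooth_on (\<psi> ` (U \<inter> N)) (\<lambda>z. X (?i z) (u i))"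
      by (rule smooth_on_subset[OF CD[OF VF_C[OF X u[OF i]] U]]) auto
    then show "smooth_on T (\<lambda>p. X (?i (fst p)) (u i))"
      unfolding T_def by (rule smooth_on_fst_compose[OF o])
    show "smooth_on T (\<lambda>p. frechet_derivative ?h (at p) (i, 0))"
      by (rule smooth_on_subset[OF smooth_on_frechet_derivative[OF prod_CD[OF h U]] TU])
  qed
  then have "smooth_on T (\<lambda>p. X (?i (fst p)) (\<lambda>y. h (y, snd p)))"
  proof (rule smooth_on_cong[OF T, rotated])
    fix p assume p: "p \<in> T"
    then have pU: "fst p \<in> \<psi> ` U" and iN: "?i (fst p) \<in> N"
      using chart_inv[OF U] by (auto simp: T_def)
    let ?x = "?i (fst p)"
    have xp: "\<psi> ?x = fst p" by (rule chart_inv'[OF U pU])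
    have "X ?x (\<lambda>y. h (y, snd p)) = (\<Sum>i\<in>Basis. X ?x (u i) *
        frechet_derivative (\<lambda>z. h (?i z, snd p)) (at (\<psi> ?x)) i)"
      by (rule TS_in_coordinates[OF U chart_inv_in[OF U pU] u N(1) iN N(4) VF_TS[OF X] slice_C[OF h]])
    moreover have "frechet_derivative (\<lambda>z. h (?i z, snd p)) (at (\<psi> ?x)) i = frechet_derivative ?h (at p) (i, 0)" for i
    proof -
      have d: "(?h has_derivative frechet_derivative ?h (at p)) (at p)"
        by (rule smooth_on_derivative[OF prod_CD[OF h U]]) (use pU in \<open>auto simp: mem_Times_iff\<close>)
      have "((\<lambda>z. ?h (z, snd p)) has_derivative (\<lambda>v. frechet_derivative ?h (at p) (v, 0))) (at (fst p))"
        by (rule has_derivative_compose[where g = ?h and f = "\<lambda>z. (z, snd p)",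
              OF has_derivative_Pair[OF has_derivative_ident has_derivative_const]]) (simp add: d)
      from fun_cong[OF frechet_derivative_at[OF this], of i, symmetric] show ?thesis
        by (simp add: xp)
    qed
    ultimately show "(\<Sum>i\<in>Basis. X (?i (fst p)) (u i) * frechet_derivative ?h (at p) (i, 0))
        = X (?i (fst p)) (\<lambda>y. h (y, snd p))" by simp
  qed
  moreover have "\<psi> ` U \<times> UNIV \<inter> T = T" using TU by blast
  ultimately show "\<exists>T. open T \<and> p \<in> T \<and> smooth_on (\<psi> ` U \<times> UNIV \<inter> T)
      (\<lambda>p. X (fst (?i (fst p), snd p)) (\<lambda>y. h (y, snd (?i (fst p), snd p))))"
    using T pT by (intro exI[of _ T]) simp
qed

lemma line_field_C:
  assumes h: "h \<in> prod.C" shows "(\<lambda>p. line_vector \<A> p h) \<in> prod.C"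
proof (rule prod_CI)
  fix U \<psi> assume U: "(U, \<psi>) \<in> \<A>"
  let ?h = "\<lambda>p. h (inv_into U \<psi> (fst p), snd p)"
  have o: "open (\<psi> ` U \<times> (UNIV :: real set))" by (rule open_Times[OF chart_open_image[OF U] open_UNIV])
  show "smooth_on (\<psi> ` U \<times> UNIV) (\<lambda>p. line_vector \<A> (inv_into U \<psi> (fst p), snd p) h)"
  proof (rule smooth_on_cong[OF o _ smooth_on_frechet_derivative[OF prod_CD[OF h U], of "(0, 1)"]])
    fix p assume "p \<in> \<psi> ` U \<times> (UNIV :: real set)"
    then have p: "fst p \<in> \<psi> ` U" by auto
    show "frechet_derivative ?h (at p) (0, 1) = line_vector \<A> (inv_into U \<psi> (fst p), snd p) h"
      using DERIV_imp_deriv[OF line_derivative[OF h U chart_inv_in[OF U p], of "snd p"]] chart_inv'[OF U p]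
      by (simp add: line_vector_apply[OF h])
  qed
qed

lemma inv_field_VF:
  assumes X: "X \<in> VF" and f: "f \<in> C" shows "inv_field X f \<in> prod.VF"
proof (rule prod.VFI[OF inv_field_TS[OF X]])
  fix h assume h: "h \<in> prod.C"
  have "(\<lambda>p. X (fst p) (\<lambda>y. h (y, snd p)) + f (fst p) * line_vector \<A> p h) \<in> prod.C"
    by (rule prod.C_add[OF lift_field_C[OF X h] prod.C_mult[OF fst_C[OF f] line_field_C[OF h]]])
  then show "(\<lambda>p. inv_field X f p h) \<in> prod.C"
    by (simp add: inv_field_def lift_apply[OF h] scaleR_tvec_apply)
qed

text \<open>The result is the bracket of TM + R: the t-invariant fields on the product are the
  sections of this algebroid. Both sides are derivations, so testing on functions from M and on
  \<open>snd\<close> suffices.\<close>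

lemma inv_field_bracket:
  assumes X: "X \<in> VF" "f \<in> C" and Y: "Y \<in> VF" "h \<in> C"
  shows "lie_bracket (inv_field X f) (inv_field Y h) p
    = inv_field (lie_bracket X Y) (\<lambda>x. X x h - Y x f) p"
proof (rule prod_TS_eqI[of _ "fst p" "snd p", unfolded prod.collapse])
  note XY = lie_bracket_VF[OF X(1) Y(1)]
  show "lie_bracket (inv_field X f) (inv_field Y h) p \<in> prod.TS p"
    by (rule prod.VF_TS[OF prod.lie_bracket_VF[OF inv_field_VF[OF X] inv_field_VF[OF Y]]])
  show "inv_field (lie_bracket X Y) (\<lambda>x. X x h - Y x f) p \<in> prod.TS p"
    by (rule inv_field_TS[OF XY])
  fix F assume F: "F \<in> C"
  show "lie_bracket (inv_field X f) (inv_field Y h) p (\<lambda>p. F (fst p))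
      = inv_field (lie_bracket X Y) (\<lambda>x. X x h - Y x f) p (\<lambda>p. F (fst p))"
    unfolding inv_field_fst[OF XY F] lie_bracket_apply inv_field_fst[OF X(1) F] inv_field_fst[OF Y(1) F]
      inv_field_fst[OF X(1) VF_C[OF Y(1) F]] inv_field_fst[OF Y(1) VF_C[OF X(1) F]] ..
next
  show "lie_bracket (inv_field X f) (inv_field Y h) p snd
      = inv_field (lie_bracket X Y) (\<lambda>x. X x h - Y x f) p snd"
    unfolding inv_field_snd[OF lie_bracket_VF[OF X(1) Y(1)]] lie_bracket_apply
      inv_field_snd[OF X(1)] inv_field_snd[OF Y(1)] inv_field_fst[OF X(1) Y(2)] inv_field_fst[OF Y(1) X(2)] ..
qed

lemma inv_field_eq_iff:
  assumes "X \<in> VF" "Y \<in> VF"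
  shows "inv_field X f p = inv_field Y h p \<longleftrightarrow> X (fst p) = Y (fst p) \<and> f (fst p) = h (fst p)"
proof (intro iffI conjI)
  assume e: "inv_field X f p = inv_field Y h p"
  show "f (fst p) = h (fst p)"
    using inv_field_snd[OF assms(1), of f p] inv_field_snd[OF assms(2), of h p] e by simp
  show "X (fst p) = Y (fst p)"
  proof (rule ext)
    fix F show "X (fst p) F = Y (fst p) F"
      using inv_field_fst[OF assms(1), of F f p] inv_field_fst[OF assms(2), of F h p] e
        VFD_nonsmooth[OF assms(1), of F "fst p"] VFD_nonsmooth[OF assms(2), of F "fst p"]
      by (cases "F \<in> C") simp_all
  qed
qed (simp add: inv_field_def)

text \<open>Invariant fields with a constant function part already reach every tangent vector, so
  they are enough to test a tensor on the product.\<close>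

lemma inv_field_through:
  assumes V: "V \<in> prod.TS p"
  obtains X where "X \<in> VF" "X (fst p) = push_fst V" "inv_field X (\<lambda>_. V snd) p = V"
proof (cases p)
  case (Pair x t)
  note V' = V[unfolded Pair]
  obtain X where X: "X \<in> VF" "X x = push_fst V" by (rule vector_field_through[OF push_fst_TS[OF V']])
  have "inv_field X (\<lambda>_. V snd) (x, t) = V"
  proof (rule prod_TS_eqI[OF inv_field_TS[OF X(1)] V'])
    show "inv_field X (\<lambda>_. V snd) (x, t) (\<lambda>p. F (fst p)) = V (\<lambda>p. F (fst p))" if "F \<in> C" for F
      using inv_field_fst[OF X(1) that, of "\<lambda>_. V snd" "(x, t)"] X(2) push_fst_apply[OF that, of V] by simp
    show "inv_field X (\<lambda>_. V snd) (x, t) snd = V snd"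
      using inv_field_snd[OF X(1), of "\<lambda>_. V snd" "(x, t)"] by simp
  qed
  with X Pair show ?thesis using that by simp
qed

lemma inv_field_linear:
  assumes "X \<in> VF" "Y \<in> VF"
  shows inv_field_add: "inv_field X f p + inv_field Y h p = inv_field (\<lambda>x. X x + Y x) (\<lambda>x. f x + h x) p"
    and inv_field_diff: "inv_field X f p - inv_field Y h p = inv_field (\<lambda>x. X x - Y x) (\<lambda>x. f x - h x) p"
proof -
  have *: "lift t (v + w) = lift t v + lift t w" "lift t (v - w) = lift t v - lift t w" for t and v w :: "'a tvec"
    by (simp_all add: pushforward_def fun_eq_iff)
  show "inv_field X f p + inv_field Y h p = inv_field (\<lambda>x. X x + Y x) (\<lambda>x. f x + h x) p"
    "inv_field X f p - inv_field Y h p = inv_field (\<lambda>x. X x - Y x) (\<lambda>x. f x - h x) p"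
    unfolding inv_field_def * by (simp_all add: scaleR_add_left scaleR_diff_left algebra_simps)
qed

end

section \<open>Normality of almost contact structures\<close>

locale almost_contact_manifold = smooth_manifold \<A>
  for \<A> :: "('a::t2_space, 'e::euclidean_space) atlas" +
  fixes \<phi> :: "'a \<Rightarrow> 'a tvec \<Rightarrow> 'a tvec" and \<xi> :: "'a \<Rightarrow> 'a tvec" and \<eta> :: "'a \<Rightarrow> 'a tvec \<Rightarrow> real"
  assumes ac: "almost_contact \<A> \<phi> \<xi> \<eta>"
begin

lemma phi_linear: "linear_map_on (TS x) (\<phi> x)"
  using ac by (simp add: almost_contact_def endomorphism_field_def)

lemma phi_TS: "v \<in> TS x \<Longrightarrow> \<phi> x v \<in> TS x"
  using ac by (auto simp: almost_contact_def endomorphism_field_def)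

lemma phi_VF: "X \<in> VF \<Longrightarrow> (\<lambda>x. \<phi> x (X x)) \<in> VF"
  using ac by (simp add: almost_contact_def endomorphism_field_def)

lemma xi_VF: "\<xi> \<in> VF"
  using ac by (simp add: almost_contact_def)

lemma xi_TS: "\<xi> x \<in> TS x"
  by (rule VF_TS[OF xi_VF])

lemma eta_\<Omega>: "\<eta> \<in> \<Omega>"
  using ac by (simp add: almost_contact_def)

lemma phi_phi: "v \<in> TS x \<Longrightarrow> \<phi> x (\<phi> x v) = - v + \<eta> x v *\<^sub>R \<xi> x"
  using ac by (simp add: almost_contact_def)

lemma eta_xi: "\<eta> x (\<xi> x) = 1"
  using ac by (simp add: almost_contact_def)

lemmas phi_add = linear_map_on_add[OF phi_linear]
  and phi_diff = linear_map_on_diff[OF phi_linear]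
  and phi_scaleR = linear_map_on_scaleR[OF phi_linear]
  and phi_minus = linear_map_on_minus[OF phi_linear]

lemma phi_zero: "\<phi> x 0 = 0"
  by (rule linear_map_on_zero[OF phi_linear TS_zero])

lemma xi_nonzero:
  assumes "c *\<^sub>R \<xi> x = 0" shows "c = 0"
proof -
  have "\<eta> x (c *\<^sub>R \<xi> x) = 0" unfolding assms by (rule \<Omega>_zero[OF eta_\<Omega>])
  then show ?thesis using \<Omega>_scaleR[OF eta_\<Omega> xi_TS, of x c] eta_xi[of x] by simp
qed

text \<open>The structure equation gives first that the square of \<open>\<phi>\<close> kills
  \<open>\<xi>\<close>, and then, applied to phi xi, that phi xi is a multiple c of
  \<open>\<xi>\<close>. Hence c squared is 0.\<close>

lemma phi_xi: "\<phi> x (\<xi> x) = 0"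
proof -
  have 0: "\<phi> x (\<phi> x (\<xi> x)) = 0"
    using phi_phi[OF xi_TS] eta_xi by simp
  then have e: "\<phi> x (\<xi> x) = \<eta> x (\<phi> x (\<xi> x)) *\<^sub>R \<xi> x"
    using phi_phi[OF phi_TS[OF xi_TS], of x] phi_zero[of x] by simp
  define c where "c = \<eta> x (\<phi> x (\<xi> x))"
  have e': "\<phi> x (\<xi> x) = c *\<^sub>R \<xi> x" using e by (simp add: c_def)
  have "0 = c *\<^sub>R (c *\<^sub>R \<xi> x)"
    using 0 unfolding e' phi_scaleR[OF xi_TS] by simp
  then have "c = 0" using xi_nonzero[of "c * c" x] by simp
  then show ?thesis using e' by simp
qed

text \<open>Computing the third power of \<open>\<phi>\<close> in the two possible groupings leaves
  a multiple of \<open>\<xi>\<close> that must vanish.\<close>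

lemma eta_phi:
  assumes v: "v \<in> TS x" shows "\<eta> x (\<phi> x v) = 0"
proof -
  have "\<phi> x (\<phi> x (\<phi> x v)) = - \<phi> x v"
    unfolding phi_phi[OF v]
    using phi_add[OF TS_uminus[OF v] TS_scaleR[OF xi_TS]] phi_minus[OF v] phi_scaleR[OF xi_TS] phi_xi by simp
  then have "\<eta> x (\<phi> x v) *\<^sub>R \<xi> x = 0"
    using phi_phi[OF phi_TS[OF v]] by simp
  then show ?thesis by (rule xi_nonzero)
qed

interpretation prod: smooth_manifold "product_with_line \<A>"
  by (rule smooth_manifold.intro[OF smooth_atlas_product])

section \<open>The almost complex structure on the product and its torsion\<close>

abbreviation "J \<equiv> almost_complex_J \<A> \<phi> \<xi> \<eta>"

lemma J_inv_field:
  assumes X: "X \<in> VF"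
  shows "J p (inv_field X f p) = inv_field (\<lambda>x. \<phi> x (X x) + f x *\<^sub>R \<xi> x) (\<lambda>x. - \<eta> x (X x)) p"
proof (cases p)
  case (Pair x t)
  have "push_fst (inv_field X f (x, t)) = X x"
  proof (rule ext)
    fix F show "push_fst (inv_field X f (x, t)) F = X x F"
      using inv_field_fst[OF X, of F f "(x, t)"] push_fst_apply[of F "inv_field X f (x, t)"]
        VFD_nonsmooth[OF X, of F x]
      by (cases "F \<in> C") (simp_all add: pushforward_def)
  qed
  moreover have "inv_field X f (x, t) snd = f x"
    using inv_field_snd[OF X, of f "(x, t)"] by simp
  ultimately show ?thesis
    unfolding Pair almost_complex_J_def Let_def prod.case
    by (simp only: inv_field_def fst_conv snd_conv) simp
qed

lemma J_TS: assumes "V \<in> prod.TS p" shows "J p V \<in> prod.TS p"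
proof -
  obtain X where X: "X \<in> VF" "inv_field X (\<lambda>_. V snd) p = V" by (rule inv_field_through[OF assms])
  have "inv_field (\<lambda>x. \<phi> x (X x) + V snd *\<^sub>R \<xi> x) (\<lambda>x. - \<eta> x (X x)) p \<in> prod.TS p"
    by (rule inv_field_TS[OF VF_add[OF phi_VF[OF X(1)] VF_scaleR[OF xi_VF]]])
  then show ?thesis using J_inv_field[OF X(1), of p "\<lambda>_. V snd"] X(2) by simp
qed

lemma J_add:
  assumes "V \<in> prod.TS p" "W \<in> prod.TS p" shows "J p (V + W) = J p V + J p W"
proof -
  obtain X where X: "X \<in> VF" "inv_field X (\<lambda>_. V snd) p = V" by (rule inv_field_through[OF assms(1)])
  obtain Y where Y: "Y \<in> VF" "inv_field Y (\<lambda>_. W snd) p = W" by (rule inv_field_through[OF assms(2)])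
  have "J p (V + W) = J p (inv_field (\<lambda>x. X x + Y x) (\<lambda>x. V snd + W snd) p)"
    using inv_field_add[OF X(1) Y(1), of "\<lambda>_. V snd" p "\<lambda>_. W snd"] X(2) Y(2) by simp
  also have "\<dots> = inv_field (\<lambda>x. \<phi> x (X x) + V snd *\<^sub>R \<xi> x) (\<lambda>x. - \<eta> x (X x)) p
      + inv_field (\<lambda>x. \<phi> x (Y x) + W snd *\<^sub>R \<xi> x) (\<lambda>x. - \<eta> x (Y x)) p"
    unfolding J_inv_field[OF VF_add[OF X(1) Y(1)]]
      inv_field_add[OF VF_add[OF phi_VF[OF X(1)] VF_scaleR[OF xi_VF]] VF_add[OF phi_VF[OF Y(1)] VF_scaleR[OF xi_VF]]]
      phi_add[OF VF_TS[OF X(1)] VF_TS[OF Y(1)]] \<Omega>_add[OF eta_\<Omega> VF_TS[OF X(1)] VF_TS[OF Y(1)]]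
    by (simp add: algebra_simps)
  also have "\<dots> = J p V + J p W"
    using J_inv_field[OF X(1), of p "\<lambda>_. V snd"] J_inv_field[OF Y(1), of p "\<lambda>_. W snd"] X(2) Y(2) by simp
  finally show ?thesis .
qed

lemma inv_field_scaleR: "c *\<^sub>R inv_field X f p = inv_field (\<lambda>x. c *\<^sub>R X x) (\<lambda>x. c * f x) p"
proof -
  have "lift t (c *\<^sub>R v) = c *\<^sub>R lift t v" for t and v :: "'a tvec"
    by (simp add: pushforward_def fun_eq_iff scaleR_fun_def)
  then show ?thesis by (simp add: inv_field_def scaleR_add_right)
qed

lemma J_scaleR:
  assumes "V \<in> prod.TS p" shows "J p (c *\<^sub>R V) = c *\<^sub>R J p V"
proof -
  obtain X where X: "X \<in> VF" "inv_field X (\<lambda>_. V snd) p = V" by (rule inv_field_through[OF assms])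
  have "J p (c *\<^sub>R V) = J p (inv_field (\<lambda>x. c *\<^sub>R X x) (\<lambda>x. c * V snd) p)"
    using inv_field_scaleR[of c X "\<lambda>_. V snd" p] X(2) by simp
  also have "\<dots> = c *\<^sub>R inv_field (\<lambda>x. \<phi> x (X x) + V snd *\<^sub>R \<xi> x) (\<lambda>x. - \<eta> x (X x)) p"
    unfolding J_inv_field[OF VF_scaleR[OF X(1)]] inv_field_scaleR
      phi_scaleR[OF VF_TS[OF X(1)]] \<Omega>_scaleR[OF eta_\<Omega> VF_TS[OF X(1)]]
    by (simp add: scaleR_add_right)
  also have "\<dots> = c *\<^sub>R J p V"
    using J_inv_field[OF X(1), of p "\<lambda>_. V snd"] X(2) by simp
  finally show ?thesis .
qed

lemma J_J:
  assumes "V \<in> prod.TS p" shows "J p (J p V) = - V"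
proof -
  obtain X where X: "X \<in> VF" "inv_field X (\<lambda>_. V snd) p = V" by (rule inv_field_through[OF assms])
  let ?X = "\<lambda>x. \<phi> x (X x) + V snd *\<^sub>R \<xi> x"
  have X': "?X \<in> VF" by (rule VF_add[OF phi_VF[OF X(1)] VF_scaleR[OF xi_VF]])
  have "J p (J p V) = inv_field (\<lambda>x. \<phi> x (?X x) + (- \<eta> x (X x)) *\<^sub>R \<xi> x) (\<lambda>x. - \<eta> x (?X x)) p"
    using J_inv_field[OF X(1), of p "\<lambda>_. V snd"] J_inv_field[OF X', of p "\<lambda>x. - \<eta> x (X x)"] X(2) by simp
  also have "\<dots> = inv_field (\<lambda>x. (-1) *\<^sub>R X x) (\<lambda>x. -1 * V snd) p"
  proof -
    have "\<phi> x (?X x) + (- \<eta> x (X x)) *\<^sub>R \<xi> x = (-1) *\<^sub>R X x" for x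
      using phi_add[OF phi_TS[OF VF_TS[OF X(1), of x]] TS_scaleR[OF xi_TS[of x], of "V snd"]]
        phi_scaleR[OF xi_TS[of x], of "V snd"] phi_xi[of x] phi_phi[OF VF_TS[OF X(1), of x]] by simp
    moreover have "- \<eta> x (?X x) = -1 * V snd" for x
      using \<Omega>_add[OF eta_\<Omega> phi_TS[OF VF_TS[OF X(1), of x]] TS_scaleR[OF xi_TS[of x], of "V snd"]]
        \<Omega>_scaleR[OF eta_\<Omega> xi_TS[of x], of "V snd"] eta_phi[OF VF_TS[OF X(1), of x]] eta_xi[of x] by simp
    ultimately show ?thesis by (simp only:)
  qed
  also have "\<dots> = (-1) *\<^sub>R V"
    using inv_field_scaleR[of "-1" X "\<lambda>_. V snd" p] X(2) by simp
  finally show ?thesis by simp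
qed

text \<open>\<open>J\<close> is given pointwise through pushforwards, and its action is known on
  invariant fields. A general \<open>V\<close> is therefore expanded: its part along M in a lifted
  local frame, with coefficients \<open>V q (\<lambda>p. u i (fst p))\<close>, and its part along
  the line, which \<open>J\<close> sends to \<open>V q snd\<close> times the lift of
  \<open>\<xi>\<close>.\<close>

lemma J_VF:
  assumes V: "V \<in> prod.VF" shows "(\<lambda>p. J p (V p)) \<in> prod.VF"
proof (rule prod.VFI[OF J_TS[OF prod.VF_TS[OF V]]], rule prod.C_local_mult)
  fix h and p :: "'a \<times> real" assume h: "h \<in> prod.C"
  obtain \<kappa> u E where fr: "local_frame (fst p) \<kappa> u E"
    using local_frame_exists by blast
  then have \<kappa>: "\<kappa> \<in> C" "\<kappa> (fst p) = 1" and u: "\<And>i. i \<in> (Basis::'e set) \<Longrightarrow> u i \<in> C"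
    and E: "\<And>i. i \<in> Basis \<Longrightarrow> E i \<in> VF"
    and frame: "\<And>y v. v \<in> TS y \<Longrightarrow> \<kappa> y *\<^sub>R v = (\<Sum>i\<in>Basis. v (u i) *\<^sub>R E i y)"
    by (simp_all add: local_frame_def)
  let ?c = "\<lambda>i (q :: 'a \<times> real). V q (\<lambda>p. u i (fst p))"
  have c: "?c i \<in> prod.C" if "i \<in> Basis" for i
    by (rule prod.VF_C[OF V fst_C[OF u[OF that]]])
  have "\<kappa> (fst q) * J q (V q) h = (\<Sum>i\<in>Basis. ?c i q * J q (inv_field (E i) (\<lambda>_. 0) q) h)
      + \<kappa> (fst q) * (V q snd * inv_field \<xi> (\<lambda>_. 0) q h)" for q
  proof -
    obtain X where X: "X \<in> VF" "X (fst q) = push_fst (V q)" "inv_field X (\<lambda>_. V q snd) q = V q"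
      by (rule inv_field_through[OF prod.VF_TS[OF V]])
    have cX: "X (fst q) (u i) = ?c i q" if "i \<in> Basis" for i
      using X(2) push_fst_apply[OF u[OF that], of "V q"] by simp
    have lin: "linear_map_on (TS (fst q)) (\<lambda>v. J q (lift (snd q) v) h)"
    proof (rule linear_map_onI)
      fix v w :: "'a tvec" assume vw: "v \<in> TS (fst q)" "w \<in> TS (fst q)"
      have l: "lift (snd q) v \<in> prod.TS q" if "v \<in> TS (fst q)" for v
        using lift_TS[OF that, of "snd q"] by simp
      have "lift (snd q) (v + w) = lift (snd q) v + lift (snd q) w"
        by (simp add: pushforward_def fun_eq_iff)
      then show "J q (lift (snd q) (v + w)) h = J q (lift (snd q) v) h + J q (lift (snd q) w) h"
        using J_add[OF l[OF vw(1)] l[OF vw(2)]] by simp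
      fix c
      have "lift (snd q) (c *\<^sub>R v) = c *\<^sub>R lift (snd q) v"
        by (simp add: pushforward_def fun_eq_iff scaleR_fun_def)
      then show "J q (lift (snd q) (c *\<^sub>R v)) h = c *\<^sub>R J q (lift (snd q) v) h"
        using J_scaleR[OF l[OF vw(1)], of c] by (simp add: scaleR_tvec_apply)
    qed (rule TS_scaleR)
    have lE: "lift (snd q) (E i (fst q)) = inv_field (E i) (\<lambda>_. 0) q" for i
      by (simp add: inv_field_def)
    have "J q (V q) = J q (inv_field X (\<lambda>_. 0) q) + V q snd *\<^sub>R inv_field \<xi> (\<lambda>_. 0) q"
    proof -
      have "J q (V q) = inv_field (\<lambda>x. \<phi> x (X x) + V q snd *\<^sub>R \<xi> x) (\<lambda>x. - \<eta> x (X x)) q"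
        using J_inv_field[OF X(1), of q "\<lambda>_. V q snd"] X(3) by simp
      also have "\<dots> = inv_field (\<lambda>x. \<phi> x (X x)) (\<lambda>x. - \<eta> x (X x)) q
          + inv_field (\<lambda>x. V q snd *\<^sub>R \<xi> x) (\<lambda>x. V q snd * 0) q"
        unfolding inv_field_add[OF phi_VF[OF X(1)] VF_scaleR[OF xi_VF]] by simp
      also have "\<dots> = J q (inv_field X (\<lambda>_. 0) q) + V q snd *\<^sub>R inv_field \<xi> (\<lambda>_. 0) q"
        using J_inv_field[OF X(1), of q "\<lambda>_. 0"] unfolding inv_field_scaleR by simp
      finally show ?thesis .
    qed
    then have "\<kappa> (fst q) * J q (V q) h
        = \<kappa> (fst q) * J q (lift (snd q) (X (fst q))) h + \<kappa> (fst q) * (V q snd * inv_field \<xi> (\<lambda>_. 0) q h)"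
      by (simp add: scaleR_tvec_apply algebra_simps inv_field_def[of X])
    also have "\<kappa> (fst q) * J q (lift (snd q) (X (fst q))) h = J q (lift (snd q) (\<kappa> (fst q) *\<^sub>R X (fst q))) h"
      using linear_map_on_scaleR[OF lin VF_TS[OF X(1)]] by simp
    also have "\<dots> = (\<Sum>i\<in>Basis. X (fst q) (u i) *\<^sub>R J q (lift (snd q) (E i (fst q))) h)"
      unfolding frame[OF VF_TS[OF X(1)]]
      by (rule linear_map_on_sum[OF subspace_TS lin VF_TS[OF E]])
    also have "\<dots> = (\<Sum>i\<in>Basis. ?c i q * J q (inv_field (E i) (\<lambda>_. 0) q) h)"
      by (rule sum.cong) (simp_all add: cX lE)
    finally show ?thesis .
  qed
  moreover have "(\<lambda>q :: 'a \<times> real. (\<Sum>i\<in>Basis. ?c i q * J q (inv_field (E i) (\<lambda>_. 0) q) h)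
      + \<kappa> (fst q) * (V q snd * inv_field \<xi> (\<lambda>_. 0) q h)) \<in> prod.C"
  proof (intro prod.C_add prod.C_sum prod.C_mult fst_C[OF \<kappa>(1)] prod.VF_C[OF V snd_C]
      prod.VF_C[OF inv_field_VF[OF xi_VF C_const] h])
    fix i :: 'e assume i: "i \<in> Basis"
    show "?c i \<in> prod.C" by (rule c[OF i])
    show "(\<lambda>q :: 'a \<times> real. J q (inv_field (E i) (\<lambda>_. 0) q) h) \<in> prod.C"
      unfolding J_inv_field[OF E[OF i]]
      by (rule prod.VF_C[OF inv_field_VF[OF VF_add[OF phi_VF[OF E[OF i]] VF_fmult[OF C_const xi_VF]]
              C_minus[OF \<Omega>_C[OF eta_\<Omega> E[OF i]]]] h])
  qed
  ultimately have "(\<lambda>q :: 'a \<times> real. \<kappa> (fst q) * J q (V q) h) \<in> prod.C" by simp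
  then show "\<exists>k\<in>prod.C. k p \<noteq> 0 \<and> (\<lambda>q. k q * J q (V q) h) \<in> prod.C"
    using fst_C[OF \<kappa>(1)] \<kappa>(2) by (intro bexI[of _ "\<lambda>q. \<kappa> (fst q)"]) simp_all
qed

definition nijenhuis :: "('a \<times> real \<Rightarrow> ('a \<times> real) tvec) \<Rightarrow> ('a \<times> real \<Rightarrow> ('a \<times> real) tvec) \<Rightarrow> 'a \<times> real \<Rightarrow> ('a \<times> real) tvec" where
  "nijenhuis V W p = lie_bracket (\<lambda>p. J p (V p)) (\<lambda>p. J p (W p)) p
     - J p (lie_bracket (\<lambda>p. J p (V p)) W p) - J p (lie_bracket V (\<lambda>p. J p (W p)) p) - lie_bracket V W p"

lemma J_minus: "V \<in> prod.TS p \<Longrightarrow> J p (- V) = - J p V"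
  using J_scaleR[of V p "-1"] by simp

lemma J_diff: "V \<in> prod.TS p \<Longrightarrow> W \<in> prod.TS p \<Longrightarrow> J p (V - W) = J p V - J p W"
  using J_add[OF _ prod.TS_uminus, of V p W] J_minus[of W p] by simp

lemma nijenhuis_skew:
  assumes V: "V \<in> prod.VF" and W: "W \<in> prod.VF"
  shows "nijenhuis V W p = - nijenhuis W V p"
proof -
  note br = prod.VF_TS[OF prod.lie_bracket_VF]
  show ?thesis
    unfolding nijenhuis_def lie_bracket_skew[of "\<lambda>p. J p (V p)" "\<lambda>p. J p (W p)" p]
      lie_bracket_skew[of "\<lambda>p. J p (V p)" W p] lie_bracket_skew[of V "\<lambda>p. J p (W p)" p]
      lie_bracket_skew[of V W p] J_minus[OF br[OF W J_VF[OF V]]] J_minus[OF br[OF J_VF[OF W] V]]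
    by (simp add: algebra_simps)
qed

text \<open>The terms with derivatives of \<open>f\<close> cancel because \<open>J\<close> squares
  to minus the identity.\<close>

lemma nijenhuis_tensor:
  assumes W: "W \<in> prod.VF"
  shows "prod.tensor_at p (\<lambda>V. nijenhuis V W p)"
proof (rule prod.tensor_atI)
  fix V V' assume V: "V \<in> prod.VF" "V' \<in> prod.VF"
  note JV = J_VF[OF V(1)] J_VF[OF V(2)] and JW = J_VF[OF W]
  note br = prod.VF_TS[OF prod.lie_bracket_VF]
  have e: "(\<lambda>p. J p (V p + V' p)) = (\<lambda>p. J p (V p) + J p (V' p))"
    using J_add[OF prod.VF_TS[OF V(1)] prod.VF_TS[OF V(2)]] by (rule ext)
  show "nijenhuis (\<lambda>p. V p + V' p) W p = nijenhuis V W p + nijenhuis V' W p"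
    unfolding nijenhuis_def e prod.lie_bracket_add_left[OF JV JW] prod.lie_bracket_add_left[OF JV W]
      prod.lie_bracket_add_left[OF V JW] prod.lie_bracket_add_left[OF V W]
      J_add[OF br[OF JV(1) W] br[OF JV(2) W]] J_add[OF br[OF V(1) JW] br[OF V(2) JW]]
    by (simp add: algebra_simps)
next
  fix f V assume f: "f \<in> prod.C" and V: "V \<in> prod.VF"
  note JV = J_VF[OF V] and JW = J_VF[OF W]
  note br = prod.VF_TS[OF prod.lie_bracket_VF]
  have e: "(\<lambda>p. J p (f p *\<^sub>R V p)) = (\<lambda>p. f p *\<^sub>R J p (V p))"
    using J_scaleR[OF prod.VF_TS[OF V]] by (rule ext)
  show "nijenhuis (\<lambda>p. f p *\<^sub>R V p) W p = f p *\<^sub>R nijenhuis V W p"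
    unfolding nijenhuis_def e prod.lie_bracket_fmult_left[OF JV JW f] prod.lie_bracket_fmult_left[OF JV W f]
      prod.lie_bracket_fmult_left[OF V JW f] prod.lie_bracket_fmult_left[OF V W f]
      J_diff[OF prod.TS_scaleR[OF br[OF JV W]] prod.TS_scaleR[OF prod.VF_TS[OF JV]]]
      J_diff[OF prod.TS_scaleR[OF br[OF V JW]] prod.TS_scaleR[OF prod.VF_TS[OF V]]]
      J_scaleR[OF br[OF JV W]] J_scaleR[OF br[OF V JW]] J_scaleR[OF prod.VF_TS[OF JV]]
      J_scaleR[OF prod.VF_TS[OF V]] J_J[OF prod.VF_TS[OF V]]
    by (simp add: algebra_simps)
qed

text \<open>The component along M of \<open>J\<close> applied to X + c d/dt.\<close>

abbreviation "twist X c \<equiv> (\<lambda>y. \<phi> y (X y) + c *\<^sub>R \<xi> y)"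

text \<open>Together with \<open>normality_function\<close>, these are the components along M and
  along d/dt of the torsion of \<open>J\<close> on X + c d/dt and Y + d d/dt, with constants c and
  d.\<close>

definition normality_vector :: "('a \<Rightarrow> 'a tvec) \<Rightarrow> real \<Rightarrow> ('a \<Rightarrow> 'a tvec) \<Rightarrow> real \<Rightarrow> 'a \<Rightarrow> 'a tvec" where
  "normality_vector X c Y d x = lie_bracket (twist X c) (twist Y d) x
     - (\<phi> x (lie_bracket (twist X c) Y x) + Y x (\<lambda>y. \<eta> y (X y)) *\<^sub>R \<xi> x)
     - (\<phi> x (lie_bracket X (twist Y d) x) + (- X x (\<lambda>y. \<eta> y (Y y))) *\<^sub>R \<xi> x)
     - lie_bracket X Y x"

definition normality_function :: "('a \<Rightarrow> 'a tvec) \<Rightarrow> real \<Rightarrow> ('a \<Rightarrow> 'a tvec) \<Rightarrow> real \<Rightarrow> 'a \<Rightarrow> real" where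
  "normality_function X c Y d x =
     twist Y d x (\<lambda>y. \<eta> y (X y)) - twist X c x (\<lambda>y. \<eta> y (Y y))
     + \<eta> x (lie_bracket (twist X c) Y x) + \<eta> x (lie_bracket X (twist Y d) x)"

lemma twist_VF: "X \<in> VF \<Longrightarrow> twist X c \<in> VF"
  by (rule VF_add[OF phi_VF VF_scaleR[OF xi_VF]])

lemma nijenhuis_inv_field:
  assumes X: "X \<in> VF" and Y: "Y \<in> VF"
  shows "nijenhuis (inv_field X (\<lambda>_. c)) (inv_field Y (\<lambda>_. d)) p
    = inv_field (normality_vector X c Y d) (normality_function X c Y d) p"
proof -
  note X' = twist_VF[OF X, of c] and Y' = twist_VF[OF Y, of d]
  note eX = \<Omega>_C[OF eta_\<Omega> X] and eY = \<Omega>_C[OF eta_\<Omega> Y]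
  have JX: "(\<lambda>p. J p (inv_field X (\<lambda>_. c) p)) = inv_field (twist X c) (\<lambda>x. - \<eta> x (X x))"
    and JY: "(\<lambda>p. J p (inv_field Y (\<lambda>_. d) p)) = inv_field (twist Y d) (\<lambda>x. - \<eta> x (Y x))"
    by (rule ext, rule J_inv_field[OF X], rule ext, rule J_inv_field[OF Y])
  have t1: "lie_bracket (inv_field (twist X c) (\<lambda>x. - \<eta> x (X x))) (inv_field (twist Y d) (\<lambda>x. - \<eta> x (Y x))) p
      = inv_field (lie_bracket (twist X c) (twist Y d))
        (\<lambda>x. twist Y d x (\<lambda>y. \<eta> y (X y)) - twist X c x (\<lambda>y. \<eta> y (Y y))) p"
    unfolding inv_field_bracket[OF X' C_minus[OF eX] Y' C_minus[OF eY]]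
      VFD_minus[OF X' eY] VFD_minus[OF Y' eX] by (simp add: algebra_simps)
  have t2: "lie_bracket (inv_field (twist X c) (\<lambda>x. - \<eta> x (X x))) (inv_field Y (\<lambda>_. d)) p
      = inv_field (lie_bracket (twist X c) Y) (\<lambda>x. Y x (\<lambda>y. \<eta> y (X y))) p"
    unfolding inv_field_bracket[OF X' C_minus[OF eX] Y C_const] VFD_const[OF X'] VFD_minus[OF Y eX] by simp
  have t3: "lie_bracket (inv_field X (\<lambda>_. c)) (inv_field (twist Y d) (\<lambda>x. - \<eta> x (Y x))) p
      = inv_field (lie_bracket X (twist Y d)) (\<lambda>x. - X x (\<lambda>y. \<eta> y (Y y))) p"
    unfolding inv_field_bracket[OF X C_const Y' C_minus[OF eY]] VFD_const[OF Y'] VFD_minus[OF X eY] by simp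
  have t4: "lie_bracket (inv_field X (\<lambda>_. c)) (inv_field Y (\<lambda>_. d)) p = inv_field (lie_bracket X Y) (\<lambda>_. 0) p"
    unfolding inv_field_bracket[OF X C_const Y C_const] VFD_const[OF X] VFD_const[OF Y] by simp
  note b1 = lie_bracket_VF[OF X' Y'] and b2 = lie_bracket_VF[OF X' Y] and b3 = lie_bracket_VF[OF X Y']
    and b4 = lie_bracket_VF[OF X Y]
  note v2 = VF_add[OF phi_VF[OF b2] VF_fmult[OF VF_C[OF Y eX] xi_VF]]
    and v3 = VF_add[OF phi_VF[OF b3] VF_fmult[OF C_minus[OF VF_C[OF X eY]] xi_VF]]
  show ?thesis
    unfolding nijenhuis_def JX JY t1 t2 t3 t4 J_inv_field[OF b2] J_inv_field[OF b3]
      inv_field_diff[OF b1 v2] inv_field_diff[OF VF_diff[OF b1 v2] v3]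
      inv_field_diff[OF VF_diff[OF VF_diff[OF b1 v2] v3] b4]
      normality_vector_def[abs_def] normality_function_def[abs_def]
    by (simp add: algebra_simps)
qed

lemma normality_vector_VF:
  assumes X: "X \<in> VF" and Y: "Y \<in> VF"
  shows "normality_vector X c Y d \<in> VF"
proof -
  note X' = twist_VF[OF X, of c] and Y' = twist_VF[OF Y, of d]
  note eX = \<Omega>_C[OF eta_\<Omega> X] and eY = \<Omega>_C[OF eta_\<Omega> Y]
  note b1 = lie_bracket_VF[OF X' Y'] and b2 = lie_bracket_VF[OF X' Y] and b3 = lie_bracket_VF[OF X Y']
    and b4 = lie_bracket_VF[OF X Y]
  note v2 = VF_add[OF phi_VF[OF b2] VF_fmult[OF VF_C[OF Y eX] xi_VF]]
    and v3 = VF_add[OF phi_VF[OF b3] VF_fmult[OF C_minus[OF VF_C[OF X eY]] xi_VF]]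
  show ?thesis
    unfolding normality_vector_def[abs_def] by (rule VF_diff[OF VF_diff[OF VF_diff[OF b1 v2] v3] b4])
qed

text \<open>The torsion is a tensor in both arguments, so it vanishes as soon as it vanishes on
  invariant fields with constant components along d/dt.\<close>

lemma normal_iff:
  "normal_structure \<A> \<phi> \<xi> \<eta> \<longleftrightarrow> (\<forall>X\<in>VF. \<forall>Y\<in>VF. \<forall>c d x.
     normality_vector X c Y d x = 0 \<and> normality_function X c Y d x = 0)"
proof -
  have normal: "normal_structure \<A> \<phi> \<xi> \<eta> \<longleftrightarrow> (\<forall>V\<in>prod.VF. \<forall>W\<in>prod.VF. \<forall>p. nijenhuis V W p = 0)"
    by (simp only: normal_structure_def integrable_acs_def nijenhuis_def)
  have zero: "inv_field (\<lambda>_. 0) (\<lambda>_. 0) p = 0" for p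
    using inv_field_scaleR[of 0 "\<lambda>_. 0" "\<lambda>_. 0" p] by simp
  have inv: "nijenhuis (inv_field X (\<lambda>_. c)) (inv_field Y (\<lambda>_. d)) p = 0
      \<longleftrightarrow> normality_vector X c Y d (fst p) = 0 \<and> normality_function X c Y d (fst p) = 0"
    if "X \<in> VF" "Y \<in> VF" for X c Y d p
    using inv_field_eq_iff[OF normality_vector_VF[OF that] VF_0, of c d "normality_function X c Y d" p "\<lambda>_. 0"]
    unfolding nijenhuis_inv_field[OF that] zero .
  show ?thesis
    unfolding normal
  proof (intro iffI ballI allI)
    fix X Y c d x
    assume N: "\<forall>V\<in>prod.VF. \<forall>W\<in>prod.VF. \<forall>p. nijenhuis V W p = 0" and X: "X \<in> VF" and Y: "Y \<in> VF"
    show "normality_vector X c Y d x = 0 \<and> normality_function X c Y d x = 0"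
      using inv[OF X Y, of c d "(x, 0)"] N inv_field_VF[OF X C_const[of c]] inv_field_VF[OF Y C_const[of d]]
      by simp
  next
    fix V W p
    assume N: "\<forall>X\<in>VF. \<forall>Y\<in>VF. \<forall>c d x. normality_vector X c Y d x = 0 \<and> normality_function X c Y d x = 0"
      and V: "V \<in> prod.VF" and W: "W \<in> prod.VF"
    obtain X where X: "X \<in> VF" "inv_field X (\<lambda>_. V p snd) p = V p"
      by (rule inv_field_through[OF prod.VF_TS[OF V]])
    obtain Y where Y: "Y \<in> VF" "inv_field Y (\<lambda>_. W p snd) p = W p"
      by (rule inv_field_through[OF prod.VF_TS[OF W]])
    let ?V = "inv_field X (\<lambda>_. V p snd)" and ?W = "inv_field Y (\<lambda>_. W p snd)"
    have V': "?V \<in> prod.VF" and W': "?W \<in> prod.VF"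
      by (rule inv_field_VF[OF X(1) C_const], rule inv_field_VF[OF Y(1) C_const])
    have "nijenhuis V W p = nijenhuis ?V W p"
      by (rule prod.tensor_at_cong[OF nijenhuis_tensor[OF W] V V' X(2)[symmetric]])
    also have "\<dots> = - nijenhuis W ?V p" by (rule nijenhuis_skew[OF V' W])
    also have "nijenhuis W ?V p = nijenhuis ?W ?V p"
      by (rule prod.tensor_at_cong[OF nijenhuis_tensor[OF V'] W W' Y(2)[symmetric]])
    also have "\<dots> = 0" using inv[OF Y(1) X(1)] N X(1) Y(1) by blast
    finally have "nijenhuis V W p = - 0" .
    then show "nijenhuis V W p = 0" by (simp only: minus_zero)
  qed
qed

end

section \<open>Contact pseudo-metric structures\<close>

locale contact_metric_manifold = pseudo_riemannian \<A> g p q + almost_contact_manifold \<A> \<phi> \<xi> \<eta>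
  for \<A> :: "('a::t2_space, 'e::euclidean_space) atlas" and g p q \<phi> \<xi> \<eta> +
  fixes \<epsilon> :: real
  defines eps_def: "\<epsilon> \<equiv> (- 1) ^ q"
  assumes g_phi_phi: "v \<in> TS x \<Longrightarrow> w \<in> TS x \<Longrightarrow> g x (\<phi> x v) (\<phi> x w) = g x v w - \<epsilon> * \<eta> x v * \<eta> x w"
    and g_phi_dd: "v \<in> TS x \<Longrightarrow> w \<in> TS x \<Longrightarrow> g x (\<phi> x v) w = dd \<eta> x v w"
begin

lemma eps_sq: "\<epsilon> * \<epsilon> = 1"
  by (simp add: eps_def power_mult_distrib[symmetric])

lemma g_xi: "v \<in> TS x \<Longrightarrow> g x v (\<xi> x) = \<epsilon> * \<eta> x v"
  using g_phi_phi[OF _ xi_TS, of v x] g_zero_right[OF phi_TS xi_TS, of v x] eta_xi[of x] phi_xi[of x]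
  by simp

lemma g_xi': "v \<in> TS x \<Longrightarrow> g x (\<xi> x) v = \<epsilon> * \<eta> x v"
  using g_xi[of v x] g_sym[OF xi_TS, of v x] by simp

lemma g_phi_skew: "v \<in> TS x \<Longrightarrow> w \<in> TS x \<Longrightarrow> g x v (\<phi> x w) = - g x (\<phi> x v) w"
  using g_phi_dd[of v x w] g_phi_dd[of w x v] dd_skew[OF eta_\<Omega>, of v x w] g_sym[OF phi_TS, of w x v] by simp

lemma dd_xi: "w \<in> TS x \<Longrightarrow> dd \<eta> x (\<xi> x) w = 0"
  using g_phi_dd[OF xi_TS, of w x] g_zero_left[OF xi_TS, of w x] phi_xi[of x] by simp

abbreviation "ph X \<equiv> (\<lambda>y. \<phi> y (X y))"

definition normality_tensor :: "('a \<Rightarrow> 'a tvec) \<Rightarrow> ('a \<Rightarrow> 'a tvec) \<Rightarrow> 'a \<Rightarrow> 'a tvec" where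
  "normality_tensor X Y x = lie_bracket (ph X) (ph Y) x - \<phi> x (lie_bracket (ph X) Y x)
     - \<phi> x (lie_bracket X (ph Y) x) + \<phi> x (\<phi> x (lie_bracket X Y x)) + dd \<eta> x (X x) (Y x) *\<^sub>R \<xi> x"

text \<open>A rewriting of d eta(xi, X) = 0, using that eta(xi) is constant.\<close>

lemma eta_bracket_xi:
  assumes X: "X \<in> VF"
  shows "\<eta> x (lie_bracket X \<xi> x) = - \<xi> x (\<lambda>y. \<eta> y (X y))"
proof -
  have "dd \<eta> x (\<xi> x) (X x) = 0" by (rule dd_xi[OF VF_TS[OF X]])
  then show ?thesis
    unfolding dd_fields[OF eta_\<Omega> xi_VF X] lie_bracket_skew[of X \<xi> x]
      \<Omega>_minus[OF eta_\<Omega> VF_TS[OF lie_bracket_VF[OF xi_VF X]]] eta_xi VFD_const[OF X] by simp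
qed

text \<open>The torsion of \<open>J\<close> splits into the four classical tensors of an almost
  contact structure. The coefficients of c and d in the vector part are, up to sign, the Lie
  derivative of \<open>\<phi>\<close> along \<open>\<xi>\<close>. The two scalar tensors vanish
  because d eta(phi X, Y) + d eta(X, phi Y) = 0 and d eta(xi, X) = 0.\<close>

lemma normality_expand:
  assumes X: "X \<in> VF" and Y: "Y \<in> VF"
  shows "normality_vector X c Y d x = normality_tensor X Y x
      + d *\<^sub>R (lie_bracket (ph X) \<xi> x - \<phi> x (lie_bracket X \<xi> x))
      - c *\<^sub>R (lie_bracket (ph Y) \<xi> x - \<phi> x (lie_bracket Y \<xi> x))"
    and "normality_function X c Y d x = 0"
proof -
  note pX = phi_VF[OF X] and pY = phi_VF[OF Y]
  note cx = VF_scaleR[OF xi_VF, of c] and dx = VF_scaleR[OF xi_VF, of d]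
  have xs: "lie_bracket Z (\<lambda>y. k *\<^sub>R \<xi> y) x = k *\<^sub>R lie_bracket Z \<xi> x" if "Z \<in> VF" for Z k
    using lie_bracket_fmult_right[OF that xi_VF C_const[of k]] VFD_const[OF that] by simp
  have xs': "lie_bracket (\<lambda>y. k *\<^sub>R \<xi> y) Z x = - (k *\<^sub>R lie_bracket Z \<xi> x)" if "Z \<in> VF" for Z k
    using xs[OF that, of k] lie_bracket_skew[of "\<lambda>y. k *\<^sub>R \<xi> y" Z x] by simp
  have b1: "lie_bracket (twist X c) (twist Y d) x = lie_bracket (ph X) (ph Y) x
      + d *\<^sub>R lie_bracket (ph X) \<xi> x - c *\<^sub>R lie_bracket (ph Y) \<xi> x"
    unfolding lie_bracket_add_left[OF pX cx twist_VF[OF Y]] lie_bracket_add_right[OF pX pY dx]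
      lie_bracket_add_right[OF cx pY dx] xs[OF pX] xs'[OF pY] xs[OF cx] xs'[OF xi_VF] lie_bracket_self
    by simp
  have b2: "lie_bracket (twist X c) Y x = lie_bracket (ph X) Y x - c *\<^sub>R lie_bracket Y \<xi> x"
    unfolding lie_bracket_add_left[OF pX cx Y] xs'[OF Y] by simp
  have b3: "lie_bracket X (twist Y d) x = lie_bracket X (ph Y) x + d *\<^sub>R lie_bracket X \<xi> x"
    unfolding lie_bracket_add_right[OF X pY dx] xs[OF X] by simp
  have br: "lie_bracket V W x \<in> TS x" if "V \<in> VF" "W \<in> VF" for V W
    by (rule VF_TS[OF lie_bracket_VF[OF that]])
  have f2: "\<phi> x (lie_bracket (ph X) Y x - c *\<^sub>R lie_bracket Y \<xi> x)
      = \<phi> x (lie_bracket (ph X) Y x) - c *\<^sub>R \<phi> x (lie_bracket Y \<xi> x)"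
    using phi_diff[OF br[OF pX Y] TS_scaleR[OF br[OF Y xi_VF]]] phi_scaleR[OF br[OF Y xi_VF]] by simp
  have f3: "\<phi> x (lie_bracket X (ph Y) x + d *\<^sub>R lie_bracket X \<xi> x)
      = \<phi> x (lie_bracket X (ph Y) x) + d *\<^sub>R \<phi> x (lie_bracket X \<xi> x)"
    using phi_add[OF br[OF X pY] TS_scaleR[OF br[OF X xi_VF]]] phi_scaleR[OF br[OF X xi_VF]] by simp
  show "normality_vector X c Y d x = normality_tensor X Y x
      + d *\<^sub>R (lie_bracket (ph X) \<xi> x - \<phi> x (lie_bracket X \<xi> x))
      - c *\<^sub>R (lie_bracket (ph Y) \<xi> x - \<phi> x (lie_bracket Y \<xi> x))"
    unfolding normality_vector_def normality_tensor_def b1 b2 b3 f2 f3 phi_phi[OF br[OF X Y]]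
      dd_fields[OF eta_\<Omega> X Y]
    by (simp add: algebra_simps)
  have e2: "\<eta> x (lie_bracket (ph X) Y x - c *\<^sub>R lie_bracket Y \<xi> x)
      = \<eta> x (lie_bracket (ph X) Y x) - c * \<eta> x (lie_bracket Y \<xi> x)"
    using \<Omega>_diff[OF eta_\<Omega> br[OF pX Y] TS_scaleR[OF br[OF Y xi_VF]]]
      \<Omega>_scaleR[OF eta_\<Omega> br[OF Y xi_VF]] by simp
  have e3: "\<eta> x (lie_bracket X (ph Y) x + d *\<^sub>R lie_bracket X \<xi> x)
      = \<eta> x (lie_bracket X (ph Y) x) + d * \<eta> x (lie_bracket X \<xi> x)"
    using \<Omega>_add[OF eta_\<Omega> br[OF X pY] TS_scaleR[OF br[OF X xi_VF]]]
      \<Omega>_scaleR[OF eta_\<Omega> br[OF X xi_VF]] by simp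
  have z: "(\<lambda>y. \<eta> y (ph Z y)) = (\<lambda>y. 0)" if "Z \<in> VF" for Z
    using eta_phi[OF VF_TS[OF that]] by (rule ext)
  have s1: "\<phi> x (Y x) (\<lambda>y. \<eta> y (X y)) + \<eta> x (lie_bracket X (ph Y) x) = - dd \<eta> x (X x) (\<phi> x (Y x))"
    unfolding dd_fields[OF eta_\<Omega> X pY] z[OF Y] VFD_const[OF X] by simp
  have s2: "\<phi> x (X x) (\<lambda>y. \<eta> y (Y y)) - \<eta> x (lie_bracket (ph X) Y x) = dd \<eta> x (\<phi> x (X x)) (Y x)"
    unfolding dd_fields[OF eta_\<Omega> pX Y] z[OF X] VFD_const[OF Y] by simp
  have s3: "dd \<eta> x (X x) (\<phi> x (Y x)) + dd \<eta> x (\<phi> x (X x)) (Y x) = 0"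
    using g_phi_dd[OF VF_TS[OF X] VF_TS[OF pY], of x] g_phi_dd[OF VF_TS[OF pX] VF_TS[OF Y], of x]
      g_phi_skew[OF VF_TS[OF pX] VF_TS[OF Y], of x] by simp
  show "normality_function X c Y d x = 0"
    unfolding normality_function_def b2 b3 e2 e3 eta_bracket_xi[OF X] eta_bracket_xi[OF Y]
    using s1 s2 s3 by (simp add: scaleR_tvec_apply algebra_simps)
qed

text \<open>The remaining obstruction, the Lie derivative of \<open>\<phi>\<close> along
  \<open>\<xi>\<close>, is controlled by the tensor itself: the value of the tensor on X and xi is,
  up to sign, \<open>\<phi>\<close> applied to that Lie derivative. One more application of
  \<open>\<phi>\<close> recovers the Lie derivative, since \<open>\<eta>\<close> vanishes on
  it.\<close>

lemma normal_iff_tensor: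
  "normal_structure \<A> \<phi> \<xi> \<eta> \<longleftrightarrow> (\<forall>X\<in>VF. \<forall>Y\<in>VF. \<forall>x. normality_tensor X Y x = 0)"
proof (intro iffI ballI allI)
  fix X Y x assume "normal_structure \<A> \<phi> \<xi> \<eta>" and X: "X \<in> VF" "Y \<in> VF"
  then have "normality_vector X 0 Y 0 x = 0" by (simp add: normal_iff)
  moreover have "normality_vector X 0 Y 0 x = normality_tensor X Y x"
    unfolding normality_expand(1)[OF X] scaleR_zero_left by (simp only: add_0_right diff_0_right)
  ultimately show "normality_tensor X Y x = 0" by metis
next
  assume T: "\<forall>X\<in>VF. \<forall>Y\<in>VF. \<forall>x. normality_tensor X Y x = 0"
  have N3: "lie_bracket (ph X) \<xi> x - \<phi> x (lie_bracket X \<xi> x) = 0" if X: "X \<in> VF" for X x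
  proof -
    note pX = phi_VF[OF X]
    have br: "lie_bracket V W x \<in> TS x" if "V \<in> VF" "W \<in> VF" for V W
      by (rule VF_TS[OF lie_bracket_VF[OF that]])
    have px: "ph \<xi> = (\<lambda>y. 0)" using phi_xi by (rule ext)
    have b0: "lie_bracket Z (\<lambda>y. 0) x = 0" if "Z \<in> VF" for Z
      using lie_bracket_fmult_right[OF that VF_0 C_const[of 0], of x] VFD_const[OF that, of x 0] by simp
    have d0: "dd \<eta> x (X x) (\<xi> x) = 0"
      using dd_skew[OF eta_\<Omega> VF_TS[OF X] xi_TS, of x] dd_xi[OF VF_TS[OF X], of x] by simp
    have t: "normality_tensor X \<xi> x = \<phi> x (\<phi> x (lie_bracket X \<xi> x)) - \<phi> x (lie_bracket (ph X) \<xi> x)"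
      unfolding normality_tensor_def px b0[OF pX] b0[OF X] phi_zero d0 by simp
    have "\<phi> x (\<phi> x (lie_bracket X \<xi> x)) = \<phi> x (lie_bracket (ph X) \<xi> x)"
      using T X xi_VF t by (metis eq_iff_diff_eq_0)
    then have "\<phi> x (\<phi> x (\<phi> x (lie_bracket X \<xi> x))) = \<phi> x (\<phi> x (lie_bracket (ph X) \<xi> x))" by simp
    moreover have "\<eta> x (lie_bracket (ph X) \<xi> x) = 0"
      using eta_bracket_xi[OF pX, of x] eta_phi[OF VF_TS[OF X]] VFD_const[OF xi_VF] by simp
    ultimately have "- \<phi> x (lie_bracket X \<xi> x) = - lie_bracket (ph X) \<xi> x"
      using phi_phi[OF phi_TS[OF br[OF X xi_VF]]] phi_phi[OF br[OF pX xi_VF]]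
        eta_phi[OF br[OF X xi_VF]] by simp
    then show ?thesis by (metis neg_equal_iff_equal right_minus_eq)
  qed
  show "normal_structure \<A> \<phi> \<xi> \<eta>"
    unfolding normal_iff
  proof (intro ballI allI conjI)
    fix X Y c d x assume X: "X \<in> VF" "Y \<in> VF"
    have "normality_tensor X Y x = 0" using T X by blast
    then show "normality_vector X c Y d x = 0"
      unfolding normality_expand(1)[OF X] N3[OF X(1)] N3[OF X(2)] by (simp only: scaleR_zero_right) simp
    show "normality_function X c Y d x = 0" by (rule normality_expand(2)[OF X])
  qed
qed

text \<open>The equation for the covariant derivative of \<open>\<phi>\<close>, paired with Z.
  Pairing turns \<open>\<xi>\<close> into \<epsilon> times eta(Z), so that \<epsilon> comes out as a
  common factor.\<close>

definition sasaki_condition :: "(('a \<Rightarrow> 'a tvec) \<Rightarrow> ('a \<Rightarrow> 'a tvec) \<Rightarrow> 'a \<Rightarrow> 'a tvec) \<Rightarrow> bool" where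
  "sasaki_condition D \<longleftrightarrow> (\<forall>X\<in>VF. \<forall>Y\<in>VF. \<forall>Z\<in>VF. \<forall>x.
     g x (D X (ph Y) x - \<phi> x (D X Y x)) (Z x)
       = \<epsilon> / 2 * (\<eta> x (Y x) * g x (X x) (Z x) - g x (X x) (Y x) * \<eta> x (Z x)))"

end

text \<open>A trilinear form that is skew in the last two arguments, has vanishing cyclic sum and the
  stated behaviour under \<open>\<phi>\<close> vanishes: the form \<open>Q(X, Y, Z) = b(\<phi> X, Y, Z) + b(X, Y, \<phi> Z)\<close> is
  symmetric in \<open>X, Y\<close> and skew in \<open>Y, Z\<close>, hence zero, and the cyclic sum does the rest.\<close>

lemma trilinear_vanishing:
  fixes b :: "'v \<Rightarrow> 'v \<Rightarrow> 'v \<Rightarrow> real" and ph :: "'v \<Rightarrow> 'v" and et :: "'v \<Rightarrow> real"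
  assumes S: "\<And>X. X \<in> S \<Longrightarrow> ph X \<in> S" "xi \<in> S"
    and skew: "\<And>X Y Z. X \<in> S \<Longrightarrow> Y \<in> S \<Longrightarrow> Z \<in> S \<Longrightarrow> b X Y Z = - b X Z Y"
    and cyc: "\<And>X Y Z. X \<in> S \<Longrightarrow> Y \<in> S \<Longrightarrow> Z \<in> S \<Longrightarrow> b X Y Z + b Y Z X + b Z X Y = 0"
    and third: "\<And>X Y Z. X \<in> S \<Longrightarrow> Y \<in> S \<Longrightarrow> Z \<in> S \<Longrightarrow> b X (ph Y) Z = b X Y (ph Z)"
    and T: "\<And>X Y Z. X \<in> S \<Longrightarrow> Y \<in> S \<Longrightarrow> Z \<in> S \<Longrightarrow>
      b (ph X) Y Z - b (ph Y) X Z - b Y X (ph Z) + b X Y (ph Z) = 0"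
    and dec: "\<And>X Y Z. X \<in> S \<Longrightarrow> Y \<in> S \<Longrightarrow> Z \<in> S \<Longrightarrow> b X Y Z = - b X Y (ph (ph Z)) + et Z * b X Y xi"
    and X: "X \<in> S" and Y: "Y \<in> S" and Z: "Z \<in> S"
  shows "b X Y Z = 0"
proof -
  define Q where "Q X Y Z = b (ph X) Y Z + b X Y (ph Z)" for X Y Z
  have Qs: "Q X Y Z = Q Y X Z" if "X \<in> S" "Y \<in> S" "Z \<in> S" for X Y Z
    using T[OF that] by (simp add: Q_def)
  have Qa: "Q X Y Z = - Q X Z Y" if "X \<in> S" "Y \<in> S" "Z \<in> S" for X Y Z
    using skew[OF S(1)[OF that(1)] that(2,3)] skew[OF that(1,2) S(1)[OF that(3)]] third[OF that(1,3,2)]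
    by (simp add: Q_def)
  have Q0: "Q X Y Z = 0" if s: "X \<in> S" "Y \<in> S" "Z \<in> S" for X Y Z
    using Qs[OF s] Qa[OF s(2,1,3)] Qs[OF s(2,3,1)] Qa[OF s(3,2,1)] Qs[OF s(3,1,2)] Qa[OF s]
    by linarith
  have q: "b (ph X) Y Z = - b X Y (ph Z)" if "X \<in> S" "Y \<in> S" "Z \<in> S" for X Y Z
    using Q0[OF that] by (simp add: Q_def)
  \<comment> \<open>The cyclic sum at (X, Y, phi Z) with every \<open>ph\<close> moved to the third
    slot: from the second slot by \<open>third\<close>, from the first by \<open>q\<close>, which
    costs a sign. Three cyclic instances then force every term to be 0.\<close>
  have c: "b X Y (ph Z) + b Y Z (ph X) - b Z X (ph Y) = 0" if s: "X \<in> S" "Y \<in> S" "Z \<in> S" for X Y Z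
    using cyc[OF s(1,2) S(1)[OF s(3)]] third[OF s(2,3,1)] q[OF s(3,1,2)] by simp
  have b0: "b X Y (ph Z) = 0" if s: "X \<in> S" "Y \<in> S" "Z \<in> S" for X Y Z
    using c[OF s] c[OF s(2,3,1)] c[OF s(3,1,2)] by linarith
  have d: "b X Y Z = et Z * b X Y xi" if s: "X \<in> S" "Y \<in> S" "Z \<in> S" for X Y Z
    using dec[OF s] b0[OF s(1,2) S(1)[OF s(3)]] by simp
  \<comment> \<open>By \<open>d\<close> the form depends on its third argument only through
    \<open>et\<close>, with the value at \<open>xi\<close> as coefficient. Skew-symmetry makes this
    coefficient vanish, first for \<open>xi\<close> and then for every second argument.\<close>
  have "b X xi xi = 0" using skew[OF X S(2) S(2)] by simp
  then have "b X xi Y = 0" using d[OF X S(2) Y] by simp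
  then have "b X Y xi = 0" using skew[OF X Y S(2)] by simp
  then show ?thesis using d[OF X Y Z] by simp
qed

section \<open>Covariant derivatives of phi and eta\<close>

context contact_metric_manifold
begin

context
  fixes D
  assumes lc: "levi_civita \<A> (tangent_algebroid \<A>) g D"
begin

lemma D_VF: "X \<in> VF \<Longrightarrow> Y \<in> VF \<Longrightarrow> D X Y \<in> VF"
  using lc by (simp add: levi_civita_def tangent_algebroid_def)

lemma D_TS: "X \<in> VF \<Longrightarrow> Y \<in> VF \<Longrightarrow> D X Y x \<in> TS x"
  by (rule VF_TS[OF D_VF])

lemma D_linear_right: "X \<in> VF \<Longrightarrow> linear_map_on VF (D X)"
  using lc by (simp add: levi_civita_def tangent_algebroid_def)

lemma D_linear_left: "Y \<in> VF \<Longrightarrow> linear_map_on VF (\<lambda>X. D X Y)"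
  using lc by (simp add: levi_civita_def tangent_algebroid_def)

lemma D_fmult_left: "f \<in> C \<Longrightarrow> X \<in> VF \<Longrightarrow> Y \<in> VF \<Longrightarrow> D (\<lambda>x. f x *\<^sub>R X x) Y = (\<lambda>x. f x *\<^sub>R D X Y x)"
  using lc by (simp add: levi_civita_def tangent_algebroid_def)

lemma D_fmult_right: "f \<in> C \<Longrightarrow> X \<in> VF \<Longrightarrow> Y \<in> VF \<Longrightarrow>
    D X (\<lambda>x. f x *\<^sub>R Y x) = (\<lambda>x. f x *\<^sub>R D X Y x + X x f *\<^sub>R Y x)"
  using lc by (simp add: levi_civita_def tangent_algebroid_def)

lemma D_torsion:
  assumes "X \<in> VF" "Y \<in> VF" shows "lie_bracket X Y x = D X Y x - D Y X x"
proof -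
  have "(\<lambda>x. D X Y x - D Y X x) = lie_bracket X Y"
    using lc assms by (simp add: levi_civita_def tangent_algebroid_def)
  from fun_cong[OF this, of x] show ?thesis by (rule sym)
qed

lemma D_metric: "X \<in> VF \<Longrightarrow> Y \<in> VF \<Longrightarrow> Z \<in> VF \<Longrightarrow>
    X x (\<lambda>y. g y (Y y) (Z y)) = g x (D X Y x) (Z x) + g x (Y x) (D X Z x)"
  using lc by (simp add: levi_civita_def tangent_algebroid_def)

lemma D_add_right:
  assumes "X \<in> VF" "Y \<in> VF" "Z \<in> VF" shows "D X (\<lambda>y. Y y + Z y) = (\<lambda>y. D X Y y + D X Z y)"
  using linear_map_on_add[OF D_linear_right[OF assms(1)] assms(2,3)] unfolding plus_fun_def .

lemma D_minus_right:
  assumes "X \<in> VF" "Y \<in> VF" shows "D X (\<lambda>y. - Y y) = (\<lambda>y. - D X Y y)"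
  using linear_map_on_minus[OF D_linear_right[OF assms(1)] assms(2)] unfolding fun_Compl_def .

lemma D_zero_right:
  assumes "X \<in> VF" shows "D X (\<lambda>y. 0) = (\<lambda>y. 0)"
  using D_fmult_right[OF C_const[of 0] assms VF_0] VFD_const[OF assms, of _ 0] by simp

lemma D_zero_left:
  assumes "X \<in> VF" shows "D (\<lambda>y. 0) X = (\<lambda>y. 0)"
  using D_fmult_left[OF C_const[of 0] VF_0 assms] by simp

text \<open>\<open>B X Y Z = g((\<nabla>\<^sub>X \<phi>) Y, Z)\<close> and \<open>K X Y = (\<nabla>\<^sub>X \<eta>)(Y)\<close>.\<close>

definition "B X Y Z x = g x (D X (ph Y) x - \<phi> x (D X Y x)) (Z x)"

definition "K X Y x = \<epsilon> * g x (D X \<xi> x) (Y x)"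

lemma Dphi_TS: "X \<in> VF \<Longrightarrow> Y \<in> VF \<Longrightarrow> D X (ph Y) x - \<phi> x (D X Y x) \<in> TS x"
  by (rule TS_diff_closed[OF D_TS[OF _ phi_VF] phi_TS[OF D_TS]])

lemma B_expand:
  assumes "X \<in> VF" "Y \<in> VF" "Z \<in> VF"
  shows "B X Y Z x = g x (D X (ph Y) x) (Z x) - g x (\<phi> x (D X Y x)) (Z x)"
  unfolding B_def
  by (rule g_diff_left[OF D_TS[OF assms(1) phi_VF[OF assms(2)]] VF_TS[OF assms(3)] phi_TS[OF D_TS[OF assms(1,2)]]])

text \<open>\<open>B\<close> is the covariant derivative of the 2-form d eta, because
  \<open>g\<close> is parallel and d eta is \<open>g\<close> with \<open>\<phi>\<close> in the first
  slot. Skew-symmetry and the cyclic identity are read off from this form.\<close>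

lemma B_Phi:
  assumes X: "X \<in> VF" and Y: "Y \<in> VF" and Z: "Z \<in> VF"
  shows "B X Y Z x = X x (\<lambda>y. dd \<eta> y (Y y) (Z y)) - dd \<eta> x (Y x) (D X Z x) - dd \<eta> x (D X Y x) (Z x)"
proof -
  have "(\<lambda>y. dd \<eta> y (Y y) (Z y)) = (\<lambda>y. g y (ph Y y) (Z y))"
    using g_phi_dd[OF VF_TS[OF Y] VF_TS[OF Z]] by simp
  then show ?thesis
    unfolding B_expand[OF X Y Z] using D_metric[OF X phi_VF[OF Y] Z, of x]
      g_phi_dd[OF VF_TS[OF Y] D_TS[OF X Z], of x] g_phi_dd[OF D_TS[OF X Y] VF_TS[OF Z], of x] by simp
qed

lemma B_skew:
  assumes X: "X \<in> VF" and Y: "Y \<in> VF" and Z: "Z \<in> VF"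
  shows "B X Y Z x = - B X Z Y x"
proof -
  have e: "(\<lambda>y. dd \<eta> y (Z y) (Y y)) = (\<lambda>y. - dd \<eta> y (Y y) (Z y))"
    using dd_skew[OF eta_\<Omega> VF_TS[OF Z] VF_TS[OF Y]] by (rule ext)
  show ?thesis
    unfolding B_Phi[OF X Y Z] B_Phi[OF X Z Y] e VFD_minus[OF X dd_C[OF eta_\<Omega> Y Z]]
    using dd_skew[OF eta_\<Omega> VF_TS[OF Y] D_TS[OF X Z], of x] dd_skew[OF eta_\<Omega> D_TS[OF X Y] VF_TS[OF Z], of x]
    by simp
qed

text \<open>For a torsion-free connection the cyclic sum of the covariant derivative of a 2-form is
  its exterior derivative, and d eta is closed.\<close>

lemma B_cyclic:
  assumes X: "X \<in> VF" and Y: "Y \<in> VF" and Z: "Z \<in> VF"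
  shows "B X Y Z x + B Y Z X x + B Z X Y x = 0"
proof -
  have d: "dd \<eta> x (lie_bracket V W x) (U x) = dd \<eta> x (D V W x) (U x) + dd \<eta> x (U x) (D W V x)"
    if "V \<in> VF" "W \<in> VF" "U \<in> VF" for V W U
  proof -
    note m = D_TS[OF that(1,2), of x] D_TS[OF that(2,1), of x] VF_TS[OF that(3), of x]
    have "dd \<eta> x (D V W x - D W V x) (U x) = - dd \<eta> x (U x) (D V W x - D W V x)"
      by (rule dd_skew[OF eta_\<Omega> TS_diff_closed[OF m(1,2)] m(3)])
    also have "dd \<eta> x (U x) (D V W x - D W V x) = dd \<eta> x (U x) (D V W x) - dd \<eta> x (U x) (D W V x)"
      by (rule linear_map_on_diff[OF dd_linear[OF eta_\<Omega> m(3)] m(1,2)])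
    finally have c: "dd \<eta> x (D V W x - D W V x) (U x)
        = - (dd \<eta> x (U x) (D V W x) - dd \<eta> x (U x) (D W V x))" .
    show ?thesis
      unfolding D_torsion[OF that(1,2)] c using dd_skew[OF eta_\<Omega> m(1,3)] by simp
  qed
  show ?thesis
    unfolding B_Phi[OF X Y Z] B_Phi[OF Y Z X] B_Phi[OF Z X Y]
    using dd_closed[OF eta_\<Omega> X Y Z, of x] d[OF X Y Z] d[OF Y Z X] d[OF Z X Y] by simp
qed

lemma B_xi:
  assumes X: "X \<in> VF" and Z: "Z \<in> VF"
  shows "B X \<xi> Z x = \<epsilon> * K X (ph Z) x"
proof -
  have px: "ph \<xi> = (\<lambda>y. 0)" using phi_xi by (rule ext)
  have "B X \<xi> Z x = - g x (\<phi> x (D X \<xi> x)) (Z x)"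
    unfolding B_expand[OF X xi_VF Z] px D_zero_right[OF X] g_zero_left[OF xi_TS VF_TS[OF Z]] by simp
  then show ?thesis
    unfolding K_def g_phi_skew[OF D_TS[OF X xi_VF] VF_TS[OF Z]]
    using eps_sq by (simp add: mult.assoc[symmetric])
qed

lemma K_eta:
  assumes X: "X \<in> VF" and Y: "Y \<in> VF"
  shows "K X Y x = X x (\<lambda>y. \<eta> y (Y y)) - \<eta> x (D X Y x)"
proof -
  have e: "(\<lambda>y. g y (\<xi> y) (Y y)) = (\<lambda>y. \<epsilon> * \<eta> y (Y y))"
    using g_xi'[OF VF_TS[OF Y]] by (rule ext)
  have "\<epsilon> * X x (\<lambda>y. \<eta> y (Y y)) = g x (D X \<xi> x) (Y x) + \<epsilon> * \<eta> x (D X Y x)"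
    using D_metric[OF X xi_VF Y, of x] unfolding e VFD_cmult[OF X \<Omega>_C[OF eta_\<Omega> Y]] g_xi'[OF D_TS[OF X Y]] .
  then have "\<epsilon> * (\<epsilon> * X x (\<lambda>y. \<eta> y (Y y))) = \<epsilon> * g x (D X \<xi> x) (Y x) + \<epsilon> * (\<epsilon> * \<eta> x (D X Y x))"
    by (simp add: algebra_simps)
  then show ?thesis
    unfolding K_def mult.assoc[symmetric] eps_sq by simp
qed

lemma K_alt:
  assumes X: "X \<in> VF" and Y: "Y \<in> VF"
  shows "K X Y x - K Y X x = dd \<eta> x (X x) (Y x)"
  unfolding K_eta[OF X Y] K_eta[OF Y X] dd_fields[OF eta_\<Omega> X Y] D_torsion[OF X Y]
    \<Omega>_diff[OF eta_\<Omega> D_TS[OF X Y] D_TS[OF Y X]] by simp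

text \<open>\<open>\<xi>\<close> has the constant square \<epsilon>, so its derivative is orthogonal
  to it.\<close>

lemma K_xi_right:
  assumes X: "X \<in> VF" shows "K X \<xi> x = 0"
proof -
  have "(\<lambda>y. g y (\<xi> y) (\<xi> y)) = (\<lambda>y. \<epsilon>)"
    using g_xi[OF xi_TS] eta_xi by simp
  then have "0 = g x (D X \<xi> x) (\<xi> x) + g x (\<xi> x) (D X \<xi> x)"
    using D_metric[OF X xi_VF xi_VF, of x] VFD_const[OF X, of x \<epsilon>] by simp
  then show ?thesis using g_sym[OF xi_TS D_TS[OF X xi_VF], of x] by (simp add: K_def)
qed

lemma ph_ph: "X \<in> VF \<Longrightarrow> ph (ph X) = (\<lambda>y. - X y + \<eta> y (X y) *\<^sub>R \<xi> y)"
  by (rule ext, rule phi_phi[OF VF_TS])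

lemma K_ph_ph_right:
  assumes X: "X \<in> VF" and Y: "Y \<in> VF"
  shows "K X (ph (ph Y)) x = - K X Y x"
proof -
  note m = D_TS[OF X xi_VF, of x] VF_TS[OF Y, of x]
  have e: "g x (D X \<xi> x) (- Y x + \<eta> x (Y x) *\<^sub>R \<xi> x) = - g x (D X \<xi> x) (Y x) + \<eta> x (Y x) * g x (D X \<xi> x) (\<xi> x)"
    using g_add_right[OF m(1) TS_uminus[OF m(2)] TS_scaleR[OF xi_TS]] g_minus_right[OF m]
      g_scaleR_right[OF m(1) xi_TS] by simp
  moreover have "\<epsilon> * g x (D X \<xi> x) (\<xi> x) = 0" using K_xi_right[OF X, of x] by (simp add: K_def)
  ultimately show ?thesis
    unfolding K_def ph_ph[OF Y] e by (auto simp: algebra_simps)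
qed

text \<open>\<open>K\<close> differs from its transpose by d eta, on which the square of
  \<open>\<phi>\<close> acts as minus the identity. This transfers the rule from the second argument
  to the first.\<close>

lemma K_ph_ph_left:
  assumes X: "X \<in> VF" and Y: "Y \<in> VF"
  shows "K (ph (ph X)) Y x = - K X Y x"
  using K_alt[OF phi_VF[OF phi_VF[OF X]] Y, of x] K_ph_ph_right[OF Y X, of x] K_alt[OF X Y, of x]
    dd_skew[OF eta_\<Omega> VF_TS[OF phi_VF[OF phi_VF[OF X]]] VF_TS[OF Y], of x]
    g_phi_dd[OF VF_TS[OF Y] VF_TS[OF phi_VF[OF phi_VF[OF X]]], of x]
    g_phi_phi[OF VF_TS[OF Y] VF_TS[OF phi_VF[OF X]], of x] eta_phi[OF VF_TS[OF X], of x]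
    g_phi_skew[OF VF_TS[OF Y] VF_TS[OF X], of x] g_phi_dd[OF VF_TS[OF Y] VF_TS[OF X], of x]
    dd_skew[OF eta_\<Omega> VF_TS[OF X] VF_TS[OF Y], of x]
  by simp

text \<open>The covariant derivative of the structure equation phi phi = - id + eta (x) xi. The left
  side gives the covariant derivative of \<open>\<phi>\<close> composed with \<open>\<phi>\<close>
  in either order, the right side the derivatives of \<open>\<eta>\<close> and
  \<open>\<xi>\<close>.\<close>

lemma B_third:
  assumes X: "X \<in> VF" and Y: "Y \<in> VF" and Z: "Z \<in> VF"
  shows "B X (ph Y) Z x - B X Y (ph Z) x = \<epsilon> * K X Y x * \<eta> x (Z x) + \<epsilon> * \<eta> x (Y x) * K X Z x"
proof -
  note pY = phi_VF[OF Y] and eY = \<Omega>_C[OF eta_\<Omega> Y]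
  have "D X (ph (ph Y)) = (\<lambda>y. - D X Y y + (\<eta> y (Y y) *\<^sub>R D X \<xi> y + X y (\<lambda>y. \<eta> y (Y y)) *\<^sub>R \<xi> y))"
    unfolding ph_ph[OF Y] D_add_right[OF X VF_uminus[OF Y] VF_fmult[OF eY xi_VF]] D_minus_right[OF X Y]
      D_fmult_right[OF eY X xi_VF] ..
  then have e: "D X (ph (ph Y)) x = - D X Y x + (\<eta> x (Y x) *\<^sub>R D X \<xi> x + X x (\<lambda>y. \<eta> y (Y y)) *\<^sub>R \<xi> x)"
    by simp
  note m = D_TS[OF X Y, of x] D_TS[OF X xi_VF, of x] xi_TS[of x] VF_TS[OF Z, of x]
  have 1: "g x (D X (ph (ph Y)) x) (Z x)
      = - g x (D X Y x) (Z x) + \<eta> x (Y x) * g x (D X \<xi> x) (Z x) + X x (\<lambda>y. \<eta> y (Y y)) * (\<epsilon> * \<eta> x (Z x))"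
    unfolding e
    using g_add_left[OF TS_uminus[OF m(1)] m(4) TS_plus[OF TS_scaleR[OF m(2)] TS_scaleR[OF m(3)]]]
      g_add_left[OF TS_scaleR[OF m(2)] m(4) TS_scaleR[OF m(3)]] g_minus_left[OF m(1,4)]
      g_scaleR_left[OF m(2,4)] g_scaleR_left[OF m(3,4)] g_xi'[OF m(4)] by simp
  have 2: "g x (\<phi> x (D X Y x)) (\<phi> x (Z x)) = g x (D X Y x) (Z x) - \<epsilon> * \<eta> x (D X Y x) * \<eta> x (Z x)"
    by (rule g_phi_phi[OF m(1,4)])
  have 3: "g x (D X (ph Y) x) (\<phi> x (Z x)) = - g x (\<phi> x (D X (ph Y) x)) (Z x)"
    by (rule g_phi_skew[OF D_TS[OF X pY] m(4)])
  have 4: "g x (D X \<xi> x) (Z x) = \<epsilon> * K X Z x"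
    unfolding K_def using eps_sq by (simp add: mult.assoc[symmetric])
  show ?thesis
    unfolding B_expand[OF X pY Z] B_expand[OF X Y phi_VF[OF Z]] 1 2 3 4 K_eta[OF X Y]
    by (simp add: algebra_simps)
qed

text \<open>Vanishing torsion replaces every bracket by covariant derivatives, and these regroup
  into covariant derivatives of \<open>\<phi>\<close>. Where a further \<open>\<phi>\<close> stands
  outside, its skewness moves it onto Z.\<close>

lemma normality_B:
  assumes X: "X \<in> VF" and Y: "Y \<in> VF" and Z: "Z \<in> VF"
  shows "g x (normality_tensor X Y x) (Z x)
    = B (ph X) Y Z x - B (ph Y) X Z x - B Y X (ph Z) x + B X Y (ph Z) x + \<epsilon> * dd \<eta> x (X x) (Y x) * \<eta> x (Z x)"
proof -
  note pX = phi_VF[OF X] and pY = phi_VF[OF Y] and pZ = phi_VF[OF Z]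
  let ?P = "\<lambda>X Y. D X (ph Y) x - \<phi> x (D X Y x)"
  note P = Dphi_TS[of _ _ x]
  have phid: "\<phi> x (v - w) = \<phi> x v - \<phi> x w" if "v \<in> TS x" "w \<in> TS x" for v w
    by (rule phi_diff[OF that])
  have "normality_tensor X Y x = ?P (ph X) Y - ?P (ph Y) X + (\<phi> x (?P Y X) - \<phi> x (?P X Y))
      + dd \<eta> x (X x) (Y x) *\<^sub>R \<xi> x"
    unfolding normality_tensor_def D_torsion[OF pX pY] D_torsion[OF pX Y] D_torsion[OF X pY] D_torsion[OF X Y]
      phid[OF D_TS[OF pX Y] D_TS[OF Y pX]] phid[OF D_TS[OF X pY] D_TS[OF pY X]] phid[OF D_TS[OF X Y] D_TS[OF Y X]]
      phid[OF phi_TS[OF D_TS[OF X Y]] phi_TS[OF D_TS[OF Y X]]]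
      phid[OF D_TS[OF Y pX] phi_TS[OF D_TS[OF Y X]]] phid[OF D_TS[OF X pY] phi_TS[OF D_TS[OF X Y]]]
    by (simp add: algebra_simps)
  moreover note a = P[OF pX Y] P[OF pY X] phi_TS[OF P[OF Y X]] phi_TS[OF P[OF X Y]] xi_TS[of x] VF_TS[OF Z, of x]
  ultimately have "g x (normality_tensor X Y x) (Z x) = g x (?P (ph X) Y) (Z x) - g x (?P (ph Y) X) (Z x)
      + (g x (\<phi> x (?P Y X)) (Z x) - g x (\<phi> x (?P X Y)) (Z x)) + dd \<eta> x (X x) (Y x) * (\<epsilon> * \<eta> x (Z x))"
    using g_add_left[OF TS_plus[OF TS_diff_closed[OF a(1,2)] TS_diff_closed[OF a(3,4)]] a(6) TS_scaleR[OF a(5)]]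
      g_add_left[OF TS_diff_closed[OF a(1,2)] a(6) TS_diff_closed[OF a(3,4)]]
      g_diff_left[OF a(1,6,2)] g_diff_left[OF a(3,6,4)] g_scaleR_left[OF a(5,6)] g_xi'[OF a(6)]
    by simp
  then show ?thesis
    using g_phi_skew[OF P[OF Y X] a(6)] g_phi_skew[OF P[OF X Y] a(6)] by (simp add: B_def)
qed

lemma sasaki_condition_B:
  "sasaki_condition D \<longleftrightarrow> (\<forall>X\<in>VF. \<forall>Y\<in>VF. \<forall>Z\<in>VF. \<forall>x.
     B X Y Z x = \<epsilon> / 2 * (\<eta> x (Y x) * g x (X x) (Z x) - g x (X x) (Y x) * \<eta> x (Z x)))"
  by (simp only: sasaki_condition_def B_def)

text \<open>One direction is insertion. In the other, normality first determines \<open>K\<close>;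
  with this, the difference of the two sides satisfies the hypothesis of
  \<open>trilinear_vanishing\<close> on moving \<open>ph\<close> between the last two
  arguments.\<close>

theorem normal_iff_sasaki_condition: "normal_structure \<A> \<phi> \<xi> \<eta> \<longleftrightarrow> sasaki_condition D"
proof
  assume S: "sasaki_condition D"
  have b: "B X Y Z x = \<epsilon> / 2 * (\<eta> x (Y x) * g x (X x) (Z x) - g x (X x) (Y x) * \<eta> x (Z x))"
    if "X \<in> VF" "Y \<in> VF" "Z \<in> VF" for X Y Z x
    using S that unfolding sasaki_condition_B by blast
  show "normal_structure \<A> \<phi> \<xi> \<eta>"
    unfolding normal_iff_tensor
  proof (intro ballI allI)
    fix X Y x assume X: "X \<in> VF" and Y: "Y \<in> VF"
    note pX = phi_VF[OF X] and pY = phi_VF[OF Y]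
    have N: "normality_tensor X Y x \<in> TS x"
      unfolding normality_tensor_def
      by (intro TS_plus TS_diff_closed TS_scaleR phi_TS VF_TS lie_bracket_VF X Y pX pY xi_VF)
    show "normality_tensor X Y x = 0"
    proof (rule g_eqI[OF N TS_zero])
      fix Z assume Z: "Z \<in> VF"
      note e = eta_phi[OF VF_TS[OF X], of x] eta_phi[OF VF_TS[OF Y], of x] eta_phi[OF VF_TS[OF Z], of x]
      note s = g_phi_skew[OF VF_TS[OF X] VF_TS[OF Z], of x] g_phi_skew[OF VF_TS[OF Y] VF_TS[OF Z], of x]
        g_phi_skew[OF VF_TS[OF X] VF_TS[OF Y], of x] g_sym[OF VF_TS[OF pY] VF_TS[OF X], of x]
        g_phi_dd[OF VF_TS[OF X] VF_TS[OF Y], of x, symmetric]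
      show "g x (normality_tensor X Y x) (Z x) = g x 0 (Z x)"
        unfolding normality_B[OF X Y Z] b[OF pX Y Z] b[OF pY X Z] b[OF Y X phi_VF[OF Z]]
          b[OF X Y phi_VF[OF Z]] g_zero_left[OF VF_TS[OF Z] VF_TS[OF Z]]
        using s by (simp add: e algebra_simps)
    qed
  qed
next
  assume N: "normal_structure \<A> \<phi> \<xi> \<eta>"
  have T: "B (ph X) Y Z x - B (ph Y) X Z x - B Y X (ph Z) x + B X Y (ph Z) x
      + \<epsilon> * dd \<eta> x (X x) (Y x) * \<eta> x (Z x) = 0" if "X \<in> VF" "Y \<in> VF" "Z \<in> VF" for X Y Z x
    using normality_B[OF that, of x] N that g_zero_left[OF VF_TS[OF that(3)] VF_TS[OF that(3)], of x]
    unfolding normal_iff_tensor by metis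
  have px: "ph \<xi> = (\<lambda>y. 0)" using phi_xi by (rule ext)
  \<comment> \<open>Normality at Y = xi and the cyclic identity at (X, xi, phi Z) both contain the
    derivative of \<open>\<phi>\<close> in the direction \<open>\<xi>\<close>. Subtracting them
    leaves a relation for \<open>K\<close> alone.\<close>
  have K_skew': "K (ph X) (ph Z) x + K (ph Z) (ph X) x = 0" if X: "X \<in> VF" and Z: "Z \<in> VF" for X Z x
  proof -
    note pX = phi_VF[OF X] and pZ = phi_VF[OF Z]
    have z: "B (ph \<xi>) X Z x = 0"
      unfolding px B_expand[OF VF_0 X Z] D_zero_left[OF X] D_zero_left[OF pX] phi_zero
        g_zero_left[OF VF_TS[OF Z] VF_TS[OF Z]] by simp
    have d: "dd \<eta> x (X x) (\<xi> x) = 0"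
      using dd_skew[OF eta_\<Omega> VF_TS[OF X] xi_TS, of x] dd_xi[OF VF_TS[OF X], of x] by simp
    have "\<epsilon> * K (ph X) (ph Z) x - B \<xi> X (ph Z) x + \<epsilon> * K X (ph (ph Z)) x = 0"
      using T[OF X xi_VF Z, of x] unfolding z d B_xi[OF pX Z] B_xi[OF X pZ] by simp
    moreover have "\<epsilon> * K X (ph (ph Z)) x - B \<xi> X (ph Z) x - \<epsilon> * K (ph Z) (ph X) x = 0"
      using B_cyclic[OF X xi_VF pZ, of x] B_skew[OF xi_VF pZ X, of x] B_skew[OF pZ X xi_VF, of x]
      unfolding B_xi[OF X pZ] B_xi[OF pZ X] by simp
    ultimately have "\<epsilon> * (K (ph X) (ph Z) x + K (ph Z) (ph X) x) = 0" by (simp add: algebra_simps)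
    moreover have "\<epsilon> \<noteq> 0" using eps_sq by auto
    ultimately show ?thesis by simp
  qed
  \<comment> \<open>Applying \<open>\<phi>\<close> twice in each argument returns
    \<open>K X Z\<close>, so \<open>K\<close> is skew. By \<open>K_alt\<close> it is then half of d
    eta; the factor 1/2 of the Sasaki condition originates here.\<close>
  have K: "K X Z x = dd \<eta> x (X x) (Z x) / 2" if X: "X \<in> VF" and Z: "Z \<in> VF" for X Z x
    using K_skew'[OF phi_VF[OF X] phi_VF[OF Z], of x] K_alt[OF X Z, of x]
    unfolding K_ph_ph_right[OF phi_VF[OF phi_VF[OF X]] Z] K_ph_ph_right[OF phi_VF[OF phi_VF[OF Z]] X]
      K_ph_ph_left[OF X Z] K_ph_ph_left[OF Z X] by simp
  show "sasaki_condition D"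
    unfolding sasaki_condition_B
  proof (intro ballI allI)
    fix X Y Z x assume XYZ: "X \<in> VF" "Y \<in> VF" "Z \<in> VF"
    define t where "t X Y Z = \<epsilon> / 2 * (\<eta> x (Y x) * g x (X x) (Z x) - g x (X x) (Y x) * \<eta> x (Z x))" for X Y Z
    define b where "b X Y Z = B X Y Z x - t X Y Z" for X Y Z
    have e: "\<eta> x (\<phi> x (Z x)) = 0" if "Z \<in> VF" for Z
      by (rule eta_phi[OF VF_TS[OF that]])
    have s: "g x (Y x) (\<phi> x (Z x)) = - g x (\<phi> x (Y x)) (Z x)" if "Y \<in> VF" "Z \<in> VF" for Y Z
      by (rule g_phi_skew[OF VF_TS[OF that(1)] VF_TS[OF that(2)]])
    have "b X Y Z = 0"
    proof (rule trilinear_vanishing[where S = VF and ph = ph and xi = \<xi> and et = "\<lambda>Z. \<eta> x (Z x)" and b = b])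
      show "ph X \<in> VF" if "X \<in> VF" for X by (rule phi_VF[OF that])
      show "\<xi> \<in> VF" by (rule xi_VF)
      fix X Y Z assume X: "X \<in> VF" and Y: "Y \<in> VF" and Z: "Z \<in> VF"
      note sym = g_sym[OF VF_TS[OF X] VF_TS[OF Y], of x] g_sym[OF VF_TS[OF Y] VF_TS[OF Z], of x]
        g_sym[OF VF_TS[OF X] VF_TS[OF Z], of x]
      note pX = phi_VF[OF X] and pY = phi_VF[OF Y] and pZ = phi_VF[OF Z]
      show "b X Y Z = - b X Z Y"
        unfolding b_def t_def B_skew[OF X Y Z, of x] by (simp add: algebra_simps)
      show "b X Y Z + b Y Z X + b Z X Y = 0"
        using B_cyclic[OF X Y Z, of x] sym unfolding b_def t_def by (simp add: algebra_simps)
      show "b X (ph Y) Z = b X Y (ph Z)"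
        using B_third[OF X Y Z, of x] g_phi_dd[OF VF_TS[OF X] VF_TS[OF Y], of x]
          g_phi_dd[OF VF_TS[OF X] VF_TS[OF Z], of x]
        unfolding K[OF X Y] K[OF X Z] b_def t_def e[OF Y] e[OF Z] s[OF X Y] s[OF X Z]
        by (simp add: algebra_simps)
      show "b (ph X) Y Z - b (ph Y) X Z - b Y X (ph Z) + b X Y (ph Z) = 0"
        using T[OF X Y Z, of x] g_phi_dd[OF VF_TS[OF X] VF_TS[OF Y], of x] s[OF X Y]
          g_sym[OF VF_TS[OF pY] VF_TS[OF X], of x]
        unfolding b_def t_def e[OF X] e[OF Y] e[OF Z] s[OF X Z] s[OF Y Z] by (simp add: algebra_simps)
      show "b X Y Z = - b X Y (ph (ph Z)) + \<eta> x (Z x) * b X Y \<xi>"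
      proof -
        have l: "g x v (ph (ph Z) x) = - g x v (Z x) + \<eta> x (Z x) * g x v (\<xi> x)" if v: "v \<in> TS x" for v
          unfolding phi_phi[OF VF_TS[OF Z]]
          using g_add_right[OF v TS_uminus[OF VF_TS[OF Z]] TS_scaleR[OF xi_TS]]
            g_minus_right[OF v VF_TS[OF Z]] g_scaleR_right[OF v xi_TS] by simp
        show ?thesis
          unfolding b_def t_def B_def l[OF Dphi_TS[OF X Y]] l[OF VF_TS[OF X]] e[OF pZ] eta_xi
          by (simp add: algebra_simps)
      qed
    qed (use XYZ in auto)
    then show "B X Y Z x = \<epsilon> / 2 * (\<eta> x (Y x) * g x (X x) (Z x) - g x (X x) (Y x) * \<eta> x (Z x))"
      by (simp add: b_def t_def)
  qed
qed

end

end

section \<open>Transport of Levi-Civita connections\<close>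

text \<open>Applied in both directions, with the roles of \<open>P\<close> and \<open>Q\<close>
  exchanged. All hypotheses concern values of sections, so nothing is demanded of the two maps
  outside the fibres.\<close>

lemma levi_civita_transport:
  fixes B1 :: "('a, 'c::real_vector, 'm) algebroid_scheme"
    and B2 :: "('a, 'd::real_vector, 'n) algebroid_scheme"
  assumes lc: "levi_civita \<A> B1 m1 D"
    and Q: "\<And>X. X \<in> sections B1 \<Longrightarrow> (\<lambda>x. Q x (X x)) \<in> sections B2"
    and P: "\<And>\<alpha>. \<alpha> \<in> sections B2 \<Longrightarrow> (\<lambda>x. P x (\<alpha> x)) \<in> sections B1"
    and QP: "\<And>\<alpha> x. \<alpha> \<in> sections B2 \<Longrightarrow> Q x (P x (\<alpha> x)) = \<alpha> x"
    and PQ: "\<And>X x. X \<in> sections B1 \<Longrightarrow> P x (Q x (X x)) = X x"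
    and Q_lin: "\<And>X Y a b x. X \<in> sections B1 \<Longrightarrow> Y \<in> sections B1 \<Longrightarrow>
      Q x (a *\<^sub>R X x + b *\<^sub>R Y x) = a *\<^sub>R Q x (X x) + b *\<^sub>R Q x (Y x)"
    and P_lin: "\<And>\<alpha> \<beta> a b x. \<alpha> \<in> sections B2 \<Longrightarrow> \<beta> \<in> sections B2 \<Longrightarrow>
      P x (a *\<^sub>R \<alpha> x + b *\<^sub>R \<beta> x) = a *\<^sub>R P x (\<alpha> x) + b *\<^sub>R P x (\<beta> x)"
    and anchor: "\<And>\<alpha> x. \<alpha> \<in> sections B2 \<Longrightarrow> anchor B2 x (\<alpha> x) = anchor B1 x (P x (\<alpha> x))"
    and bracket: "\<And>\<alpha> \<beta> x. \<alpha> \<in> sections B2 \<Longrightarrow> \<beta> \<in> sections B2 \<Longrightarrow>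
      bracket B2 \<alpha> \<beta> x = Q x (bracket B1 (\<lambda>x. P x (\<alpha> x)) (\<lambda>x. P x (\<beta> x)) x)"
    and metric: "\<And>\<alpha> \<beta> x. \<alpha> \<in> sections B2 \<Longrightarrow> \<beta> \<in> sections B2 \<Longrightarrow>
      m2 x (\<alpha> x) (\<beta> x) = m1 x (P x (\<alpha> x)) (P x (\<beta> x))"
  shows "levi_civita \<A> B2 m2 (\<lambda>\<alpha> \<beta> x. Q x (D (\<lambda>x. P x (\<alpha> x)) (\<lambda>x. P x (\<beta> x)) x))"
proof -
  have sec: "D X Y \<in> sections B1" if "X \<in> sections B1" "Y \<in> sections B1" for X Y
    using lc that by (simp add: levi_civita_def)
  have linr: "linear_map_on (sections B1) (D X)" if "X \<in> sections B1" for X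
    using lc that by (simp add: levi_civita_def)
  have linl: "linear_map_on (sections B1) (\<lambda>X. D X Y)" if "Y \<in> sections B1" for Y
    using lc that by (simp add: levi_civita_def)
  have fl: "D (\<lambda>x. f x *\<^sub>R X x) Y = (\<lambda>x. f x *\<^sub>R D X Y x)"
    if "f \<in> smooth_funs \<A>" "X \<in> sections B1" "Y \<in> sections B1" for f X Y
    using lc that by (simp add: levi_civita_def)
  have fr: "D X (\<lambda>x. f x *\<^sub>R Y x) = (\<lambda>x. f x *\<^sub>R D X Y x + anchor B1 x (X x) f *\<^sub>R Y x)"
    if "f \<in> smooth_funs \<A>" "X \<in> sections B1" "Y \<in> sections B1" for f X Y
    using lc that by (simp add: levi_civita_def)
  have tor: "(\<lambda>x. D X Y x - D Y X x) = bracket B1 X Y" if "X \<in> sections B1" "Y \<in> sections B1" for X Y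
    using lc that by (simp add: levi_civita_def)
  have met: "anchor B1 x (X x) (\<lambda>y. m1 y (Y y) (Z y)) = m1 x (D X Y x) (Z x) + m1 x (Y x) (D X Z x)"
    if "X \<in> sections B1" "Y \<in> sections B1" "Z \<in> sections B1" for X Y Z x
    using lc that by (simp add: levi_civita_def)
  have Qs: "Q x (a *\<^sub>R X x) = a *\<^sub>R Q x (X x)" if "X \<in> sections B1" for X a x
    using Q_lin[OF that that, of x a 0] by simp
  have Ps: "P x (a *\<^sub>R \<alpha> x) = a *\<^sub>R P x (\<alpha> x)" if "\<alpha> \<in> sections B2" for \<alpha> a x
    using P_lin[OF that that, of x a 0] by simp
  have pf: "a *\<^sub>R X + b *\<^sub>R Y = (\<lambda>x. a *\<^sub>R X x + b *\<^sub>R Y x)" for a b and X Y :: "'x \<Rightarrow> 'y::real_vector"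
    by (simp add: plus_fun_def scaleR_fun_def)
  have Plin: "(\<lambda>x. P x ((a *\<^sub>R \<alpha> + b *\<^sub>R \<beta>) x)) = a *\<^sub>R (\<lambda>x. P x (\<alpha> x)) + b *\<^sub>R (\<lambda>x. P x (\<beta> x))"
    if "\<alpha> \<in> sections B2" "\<beta> \<in> sections B2" for \<alpha> \<beta> a b
    unfolding pf by (rule ext) (rule P_lin[OF that])
  have DQ: "m2 x (Q x (X x)) (\<beta> x) = m1 x (X x) (P x (\<beta> x))" if "X \<in> sections B1" "\<beta> \<in> sections B2" for X \<beta> x
    using metric[OF Q[OF that(1)] that(2), of x] PQ[OF that(1), of x] by simp
  have DQ': "m2 x (\<beta> x) (Q x (X x)) = m1 x (P x (\<beta> x)) (X x)" if "X \<in> sections B1" "\<beta> \<in> sections B2" for X \<beta> x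
    using metric[OF that(2) Q[OF that(1)], of x] PQ[OF that(1), of x] by simp
  show ?thesis
    unfolding levi_civita_def
  proof (intro conjI ballI allI)
    fix \<alpha> assume a: "\<alpha> \<in> sections B2"
    note Pa = P[OF a]
    show "linear_map_on (sections B2) (\<lambda>\<beta> x. Q x (D (\<lambda>x. P x (\<alpha> x)) (\<lambda>x. P x (\<beta> x)) x))"
      unfolding linear_map_on_def
    proof (intro ballI allI)
      fix \<beta> \<gamma> s t assume b: "\<beta> \<in> sections B2" and c: "\<gamma> \<in> sections B2"
      have "D (\<lambda>x. P x (\<alpha> x)) (\<lambda>x. P x ((s *\<^sub>R \<beta> + t *\<^sub>R \<gamma>) x))
          = s *\<^sub>R D (\<lambda>x. P x (\<alpha> x)) (\<lambda>x. P x (\<beta> x)) + t *\<^sub>R D (\<lambda>x. P x (\<alpha> x)) (\<lambda>x. P x (\<gamma> x))"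
        unfolding Plin[OF b c] using linr[OF Pa] P[OF b] P[OF c] by (simp add: linear_map_on_def)
      then show "(\<lambda>x. Q x (D (\<lambda>x. P x (\<alpha> x)) (\<lambda>x. P x ((s *\<^sub>R \<beta> + t *\<^sub>R \<gamma>) x)) x))
          = s *\<^sub>R (\<lambda>x. Q x (D (\<lambda>x. P x (\<alpha> x)) (\<lambda>x. P x (\<beta> x)) x))
          + t *\<^sub>R (\<lambda>x. Q x (D (\<lambda>x. P x (\<alpha> x)) (\<lambda>x. P x (\<gamma> x)) x))"
        unfolding pf by (simp only:) (rule ext, rule Q_lin[OF sec[OF Pa P[OF b]] sec[OF Pa P[OF c]]])
    qed
    show "linear_map_on (sections B2) (\<lambda>\<beta> x. Q x (D (\<lambda>x. P x (\<beta> x)) (\<lambda>x. P x (\<alpha> x)) x))"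
      unfolding linear_map_on_def
    proof (intro ballI allI)
      fix \<beta> \<gamma> s t assume b: "\<beta> \<in> sections B2" and c: "\<gamma> \<in> sections B2"
      have "D (\<lambda>x. P x ((s *\<^sub>R \<beta> + t *\<^sub>R \<gamma>) x)) (\<lambda>x. P x (\<alpha> x))
          = s *\<^sub>R D (\<lambda>x. P x (\<beta> x)) (\<lambda>x. P x (\<alpha> x)) + t *\<^sub>R D (\<lambda>x. P x (\<gamma> x)) (\<lambda>x. P x (\<alpha> x))"
        unfolding Plin[OF b c] using linl[OF Pa] P[OF b] P[OF c] by (simp add: linear_map_on_def)
      then show "(\<lambda>x. Q x (D (\<lambda>x. P x ((s *\<^sub>R \<beta> + t *\<^sub>R \<gamma>) x)) (\<lambda>x. P x (\<alpha> x)) x))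
          = s *\<^sub>R (\<lambda>x. Q x (D (\<lambda>x. P x (\<beta> x)) (\<lambda>x. P x (\<alpha> x)) x))
          + t *\<^sub>R (\<lambda>x. Q x (D (\<lambda>x. P x (\<gamma> x)) (\<lambda>x. P x (\<alpha> x)) x))"
        unfolding pf by (simp only:) (rule ext, rule Q_lin[OF sec[OF P[OF b] Pa] sec[OF P[OF c] Pa]])
    qed
    fix \<beta> assume b: "\<beta> \<in> sections B2"
    note Pb = P[OF b]
    show "(\<lambda>x. Q x (D (\<lambda>x. P x (\<alpha> x)) (\<lambda>x. P x (\<beta> x)) x)) \<in> sections B2"
      by (rule Q[OF sec[OF Pa Pb]])
    show "(\<lambda>x. Q x (D (\<lambda>x. P x (\<alpha> x)) (\<lambda>x. P x (\<beta> x)) x) - Q x (D (\<lambda>x. P x (\<beta> x)) (\<lambda>x. P x (\<alpha> x)) x))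
        = bracket B2 \<alpha> \<beta>"
    proof (rule ext)
      fix x
      show "Q x (D (\<lambda>x. P x (\<alpha> x)) (\<lambda>x. P x (\<beta> x)) x) - Q x (D (\<lambda>x. P x (\<beta> x)) (\<lambda>x. P x (\<alpha> x)) x)
          = bracket B2 \<alpha> \<beta> x"
        unfolding bracket[OF a b] tor[OF Pa Pb, symmetric]
        using Q_lin[OF sec[OF Pa Pb] sec[OF Pb Pa], of x 1 "-1"] by simp
    qed
    fix \<gamma> x assume c: "\<gamma> \<in> sections B2"
    note Pc = P[OF c]
    have "(\<lambda>y. m2 y (\<beta> y) (\<gamma> y)) = (\<lambda>y. m1 y (P y (\<beta> y)) (P y (\<gamma> y)))"
      using metric[OF b c] by simp
    then show "anchor B2 x (\<alpha> x) (\<lambda>y. m2 y (\<beta> y) (\<gamma> y))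
        = m2 x (Q x (D (\<lambda>x. P x (\<alpha> x)) (\<lambda>x. P x (\<beta> x)) x)) (\<gamma> x)
        + m2 x (\<beta> x) (Q x (D (\<lambda>x. P x (\<alpha> x)) (\<lambda>x. P x (\<gamma> x)) x))"
      using met[OF Pa Pb Pc, of x] anchor[OF a, of x] DQ[OF sec[OF Pa Pb] c, of x] DQ'[OF sec[OF Pa Pc] b, of x]
      by simp
  next
    fix f \<alpha> \<beta> assume f: "f \<in> smooth_funs \<A>" and a: "\<alpha> \<in> sections B2" and b: "\<beta> \<in> sections B2"
    note Pa = P[OF a] and Pb = P[OF b]
    show "(\<lambda>x. Q x (D (\<lambda>x. P x (f x *\<^sub>R \<alpha> x)) (\<lambda>x. P x (\<beta> x)) x))
        = (\<lambda>x. f x *\<^sub>R Q x (D (\<lambda>x. P x (\<alpha> x)) (\<lambda>x. P x (\<beta> x)) x))"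
      unfolding Ps[OF a] fl[OF f Pa Pb] Qs[OF sec[OF Pa Pb]] ..
    show "(\<lambda>x. Q x (D (\<lambda>x. P x (\<alpha> x)) (\<lambda>x. P x (f x *\<^sub>R \<beta> x)) x))
        = (\<lambda>x. f x *\<^sub>R Q x (D (\<lambda>x. P x (\<alpha> x)) (\<lambda>x. P x (\<beta> x)) x) + anchor B2 x (\<alpha> x) f *\<^sub>R \<beta> x)"
      unfolding Ps[OF b] fr[OF f Pa Pb] Q_lin[OF sec[OF Pa Pb] Pb] QP[OF b] anchor[OF a] ..
  qed
qed

section \<open>The Jacobi structure in terms of the contact pseudo-metric structure\<close>

context contact_metric_manifold
begin

abbreviation "AA \<equiv> TM_plus_R \<A>"
abbreviation "\<theta> \<equiv> (\<lambda>x v. \<epsilon> * \<eta> x v)"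
abbreviation "\<pi>\<^sub>J \<equiv> bisection_of_pair (contact_bivector \<A> \<theta>) (reeb_field \<A> \<theta>)"
abbreviation "\<Omega>\<^sub>A \<equiv> dual_sections \<A> AA"
abbreviation "G \<equiv> (\<lambda>x (v, r) (w, s). g x v w + \<epsilon> * r * s)"

definition SA :: "('a \<Rightarrow> 'a tvec \<times> real) set" where
  "SA = {s. (\<lambda>x. fst (s x)) \<in> VF \<and> (\<lambda>x. snd (s x)) \<in> C}"

lemma AA_simps: "fiber AA x = TS x \<times> UNIV" "sections AA = SA" "anchor AA x V = fst V"
  "bracket AA X Y x = (lie_bracket (\<lambda>y. fst (X y)) (\<lambda>y. fst (Y y)) x,
     fst (X x) (\<lambda>y. snd (Y y)) - fst (Y x) (\<lambda>y. snd (X y)))"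
  by (simp_all add: TM_plus_R_def SA_def)

lemma SA_fst: "X \<in> SA \<Longrightarrow> (\<lambda>x. fst (X x)) \<in> VF" and SA_snd: "X \<in> SA \<Longrightarrow> (\<lambda>x. snd (X x)) \<in> C"
  by (simp_all add: SA_def)

lemma SA_TS: "X \<in> SA \<Longrightarrow> fst (X x) \<in> TS x"
  by (rule VF_TS[OF SA_fst])

lemma SA_Pair: "X \<in> VF \<Longrightarrow> f \<in> C \<Longrightarrow> (\<lambda>x. (X x, f x)) \<in> SA"
  by (simp add: SA_def)

lemma dual_fiber_AA:
  "a \<in> dual_fiber AA x \<longleftrightarrow> linear_map_on (TS x \<times> UNIV) a \<and> (\<forall>v r. v \<notin> TS x \<longrightarrow> a (v, r) = 0)"
  by (auto simp: dual_fiber_def AA_simps)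

lemma dual_fiber_split:
  assumes "a \<in> dual_fiber AA x" "v \<in> TS x"
  shows "a (v, r) = a (v, 0) + r * a (0, 1)"
proof -
  have "linear_map_on (TS x \<times> UNIV) a" using assms by (simp add: dual_fiber_AA)
  then have "a (1 *\<^sub>R (v, 0) + r *\<^sub>R (0, 1)) = 1 *\<^sub>R a (v, 0) + r *\<^sub>R a (0, 1)"
    unfolding linear_map_on_def using assms(2) TS_zero by blast
  then show ?thesis by simp
qed

lemma dual_fiber_fst_linear:
  assumes "a \<in> dual_fiber AA x" shows "linear_map_on (TS x) (\<lambda>v. a (v, 0))"
proof -
  have l: "linear_map_on (TS x \<times> UNIV) a" using assms by (simp add: dual_fiber_AA)
  show ?thesis
    unfolding linear_map_on_def
  proof (intro ballI allI)
    fix u v s t assume "u \<in> TS x" "v \<in> TS x"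
    then have "a (s *\<^sub>R (u, 0) + t *\<^sub>R (v, 0)) = s *\<^sub>R a (u, 0) + t *\<^sub>R a (v, 0)"
      using l unfolding linear_map_on_def by blast
    then show "a (s *\<^sub>R u + t *\<^sub>R v, 0) = s *\<^sub>R a (u, 0) + t *\<^sub>R a (v, 0)" by simp
  qed
qed

lemma dual_fiberI:
  assumes "linear_map_on (TS x) \<alpha>"
  shows "(\<lambda>(v, r). if v \<in> TS x then \<alpha> v + c * r else 0) \<in> dual_fiber AA x"
proof -
  have "linear_map_on (TS x \<times> UNIV) (\<lambda>(v, r). if v \<in> TS x then \<alpha> v + c * r else 0)"
    using linear_map_on_add[OF assms] linear_map_on_scaleR[OF assms] TS_plus TS_scaleR
    by (intro linear_map_onI) (auto simp: algebra_simps)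
  then show ?thesis by (simp add: dual_fiber_AA)
qed

lemma theta_\<Omega>: "\<theta> \<in> \<Omega>"
proof (rule \<Omega>I)
  show "linear_map_on (TS x) (\<lambda>v. \<epsilon> * \<eta> x v)" for x
    using \<Omega>_linear[OF eta_\<Omega>, of x] by (auto simp: linear_map_on_def algebra_simps)
  show "\<epsilon> * \<eta> x v = 0" if "v \<notin> TS x" for x v using \<Omega>_outside[OF eta_\<Omega> that] by simp
  show "(\<lambda>x. \<epsilon> * \<eta> x (X x)) \<in> C" if "X \<in> VF" for X
    by (rule C_cmult[OF \<Omega>_C[OF eta_\<Omega> that]])
qed

lemma dd_theta:
  assumes v: "v \<in> TS x" and w: "w \<in> TS x" shows "dd \<theta> x v w = \<epsilon> * g x (\<phi> x v) w"
proof -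
  obtain X where X: "X \<in> VF" "X x = v" by (rule vector_field_through[OF v])
  obtain Y where Y: "Y \<in> VF" "Y x = w" by (rule vector_field_through[OF w])
  show ?thesis
    unfolding g_phi_dd[OF v w] unfolding X(2)[symmetric] Y(2)[symmetric] dd_fields[OF theta_\<Omega> X(1) Y(1)]
      dd_fields[OF eta_\<Omega> X(1) Y(1)] VFD_cmult[OF X(1) \<Omega>_C[OF eta_\<Omega> Y(1)]]
      VFD_cmult[OF Y(1) \<Omega>_C[OF eta_\<Omega> X(1)]] by (simp add: algebra_simps)
qed

lemma eps_nonzero: "\<epsilon> \<noteq> 0"
  using eps_sq by auto

lemma eps_cancel: "\<epsilon> * (\<epsilon> * r) = r"
  using eps_sq by (simp add: mult.assoc[symmetric])

text \<open>The kernel of d eta is spanned by \<open>\<xi>\<close>: nondegeneracy of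
  \<open>g\<close> gives phi E = 0, hence E = eta(E) xi. As \<open>\<theta>\<close> is \<epsilon>
  times \<open>\<eta>\<close>, normalization yields eta(E) = \<epsilon>.\<close>

lemma reeb: "reeb_field \<A> \<theta> = (\<lambda>x. \<epsilon> *\<^sub>R \<xi> x)"
  unfolding reeb_field_def
proof (rule the_equality)
  have "dd \<theta> x (\<epsilon> *\<^sub>R \<xi> x) w = 0" if "w \<in> TS x" for x w
    using dd_theta[OF TS_scaleR[OF xi_TS] that, of \<epsilon>] phi_scaleR[OF xi_TS, of x \<epsilon>] phi_xi[of x]
      g_zero_left[OF xi_TS that] by simp
  then show "(\<lambda>x. \<epsilon> *\<^sub>R \<xi> x) \<in> VF \<and> (\<forall>x. \<theta> x (\<epsilon> *\<^sub>R \<xi> x) = 1) \<and>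
      (\<forall>x. \<forall>w\<in>TS x. dd \<theta> x (\<epsilon> *\<^sub>R \<xi> x) w = 0)"
    using VF_scaleR[OF xi_VF] \<Omega>_scaleR[OF eta_\<Omega> xi_TS] eta_xi eps_sq by simp
next
  fix E assume E: "E \<in> VF \<and> (\<forall>x. \<theta> x (E x) = 1) \<and> (\<forall>x. \<forall>w\<in>TS x. dd \<theta> x (E x) w = 0)"
  show "E = (\<lambda>x. \<epsilon> *\<^sub>R \<xi> x)"
  proof (rule ext)
    fix x
    have Ex: "E x \<in> TS x" using E VF_TS by blast
    have "g x (\<phi> x (E x)) w = 0" if "w \<in> TS x" for w
      using dd_theta[OF Ex that] E that eps_nonzero by simp
    then have "\<phi> x (E x) = 0" by (rule g_nondegenerate[OF phi_TS[OF Ex]])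
    then have "E x = \<eta> x (E x) *\<^sub>R \<xi> x"
      using phi_phi[OF Ex] phi_zero[of x] by simp
    moreover have "\<eta> x (E x) = \<epsilon>"
      using E eps_cancel[of "\<eta> x (E x)"] by (metis mult.right_neutral)
    ultimately show "E x = \<epsilon> *\<^sub>R \<xi> x" by simp
  qed
qed

text \<open>The 1-form that \<open>contact_flat\<close> assigns to v is the \<open>g\<close>-dual of
  \<epsilon> (phi v + eta(v) xi). The endomorphism phi + eta (x) xi has the inverse - phi + eta (x)
  xi, and \<epsilon> squared is 1.\<close>

definition flat_inv :: "'a \<Rightarrow> ('a tvec \<Rightarrow> real) \<Rightarrow> 'a tvec" where
  "flat_inv x \<alpha> = \<epsilon> *\<^sub>R (- \<phi> x (sharp x \<alpha>) + \<eta> x (sharp x \<alpha>) *\<^sub>R \<xi> x)"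

lemma flat_inv_flat:
  assumes v: "v \<in> TS x" shows "flat_inv x (contact_flat \<A> \<theta> x v) = v"
proof -
  let ?a = "\<epsilon> *\<^sub>R (\<phi> x v + \<eta> x v *\<^sub>R \<xi> x)"
  have pv: "\<phi> x v \<in> TS x" and ex: "\<eta> x v *\<^sub>R \<xi> x \<in> TS x"
    by (rule phi_TS[OF v], rule TS_scaleR[OF xi_TS])
  have s: "sharp x (contact_flat \<A> \<theta> x v) = ?a"
  proof (rule sharp_unique[OF TS_scaleR[OF TS_plus[OF pv ex]]])
    fix w assume w: "w \<in> TS x"
    show "g x ?a w = contact_flat \<A> \<theta> x v w"
      using w g_scaleR_left[OF TS_plus[OF pv ex] w, of \<epsilon>] g_add_left[OF pv w ex] g_scaleR_left[OF xi_TS w, of "\<eta> x v"]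
        g_xi'[OF w] dd_theta[OF v w] by (simp add: contact_flat_def algebra_simps)
  qed
  have "\<phi> x ?a = \<epsilon> *\<^sub>R (- v + \<eta> x v *\<^sub>R \<xi> x)"
    using phi_scaleR[OF TS_plus[OF pv ex], of \<epsilon>] phi_add[OF pv ex] phi_scaleR[OF xi_TS, of x "\<eta> x v"]
      phi_xi[of x] phi_phi[OF v] by simp
  moreover have "\<eta> x ?a = \<epsilon> * \<eta> x v"
    using \<Omega>_scaleR[OF eta_\<Omega> TS_plus[OF pv ex], of \<epsilon>] \<Omega>_add[OF eta_\<Omega> pv ex]
      \<Omega>_scaleR[OF eta_\<Omega> xi_TS, of x "\<eta> x v"] eta_xi[of x] eta_phi[OF v] by simp
  ultimately have "flat_inv x (contact_flat \<A> \<theta> x v)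
      = \<epsilon> *\<^sub>R (- (\<epsilon> *\<^sub>R (- v + \<eta> x v *\<^sub>R \<xi> x)) + (\<epsilon> * \<eta> x v) *\<^sub>R \<xi> x)"
    unfolding flat_inv_def s by simp
  also have "\<dots> = (\<epsilon> * \<epsilon>) *\<^sub>R v"
    by (simp add: algebra_simps)
  finally show ?thesis using eps_sq by simp
qed

lemma flat_inv_TS:
  assumes "linear_map_on (TS x) \<alpha>" shows "flat_inv x \<alpha> \<in> TS x"
  unfolding flat_inv_def
  by (intro TS_scaleR TS_plus TS_uminus phi_TS xi_TS sharp_TS[OF assms])

lemma contact_flat_inv:
  assumes \<alpha>: "linear_map_on (TS x) \<alpha>" "\<And>v. v \<notin> TS x \<Longrightarrow> \<alpha> v = 0"
  shows "inv_into (TS x) (contact_flat \<A> \<theta> x) \<alpha> = flat_inv x \<alpha>"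
proof -
  have inj: "inj_on (contact_flat \<A> \<theta> x) (TS x)"
    by (rule inj_on_inverseI[of _ "flat_inv x"]) (rule flat_inv_flat)
  let ?a = "sharp x \<alpha>"
  note a = sharp_TS[OF \<alpha>(1)]
  have fi: "flat_inv x \<alpha> \<in> TS x" by (rule flat_inv_TS[OF \<alpha>(1)])
  have m: "- \<phi> x ?a \<in> TS x" "\<eta> x ?a *\<^sub>R \<xi> x \<in> TS x"
    by (rule TS_uminus[OF phi_TS[OF a]], rule TS_scaleR[OF xi_TS])
  have p: "\<phi> x (flat_inv x \<alpha>) = \<epsilon> *\<^sub>R (?a - \<eta> x ?a *\<^sub>R \<xi> x)"
    unfolding flat_inv_def phi_scaleR[OF TS_plus[OF m]] phi_add[OF m] phi_minus[OF phi_TS[OF a]]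
      phi_scaleR[OF xi_TS] phi_xi phi_phi[OF a] by simp
  have e: "\<eta> x (flat_inv x \<alpha>) = \<epsilon> * \<eta> x ?a"
    unfolding flat_inv_def \<Omega>_scaleR[OF eta_\<Omega> TS_plus[OF m]] \<Omega>_add[OF eta_\<Omega> m]
      \<Omega>_minus[OF eta_\<Omega> phi_TS[OF a]] \<Omega>_scaleR[OF eta_\<Omega> xi_TS] eta_phi[OF a] eta_xi by simp
  have "contact_flat \<A> \<theta> x (flat_inv x \<alpha>) = \<alpha>"
  proof (rule ext)
    fix w show "contact_flat \<A> \<theta> x (flat_inv x \<alpha>) w = \<alpha> w"
    proof (cases "w \<in> TS x")
      case True
      have gw: "g x (\<epsilon> *\<^sub>R (?a - \<eta> x ?a *\<^sub>R \<xi> x)) w = \<epsilon> * (\<alpha> w - \<eta> x ?a * (\<epsilon> * \<eta> x w))"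
        using g_scaleR_left[OF TS_diff_closed[OF a m(2)] True, of \<epsilon>] g_diff_left[OF a True m(2)]
          g_scaleR_left[OF xi_TS True, of "\<eta> x ?a"] g_xi'[OF True] g_sharp[OF \<alpha>(1) True] by simp
      show ?thesis
        using True unfolding contact_flat_def dd_theta[OF fi True] p e gw
        by (simp add: algebra_simps eps_cancel)
    qed (simp add: contact_flat_def \<alpha>(2))
  qed
  then show ?thesis using inv_into_f_f[OF inj fi] by simp
qed

text \<open>\<open>Q\<close> and \<open>P\<close> are closed forms of \<open>(\<pi>\<^sup>\<sharp>)\<^sup>-\<^sup>1\<close> and \<open>\<pi>\<^sup>\<sharp>\<close>.\<close>

definition Q :: "'a \<Rightarrow> 'a tvec \<times> real \<Rightarrow> 'a tvec \<times> real \<Rightarrow> real" where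
  "Q x V = (\<lambda>(w, s). if w \<in> TS x
     then (- \<epsilon> * g x (\<phi> x (fst V)) w - \<epsilon> * snd V * \<eta> x w) + \<epsilon> * \<eta> x (fst V) * s else 0)"

lemma Q_linear:
  assumes v: "v \<in> TS x" shows "linear_map_on (TS x) (\<lambda>w. - \<epsilon> * g x (\<phi> x v) w - \<epsilon> * r * \<eta> x w)"
  using g_linear[OF phi_TS[OF v]] \<Omega>_linear[OF eta_\<Omega>, of x]
  by (auto simp: linear_map_on_def algebra_simps)

lemma Q_dual: "fst V \<in> TS x \<Longrightarrow> Q x V \<in> dual_fiber AA x"
  unfolding Q_def by (rule dual_fiberI[OF Q_linear])

lemma Q_apply:
  "w \<in> TS x \<Longrightarrow> Q x V (w, s) = - \<epsilon> * g x (\<phi> x (fst V)) w - \<epsilon> * snd V * \<eta> x w + \<epsilon> * \<eta> x (fst V) * s"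
  by (simp add: Q_def)

definition P :: "'a \<Rightarrow> ('a tvec \<times> real \<Rightarrow> real) \<Rightarrow> 'a tvec \<times> real" where
  "P x a = (\<epsilon> *\<^sub>R (\<phi> x (sharp x (\<lambda>v. a (v, 0))) + a (0, 1) *\<^sub>R \<xi> x), - \<eta> x (sharp x (\<lambda>v. a (v, 0))))"

lemma P_TS:
  assumes "a \<in> dual_fiber AA x" shows "fst (P x a) \<in> TS x"
  unfolding P_def fst_conv
  by (intro TS_scaleR TS_plus phi_TS xi_TS sharp_TS[OF dual_fiber_fst_linear[OF assms]])

lemma Q_sharp:
  assumes v: "fst V \<in> TS x"
  shows "sharp x (\<lambda>v. Q x V (v, 0)) = - (\<epsilon> *\<^sub>R \<phi> x (fst V)) - snd V *\<^sub>R \<xi> x"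
proof (rule sharp_unique)
  note m = TS_scaleR[OF phi_TS[OF v], of \<epsilon>] TS_scaleR[OF xi_TS[of x], of "snd V"]
  show "- (\<epsilon> *\<^sub>R \<phi> x (fst V)) - snd V *\<^sub>R \<xi> x \<in> TS x"
    by (rule TS_diff_closed[OF TS_uminus[OF m(1)] m(2)])
  fix w assume w: "w \<in> TS x"
  show "g x (- (\<epsilon> *\<^sub>R \<phi> x (fst V)) - snd V *\<^sub>R \<xi> x) w = Q x V (w, 0)"
    unfolding Q_apply[OF w] g_diff_left[OF TS_uminus[OF m(1)] w m(2)] g_minus_left[OF m(1) w]
      g_scaleR_left[OF phi_TS[OF v] w] g_scaleR_left[OF xi_TS w] g_xi'[OF w] by simp
qed

lemma PQ:
  assumes v: "fst V \<in> TS x" shows "P x (Q x V) = V"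
proof -
  note m = TS_scaleR[OF phi_TS[OF v], of \<epsilon>] TS_scaleR[OF xi_TS[of x], of "snd V"]
  have e: "\<eta> x (- (\<epsilon> *\<^sub>R \<phi> x (fst V)) - snd V *\<^sub>R \<xi> x) = - snd V"
    unfolding \<Omega>_diff[OF eta_\<Omega> TS_uminus[OF m(1)] m(2)] \<Omega>_minus[OF eta_\<Omega> m(1)]
      \<Omega>_scaleR[OF eta_\<Omega> phi_TS[OF v]] \<Omega>_scaleR[OF eta_\<Omega> xi_TS] eta_phi[OF v] eta_xi by simp
  have p: "\<phi> x (- (\<epsilon> *\<^sub>R \<phi> x (fst V)) - snd V *\<^sub>R \<xi> x) = \<epsilon> *\<^sub>R (fst V - \<eta> x (fst V) *\<^sub>R \<xi> x)"
    unfolding phi_diff[OF TS_uminus[OF m(1)] m(2)] phi_minus[OF m(1)]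
      phi_scaleR[OF phi_TS[OF v]] phi_scaleR[OF xi_TS] phi_xi phi_phi[OF v] by (simp add: algebra_simps)
  have f: "Q x V (0, 1) = \<epsilon> * \<eta> x (fst V)"
    unfolding Q_apply[OF TS_zero] using g_zero_right[OF phi_TS[OF v] xi_TS] \<Omega>_zero[OF eta_\<Omega>, of x] by simp
  have "\<epsilon> *\<^sub>R (\<epsilon> *\<^sub>R (fst V - \<eta> x (fst V) *\<^sub>R \<xi> x) + (\<epsilon> * \<eta> x (fst V)) *\<^sub>R \<xi> x) = (\<epsilon> * \<epsilon>) *\<^sub>R fst V"
    by (simp add: algebra_simps)
  then show ?thesis
    unfolding P_def Q_sharp[OF v] e p f eps_sq by simp
qed

lemma QP:
  assumes a: "a \<in> dual_fiber AA x" shows "Q x (P x a) = a"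
proof (rule ext)
  fix W :: "'a tvec \<times> real"
  obtain w s where W: "W = (w, s)" by (cases W)
  let ?s = "sharp x (\<lambda>v. a (v, 0))"
  note l = dual_fiber_fst_linear[OF a] and sT = sharp_TS[OF dual_fiber_fst_linear[OF a]]
  note m = phi_TS[OF sT] TS_scaleR[OF xi_TS[of x], of "a (0, 1)"]
  show "Q x (P x a) W = a W"
  proof (cases "w \<in> TS x")
    case True
    have p: "\<phi> x (fst (P x a)) = \<epsilon> *\<^sub>R (- ?s + \<eta> x ?s *\<^sub>R \<xi> x)"
      unfolding P_def fst_conv phi_scaleR[OF TS_plus[OF m]] phi_add[OF m] phi_scaleR[OF xi_TS] phi_xi phi_phi[OF sT]
      by simp
    have e: "\<eta> x (fst (P x a)) = \<epsilon> * a (0, 1)"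
      unfolding P_def fst_conv \<Omega>_scaleR[OF eta_\<Omega> TS_plus[OF m]] \<Omega>_add[OF eta_\<Omega> m]
        \<Omega>_scaleR[OF eta_\<Omega> xi_TS] eta_phi[OF sT] eta_xi by simp
    have gw: "g x (\<epsilon> *\<^sub>R (- ?s + \<eta> x ?s *\<^sub>R \<xi> x)) w = \<epsilon> * (- a (w, 0) + \<eta> x ?s * (\<epsilon> * \<eta> x w))"
      unfolding g_scaleR_left[OF TS_plus[OF TS_uminus[OF sT] TS_scaleR[OF xi_TS]] True]
        g_add_left[OF TS_uminus[OF sT] True TS_scaleR[OF xi_TS]] g_minus_left[OF sT True]
        g_scaleR_left[OF xi_TS True] g_xi'[OF True] g_sharp[OF l True] ..
    have "Q x (P x a) (w, s) = a (w, 0) + s * a (0, 1)"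
      unfolding Q_apply[OF True] p e gw by (simp add: P_def algebra_simps eps_cancel)
    then show ?thesis using dual_fiber_split[OF a True, of s] W by simp
  next
    case False
    then show ?thesis using a W by (simp add: Q_def dual_fiber_AA)
  qed
qed

text \<open>This is the twisted differential of the section (theta, 0) of the dual bundle: the first
  term is d theta, and the other two are the wedge product of (0, 1) with that section.\<close>

definition om :: "'a \<Rightarrow> 'a tvec \<times> real \<Rightarrow> 'a tvec \<times> real \<Rightarrow> real" where
  "om x V W = \<epsilon> * (g x (\<phi> x (fst V)) (fst W) + snd V * \<eta> x (fst W) - snd W * \<eta> x (fst V))"

text \<open>The order of the arguments fixes the sign: \<open>Q x W\<close> is minus the contraction
  of \<open>om\<close> with W in its first slot. With this sign, pairing reproduces the convention
  for the sharp map of \<open>\<pi>\<^sub>J\<close>.\<close>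

lemma Q_om:
  assumes "fst V \<in> TS x" "fst W \<in> TS x" shows "Q x W V = om x V W"
  using Q_apply[OF assms(1), of W "snd V"] g_phi_skew[OF assms] g_sym[OF assms(1) phi_TS[OF assms(2)]]
  by (simp add: om_def algebra_simps)

text \<open>For V = (v, r), the form part of \<open>Q x V\<close> is the image under
  \<open>contact_flat\<close> of - v + (eta(v) - epsilon r) xi. The multiple of \<open>\<xi>\<close>
  drops out of d theta, and the terms with the Reeb field supply the other two terms of
  \<open>om\<close>.\<close>

lemma pi_Q:
  assumes v: "fst V \<in> TS x" and w: "fst W \<in> TS x"
  shows "\<pi>\<^sub>J x (Q x V) (Q x W) = om x V W"
proof -
  have fi: "inv_into (TS x) (contact_flat \<A> \<theta> x) (\<lambda>w. Q x V (w, 0)) = - fst V + (\<eta> x (fst V) - \<epsilon> * snd V) *\<^sub>R \<xi> x"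
    if v: "fst V \<in> TS x" for V
  proof -
    note m = TS_scaleR[OF phi_TS[OF v], of \<epsilon>] TS_scaleR[OF xi_TS[of x], of "snd V"]
    have e: "\<eta> x (- (\<epsilon> *\<^sub>R \<phi> x (fst V)) - snd V *\<^sub>R \<xi> x) = - snd V"
      unfolding \<Omega>_diff[OF eta_\<Omega> TS_uminus[OF m(1)] m(2)] \<Omega>_minus[OF eta_\<Omega> m(1)]
        \<Omega>_scaleR[OF eta_\<Omega> phi_TS[OF v]] \<Omega>_scaleR[OF eta_\<Omega> xi_TS] eta_phi[OF v] eta_xi by simp
    have p: "\<phi> x (- (\<epsilon> *\<^sub>R \<phi> x (fst V)) - snd V *\<^sub>R \<xi> x) = \<epsilon> *\<^sub>R (fst V - \<eta> x (fst V) *\<^sub>R \<xi> x)"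
      unfolding phi_diff[OF TS_uminus[OF m(1)] m(2)] phi_minus[OF m(1)]
        phi_scaleR[OF phi_TS[OF v]] phi_scaleR[OF xi_TS] phi_xi phi_phi[OF v] by (simp add: algebra_simps)
    have l: "linear_map_on (TS x) (\<lambda>w. Q x V (w, 0))"
      by (rule dual_fiber_fst_linear[OF Q_dual[OF v]])
    have "inv_into (TS x) (contact_flat \<A> \<theta> x) (\<lambda>w. Q x V (w, 0)) = flat_inv x (\<lambda>w. Q x V (w, 0))"
      by (rule contact_flat_inv[OF l]) (simp add: Q_def)
    also have "\<dots> = - ((\<epsilon> * \<epsilon>) *\<^sub>R (fst V - \<eta> x (fst V) *\<^sub>R \<xi> x)) - (\<epsilon> * snd V) *\<^sub>R \<xi> x"
      unfolding flat_inv_def Q_sharp[OF v] e p by (simp add: algebra_simps)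
    also have "\<dots> = - fst V + (\<eta> x (fst V) - \<epsilon> * snd V) *\<^sub>R \<xi> x"
      unfolding eps_sq by (simp add: algebra_simps)
    finally show ?thesis .
  qed
  have bE: "Q x W (\<epsilon> *\<^sub>R \<xi> x, 0) = - snd W" if w: "fst W \<in> TS x" for W
    unfolding Q_apply[OF TS_scaleR[OF xi_TS]] g_scaleR_right[OF phi_TS[OF w] xi_TS] g_xi[OF phi_TS[OF w]]
      eta_phi[OF w] \<Omega>_scaleR[OF eta_\<Omega> xi_TS] eta_xi
    by (simp add: eps_cancel algebra_simps)
  have f: "Q x V (0, 1) = \<epsilon> * \<eta> x (fst V)" if v: "fst V \<in> TS x" for V
    unfolding Q_apply[OF TS_zero] using g_zero_right[OF phi_TS[OF v] xi_TS] \<Omega>_zero[OF eta_\<Omega>, of x] by simp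
  have dt: "dd \<theta> x (- fst V + c *\<^sub>R \<xi> x) (- fst W + d *\<^sub>R \<xi> x) = \<epsilon> * g x (\<phi> x (fst V)) (fst W)" for c d
  proof -
    note m = TS_uminus[OF v] TS_scaleR[OF xi_TS[of x], of c] TS_uminus[OF w] TS_scaleR[OF xi_TS[of x], of d]
    have p: "\<phi> x (- fst V + c *\<^sub>R \<xi> x) = - \<phi> x (fst V)"
      unfolding phi_add[OF m(1,2)] phi_minus[OF v] phi_scaleR[OF xi_TS] phi_xi by simp
    show ?thesis
      unfolding dd_theta[OF TS_plus[OF m(1,2)] TS_plus[OF m(3,4)]] p
        g_minus_left[OF phi_TS[OF v] TS_plus[OF m(3,4)]] g_add_right[OF phi_TS[OF v] m(3,4)]
        g_minus_right[OF phi_TS[OF v] w] g_scaleR_right[OF phi_TS[OF v] xi_TS] g_xi[OF phi_TS[OF v]] eta_phi[OF v]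
      by simp
  qed
  show ?thesis
    unfolding bisection_of_pair_def Let_def contact_bivector_def fi[OF v] fi[OF w] dt reeb bE[OF v] bE[OF w]
      f[OF v] f[OF w] om_def by (simp add: algebra_simps)
qed

text \<open>Uniqueness holds because elements of the fibre are separated by the covectors coming
  from \<open>g\<close> and by the projection to the second component.\<close>

lemma contract_pi:
  assumes a: "a \<in> dual_fiber AA x" shows "contract AA \<pi>\<^sub>J x a = P x a"
  unfolding contract_def
proof (rule the_equality)
  show "P x a \<in> fiber AA x \<and> (\<forall>b\<in>dual_fiber AA x. b (P x a) = \<pi>\<^sub>J x a b)"
  proof (intro conjI ballI)
    show "P x a \<in> fiber AA x" using P_TS[OF a] by (simp add: AA_simps mem_Times_iff)
    fix b assume b: "b \<in> dual_fiber AA x"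
    show "b (P x a) = \<pi>\<^sub>J x a b"
      using Q_om[OF P_TS[OF a] P_TS[OF b]] pi_Q[OF P_TS[OF a] P_TS[OF b]] unfolding QP[OF a] QP[OF b] by simp
  qed
next
  fix u assume u: "u \<in> fiber AA x \<and> (\<forall>b\<in>dual_fiber AA x. b u = \<pi>\<^sub>J x a b)"
  have uT: "fst u \<in> TS x" using u by (auto simp: AA_simps)
  have eq: "b u = b (P x a)" if b: "b \<in> dual_fiber AA x" for b
    using u b Q_om[OF P_TS[OF a] P_TS[OF b]] pi_Q[OF P_TS[OF a] P_TS[OF b]] unfolding QP[OF a] QP[OF b] by simp
  have "fst u = fst (P x a)"
  proof (rule g_eqI[OF uT P_TS[OF a]])
    fix Z assume Z: "Z \<in> VF"
    have "(\<lambda>(v, r). if v \<in> TS x then g x (Z x) v + 0 * r else 0) \<in> dual_fiber AA x"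
      by (rule dual_fiberI[OF g_linear[OF VF_TS[OF Z]]])
    from eq[OF this] show "g x (fst u) (Z x) = g x (fst (P x a)) (Z x)"
      using uT P_TS[OF a] g_sym[OF VF_TS[OF Z] uT] g_sym[OF VF_TS[OF Z] P_TS[OF a]]
      by (simp add: case_prod_unfold)
  qed
  moreover have "snd u = snd (P x a)"
  proof -
    have "(\<lambda>(v, r). if v \<in> TS x then 0 + 1 * r else 0) \<in> dual_fiber AA x"
      by (rule dual_fiberI) (simp add: linear_map_on_def)
    from eq[OF this] show ?thesis using uT P_TS[OF a] by (simp add: case_prod_unfold)
  qed
  ultimately show "u = P x a" by (rule prod_eqI)
qed

section \<open>Smoothness and linearity of P and Q\<close>

lemma \<Omega>\<^sub>A_iff: "\<alpha> \<in> \<Omega>\<^sub>A \<longleftrightarrow> (\<forall>x. \<alpha> x \<in> dual_fiber AA x) \<and> (\<forall>X\<in>SA. (\<lambda>x. \<alpha> x (X x)) \<in> C)"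
  by (simp add: dual_sections_def AA_simps)

lemma \<Omega>\<^sub>A_fiber: "\<alpha> \<in> \<Omega>\<^sub>A \<Longrightarrow> \<alpha> x \<in> dual_fiber AA x"
  and \<Omega>\<^sub>A_C: "\<alpha> \<in> \<Omega>\<^sub>A \<Longrightarrow> X \<in> SA \<Longrightarrow> (\<lambda>x. \<alpha> x (X x)) \<in> C"
  by (simp_all add: \<Omega>\<^sub>A_iff)

lemma Q_fields:
  assumes X: "X \<in> SA" and Y: "Y \<in> SA"
  shows "Q x (X x) (Y x) = - \<epsilon> * (dd \<eta> x (fst (X x)) (fst (Y x)) + snd (X x) * \<eta> x (fst (Y x))
    - snd (Y x) * \<eta> x (fst (X x)))"
  using Q_apply[OF SA_TS[OF Y], of x "X x" "snd (Y x)"] g_phi_dd[OF SA_TS[OF X] SA_TS[OF Y], of x]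
  by (simp add: algebra_simps)

lemma om_fields:
  assumes X: "X \<in> SA" and Y: "Y \<in> SA"
  shows "om x (X x) (Y x) = \<epsilon> * (dd \<eta> x (fst (X x)) (fst (Y x)) + snd (X x) * \<eta> x (fst (Y x))
    - snd (Y x) * \<eta> x (fst (X x)))"
  unfolding om_def g_phi_dd[OF SA_TS[OF X] SA_TS[OF Y]] ..

lemma form_C:
  assumes X: "X \<in> SA" and Y: "Y \<in> SA"
  shows "(\<lambda>x. dd \<eta> x (fst (X x)) (fst (Y x)) + snd (X x) * \<eta> x (fst (Y x)) - snd (Y x) * \<eta> x (fst (X x))) \<in> C"
  by (intro C_add C_diff C_mult dd_C[OF eta_\<Omega> SA_fst[OF X] SA_fst[OF Y]] SA_snd[OF X] SA_snd[OF Y]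
      \<Omega>_C[OF eta_\<Omega> SA_fst[OF X]] \<Omega>_C[OF eta_\<Omega> SA_fst[OF Y]])

lemma form_derivative:
  assumes X: "X \<in> VF" and Y: "Y \<in> SA" and Z: "Z \<in> SA"
  shows "X x (\<lambda>x. dd \<eta> x (fst (Y x)) (fst (Z x)) + snd (Y x) * \<eta> x (fst (Z x)) - snd (Z x) * \<eta> x (fst (Y x)))
    = X x (\<lambda>x. dd \<eta> x (fst (Y x)) (fst (Z x)))
      + (snd (Y x) * X x (\<lambda>x. \<eta> x (fst (Z x))) + \<eta> x (fst (Z x)) * X x (\<lambda>x. snd (Y x)))
      - (snd (Z x) * X x (\<lambda>x. \<eta> x (fst (Y x))) + \<eta> x (fst (Y x)) * X x (\<lambda>x. snd (Z x)))"
proof -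
  note c = dd_C[OF eta_\<Omega> SA_fst[OF Y] SA_fst[OF Z]] SA_snd[OF Y] SA_snd[OF Z]
    \<Omega>_C[OF eta_\<Omega> SA_fst[OF Y]] \<Omega>_C[OF eta_\<Omega> SA_fst[OF Z]]
  show ?thesis
    unfolding VFD_diff[OF X C_add[OF c(1) C_mult[OF c(2,5)]] C_mult[OF c(3,4)]]
      VFD_add[OF X c(1) C_mult[OF c(2,5)]] VFD_mult[OF X c(2,5)] VFD_mult[OF X c(3,4)] ..
qed

lemma Q_section:
  assumes X: "X \<in> SA" shows "(\<lambda>x. Q x (X x)) \<in> \<Omega>\<^sub>A"
  unfolding \<Omega>\<^sub>A_iff
proof (intro conjI allI ballI)
  show "Q x (X x) \<in> dual_fiber AA x" for x by (rule Q_dual[OF SA_TS[OF X]])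
  fix Y assume Y: "Y \<in> SA"
  show "(\<lambda>x. Q x (X x) (Y x)) \<in> C"
    unfolding Q_fields[OF X Y] by (rule C_cmult[OF form_C[OF X Y]])
qed

lemma P_section:
  assumes a: "\<alpha> \<in> \<Omega>\<^sub>A" shows "(\<lambda>x. P x (\<alpha> x)) \<in> SA"
proof -
  have s: "(\<lambda>x. sharp x (\<lambda>v. \<alpha> x (v, 0))) \<in> VF"
    by (rule sharp_VF[OF dual_fiber_fst_linear[OF \<Omega>\<^sub>A_fiber[OF a]] \<Omega>\<^sub>A_C[OF a SA_Pair[OF _ C_const]]])
  have f: "(\<lambda>x. \<alpha> x (0, 1)) \<in> C"
    by (rule \<Omega>\<^sub>A_C[OF a SA_Pair[OF VF_0 C_const]])
  show ?thesis
    unfolding P_def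
    by (rule SA_Pair[OF VF_scaleR[OF VF_add[OF phi_VF[OF s] VF_fmult[OF f xi_VF]]] C_minus[OF \<Omega>_C[OF eta_\<Omega> s]]])
qed

lemma Q_lin:
  assumes V: "fst V \<in> TS x" and W: "fst W \<in> TS x"
  shows "Q x (a *\<^sub>R V + b *\<^sub>R W) = a *\<^sub>R Q x V + b *\<^sub>R Q x W"
proof (rule ext)
  fix U :: "'a tvec \<times> real"
  obtain w s where U: "U = (w, s)" by (cases U)
  show "Q x (a *\<^sub>R V + b *\<^sub>R W) U = (a *\<^sub>R Q x V + b *\<^sub>R Q x W) U"
  proof (cases "w \<in> TS x")
    case True
    note m = TS_scaleR[OF V, of a] TS_scaleR[OF W, of b]
    have "fst (a *\<^sub>R V + b *\<^sub>R W) = a *\<^sub>R fst V + b *\<^sub>R fst W" "snd (a *\<^sub>R V + b *\<^sub>R W) = a * snd V + b * snd W"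
      by simp_all
    moreover have "g x (\<phi> x (a *\<^sub>R fst V + b *\<^sub>R fst W)) w = a * g x (\<phi> x (fst V)) w + b * g x (\<phi> x (fst W)) w"
      unfolding phi_add[OF m] phi_scaleR[OF V] phi_scaleR[OF W]
        g_add_left[OF TS_scaleR[OF phi_TS[OF V]] True TS_scaleR[OF phi_TS[OF W]]]
        g_scaleR_left[OF phi_TS[OF V] True] g_scaleR_left[OF phi_TS[OF W] True] ..
    moreover have "\<eta> x (a *\<^sub>R fst V + b *\<^sub>R fst W) = a * \<eta> x (fst V) + b * \<eta> x (fst W)"
      unfolding \<Omega>_add[OF eta_\<Omega> m] \<Omega>_scaleR[OF eta_\<Omega> V] \<Omega>_scaleR[OF eta_\<Omega> W] ..
    ultimately have "Q x (a *\<^sub>R V + b *\<^sub>R W) (w, s) = a * Q x V (w, s) + b * Q x W (w, s)"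
      unfolding Q_apply[OF True] by (simp only:) (simp add: algebra_simps)
    then show ?thesis unfolding U by (simp add: scaleR_fun_def)
  qed (simp add: U Q_def scaleR_fun_def)
qed

lemma P_lin:
  assumes a: "a \<in> dual_fiber AA x" and b: "b \<in> dual_fiber AA x"
  shows "P x (s *\<^sub>R a + t *\<^sub>R b) = s *\<^sub>R P x a + t *\<^sub>R P x b"
proof -
  have T: "fst (s *\<^sub>R P x a + t *\<^sub>R P x b) \<in> TS x"
    using TS_plus[OF TS_scaleR[OF P_TS[OF a]] TS_scaleR[OF P_TS[OF b]]] by simp
  have "s *\<^sub>R a + t *\<^sub>R b = Q x (s *\<^sub>R P x a + t *\<^sub>R P x b)"
    unfolding Q_lin[OF P_TS[OF a] P_TS[OF b]] QP[OF a] QP[OF b] ..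
  then show ?thesis using PQ[OF T] by metis
qed

section \<open>The bracket of the dual algebroid\<close>

abbreviation "\<phi>\<^sub>0 \<equiv> dual_pair \<A> (\<lambda>x v. 0) (\<lambda>x. 1)"
abbreviation "AD \<equiv> dual_algebroid \<A> AA \<phi>\<^sub>0 \<pi>\<^sub>J"
abbreviation "G' \<equiv> dual_metric AA \<pi>\<^sub>J G"

lemma AD_simps: "sections AD = \<Omega>\<^sub>A" "anchor AD x a = fst (contract AA \<pi>\<^sub>J x a)"
  "bracket AD = dual_bracket AA \<phi>\<^sub>0 \<pi>\<^sub>J"
  by (simp_all add: dual_algebroid_def AA_simps)

lemma phi0_apply: "v \<in> TS x \<Longrightarrow> \<phi>\<^sub>0 x (v, r) = r"
  by (simp add: dual_pair_def)

lemma extend_AA: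
  assumes X: "X \<in> SA"
  shows "extend AA x (X x) \<in> SA" "extend AA x (X x) x = X x"
proof -
  have "\<exists>Y. Y \<in> sections AA \<and> Y x = X x" using X by (auto simp: AA_simps)
  from someI_ex[OF this] show "extend AA x (X x) \<in> SA" "extend AA x (X x) x = X x"
    by (simp_all add: extend_def AA_simps)
qed

text \<open>As for vector fields, the extensions picked in \<open>d1\<close> must be shown to be
  irrelevant. Splitting \<open>\<beta>\<close> into a 1-form and a function expresses the formula
  through the values of the two sections at \<open>x\<close>, with derivatives falling only on the
  components of \<open>\<beta>\<close>.\<close>

lemma d1_AA:
  assumes b: "\<beta> \<in> \<Omega>\<^sub>A" and X: "X \<in> SA" and Y: "Y \<in> SA"
  shows "d1 AA \<beta> x (X x) (Y x) = fst (X x) (\<lambda>y. \<beta> y (Y y)) - fst (Y x) (\<lambda>y. \<beta> y (X y)) - \<beta> x (bracket AA X Y x)"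
proof -
  define \<beta>1 where "\<beta>1 x v = \<beta> x (v, 0)" for x v
  define \<beta>0 where "\<beta>0 x = \<beta> x (0, 1)" for x
  have b1: "\<beta>1 \<in> \<Omega>"
    unfolding \<beta>1_def
  proof (rule \<Omega>I)
    show "linear_map_on (TS x) (\<lambda>v. \<beta> x (v, 0))" for x
      by (rule dual_fiber_fst_linear[OF \<Omega>\<^sub>A_fiber[OF b]])
    show "\<beta> x (v, 0) = 0" if "v \<notin> TS x" for x v
      using \<Omega>\<^sub>A_fiber[OF b, of x] that by (simp add: dual_fiber_AA)
    show "(\<lambda>x. \<beta> x (X x, 0)) \<in> C" if "X \<in> VF" for X
      by (rule \<Omega>\<^sub>A_C[OF b SA_Pair[OF that C_const]])
  qed
  have b0: "\<beta>0 \<in> C"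
    unfolding \<beta>0_def by (rule \<Omega>\<^sub>A_C[OF b SA_Pair[OF VF_0 C_const]])
  have split: "\<beta> x V = \<beta>1 x (fst V) + snd V * \<beta>0 x" if "fst V \<in> TS x" for x V
    unfolding \<beta>1_def \<beta>0_def using dual_fiber_split[OF \<Omega>\<^sub>A_fiber[OF b] that, of "snd V"] by simp
  let ?N = "\<lambda>X Y. fst (X x) (\<lambda>y. \<beta> y (Y y)) - fst (Y x) (\<lambda>y. \<beta> y (X y)) - \<beta> x (bracket AA X Y x)"
  have N: "?N X Y = dd \<beta>1 x (fst (X x)) (fst (Y x)) + snd (Y x) * fst (X x) \<beta>0 - snd (X x) * fst (Y x) \<beta>0"
    if X: "X \<in> SA" and Y: "Y \<in> SA" for X Y
  proof -
    note fX = SA_fst[OF X] and fY = SA_fst[OF Y]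
    have e: "(\<lambda>y. \<beta> y (Z y)) = (\<lambda>y. \<beta>1 y (fst (Z y)) + snd (Z y) * \<beta>0 y)" if "Z \<in> SA" for Z
      by (rule ext) (rule split[OF SA_TS[OF that]])
    have br: "fst (bracket AA X Y x) \<in> TS x"
      using VF_TS[OF lie_bracket_VF[OF fX fY]] by (simp add: AA_simps)
    have bb: "\<beta> x (bracket AA X Y x) = \<beta>1 x (lie_bracket (\<lambda>y. fst (X y)) (\<lambda>y. fst (Y y)) x)
        + (fst (X x) (\<lambda>y. snd (Y y)) - fst (Y x) (\<lambda>y. snd (X y))) * \<beta>0 x"
      using split[OF br] by (simp add: AA_simps)
    show ?thesis
      unfolding bb e[OF X] e[OF Y] dd_fields[OF b1 fX fY]
        VFD_add[OF fX \<Omega>_C[OF b1 fY] C_mult[OF SA_snd[OF Y] b0]] VFD_mult[OF fX SA_snd[OF Y] b0]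
        VFD_add[OF fY \<Omega>_C[OF b1 fX] C_mult[OF SA_snd[OF X] b0]] VFD_mult[OF fY SA_snd[OF X] b0]
      by (simp add: algebra_simps)
  qed
  let ?X = "extend AA x (X x)" and ?Y = "extend AA x (Y x)"
  have "d1 AA \<beta> x (X x) (Y x) = ?N ?X ?Y"
    using extend_AA(2)[OF X, of x] extend_AA(2)[OF Y, of x] by (simp add: d1_def Let_def AA_simps)
  also have "\<dots> = dd \<beta>1 x (fst (?X x)) (fst (?Y x)) + snd (?Y x) * fst (?X x) \<beta>0 - snd (?X x) * fst (?Y x) \<beta>0"
    by (rule N[OF extend_AA(1)[OF X] extend_AA(1)[OF Y]])
  also have "\<dots> = dd \<beta>1 x (fst (X x)) (fst (Y x)) + snd (Y x) * fst (X x) \<beta>0 - snd (X x) * fst (Y x) \<beta>0"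
    by (simp only: extend_AA(2)[OF X] extend_AA(2)[OF Y])
  also have "\<dots> = ?N X Y"
    by (rule N[OF X Y, symmetric])
  finally show ?thesis .
qed

lemma bracket_SA:
  assumes X: "X \<in> SA" and Y: "Y \<in> SA" shows "bracket AA X Y \<in> SA"
proof -
  have e: "bracket AA X Y = (\<lambda>x. (lie_bracket (\<lambda>y. fst (X y)) (\<lambda>y. fst (Y y)) x,
     fst (X x) (\<lambda>y. snd (Y y)) - fst (Y x) (\<lambda>y. snd (X y))))"
    by (rule ext) (rule AA_simps)
  show ?thesis unfolding e
    by (rule SA_Pair[OF lie_bracket_VF[OF SA_fst[OF X] SA_fst[OF Y]]
          C_diff[OF VF_C[OF SA_fst[OF X] SA_snd[OF Y]] VF_C[OF SA_fst[OF Y] SA_snd[OF X]]]])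
qed

text \<open>The map \<open>\<pi>\<^sup>\<sharp>\<close> (inverse to \<open>Q\<close>) intertwines the brackets because \<open>om\<close> is \<open>d\<^sub>A\<^sub>,\<^sub>\<phi>\<^sub>0\<close>-exact.\<close>

lemma dual_bracket_Q:
  assumes X: "X \<in> SA" and Y: "Y \<in> SA"
  shows "dual_bracket AA \<phi>\<^sub>0 \<pi>\<^sub>J (\<lambda>x. Q x (X x)) (\<lambda>x. Q x (Y x)) x = Q x (bracket AA X Y x)"
proof (rule ext)
  fix V :: "'a tvec \<times> real"
  obtain v s where V: "V = (v, s)" by (cases V)
  have cQ: "contract AA \<pi>\<^sub>J x (Q x (Z x)) = Z x" if "Z \<in> SA" for Z x
    unfolding contract_pi[OF Q_dual[OF SA_TS[OF that]]] by (rule PQ[OF SA_TS[OF that]])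
  note fX = SA_fst[OF X] and fY = SA_fst[OF Y]
  show "dual_bracket AA \<phi>\<^sub>0 \<pi>\<^sub>J (\<lambda>x. Q x (X x)) (\<lambda>x. Q x (Y x)) x V = Q x (bracket AA X Y x) V"
  proof (cases "v \<in> TS x")
    case False
    then show ?thesis
      by (simp add: dual_bracket_def Let_def V lie_deriv_phi_def dphi0_def d0_def AA_simps dual_pair_def Q_def)
  next
    case True
    obtain Z where Z: "Z \<in> VF" "Z x = v" by (rule vector_field_through[OF True])
    \<comment> \<open>A constant second component, so that its derivatives disappear from the
      brackets with \<open>?W\<close>.\<close>
    let ?W = "\<lambda>x. (Z x, s)"
    have W: "?W \<in> SA" by (rule SA_Pair[OF Z(1) C_const])
    have Wx: "?W x = V" by (simp add: Z(2) V)
    let ?a = "\<lambda>x. Q x (X x)" and ?b = "\<lambda>x. Q x (Y x)"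
    have p0: "\<phi>\<^sub>0 x U = snd U" if "fst U \<in> TS x" for U
      using phi0_apply[OF that, of "snd U"] by simp
    have ld: "lie_deriv_phi AA \<phi>\<^sub>0 S \<beta> x (?W x) = fst (S x) (\<lambda>y. \<beta> y (?W y)) - \<beta> x (bracket AA S ?W x)
        + snd (S x) * \<beta> x (?W x)"
      if S: "S \<in> SA" and b: "\<beta> \<in> \<Omega>\<^sub>A" for S \<beta>
      unfolding lie_deriv_phi_def dphi1_def dphi0_def d0_def d1_AA[OF b S W] p0[OF SA_TS[OF S]] p0[OF SA_TS[OF W]]
      using True Z(2) by (simp add: AA_simps)
    have d: "dphi0 AA \<phi>\<^sub>0 f x (?W x) = Z x f + f x * s" for f
      unfolding dphi0_def d0_def p0[OF SA_TS[OF W]] using True Z(2) by (simp add: AA_simps)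
    have L: "dual_bracket AA \<phi>\<^sub>0 \<pi>\<^sub>J ?a ?b x (?W x)
        = (fst (X x) (\<lambda>y. Q y (Y y) (?W y)) - Q x (Y x) (bracket AA X ?W x) + snd (X x) * Q x (Y x) (?W x))
        - (fst (Y x) (\<lambda>y. Q y (X y) (?W y)) - Q x (X x) (bracket AA Y ?W x) + snd (Y x) * Q x (X x) (?W x))
        - (Z x (\<lambda>y. Q y (Y y) (X y)) + Q x (Y x) (X x) * s)"
      unfolding dual_bracket_def Let_def cQ[OF X] cQ[OF Y] ld[OF X Q_section[OF Y]] ld[OF Y Q_section[OF X]] d ..
    let ?F = "\<lambda>X Y x. dd \<eta> x (fst (X x)) (fst (Y x)) + snd (X x) * \<eta> x (fst (Y x)) - snd (Y x) * \<eta> x (fst (X x))"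
    have Qd: "U x (\<lambda>y. Q y (S y) (S' y)) = - \<epsilon> * U x (?F S S')" if "U \<in> VF" "S \<in> SA" "S' \<in> SA" for U S S'
      unfolding Q_fields[OF that(2,3)] by (rule VFD_cmult[OF that(1) form_C[OF that(2,3)]])
    note fW = SA_fst[OF W]
    note Qs = Q_fields[OF Y bracket_SA[OF X W]] Q_fields[OF X bracket_SA[OF Y W]] Q_fields[OF Y W]
      Q_fields[OF X W] Q_fields[OF Y X] Q_fields[OF bracket_SA[OF X Y] W]
    have z0: "fst (U x) (\<lambda>y. snd (?W y)) = 0" if "U \<in> SA" for U
      using VFD_const[OF SA_fst[OF that], of x s] by simp
    let ?X = "\<lambda>y. fst (X y)" and ?Y = "\<lambda>y. fst (Y y)"
    have e1: "\<eta> x (lie_bracket ?X ?Y x) = fst (X x) (\<lambda>y. \<eta> y (?Y y)) - fst (Y x) (\<lambda>y. \<eta> y (?X y)) - dd \<eta> x (fst (X x)) (fst (Y x))"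
      and e2: "\<eta> x (lie_bracket ?X Z x) = fst (X x) (\<lambda>y. \<eta> y (Z y)) - Z x (\<lambda>y. \<eta> y (?X y)) - dd \<eta> x (fst (X x)) (Z x)"
      and e3: "\<eta> x (lie_bracket ?Y Z x) = fst (Y x) (\<lambda>y. \<eta> y (Z y)) - Z x (\<lambda>y. \<eta> y (?Y y)) - dd \<eta> x (fst (Y x)) (Z x)"
      using dd_fields[OF eta_\<Omega> fX fY, of x] dd_fields[OF eta_\<Omega> fX Z(1), of x] dd_fields[OF eta_\<Omega> fY Z(1), of x]
      by simp_all
    have k1: "dd \<eta> x (fst (Y x)) (lie_bracket ?X Z x) = dd \<eta> x (lie_bracket Z ?X x) (fst (Y x))"
      unfolding lie_bracket_skew[of ?X Z x] linear_map_on_minus[OF dd_linear[OF eta_\<Omega> VF_TS[OF fY]]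
          VF_TS[OF lie_bracket_VF[OF Z(1) fX]]]
      using dd_skew[OF eta_\<Omega> VF_TS[OF fY] VF_TS[OF lie_bracket_VF[OF Z(1) fX]], of x] by simp
    have k2: "dd \<eta> x (fst (X x)) (lie_bracket ?Y Z x) = - dd \<eta> x (lie_bracket ?Y Z x) (fst (X x))"
      by (rule dd_skew[OF eta_\<Omega> VF_TS[OF fX] VF_TS[OF lie_bracket_VF[OF fY Z(1)]]])
    have k3: "(\<lambda>y. dd \<eta> y (fst (X y)) (Z y)) = (\<lambda>y. - dd \<eta> y (Z y) (fst (X y)))"
      by (rule ext) (rule dd_skew[OF eta_\<Omega> VF_TS[OF fX] VF_TS[OF Z(1)]])
    have k3': "dd \<eta> x (fst (X x)) (Z x) = - dd \<eta> x (Z x) (fst (X x))"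
      by (rule dd_skew[OF eta_\<Omega> VF_TS[OF fX] VF_TS[OF Z(1)]])
    have k4: "(\<lambda>y. dd \<eta> y (fst (Y y)) (fst (X y))) = (\<lambda>y. - dd \<eta> y (fst (X y)) (fst (Y y)))"
      by (rule ext) (rule dd_skew[OF eta_\<Omega> VF_TS[OF fY] VF_TS[OF fX]])
    have k4': "dd \<eta> x (fst (Y x)) (fst (X x)) = - dd \<eta> x (fst (X x)) (fst (Y x))"
      by (rule dd_skew[OF eta_\<Omega> VF_TS[OF fY] VF_TS[OF fX]])
    note cl = dd_closed[OF eta_\<Omega> fX fY Z(1), of x]
    \<comment> \<open>Up to regrouping, this says that the twisted differential of the 2-form
      \<open>?F\<close> vanishes on \<open>X\<close>, \<open>Y\<close> and \<open>?W\<close>.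
      Expansion reduces it to d(d eta) = 0.\<close>
    have "(fst (X x) (?F Y ?W) - ?F Y (bracket AA X ?W) x + snd (X x) * ?F Y ?W x)
        - (fst (Y x) (?F X ?W) - ?F X (bracket AA Y ?W) x + snd (Y x) * ?F X ?W x)
        - (Z x (?F Y X) + ?F Y X x * s) = ?F (bracket AA X Y) ?W x"
      unfolding form_derivative[OF fX Y W] form_derivative[OF fY X W] form_derivative[OF Z(1) Y X]
      unfolding AA_simps fst_conv snd_conv e1 e2 e3 k1 k2 k3 k3' k4 k4'
        VFD_minus[OF fY dd_C[OF eta_\<Omega> Z(1) fX]] VFD_minus[OF Z(1) dd_C[OF eta_\<Omega> fX fY]]
        VFD_const[OF fX] VFD_const[OF fY]
      using cl by (simp add: algebra_simps)
    then have "- \<epsilon> * ((fst (X x) (?F Y ?W) - ?F Y (bracket AA X ?W) x + snd (X x) * ?F Y ?W x)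
        - (fst (Y x) (?F X ?W) - ?F X (bracket AA Y ?W) x + snd (Y x) * ?F X ?W x)
        - (Z x (?F Y X) + ?F Y X x * s)) = - \<epsilon> * ?F (bracket AA X Y) ?W x" by simp
    then have "dual_bracket AA \<phi>\<^sub>0 \<pi>\<^sub>J ?a ?b x (?W x) = Q x (bracket AA X Y x) (?W x)"
      unfolding L Qd[OF fX Y W] Qd[OF fY X W] Qd[OF Z(1) Y X] unfolding Qs by (simp only: right_diff_distrib distrib_left) (simp add: algebra_simps)
    then show ?thesis unfolding Wx .
  qed
qed

section \<open>The dual metric and its contraction\<close>

lemma G'_P:
  assumes "a \<in> dual_fiber AA x" "b \<in> dual_fiber AA x"
  shows "G' x a b = G x (P x a) (P x b)"
  unfolding dual_metric_def contract_pi[OF assms(1)] contract_pi[OF assms(2)] ..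

lemma G_apply: "G x V W = g x (fst V) (fst W) + \<epsilon> * snd V * snd W"
  by (simp add: case_prod_unfold)

text \<open>The covector (- eta, 0) is the one that the dual metric associates with (- epsilon xi,
  0), the value of \<open>X\<^sub>0\<close>. Knowing its image under \<open>P\<close> makes its
  contraction with \<open>\<pi>\<^sub>J\<close> computable.\<close>

lemma G_xi_dual:
  defines "c \<equiv> \<lambda>x. (\<lambda>(v, r). if v \<in> TS x then - \<eta> x v + 0 * r else 0)"
  shows c_dual: "c x \<in> dual_fiber AA x" and P_c: "P x (c x) = (0, \<epsilon>)"
proof -
  have l: "linear_map_on (TS x) (\<lambda>v. - \<eta> x v)" for x
    using \<Omega>_linear[OF eta_\<Omega>, of x] by (auto simp: linear_map_on_def)
  show cd: "c x \<in> dual_fiber AA x" unfolding c_def by (rule dual_fiberI[OF l])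
  have "sharp x (\<lambda>v. c x (v, 0)) = (- \<epsilon>) *\<^sub>R \<xi> x"
  proof (rule sharp_unique[OF TS_scaleR[OF xi_TS]])
    fix w assume w: "w \<in> TS x"
    show "g x ((- \<epsilon>) *\<^sub>R \<xi> x) w = c x (w, 0)"
      unfolding g_scaleR_left[OF xi_TS w] g_xi'[OF w] using w by (simp add: c_def eps_cancel)
  qed
  then show "P x (c x) = (0, \<epsilon>)"
    unfolding P_def using phi_scaleR[OF xi_TS, of x "- \<epsilon>"] phi_xi[of x] \<Omega>_scaleR[OF eta_\<Omega> xi_TS, of x "- \<epsilon>"] eta_xi[of x]
      TS_zero \<Omega>_zero[OF eta_\<Omega>, of x] by (simp add: c_def)
qed

text \<open>\<open>G'\<close> is the usual dual of \<open>G\<close>, so that contraction with it inverts \<open>G\<^sup>\<flat>\<close>.\<close>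

lemma contract_G':
  assumes V: "fst V \<in> TS x"
  shows "contract AA G' x (\<lambda>(w, s). if w \<in> TS x then g x (fst V) w + (\<epsilon> * snd V) * s else 0) = V"
proof -
  let ?c = "\<lambda>(w, s). if w \<in> TS x then g x (fst V) w + (\<epsilon> * snd V) * s else 0"
  have cd: "?c \<in> dual_fiber AA x" by (rule dual_fiberI[OF g_linear[OF V]])
  have s: "sharp x (\<lambda>v. ?c (v, 0)) = fst V"
    by (rule sharp_unique[OF V]) simp
  have c01: "?c (0, 1) = \<epsilon> * snd V"
    using TS_zero g_zero_right[OF V xi_TS] by simp
  \<comment> \<open>\<open>G\<close> and \<open>om\<close> are related by the endomorphism that
    sends (v, r) to (epsilon phi v + r xi, - eta(v)). It squares to minus the identity and preserves
    \<open>G\<close>, which is why the metric defined through \<open>\<pi>\<^sub>J\<close> is the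
    usual dual metric.\<close>
  have Pc: "P x ?c = (\<epsilon> *\<^sub>R (\<phi> x (fst V)) + snd V *\<^sub>R \<xi> x, - \<eta> x (fst V))"
    unfolding P_def s c01 using eps_sq by (simp add: scaleR_add_right)
  have eq: "b V = G' x ?c b" if b: "b \<in> dual_fiber AA x" for b
  proof -
    let ?W = "P x b"
    note w = P_TS[OF b] and pv = phi_TS[OF V]
    have "b V = om x V ?W" using Q_om[OF V w] QP[OF b] by simp
    also have "\<dots> = G x (P x ?c) ?W"
      unfolding G_apply Pc fst_conv snd_conv om_def g_add_left[OF TS_scaleR[OF pv] w TS_scaleR[OF xi_TS]]
        g_scaleR_left[OF pv w] g_scaleR_left[OF xi_TS w] g_xi'[OF w] by (simp add: algebra_simps)
    finally show ?thesis unfolding G'_P[OF cd b] .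
  qed
  show ?thesis
    unfolding contract_def
  proof (rule the_equality)
    show "V \<in> fiber AA x \<and> (\<forall>b\<in>dual_fiber AA x. b V = G' x ?c b)"
      using V eq by (simp add: AA_simps mem_Times_iff)
    fix u assume u: "u \<in> fiber AA x \<and> (\<forall>b\<in>dual_fiber AA x. b u = G' x ?c b)"
    have uT: "fst u \<in> TS x" using u by (auto simp: AA_simps)
    have e: "b u = b V" if b: "b \<in> dual_fiber AA x" for b using u eq[OF b] b by simp
    have "fst u = fst V"
    proof (rule g_eqI[OF uT V])
      fix Z assume Z: "Z \<in> VF"
      have "(\<lambda>(v, r). if v \<in> TS x then g x (Z x) v + 0 * r else 0) \<in> dual_fiber AA x"
        by (rule dual_fiberI[OF g_linear[OF VF_TS[OF Z]]])
      from e[OF this] show "g x (fst u) (Z x) = g x (fst V) (Z x)"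
        using uT V g_sym[OF VF_TS[OF Z] uT] g_sym[OF VF_TS[OF Z] V] by (simp add: case_prod_unfold)
    qed
    moreover have "snd u = snd V"
    proof -
      have "(\<lambda>(v, r). if v \<in> TS x then 0 + 1 * r else 0) \<in> dual_fiber AA x"
        by (rule dual_fiberI) (simp add: linear_map_on_def)
      from e[OF this] show ?thesis using uT V by (simp add: case_prod_unfold)
    qed
    ultimately show "u = V" by (rule prod_eqI)
  qed
qed

text \<open>\<open>inv_into\<close> returns this covector once the contraction is injective on the
  dual fibre. Injectivity follows because \<open>sharp\<close> writes every covector in the
  displayed form.\<close>

lemma contract_G'_inv:
  assumes V: "fst V \<in> TS x"
  shows "inv_into (dual_fiber AA x) (contract AA G' x) V
    = (\<lambda>(w, s). if w \<in> TS x then g x (fst V) w + (\<epsilon> * snd V) * s else 0)"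
proof -
  let ?c = "\<lambda>V :: 'a tvec \<times> real. (\<lambda>(w, s). if w \<in> TS x then g x (fst V) w + (\<epsilon> * snd V) * s else 0)"
  have cd: "?c U \<in> dual_fiber AA x" if "fst U \<in> TS x" for U by (rule dual_fiberI[OF g_linear[OF that]])
  have rep: "\<exists>U. fst U \<in> TS x \<and> a = ?c U" if a: "a \<in> dual_fiber AA x" for a
  proof (intro exI conjI)
    note l = dual_fiber_fst_linear[OF a]
    let ?U = "(sharp x (\<lambda>v. a (v, 0)), \<epsilon> * a (0, 1))"
    show "fst ?U \<in> TS x" using sharp_TS[OF l] by simp
    show "a = ?c ?U"
    proof (rule ext)
      fix W :: "'a tvec \<times> real"
      obtain w s where W: "W = (w, s)" by (cases W)
      show "a W = ?c ?U W"
        using dual_fiber_split[OF a, of w s] g_sharp[OF l, of w] a unfolding W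
        by (auto simp: eps_cancel dual_fiber_AA)
    qed
  qed
  have inj: "inj_on (contract AA G' x) (dual_fiber AA x)"
  proof (rule inj_onI)
    fix a b assume a: "a \<in> dual_fiber AA x" and b: "b \<in> dual_fiber AA x"
      and e: "contract AA G' x a = contract AA G' x b"
    obtain U where U: "fst U \<in> TS x" "a = ?c U" using rep[OF a] by blast
    obtain U' where U': "fst U' \<in> TS x" "b = ?c U'" using rep[OF b] by blast
    have "U = U'" using e unfolding U(2) U'(2) contract_G'[OF U(1)] contract_G'[OF U'(1)] .
    then show "a = b" by (simp only: U(2) U'(2))
  qed
  show ?thesis using inv_into_f_f[OF inj cd[OF V]] unfolding contract_G'[OF V] .
qed

section \<open>Levi-Civita connections on \<open>TM \<oplus> \<real>\<close>\<close>

lemma levi_civitaD: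
  assumes "levi_civita \<A> A1 m D"
  shows lc_section: "\<And>X Y. X \<in> sections A1 \<Longrightarrow> Y \<in> sections A1 \<Longrightarrow> D X Y \<in> sections A1"
    and lc_linear_right: "\<And>X. X \<in> sections A1 \<Longrightarrow> linear_map_on (sections A1) (D X)"
    and lc_linear_left: "\<And>Y. Y \<in> sections A1 \<Longrightarrow> linear_map_on (sections A1) (\<lambda>X. D X Y)"
    and lc_fmult_left: "\<And>f X Y. f \<in> C \<Longrightarrow> X \<in> sections A1 \<Longrightarrow> Y \<in> sections A1 \<Longrightarrow>
      D (\<lambda>x. f x *\<^sub>R X x) Y = (\<lambda>x. f x *\<^sub>R D X Y x)"
    and lc_fmult_right: "\<And>f X Y. f \<in> C \<Longrightarrow> X \<in> sections A1 \<Longrightarrow> Y \<in> sections A1 \<Longrightarrow>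
      D X (\<lambda>x. f x *\<^sub>R Y x) = (\<lambda>x. f x *\<^sub>R D X Y x + anchor A1 x (X x) f *\<^sub>R Y x)"
    and lc_torsion: "\<And>X Y. X \<in> sections A1 \<Longrightarrow> Y \<in> sections A1 \<Longrightarrow>
      (\<lambda>x. D X Y x - D Y X x) = bracket A1 X Y"
    and lc_metric: "\<And>X Y Z x. X \<in> sections A1 \<Longrightarrow> Y \<in> sections A1 \<Longrightarrow> Z \<in> sections A1 \<Longrightarrow>
      anchor A1 x (X x) (\<lambda>y. m y (Y y) (Z y)) = m x (D X Y x) (Z x) + m x (Y x) (D X Z x)"
  using assms by (simp_all add: levi_civita_def)

lemma lincomb_fun: "a *\<^sub>R X + b *\<^sub>R Y = (\<lambda>x. a *\<^sub>R X x + b *\<^sub>R Y x)"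
  for X Y :: "'x \<Rightarrow> 'y::real_vector"
  by (simp add: plus_fun_def scaleR_fun_def)

text \<open>\<open>G\<close> behaves like the product of \<open>g\<close> with a constant metric on
  a trivial line bundle, so its connection is the direct sum of that of \<open>g\<close> and plain
  differentiation of functions.\<close>

lemma levi_civita_AA:
  assumes lc: "levi_civita \<A> (tangent_algebroid \<A>) g D"
  shows "levi_civita \<A> AA G (\<lambda>X Y x. (D (\<lambda>x. fst (X x)) (\<lambda>x. fst (Y x)) x, fst (X x) (\<lambda>y. snd (Y y))))"
    (is "levi_civita \<A> AA G ?N")
proof -
  note D = D_VF[OF lc] and DT = D_TS[OF lc]
  show ?thesis
    unfolding levi_civita_def AA_simps(2,3)
  proof (intro conjI ballI allI)
    fix X assume X: "X \<in> SA"
    note fX = SA_fst[OF X]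
    show "linear_map_on SA (?N X)"
      unfolding linear_map_on_def
    proof (intro ballI allI)
      fix Y Z a b assume Y: "Y \<in> SA" and Z: "Z \<in> SA"
      note fY = SA_fst[OF Y] and fZ = SA_fst[OF Z]
      have 1: "D (\<lambda>x. fst (X x)) (\<lambda>x. fst ((a *\<^sub>R Y + b *\<^sub>R Z) x))
          = (\<lambda>x. a *\<^sub>R D (\<lambda>x. fst (X x)) (\<lambda>x. fst (Y x)) x + b *\<^sub>R D (\<lambda>x. fst (X x)) (\<lambda>x. fst (Z x)) x)"
        using D_linear_right[OF lc fX, unfolded linear_map_on_def, rule_format, OF fY fZ, of a b]
        unfolding lincomb_fun fst_add fst_scaleR lincomb_fun .
      have 2: "fst (X x) (\<lambda>y. snd ((a *\<^sub>R Y + b *\<^sub>R Z) y))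
          = a * fst (X x) (\<lambda>y. snd (Y y)) + b * fst (X x) (\<lambda>y. snd (Z y))" for x
        using VFD_add[OF fX C_cmult[OF SA_snd[OF Y], of a] C_cmult[OF SA_snd[OF Z], of b], of x]
          VFD_cmult[OF fX SA_snd[OF Y], of x a] VFD_cmult[OF fX SA_snd[OF Z], of x b]
        unfolding lincomb_fun by simp
      show "?N X (a *\<^sub>R Y + b *\<^sub>R Z) = a *\<^sub>R ?N X Y + b *\<^sub>R ?N X Z"
        unfolding 1 2 unfolding lincomb_fun scaleR_Pair add_Pair lincomb_fun real_scaleR_def by (rule refl)
    qed
    show "linear_map_on SA (\<lambda>Y. ?N Y X)"
      unfolding linear_map_on_def
    proof (intro ballI allI)
      fix Y Z a b assume Y: "Y \<in> SA" and Z: "Z \<in> SA"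
      note fY = SA_fst[OF Y] and fZ = SA_fst[OF Z]
      have 1: "D (\<lambda>x. fst ((a *\<^sub>R Y + b *\<^sub>R Z) x)) (\<lambda>x. fst (X x))
          = (\<lambda>x. a *\<^sub>R D (\<lambda>x. fst (Y x)) (\<lambda>x. fst (X x)) x + b *\<^sub>R D (\<lambda>x. fst (Z x)) (\<lambda>x. fst (X x)) x)"
        using D_linear_left[OF lc fX, unfolded linear_map_on_def, rule_format, OF fY fZ, of a b]
        unfolding lincomb_fun fst_add fst_scaleR lincomb_fun .
      have 2: "fst ((a *\<^sub>R Y + b *\<^sub>R Z) x) (\<lambda>y. snd (X y))
          = a * fst (Y x) (\<lambda>y. snd (X y)) + b * fst (Z x) (\<lambda>y. snd (X y))" for x
        unfolding lincomb_fun by (simp add: scaleR_tvec_apply)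
      show "?N (a *\<^sub>R Y + b *\<^sub>R Z) X = a *\<^sub>R ?N Y X + b *\<^sub>R ?N Z X"
        unfolding 1 2 unfolding lincomb_fun scaleR_Pair add_Pair lincomb_fun real_scaleR_def by (rule refl)
    qed
    fix Y assume Y: "Y \<in> SA"
    note fY = SA_fst[OF Y]
    show "?N X Y \<in> SA" by (rule SA_Pair[OF D[OF fX fY] VF_C[OF fX SA_snd[OF Y]]])
    show "(\<lambda>x. ?N X Y x - ?N Y X x) = bracket AA X Y"
      using D_torsion[OF lc fX fY] by (intro ext) (simp add: AA_simps)
    fix Z x assume Z: "Z \<in> SA"
    note fZ = SA_fst[OF Z]
    show "fst (X x) (\<lambda>y. G y (Y y) (Z y)) = G x (?N X Y x) (Z x) + G x (Y x) (?N X Z x)"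
    proof -
      have "fst (X x) (\<lambda>y. G y (Y y) (Z y)) = fst (X x) (\<lambda>y. g y (fst (Y y)) (fst (Z y)))
          + \<epsilon> * (snd (Y x) * fst (X x) (\<lambda>y. snd (Z y)) + snd (Z x) * fst (X x) (\<lambda>y. snd (Y y)))"
        unfolding G_apply unfolding mult.assoc VFD_add[OF fX g_C[OF fY fZ] C_cmult[OF C_mult[OF SA_snd[OF Y] SA_snd[OF Z]]]]
          VFD_cmult[OF fX C_mult[OF SA_snd[OF Y] SA_snd[OF Z]]] VFD_mult[OF fX SA_snd[OF Y] SA_snd[OF Z]] ..
      then show ?thesis
        unfolding G_apply D_metric[OF lc fX fY fZ] fst_conv snd_conv by (simp add: algebra_simps)
    qed
  next
    fix f X Y assume f: "f \<in> C" and X: "X \<in> SA" and Y: "Y \<in> SA"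
    note fX = SA_fst[OF X] and fY = SA_fst[OF Y]
    have 1: "D (\<lambda>x. fst (f x *\<^sub>R X x)) (\<lambda>x. fst (Y x)) = (\<lambda>x. f x *\<^sub>R D (\<lambda>x. fst (X x)) (\<lambda>x. fst (Y x)) x)"
      unfolding fst_scaleR by (rule D_fmult_left[OF lc f fX fY])
    show "?N (\<lambda>x. f x *\<^sub>R X x) Y = (\<lambda>x. f x *\<^sub>R ?N X Y x)"
      unfolding 1 by (rule ext) (simp add: scaleR_tvec_apply)
    have 2: "D (\<lambda>x. fst (X x)) (\<lambda>x. fst (f x *\<^sub>R Y x))
        = (\<lambda>x. f x *\<^sub>R D (\<lambda>x. fst (X x)) (\<lambda>x. fst (Y x)) x + fst (X x) f *\<^sub>R fst (Y x))"
      unfolding fst_scaleR by (rule D_fmult_right[OF lc f fX fY])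
    have 3: "fst (X x) (\<lambda>y. snd (f y *\<^sub>R Y y)) = f x * fst (X x) (\<lambda>y. snd (Y y)) + fst (X x) f * snd (Y x)" for x
      using VFD_mult[OF fX f SA_snd[OF Y], of x] by simp
    show "?N X (\<lambda>x. f x *\<^sub>R Y x) = (\<lambda>x. f x *\<^sub>R ?N X Y x + fst (X x) f *\<^sub>R Y x)"
      unfolding 2 3 by (rule ext) (simp add: prod_eq_iff)
  qed
qed

lemma TM_simps: "sections (tangent_algebroid \<A>) = VF" "anchor (tangent_algebroid \<A>) x v = v"
  "bracket (tangent_algebroid \<A>) = lie_bracket"
  by (simp_all add: tangent_algebroid_def)

text \<open>The real component of N X Y is a second fundamental form. It is skew in X and Y, by
  metricity along the section \<open>T\<close>, whose anchor is 0; it is symmetric because the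
  torsion vanishes. Hence it is 0, and the first component inherits all axioms.\<close>

lemma levi_civita_TM:
  assumes lc: "levi_civita \<A> AA G N"
  defines "h \<equiv> \<lambda>X :: 'a \<Rightarrow> 'a tvec. (\<lambda>x. (X x, 0 :: real))"
  shows "levi_civita \<A> (tangent_algebroid \<A>) g (\<lambda>X Y x. fst (N (h X) (h Y) x))"
    and "X \<in> VF \<Longrightarrow> Y \<in> VF \<Longrightarrow> snd (N (h X) (h Y) x) = 0"
proof -
  note L = levi_civitaD[OF lc, unfolded AA_simps(2,3)]
  have h: "h X \<in> SA" if "X \<in> VF" for X
    unfolding h_def by (rule SA_Pair[OF that C_const])
  have hl: "h (a *\<^sub>R X + b *\<^sub>R Y) = a *\<^sub>R h X + b *\<^sub>R h Y" for a b X Y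
    unfolding h_def lincomb_fun scaleR_Pair by (rule ext) (simp only: add_Pair lincomb_fun prod.inject add_0_left scaleR_zero_right simp_thms)
  have hf: "h (\<lambda>x. f x *\<^sub>R X x) = (\<lambda>x. f x *\<^sub>R h X x)" for f X
    unfolding h_def by simp
  have G0: "G x V (h Z x) = g x (fst V) (Z x)" "G x (h Z x) V = g x (Z x) (fst V)" for x V Z
    unfolding G_apply h_def by simp_all
  show "levi_civita \<A> (tangent_algebroid \<A>) g (\<lambda>X Y x. fst (N (h X) (h Y) x))"
    unfolding levi_civita_def TM_simps
  proof (intro conjI ballI allI)
    fix X assume X: "X \<in> VF"
    show "linear_map_on VF (\<lambda>Y x. fst (N (h X) (h Y) x))"
      unfolding linear_map_on_def
    proof (intro ballI allI)
      fix Y Z a b assume Y: "Y \<in> VF" and Z: "Z \<in> VF"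
      have "N (h X) (a *\<^sub>R h Y + b *\<^sub>R h Z) = a *\<^sub>R N (h X) (h Y) + b *\<^sub>R N (h X) (h Z)"
        using L(2)[OF h[OF X]] h[OF Y] h[OF Z] unfolding linear_map_on_def by blast
      then show "(\<lambda>x. fst (N (h X) (h (a *\<^sub>R Y + b *\<^sub>R Z)) x))
          = a *\<^sub>R (\<lambda>x. fst (N (h X) (h Y) x)) + b *\<^sub>R (\<lambda>x. fst (N (h X) (h Z) x))"
        unfolding hl by (simp only: lincomb_fun fst_add fst_scaleR)
    qed
    show "linear_map_on VF (\<lambda>Y x. fst (N (h Y) (h X) x))"
      unfolding linear_map_on_def
    proof (intro ballI allI)
      fix Y Z a b assume Y: "Y \<in> VF" and Z: "Z \<in> VF"
      have "N (a *\<^sub>R h Y + b *\<^sub>R h Z) (h X) = a *\<^sub>R N (h Y) (h X) + b *\<^sub>R N (h Z) (h X)"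
        using L(3)[OF h[OF X]] h[OF Y] h[OF Z] unfolding linear_map_on_def by blast
      then show "(\<lambda>x. fst (N (h (a *\<^sub>R Y + b *\<^sub>R Z)) (h X) x))
          = a *\<^sub>R (\<lambda>x. fst (N (h Y) (h X) x)) + b *\<^sub>R (\<lambda>x. fst (N (h Z) (h X) x))"
        unfolding hl by (simp only: lincomb_fun fst_add fst_scaleR)
    qed
    fix Y assume Y: "Y \<in> VF"
    show "(\<lambda>x. fst (N (h X) (h Y) x)) \<in> VF"
      by (rule SA_fst[OF L(1)[OF h[OF X] h[OF Y]]])
    show "(\<lambda>x. fst (N (h X) (h Y) x) - fst (N (h Y) (h X) x)) = lie_bracket X Y"
    proof (rule ext)
      fix x
      have "N (h X) (h Y) x - N (h Y) (h X) x = bracket AA (h X) (h Y) x"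
        using fun_cong[OF L(6)[OF h[OF X] h[OF Y]], of x] .
      then have "fst (N (h X) (h Y) x - N (h Y) (h X) x) = lie_bracket (\<lambda>y. fst (h X y)) (\<lambda>y. fst (h Y y)) x"
        by (simp only: AA_simps fst_conv)
      then show "fst (N (h X) (h Y) x) - fst (N (h Y) (h X) x) = lie_bracket X Y x"
        unfolding fst_diff h_def fst_conv .
    qed
    fix Z x assume Z: "Z \<in> VF"
    show "X x (\<lambda>y. g y (Y y) (Z y)) = g x (fst (N (h X) (h Y) x)) (Z x) + g x (Y x) (fst (N (h X) (h Z) x))"
      using L(7)[OF h[OF X] h[OF Y] h[OF Z], of x] unfolding G0 unfolding h_def fst_conv .
  next
    fix f X Y assume f: "f \<in> C" and X: "X \<in> VF" and Y: "Y \<in> VF"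
    show "(\<lambda>x. fst (N (h (\<lambda>x. f x *\<^sub>R X x)) (h Y) x)) = (\<lambda>x. f x *\<^sub>R fst (N (h X) (h Y) x))"
      unfolding hf L(4)[OF f h[OF X] h[OF Y]] fst_scaleR ..
    show "(\<lambda>x. fst (N (h X) (h (\<lambda>x. f x *\<^sub>R Y x)) x)) = (\<lambda>x. f x *\<^sub>R fst (N (h X) (h Y) x) + X x f *\<^sub>R Y x)"
      unfolding hf L(5)[OF f h[OF X] h[OF Y]] fst_add fst_scaleR unfolding h_def fst_conv ..
  qed
  assume X: "X \<in> VF" and Y: "Y \<in> VF"
  define T where "T = (\<lambda>x :: 'a. (0 :: 'a tvec, 1 :: real))"
  have T: "T \<in> SA" unfolding T_def by (rule SA_Pair[OF VF_0 C_const])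
  have tor: "N V W x - N W V x = bracket AA V W x" if "V \<in> SA" "W \<in> SA" for V W
    using fun_cong[OF L(6)[OF that], of x] .
  \<comment> \<open>The Weingarten relation: \<open>h Y\<close> is orthogonal to \<open>T\<close>,
    and the derivatives of \<open>T\<close> along \<open>h X\<close> and of \<open>h X\<close> along
    \<open>T\<close> have the same first component, since the bracket of \<open>X\<close> with the
    zero field is 0.\<close>
  have e: "\<epsilon> * snd (N (h X) (h Y) x) = - g x (Y x) (fst (N T (h X) x))" if X: "X \<in> VF" and Y: "Y \<in> VF" for X Y
  proof -
    have z: "(\<lambda>y. G y (h Y y) (T y)) = (\<lambda>y. 0)"
      unfolding G_apply h_def T_def using g_zero_right[OF VF_TS[OF Y] xi_TS] by simp
    have "0 = G x (N (h X) (h Y) x) (T x) + G x (h Y x) (N (h X) T x)"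
      using L(7)[OF h[OF X] h[OF Y] T, of x] VFD_const[OF SA_fst[OF h[OF X]], of x 0] unfolding z by simp
    moreover have "G x (N (h X) (h Y) x) (T x) = \<epsilon> * snd (N (h X) (h Y) x)"
      unfolding G_apply T_def using g_zero_right[OF SA_TS[OF L(1)[OF h[OF X] h[OF Y]]] xi_TS, of x] by simp
    moreover have "fst (N (h X) T x) = fst (N T (h X) x)"
    proof -
      have "lie_bracket X (\<lambda>y. 0) x = 0"
        using lie_bracket_fmult_right[OF X VF_0 C_const[of 0], of x] VFD_const[OF X, of x 0] by simp
      then have "fst (N (h X) T x - N T (h X) x) = 0"
        unfolding tor[OF h[OF X] T] AA_simps fst_conv by (simp add: h_def T_def)
      then show ?thesis unfolding fst_diff by (metis eq_iff_diff_eq_0)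
    qed
    ultimately show ?thesis unfolding G0 by simp
  qed
  have "0 = G x (N T (h X) x) (h Y x) + G x (h X x) (N T (h Y) x)"
    using L(7)[OF T h[OF X] h[OF Y], of x] by (simp add: T_def)
  then have "\<epsilon> * (snd (N (h X) (h Y) x) + snd (N (h Y) (h X) x)) = 0"
    unfolding distrib_left e[OF X Y] e[OF Y X] G0
    using g_sym[OF SA_TS[OF L(1)[OF T h[OF X]]] VF_TS[OF Y], of x] by simp
  moreover have "snd (N (h X) (h Y) x - N (h Y) (h X) x) = 0"
    unfolding tor[OF h[OF X] h[OF Y]] AA_simps snd_conv
    using VFD_const[OF X, of x 0] VFD_const[OF Y, of x 0] by (simp add: h_def)
  ultimately show "snd (N (h X) (h Y) x) = 0" using eps_nonzero by simp
qed

section \<open>Compatibility as the Sasaki condition\<close>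

text \<open>The compatibility equation transported by \<open>Q\<close>, with \<open>U\<close> and
  \<open>V\<close> in place of the covariant derivatives of \<open>Y\<close> and \<open>Z\<close>
  along \<open>X\<close>. Pairing with \<open>X\<^sub>0\<close> has become the second component, and
  contracting \<open>\<pi>\<^sub>J\<close> with the metric dual of \<open>X\<^sub>0\<close> has
  become \<open>\<eta>\<close>.\<close>

definition compat_at :: "('a \<Rightarrow> 'a tvec \<times> real) \<Rightarrow> ('a \<Rightarrow> 'a tvec \<times> real) \<Rightarrow> ('a \<Rightarrow> 'a tvec \<times> real)
    \<Rightarrow> 'a tvec \<times> real \<Rightarrow> 'a tvec \<times> real \<Rightarrow> 'a \<Rightarrow> bool" where
  "compat_at X Y Z U V x \<longleftrightarrow>
     fst (X x) (\<lambda>y. om y (Y y) (Z y)) - om x U (Z x) - om x (Y x) V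
     = - (1 / 2) * (snd (Y x) * om x (Z x) (X x) + snd (Z x) * om x (X x) (Y x)
         + G x (X x) (Y x) * \<eta> x (fst (Z x)) - G x (X x) (Z x) * \<eta> x (fst (Y x)))"

abbreviation "X\<^sub>0 \<equiv> (\<lambda>x. - contract AA \<pi>\<^sub>J x (\<phi>\<^sub>0 x))"
abbreviation "X\<^sub>0' \<equiv> (\<lambda>x. inv_into (dual_fiber AA x) (contract AA G' x) (X\<^sub>0 x))"

lemma X0_eq: "X\<^sub>0 x = (- (\<epsilon> *\<^sub>R \<xi> x), 0)"
proof -
  have d: "\<phi>\<^sub>0 x \<in> dual_fiber AA x"
    unfolding dual_pair_def by (rule dual_fiberI) (simp add: linear_map_on_def)
  have "sharp x (\<lambda>v. \<phi>\<^sub>0 x (v, 0)) = 0"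
    by (rule sharp_unique[OF TS_zero]) (use g_zero_left[OF xi_TS] in \<open>simp add: phi0_apply\<close>)
  then have "P x (\<phi>\<^sub>0 x) = (\<epsilon> *\<^sub>R \<xi> x, 0)"
    unfolding P_def using phi_zero[of x] \<Omega>_zero[OF eta_\<Omega>, of x] phi0_apply[OF TS_zero, of x 1] by simp
  then show ?thesis unfolding contract_pi[OF d] by simp
qed

lemma Q_X0:
  assumes Y: "fst V \<in> TS x" shows "Q x V (X\<^sub>0 x) = snd V"
proof -
  have T: "fst (- (\<epsilon> *\<^sub>R \<xi> x), 0 :: real) \<in> TS x"
    using TS_uminus[OF TS_scaleR[OF xi_TS]] by simp
  have "\<phi> x (- (\<epsilon> *\<^sub>R \<xi> x)) = 0"
    using phi_minus[OF TS_scaleR[OF xi_TS], of x \<epsilon>] phi_scaleR[OF xi_TS, of x \<epsilon>] phi_xi[of x] by simp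
  moreover have "\<eta> x (- (\<epsilon> *\<^sub>R \<xi> x)) = - \<epsilon>"
    using \<Omega>_minus[OF eta_\<Omega> TS_scaleR[OF xi_TS], of x \<epsilon>] \<Omega>_scaleR[OF eta_\<Omega> xi_TS, of x \<epsilon>] eta_xi[of x] by simp
  ultimately show ?thesis
    unfolding X0_eq Q_om[OF T Y] om_def fst_conv snd_conv
    using g_zero_left[OF xi_TS Y] by (simp add: eps_cancel algebra_simps)
qed

lemma X0'_eq: "X\<^sub>0' x = Q x (0, \<epsilon>)"
proof -
  let ?c = "\<lambda>(v, r). if v \<in> TS x then - \<eta> x v + 0 * r else 0"
  have T: "fst (- (\<epsilon> *\<^sub>R \<xi> x), 0 :: real) \<in> TS x"
    using TS_uminus[OF TS_scaleR[OF xi_TS]] by simp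
  have "g x (- (\<epsilon> *\<^sub>R \<xi> x)) w = - \<eta> x w" if "w \<in> TS x" for w
    using g_minus_left[OF TS_scaleR[OF xi_TS] that, of \<epsilon>] g_scaleR_left[OF xi_TS that, of \<epsilon>] g_xi'[OF that]
    by (simp add: eps_cancel)
  then have "(\<lambda>(w, s). if w \<in> TS x then g x (fst (- (\<epsilon> *\<^sub>R \<xi> x), 0 :: real)) w
      + (\<epsilon> * snd (- (\<epsilon> *\<^sub>R \<xi> x), 0 :: real)) * s else 0) = ?c"
    by (auto simp: fun_eq_iff)
  then have "X\<^sub>0' x = ?c"
    unfolding X0_eq contract_G'_inv[OF T] .
  also have "\<dots> = Q x (P x ?c)" by (rule QP[OF c_dual, symmetric])
  also have "\<dots> = Q x (0, \<epsilon>)" unfolding P_c ..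
  finally show ?thesis .
qed

lemma pi_X0':
  assumes V: "fst V \<in> TS x" shows "\<pi>\<^sub>J x (X\<^sub>0' x) (Q x V) = \<eta> x (fst V)"
proof -
  have T: "fst (0 :: 'a tvec, \<epsilon>) \<in> TS x" using TS_zero by simp
  show ?thesis
    unfolding X0'_eq pi_Q[OF T V] om_def fst_conv snd_conv
    using phi_zero[of x] g_zero_left[OF xi_TS V] \<Omega>_zero[OF eta_\<Omega>, of x] by (simp add: eps_cancel)
qed

lemma compat_translate:
  assumes X: "X \<in> SA" and Y: "Y \<in> SA" and Z: "Z \<in> SA" and U: "fst U \<in> TS x" and V: "fst V \<in> TS x"
  shows "anchor AD x (Q x (X x)) (\<lambda>y. \<pi>\<^sub>J y (Q y (Y y)) (Q y (Z y)))
      - \<pi>\<^sub>J x (Q x U) (Q x (Z x)) - \<pi>\<^sub>J x (Q x (Y x)) (Q x V)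
      = - (1 / 2) *
        (Q x (Y x) (X\<^sub>0 x) * \<pi>\<^sub>J x (Q x (Z x)) (Q x (X x)) + Q x (Z x) (X\<^sub>0 x) * \<pi>\<^sub>J x (Q x (X x)) (Q x (Y x))
         + G' x (Q x (X x)) (Q x (Y x)) * \<pi>\<^sub>J x (X\<^sub>0' x) (Q x (Z x))
         - G' x (Q x (X x)) (Q x (Z x)) * \<pi>\<^sub>J x (X\<^sub>0' x) (Q x (Y x)))
    \<longleftrightarrow> compat_at X Y Z U V x"
proof -
  note t = SA_TS[OF X] SA_TS[OF Y] SA_TS[OF Z]
  have a: "anchor AD x (Q x (X x)) = fst (X x)"
    unfolding AD_simps contract_pi[OF Q_dual[OF t(1)]] PQ[OF t(1)] ..
  have Gp: "G' x (Q x V) (Q x W) = G x V W" if "fst V \<in> TS x" "fst W \<in> TS x" for V W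
    unfolding G'_P[OF Q_dual[OF that(1)] Q_dual[OF that(2)]] PQ[OF that(1)] PQ[OF that(2)] ..
  show ?thesis
    unfolding a pi_Q[OF t(2,3)] pi_Q[OF U t(3)] pi_Q[OF t(2) V] pi_Q[OF t(3,1)] pi_Q[OF t(1,2)]
      Q_X0[OF t(2)] Q_X0[OF t(3)] pi_X0'[OF t(2)] pi_X0'[OF t(3)] Gp[OF t(1,2)] Gp[OF t(1,3)] compat_at_def ..
qed

text \<open>Both sides quantify existentially over connections, so each direction carries its
  witness across by \<open>levi_civita_transport\<close>; \<open>compat_translate\<close> then
  compares the equations pointwise.\<close>

lemma compatible_iff:
  "compatible \<A> AA \<phi>\<^sub>0 \<pi>\<^sub>J G' \<longleftrightarrow> (\<exists>N. levi_civita \<A> AA G N \<and>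
     (\<forall>X\<in>SA. \<forall>Y\<in>SA. \<forall>Z\<in>SA. \<forall>x. compat_at X Y Z (N X Y x) (N X Z x) x))"
proof -
  have QPs: "(\<lambda>x. Q x (P x (\<alpha> x))) = \<alpha>" if "\<alpha> \<in> \<Omega>\<^sub>A" for \<alpha>
    using QP[OF \<Omega>\<^sub>A_fiber[OF that]] by (rule ext)
  have an: "anchor AD x (\<alpha> x) = anchor AA x (P x (\<alpha> x))" if "\<alpha> \<in> sections AD" for \<alpha> x
    using that contract_pi[OF \<Omega>\<^sub>A_fiber, of \<alpha> x] by (simp add: AD_simps AA_simps)
  have br: "bracket AD \<alpha> \<beta> x = Q x (bracket AA (\<lambda>x. P x (\<alpha> x)) (\<lambda>x. P x (\<beta> x)) x)"
    if "\<alpha> \<in> sections AD" "\<beta> \<in> sections AD" for \<alpha> \<beta> x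
    using dual_bracket_Q[OF P_section P_section, of \<alpha> \<beta> x] that QPs[of \<alpha>] QPs[of \<beta>] by (simp only: AD_simps)
  have me: "G' x (\<alpha> x) (\<beta> x) = G x (P x (\<alpha> x)) (P x (\<beta> x))"
    if "\<alpha> \<in> sections AD" "\<beta> \<in> sections AD" for \<alpha> \<beta> x
    using that by (intro G'_P \<Omega>\<^sub>A_fiber) (simp_all only: AD_simps)
  show ?thesis
  proof
    assume "compatible \<A> AA \<phi>\<^sub>0 \<pi>\<^sub>J G'"
    then obtain D where lc: "levi_civita \<A> AD G' D"
      and comp: "\<And>\<alpha> \<beta> \<gamma> x. \<alpha> \<in> \<Omega>\<^sub>A \<Longrightarrow> \<beta> \<in> \<Omega>\<^sub>A \<Longrightarrow> \<gamma> \<in> \<Omega>\<^sub>A \<Longrightarrow>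
        anchor AD x (\<alpha> x) (\<lambda>y. \<pi>\<^sub>J y (\<beta> y) (\<gamma> y)) - \<pi>\<^sub>J x (D \<alpha> \<beta> x) (\<gamma> x) - \<pi>\<^sub>J x (\<beta> x) (D \<alpha> \<gamma> x)
          = - (1 / 2) * (\<beta> x (X\<^sub>0 x) * \<pi>\<^sub>J x (\<gamma> x) (\<alpha> x) + \<gamma> x (X\<^sub>0 x) * \<pi>\<^sub>J x (\<alpha> x) (\<beta> x)
             + G' x (\<alpha> x) (\<beta> x) * \<pi>\<^sub>J x (X\<^sub>0' x) (\<gamma> x) - G' x (\<alpha> x) (\<gamma> x) * \<pi>\<^sub>J x (X\<^sub>0' x) (\<beta> x))"
      unfolding compatible_def Let_def AD_simps(1) by blast
    define N where "N X Y x = P x (D (\<lambda>x. Q x (X x)) (\<lambda>x. Q x (Y x)) x)" for X Y x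
    have "levi_civita \<A> AA G (\<lambda>X Y x. P x (D (\<lambda>x. Q x (X x)) (\<lambda>x. Q x (Y x)) x))"
    proof (rule levi_civita_transport[OF lc])
      show "(\<lambda>x. P x (\<alpha> x)) \<in> sections AA" if "\<alpha> \<in> sections AD" for \<alpha>
        using P_section that by (simp only: AD_simps AA_simps)
      show "(\<lambda>x. Q x (X x)) \<in> sections AD" if "X \<in> sections AA" for X
        using Q_section that by (simp only: AD_simps AA_simps)
      show "P x (Q x (X x)) = X x" if "X \<in> sections AA" for X x
        using PQ[OF SA_TS] that by (simp only: AA_simps)
      show "Q x (P x (\<alpha> x)) = \<alpha> x" if "\<alpha> \<in> sections AD" for \<alpha> x
        using QP[OF \<Omega>\<^sub>A_fiber] that by (simp only: AD_simps)
      show "P x (a *\<^sub>R \<alpha> x + b *\<^sub>R \<beta> x) = a *\<^sub>R P x (\<alpha> x) + b *\<^sub>R P x (\<beta> x)"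
        if "\<alpha> \<in> sections AD" "\<beta> \<in> sections AD" for \<alpha> \<beta> a b x
        using that by (intro P_lin \<Omega>\<^sub>A_fiber) (simp_all only: AD_simps)
      show "Q x (a *\<^sub>R X x + b *\<^sub>R Y x) = a *\<^sub>R Q x (X x) + b *\<^sub>R Q x (Y x)"
        if "X \<in> sections AA" "Y \<in> sections AA" for X Y a b x
        using that by (intro Q_lin SA_TS) (simp_all only: AA_simps)
      fix X Y x assume "X \<in> sections AA" "Y \<in> sections AA"
      then have X: "X \<in> SA" and Y: "Y \<in> SA" by (simp_all only: AA_simps)
      have QX: "(\<lambda>x. Q x (X x)) \<in> sections AD" and QY: "(\<lambda>x. Q x (Y x)) \<in> sections AD"
        using Q_section[OF X] Q_section[OF Y] by (simp_all only: AD_simps)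
      have p: "P x (Q x (X x)) = X x" "P x (Q x (Y x)) = Y x" for x
        by (rule PQ[OF SA_TS[OF X]], rule PQ[OF SA_TS[OF Y]])
      show "anchor AA x (X x) = anchor AD x (Q x (X x))"
        using an[OF QX, of x] unfolding p by (rule sym)
      show "bracket AA X Y x = P x (bracket AD (\<lambda>x. Q x (X x)) (\<lambda>x. Q x (Y x)) x)"
        using br[OF QX QY, of x] PQ[OF SA_TS[OF bracket_SA[OF X Y]], of x] unfolding p by simp
      show "G x (X x) (Y x) = G' x (Q x (X x)) (Q x (Y x))"
        using me[OF QX QY, of x] unfolding p by (rule sym)
    qed
    moreover have "compat_at X Y Z (N X Y x) (N X Z x) x" if X: "X \<in> SA" and Y: "Y \<in> SA" and Z: "Z \<in> SA" for X Y Z x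
    proof -
      note QX = Q_section[OF X] and QY = Q_section[OF Y] and QZ = Q_section[OF Z]
      have DY: "D (\<lambda>x. Q x (X x)) (\<lambda>x. Q x (Y x)) x \<in> dual_fiber AA x"
        and DZ: "D (\<lambda>x. Q x (X x)) (\<lambda>x. Q x (Z x)) x \<in> dual_fiber AA x"
        using \<Omega>\<^sub>A_fiber lc_section[OF lc, unfolded AD_simps(1), OF QX QY] lc_section[OF lc, unfolded AD_simps(1), OF QX QZ]
        by blast+
      have TY: "fst (N X Y x) \<in> TS x" and TZ: "fst (N X Z x) \<in> TS x"
        unfolding N_def by (rule P_TS[OF DY], rule P_TS[OF DZ])
      have q: "D (\<lambda>x. Q x (X x)) (\<lambda>x. Q x (Y x)) x = Q x (N X Y x)"
        "D (\<lambda>x. Q x (X x)) (\<lambda>x. Q x (Z x)) x = Q x (N X Z x)"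
        unfolding N_def QP[OF DY] QP[OF DZ] by (rule refl)+
      show ?thesis
        using comp[OF QX QY QZ, of x] unfolding q by (rule iffD1[OF compat_translate[OF X Y Z TY TZ]])
    qed
    ultimately show "\<exists>N. levi_civita \<A> AA G N \<and>
       (\<forall>X\<in>SA. \<forall>Y\<in>SA. \<forall>Z\<in>SA. \<forall>x. compat_at X Y Z (N X Y x) (N X Z x) x)"
      by (intro exI[of _ N]) (simp add: N_def[abs_def])
  next
    assume "\<exists>N. levi_civita \<A> AA G N \<and>
       (\<forall>X\<in>SA. \<forall>Y\<in>SA. \<forall>Z\<in>SA. \<forall>x. compat_at X Y Z (N X Y x) (N X Z x) x)"
    then obtain N where lc: "levi_civita \<A> AA G N"
      and comp: "\<And>X Y Z x. X \<in> SA \<Longrightarrow> Y \<in> SA \<Longrightarrow> Z \<in> SA \<Longrightarrow> compat_at X Y Z (N X Y x) (N X Z x) x"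
      by blast
    define D where "D \<alpha> \<beta> x = Q x (N (\<lambda>x. P x (\<alpha> x)) (\<lambda>x. P x (\<beta> x)) x)" for \<alpha> \<beta> x
    have "levi_civita \<A> AD G' (\<lambda>\<alpha> \<beta> x. Q x (N (\<lambda>x. P x (\<alpha> x)) (\<lambda>x. P x (\<beta> x)) x))"
    proof (rule levi_civita_transport[OF lc])
      show "(\<lambda>x. P x (\<alpha> x)) \<in> sections AA" if "\<alpha> \<in> sections AD" for \<alpha>
        using P_section that by (simp only: AD_simps AA_simps)
      show "(\<lambda>x. Q x (X x)) \<in> sections AD" if "X \<in> sections AA" for X
        using Q_section that by (simp only: AD_simps AA_simps)
      show "P x (Q x (X x)) = X x" if "X \<in> sections AA" for X x
        using PQ[OF SA_TS] that by (simp only: AA_simps)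
      show "Q x (P x (\<alpha> x)) = \<alpha> x" if "\<alpha> \<in> sections AD" for \<alpha> x
        using QP[OF \<Omega>\<^sub>A_fiber] that by (simp only: AD_simps)
      show "P x (a *\<^sub>R \<alpha> x + b *\<^sub>R \<beta> x) = a *\<^sub>R P x (\<alpha> x) + b *\<^sub>R P x (\<beta> x)"
        if "\<alpha> \<in> sections AD" "\<beta> \<in> sections AD" for \<alpha> \<beta> a b x
        using that by (intro P_lin \<Omega>\<^sub>A_fiber) (simp_all only: AD_simps)
      show "Q x (a *\<^sub>R X x + b *\<^sub>R Y x) = a *\<^sub>R Q x (X x) + b *\<^sub>R Q x (Y x)"
        if "X \<in> sections AA" "Y \<in> sections AA" for X Y a b x
        using that by (intro Q_lin SA_TS) (simp_all only: AA_simps)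
    qed (rule an br me; assumption)+
    then have lcD: "levi_civita \<A> AD G' D" by (simp add: D_def[abs_def])
    have "anchor AD x (\<alpha> x) (\<lambda>y. \<pi>\<^sub>J y (\<beta> y) (\<gamma> y)) - \<pi>\<^sub>J x (D \<alpha> \<beta> x) (\<gamma> x) - \<pi>\<^sub>J x (\<beta> x) (D \<alpha> \<gamma> x)
          = - (1 / 2) * (\<beta> x (X\<^sub>0 x) * \<pi>\<^sub>J x (\<gamma> x) (\<alpha> x) + \<gamma> x (X\<^sub>0 x) * \<pi>\<^sub>J x (\<alpha> x) (\<beta> x)
             + G' x (\<alpha> x) (\<beta> x) * \<pi>\<^sub>J x (X\<^sub>0' x) (\<gamma> x) - G' x (\<alpha> x) (\<gamma> x) * \<pi>\<^sub>J x (X\<^sub>0' x) (\<beta> x))"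
      if a: "\<alpha> \<in> \<Omega>\<^sub>A" and b: "\<beta> \<in> \<Omega>\<^sub>A" and c: "\<gamma> \<in> \<Omega>\<^sub>A" for \<alpha> \<beta> \<gamma> x
    proof -
      note Pa = P_section[OF a] and Pb = P_section[OF b] and Pc = P_section[OF c]
      note s = lc_section[OF lc, unfolded AA_simps(2)]
      have "compat_at (\<lambda>x. P x (\<alpha> x)) (\<lambda>x. P x (\<beta> x)) (\<lambda>x. P x (\<gamma> x))
          (N (\<lambda>x. P x (\<alpha> x)) (\<lambda>x. P x (\<beta> x)) x) (N (\<lambda>x. P x (\<alpha> x)) (\<lambda>x. P x (\<gamma> x)) x) x"
        by (rule comp[OF Pa Pb Pc])
      from iffD2[OF compat_translate[OF Pa Pb Pc SA_TS[OF s[OF Pa Pb]] SA_TS[OF s[OF Pa Pc]]] this]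
      show ?thesis
        unfolding QP[OF \<Omega>\<^sub>A_fiber[OF a]] QP[OF \<Omega>\<^sub>A_fiber[OF b]] QP[OF \<Omega>\<^sub>A_fiber[OF c]] D_def[symmetric] .
    qed
    then show "compatible \<A> AA \<phi>\<^sub>0 \<pi>\<^sub>J G'"
      unfolding compatible_def Let_def AD_simps(1) using lcD by blast
  qed
qed

text \<open>The Sasaki condition at Y = xi determines the covariant derivative of
  \<open>\<eta>\<close>: inserting phi Z for the third field produces phi phi Z in the second slot
  of \<open>K\<close>, which \<open>K_ph_ph_right\<close> removes.\<close>

lemma sasaki_K:
  assumes lc: "levi_civita \<A> (tangent_algebroid \<A>) g D" and S: "sasaki_condition D"
    and X: "X \<in> VF" and Z: "Z \<in> VF"
  shows "K D X Z x = dd \<eta> x (X x) (Z x) / 2"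
proof -
  note pZ = phi_VF[OF Z] and t = VF_TS[OF X, of x] VF_TS[OF Z, of x]
  have "B D X \<xi> (ph Z) x = \<epsilon> / 2 * (g x (X x) (\<phi> x (Z x)) - g x (X x) (\<xi> x) * \<eta> x (\<phi> x (Z x)))"
    using S X xi_VF pZ unfolding sasaki_condition_B[OF lc] by (simp add: eta_xi)
  then have "\<epsilon> * K D X (ph (ph Z)) x = \<epsilon> * (g x (X x) (\<phi> x (Z x)) / 2)"
    unfolding B_xi[OF lc X pZ] eta_phi[OF t(2)] by simp
  then have "K D X (ph (ph Z)) x = g x (X x) (\<phi> x (Z x)) / 2"
    using eps_nonzero by (metis mult_cancel_left)
  then have "- K D X Z x = g x (X x) (\<phi> x (Z x)) / 2"
    unfolding K_ph_ph_right[OF lc X Z] .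
  then show ?thesis using g_phi_skew[OF t] g_phi_dd[OF t] by simp
qed

text \<open>On sections with vanishing real component the equation is the Sasaki condition up to a
  factor \<epsilon>. In general the terms quadratic in the real components cancel, and the linear
  ones contain the covariant derivative of \<open>\<eta>\<close>, which \<open>sasaki_K\<close>
  supplies.\<close>

theorem compatible_iff_normal: "compatible \<A> AA \<phi>\<^sub>0 \<pi>\<^sub>J G' \<longleftrightarrow> normal_structure \<A> \<phi> \<xi> \<eta>"
  unfolding compatible_iff
proof
  assume "\<exists>N. levi_civita \<A> AA G N \<and>
     (\<forall>X\<in>SA. \<forall>Y\<in>SA. \<forall>Z\<in>SA. \<forall>x. compat_at X Y Z (N X Y x) (N X Z x) x)"
  then obtain N where lcN: "levi_civita \<A> AA G N"
    and comp: "\<And>X Y Z x. X \<in> SA \<Longrightarrow> Y \<in> SA \<Longrightarrow> Z \<in> SA \<Longrightarrow> compat_at X Y Z (N X Y x) (N X Z x) x"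
    by blast
  define D where "D X Y x = fst (N (\<lambda>x. (X x, 0)) (\<lambda>x. (Y x, 0)) x)" for X Y x
  have lc: "levi_civita \<A> (tangent_algebroid \<A>) g D"
    using levi_civita_TM(1)[OF lcN] by (simp add: D_def[abs_def])
  have "sasaki_condition D"
    unfolding sasaki_condition_B[OF lc]
  proof (intro ballI allI)
    fix X Y Z x assume X: "X \<in> VF" and Y: "Y \<in> VF" and Z: "Z \<in> VF"
    let ?h = "\<lambda>X :: 'a \<Rightarrow> 'a tvec. (\<lambda>x. (X x, 0 :: real))"
    have h: "?h X \<in> SA" "?h Y \<in> SA" "?h Z \<in> SA"
      by (rule SA_Pair[OF X C_const], rule SA_Pair[OF Y C_const], rule SA_Pair[OF Z C_const])
    have n: "N (?h X) (?h Y) x = (D X Y x, 0)" "N (?h X) (?h Z) x = (D X Z x, 0)"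
      using levi_civita_TM(2)[OF lcN X Y] levi_civita_TM(2)[OF lcN X Z] by (simp_all add: D_def prod_eq_iff)
    have o: "om x (v, 0) (w, 0) = \<epsilon> * dd \<eta> x v w" if "v \<in> TS x" "w \<in> TS x" for v w x
      using g_phi_dd[OF that] by (simp add: om_def)
    have of: "(\<lambda>y. om y (Y y, 0) (Z y, 0)) = (\<lambda>y. \<epsilon> * dd \<eta> y (Y y) (Z y))"
      using o[OF VF_TS[OF Y] VF_TS[OF Z]] by (rule ext)
    have "\<epsilon> * X x (\<lambda>y. dd \<eta> y (Y y) (Z y)) - \<epsilon> * dd \<eta> x (D X Y x) (Z x) - \<epsilon> * dd \<eta> x (Y x) (D X Z x)
        = - (1 / 2) * (g x (X x) (Y x) * \<eta> x (Z x) - g x (X x) (Z x) * \<eta> x (Y x))"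
      using comp[OF h, of x]
      unfolding compat_at_def n of o[OF D_TS[OF lc X Y] VF_TS[OF Z]] o[OF VF_TS[OF Y] D_TS[OF lc X Z]] G_apply
        fst_conv snd_conv VFD_cmult[OF X dd_C[OF eta_\<Omega> Y Z]]
      by simp
    then have "\<epsilon> * B D X Y Z x = (\<eta> x (Y x) * g x (X x) (Z x) - g x (X x) (Y x) * \<eta> x (Z x)) / 2"
      unfolding B_Phi[OF lc X Y Z] by (simp add: algebra_simps)
    then have "\<epsilon> * (\<epsilon> * B D X Y Z x) = \<epsilon> * ((\<eta> x (Y x) * g x (X x) (Z x) - g x (X x) (Y x) * \<eta> x (Z x)) / 2)"
      by simp
    then show "B D X Y Z x = \<epsilon> / 2 * (\<eta> x (Y x) * g x (X x) (Z x) - g x (X x) (Y x) * \<eta> x (Z x))"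
      unfolding eps_cancel by simp
  qed
  then show "normal_structure \<A> \<phi> \<xi> \<eta>"
    using normal_iff_sasaki_condition[OF lc] by blast
next
  assume N: "normal_structure \<A> \<phi> \<xi> \<eta>"
  obtain D where lc: "levi_civita \<A> (tangent_algebroid \<A>) g D"
    using levi_civita_exists by blast
  have S: "sasaki_condition D" using N normal_iff_sasaki_condition[OF lc] by blast
  let ?N = "\<lambda>X Y x. (D (\<lambda>x. fst (X x)) (\<lambda>x. fst (Y x)) x, fst (X x) (\<lambda>y. snd (Y y)))"
  have "compat_at X Y Z (?N X Y x) (?N X Z x) x" if X: "X \<in> SA" and Y: "Y \<in> SA" and Z: "Z \<in> SA" for X Y Z x
  proof -
    note fX = SA_fst[OF X] and fY = SA_fst[OF Y] and fZ = SA_fst[OF Z]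
    let ?X = "\<lambda>x. fst (X x)" and ?Y = "\<lambda>x. fst (Y x)" and ?Z = "\<lambda>x. fst (Z x)"
    have NY: "?N X Y \<in> SA" and NZ: "?N X Z \<in> SA"
      by (rule SA_Pair[OF D_VF[OF lc fX fY] VF_C[OF fX SA_snd[OF Y]]],
          rule SA_Pair[OF D_VF[OF lc fX fZ] VF_C[OF fX SA_snd[OF Z]]])
    have of: "?X x (\<lambda>y. om y (Y y) (Z y)) = \<epsilon> * ?X x (\<lambda>x. dd \<eta> x (?Y x) (?Z x) + snd (Y x) * \<eta> x (?Z x) - snd (Z x) * \<eta> x (?Y x))"
      unfolding om_fields[OF Y Z] by (rule VFD_cmult[OF fX form_C[OF Y Z]])
    have b: "?X x (\<lambda>x. dd \<eta> x (?Y x) (?Z x)) = dd \<eta> x (?Y x) (D ?X ?Z x) + dd \<eta> x (D ?X ?Y x) (?Z x)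
        + \<epsilon> / 2 * (\<eta> x (?Y x) * g x (?X x) (?Z x) - g x (?X x) (?Y x) * \<eta> x (?Z x))"
      using S[unfolded sasaki_condition_B[OF lc], rule_format, OF fX fY fZ, of x] B_Phi[OF lc fX fY fZ, of x] by linarith
    \<comment> \<open>Replacing the covariant derivative of \<open>\<eta>\<close> by half of d eta
      is what matches the terms linear in the real components with the factor 1/2 on the right-hand
      side.\<close>
    have k: "?X x (\<lambda>x. \<eta> x (W x)) = \<eta> x (D ?X W x) + dd \<eta> x (?X x) (W x) / 2" if "W \<in> VF" for W
      using sasaki_K[OF lc S fX that, of x] K_eta[OF lc fX that, of x] by simp
    have sk: "dd \<eta> x (?Z x) (?X x) = - dd \<eta> x (?X x) (?Z x)"
      by (rule dd_skew[OF eta_\<Omega> VF_TS[OF fZ] VF_TS[OF fX]])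
    have o1: "om x (?N X Y x) (Z x) = \<epsilon> * (dd \<eta> x (D ?X ?Y x) (?Z x) + ?X x (\<lambda>y. snd (Y y)) * \<eta> x (?Z x)
        - snd (Z x) * \<eta> x (D ?X ?Y x))"
      using om_fields[OF NY Z, of x] by (simp only: fst_conv snd_conv)
    have o2: "om x (Y x) (?N X Z x) = \<epsilon> * (dd \<eta> x (?Y x) (D ?X ?Z x) + snd (Y x) * \<eta> x (D ?X ?Z x)
        - ?X x (\<lambda>y. snd (Z y)) * \<eta> x (?Y x))"
      using om_fields[OF Y NZ, of x] by (simp only: fst_conv snd_conv)
    show ?thesis
      unfolding compat_at_def of form_derivative[OF fX Y Z] b k[OF fY] k[OF fZ] o1 o2
        om_fields[OF Z X] om_fields[OF X Y] G_apply sk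
      by (simp add: field_simps eps_cancel)
  qed
  then show "\<exists>N. levi_civita \<A> AA G N \<and>
     (\<forall>X\<in>SA. \<forall>Y\<in>SA. \<forall>Z\<in>SA. \<forall>x. compat_at X Y Z (N X Y x) (N X Z x) x)"
    using levi_civita_AA[OF lc] by (intro exI[of _ ?N]) simp
qed

end

theorem theorem3p4:
  fixes \<A> :: "('a::{t2_space, second_countable_topology}, 'e::euclidean_space) atlas"
    and \<phi> :: "'a \<Rightarrow> 'a tvec \<Rightarrow> 'a tvec"
    and \<xi> :: "'a \<Rightarrow> 'a tvec"
    and \<eta> :: "'a \<Rightarrow> 'a tvec \<Rightarrow> real"
    and g :: "'a \<Rightarrow> 'a tvec \<Rightarrow> 'a tvec \<Rightarrow> real"
    and n p q :: nat
  assumes "smooth_atlas \<A>"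
    and "DIM('e) = 2 * n + 1"
    and "contact_pseudo_metric \<A> n p q \<phi> \<xi> \<eta> g"
  shows "let \<epsilon> = (- 1) ^ q :: real;
             \<theta> = (\<lambda>x v. \<epsilon> * \<eta> x v);
             \<Lambda> = contact_bivector \<A> \<theta>;
             E = reeb_field \<A> \<theta>;
             \<pi> = bisection_of_pair \<Lambda> E;
             G = (\<lambda>x (v, r) (w, s). g x v w + \<epsilon> * r * s);
             G' = dual_metric (TM_plus_R \<A>) \<pi> G
         in compatible \<A> (TM_plus_R \<A>) (dual_pair \<A> (\<lambda>x v. 0) (\<lambda>x. 1)) \<pi> G'
            \<longleftrightarrow> sasakian_pseudo_metric \<A> n p q \<phi> \<xi> \<eta> g"
proof -
  interpret contact_metric_manifold \<A> g p q \<phi> \<xi> \<eta> "(- 1) ^ q"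
    by unfold_locales
      (use assms(1,3) in \<open>auto simp: contact_pseudo_metric_def almost_contact_pseudo_metric_def\<close>)
  show ?thesis
    using compatible_iff_normal assms(3) unfolding Let_def sasakian_pseudo_metric_def by blast
qed

end
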